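(* Let $1\le p<\infty$, $0<\alpha\le 1$, $w\in A_p$, and let $\varphi_1,\varphi_2$ be positive measurable functions on $\mathbb{R}^n\times(0,\infty)$ for which there is a constant $C>0$ such that for all $x\in\mathbb{R}^n$ and $r>0$ $$\int_r^\infty \frac{\operatorname{ess\,inf}_{t<s<\infty}\varphi_1(x,s)\,w(B(x,s))^{1/p}}{w(B(x,t))^{1/p}}\,\frac{dt}{t}\le C\,\varphi_2(x,r).$$ Then the operator $G_\alpha$ is bounded from $M^{p,\varphi_1}_w(l_2)$ to $M^{p,\varphi_2}_w(l_2)$ if $p>1$, and from $M^{1,\varphi_1}_w(l_2)$ to $WM^{1,\varphi_2}_w(l_2)$ if $p=1$.
   Context: $B(x,r)$ is the open ball in $\mathbb{R}^n$ with centre $x$ and radius $r$. A weight is a locally integrable function on $\mathbb{R}^n$ that is positive and finite a.e.; $w(E)=\int_E w(x)\,dx$. $A_p$ denotes the Muckenhoupt class of weights: for $1<p<\infty$, $\sup_B\big(\frac1{|B|}\int_B w\big)\big(\frac1{|B|}\int_B w^{1-p'}\big)^{p-1}<\infty$ over all balls $B$, where $1/p+1/p'=1$; for $p=1$, $Mw\le Cw$ a.e., $M$ being the Hardy-Littlewood maximal operator. Vector-valued functions are sequences $\vec f=(f_j)_{j\ge1}$ of Lebesgue measurable functions on $\mathbb{R}^n$ with $\|\vec f(x)\|_{l_2}=(\sum_j|f_j(x)|^2)^{1/2}$. For a ball $B$, $\|\vec f\|_{L^p_w(B,l_2)}=\big(\int_B\|\vec f(y)\|_{l_2}^p w(y)\,dy\big)^{1/p}$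 and $\|\vec f\|_{WL^p_w(B,l_2)}=\sup_{t>0}t\,w(\{y\in B:\|\vec f(y)\|_{l_2}>t\})^{1/p}$; $L^{p,\mathrm{loc}}_w(l_2)$ (resp. $WL^{p,\mathrm{loc}}_w(l_2)$) is the set of $\vec f$ for which $\|\vec f\|_{L^p_w(B,l_2)}$ (resp. $\|\vec f\|_{WL^p_w(B,l_2)}$) is finite for every ball $B$. For a positive measurable $\varphi$ on $\mathbb{R}^n\times(0,\infty)$, $M^{p,\varphi}_w(l_2)$ is the set of $\vec f\in L^{p,\mathrm{loc}}_w(l_2)$ with $$\|\vec f\|_{M^{p,\varphi}_w(l_2)}=\sup_{x\in\mathbb{R}^n,\,r>0}\varphi(x,r)^{-1}w(B(x,r))^{-1/p}\|\vec f\|_{L^p_w(B(x,r),l_2)}<\infty,$$ and $WM^{p,\varphi}_w(l_2)$ is the set of $\vec f\in WL^{p,\mathrm{loc}}_w(l_2)$ with finite quasinorm $\|\vec f\|_{WM^{p,\varphi}_w(l_2)}$ obtained by replacing $\|\vec f\|_{L^p_w(B(x,r),l_2)}$ by $\|\vec f\|_{WL^p_w(B(x,r),l_2)}$ in the same formula. For $0<\alpha\le1$, $\mathcal{C}_\alpha$ is the family of functions $\phi:\mathbb{R}^n\to\mathbb{R}$ supported in $\{|x|\le1\}$ with $\int\phi=0$ and $|\phi(x)-\phi(x')|\le|x-x'|^\alpha$ for all $x,x'$. Put $\phi_t(y)=t^{-n}\phi(y/t)$ and, for locally integrable $f$, $A_\alpha f(t,y)=\sup_{\phi\in\mathcal{C}_\alpha}|f*\phi_t(y)|$.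 The intrinsic square (Lusin) function is $$G_\alpha f(x)=\Big(\iint_{\Gamma(x)}(A_\alpha f(t,y))^2\frac{dy\,dt}{t^{n+1}}\Big)^{1/2},\qquad \Gamma(x)=\{(y,t):y\in\mathbb{R}^n,\ t>0,\ |x-y|<t\}.$$ $G_\alpha$ acts on sequences componentwise: $G_\alpha\vec f=(G_\alpha f_j)_{j\ge1}$. An operator $T$ is bounded from $X$ to $Y$ if there is a constant $C$ with $\|T\vec f\|_Y\le C\|\vec f\|_X$ for all $\vec f\in X$. *)

theory Defs
  imports "HOL-Analysis.Analysis"
begin

text \<open>
  The space R^n is a type \<open>'a\<close> of class \<open>euclidean_space\<close>, with \<open>n = DIM('a)\<close>. Norms, weights and
  integrals of nonnegative functions take values in \<open>ennreal\<close>, so that no suprema or integrals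
  are silently truncated when they are infinite.
\<close>

text \<open>
  Real powers on \<open>[0, \<infinity>]\<close>, with the usual conventions at the end points.
\<close>

definition epowr :: "ennreal \<Rightarrow> real \<Rightarrow> ennreal" where
  "epowr x a =
    (if a = 0 then 1
     else if x = 0 then (if a > 0 then 0 else \<infinity>)
     else if x = \<infinity> then (if a > 0 then \<infinity> else 0)
     else ennreal (enn2real x powr a))"

definition weight :: "('a::euclidean_space \<Rightarrow> ennreal) \<Rightarrow> bool" where
  "weight w \<longleftrightarrow> w \<in> borel_measurable lebesgue
     \<and> (\<forall>K. compact K \<longrightarrow> (\<integral>\<^sup>+x\<in>K. w x \<partial>lebesgue) < \<infinity>)
     \<and> (AE x in lebesgue. 0 < w x \<and> w x < \<infinity>)"

definition wmeas :: "('a::euclidean_space \<Rightarrow> ennreal) \<Rightarrow> 'a set \<Rightarrow> ennreal" where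
  "wmeas w E = (\<integral>\<^sup>+x\<in>E. w x \<partial>lebesgue)"

definition ball_mean :: "('a::euclidean_space \<Rightarrow> ennreal) \<Rightarrow> 'a \<Rightarrow> real \<Rightarrow> ennreal" where
  "ball_mean g x r = (\<integral>\<^sup>+y\<in>ball x r. g y \<partial>lebesgue) / emeasure lebesgue (ball x r)"

text \<open>The centred Hardy--Littlewood maximal operator, applied to a modulus \<open>g = \<bar>f\<bar>\<close>.\<close>

definition HL_maximal :: "('a::euclidean_space \<Rightarrow> ennreal) \<Rightarrow> 'a \<Rightarrow> ennreal" where
  "HL_maximal g x = (SUP r\<in>{0<..}. ball_mean g x r)"

definition conj_exponent :: "real \<Rightarrow> real" where
  "conj_exponent p = p / (p - 1)"

text \<open>The definition is meant for \<open>p \<ge> 1\<close>; there are no weights in the class otherwise.\<close>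

definition Muckenhoupt :: "real \<Rightarrow> ('a::euclidean_space \<Rightarrow> ennreal) set" where
  "Muckenhoupt p = {w. weight w \<and>
     (p > 1 \<and> (SUP x. SUP r\<in>{0<..}. ball_mean w x r *
          epowr (ball_mean (\<lambda>y. epowr (w y) (1 - conj_exponent p)) x r) (p - 1)) < \<infinity>
      \<or> p = 1 \<and> (\<exists>C::real. AE x in lebesgue. HL_maximal w x \<le> ennreal C * w x))}"

text \<open>
  Sequences of functions are extended real valued, because the components of the square function
  may be infinite on null sets. Sequences are indexed from 0 instead of 1.
\<close>

definition l2_norm :: "(nat \<Rightarrow> 'a \<Rightarrow> ereal) \<Rightarrow> 'a \<Rightarrow> ennreal" where
  "l2_norm f x = epowr (\<Sum>j. (e2ennreal \<bar>f j x\<bar>)\<^sup>2) (1/2)"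

definition meas_seq :: "(nat \<Rightarrow> 'a::euclidean_space \<Rightarrow> ereal) \<Rightarrow> bool" where
  "meas_seq f \<longleftrightarrow> (\<forall>j. f j \<in> borel_measurable lebesgue)"

definition Lp_norm ::
    "real \<Rightarrow> ('a::euclidean_space \<Rightarrow> ennreal) \<Rightarrow> 'a set \<Rightarrow> (nat \<Rightarrow> 'a \<Rightarrow> ereal) \<Rightarrow> ennreal" where
  "Lp_norm p w B f = epowr (\<integral>\<^sup>+y\<in>B. (epowr (l2_norm f y) p * w y) \<partial>lebesgue) (1/p)"

definition WLp_norm ::
    "real \<Rightarrow> ('a::euclidean_space \<Rightarrow> ennreal) \<Rightarrow> 'a set \<Rightarrow> (nat \<Rightarrow> 'a \<Rightarrow> ereal) \<Rightarrow> ennreal" where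
  "WLp_norm p w B f =
     (SUP t\<in>{0<..}. ennreal t * epowr (wmeas w {y\<in>B. l2_norm f y > ennreal t}) (1/p))"

definition Lp_loc ::
    "real \<Rightarrow> ('a::euclidean_space \<Rightarrow> ennreal) \<Rightarrow> (nat \<Rightarrow> 'a \<Rightarrow> ereal) set" where
  "Lp_loc p w = {f. meas_seq f \<and> (\<forall>x. \<forall>r>0. Lp_norm p w (ball x r) f < \<infinity>)}"

definition WLp_loc ::
    "real \<Rightarrow> ('a::euclidean_space \<Rightarrow> ennreal) \<Rightarrow> (nat \<Rightarrow> 'a \<Rightarrow> ereal) set" where
  "WLp_loc p w = {f. meas_seq f \<and> (\<forall>x. \<forall>r>0. WLp_norm p w (ball x r) f < \<infinity>)}"

definition Morrey_norm ::
    "real \<Rightarrow> ('a::euclidean_space \<Rightarrow> real \<Rightarrow> real) \<Rightarrow> ('a \<Rightarrow> ennreal) \<Rightarrow> (nat \<Rightarrow> 'a \<Rightarrow> ereal) \<Rightarrow> ennreal" where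
  "Morrey_norm p \<phi> w f = (SUP x. SUP r\<in>{0<..}.
     inverse (ennreal (\<phi> x r)) * epowr (wmeas w (ball x r)) (- 1/p) * Lp_norm p w (ball x r) f)"

definition WMorrey_norm ::
    "real \<Rightarrow> ('a::euclidean_space \<Rightarrow> real \<Rightarrow> real) \<Rightarrow> ('a \<Rightarrow> ennreal) \<Rightarrow> (nat \<Rightarrow> 'a \<Rightarrow> ereal) \<Rightarrow> ennreal" where
  "WMorrey_norm p \<phi> w f = (SUP x. SUP r\<in>{0<..}.
     inverse (ennreal (\<phi> x r)) * epowr (wmeas w (ball x r)) (- 1/p) * WLp_norm p w (ball x r) f)"

definition Morrey ::
    "real \<Rightarrow> ('a::euclidean_space \<Rightarrow> real \<Rightarrow> real) \<Rightarrow> ('a \<Rightarrow> ennreal) \<Rightarrow> (nat \<Rightarrow> 'a \<Rightarrow> ereal) set" where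
  "Morrey p \<phi> w = {f \<in> Lp_loc p w. Morrey_norm p \<phi> w f < \<infinity>}"

definition WMorrey ::
    "real \<Rightarrow> ('a::euclidean_space \<Rightarrow> real \<Rightarrow> real) \<Rightarrow> ('a \<Rightarrow> ennreal) \<Rightarrow> (nat \<Rightarrow> 'a \<Rightarrow> ereal) set" where
  "WMorrey p \<phi> w = {f \<in> WLp_loc p w. WMorrey_norm p \<phi> w f < \<infinity>}"

text \<open>
  A positive measurable function on \<open>R^n \<times> (0, \<infinity>)\<close>; the values at \<open>r \<le> 0\<close> are irrelevant.
\<close>

definition pos_measurable :: "('a::euclidean_space \<Rightarrow> real \<Rightarrow> real) \<Rightarrow> bool" where
  "pos_measurable \<phi> \<longleftrightarrow>
     (\<lambda>(x, r). \<phi> x r) \<in> borel_measurable (restrict_space lebesgue (UNIV \<times> {0<..}))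
     \<and> (\<forall>x. \<forall>r>0. \<phi> x r > 0)"

text \<open>
  The library has an essential supremum only, and it is set to \<open>top\<close> for nonmeasurable functions.
  Sections \<open>\<phi> x\<close> of a Lebesgue measurable function may fail to be measurable for a null set
  of \<open>x\<close>; the definition below makes sense without measurability.
\<close>

definition ess_inf_on :: "real set \<Rightarrow> (real \<Rightarrow> ennreal) \<Rightarrow> ennreal" where
  "ess_inf_on S g = Sup {c. AE s in lebesgue. s \<in> S \<longrightarrow> c \<le> g s}"

definition C_class :: "real \<Rightarrow> ('a::euclidean_space \<Rightarrow> real) set" where
  "C_class \<alpha> = {\<phi>. (\<forall>x. norm x > 1 \<longrightarrow> \<phi> x = 0) \<and> (LINT x|lebesgue. \<phi> x) = 0
     \<and> (\<forall>x x'. \<bar>\<phi> x - \<phi> x'\<bar> \<le> norm (x - x') powr \<alpha>)}"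

definition dilate :: "('a::euclidean_space \<Rightarrow> real) \<Rightarrow> real \<Rightarrow> 'a \<Rightarrow> real" where
  "dilate \<phi> t y = \<phi> (y /\<^sub>R t) / t ^ DIM('a)"

text \<open>
  The convolution is meant for \<open>f\<close> locally integrable, hence finite almost everywhere, and \<open>g\<close>
  bounded with compact support; \<open>real_of_ereal\<close> changes such an \<open>f\<close> on a null set only.
\<close>

definition convol :: "('a::euclidean_space \<Rightarrow> ereal) \<Rightarrow> ('a \<Rightarrow> real) \<Rightarrow> 'a \<Rightarrow> real" where
  "convol f g y = (LINT z|lebesgue. real_of_ereal (f z) * g (y - z))"

definition A_fun :: "real \<Rightarrow> ('a::euclidean_space \<Rightarrow> ereal) \<Rightarrow> real \<Rightarrow> 'a \<Rightarrow> ennreal" where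
  "A_fun \<alpha> f t y = (SUP \<phi>\<in>C_class \<alpha>. ennreal \<bar>convol f (dilate \<phi> t) y\<bar>)"

definition cone :: "'a::euclidean_space \<Rightarrow> ('a \<times> real) set" where
  "cone x = {(y, t). t > 0 \<and> norm (x - y) < t}"

definition G_fun :: "real \<Rightarrow> ('a::euclidean_space \<Rightarrow> ereal) \<Rightarrow> 'a \<Rightarrow> ereal" where
  "G_fun \<alpha> f x = enn2ereal (epowr
     (\<integral>\<^sup>+z\<in>cone x. (case z of (y, t) \<Rightarrow>
        (A_fun \<alpha> f t y)\<^sup>2 * ennreal (1 / t ^ (DIM('a) + 1))) \<partial>lebesgue) (1/2))"

definition G_seq :: "real \<Rightarrow> (nat \<Rightarrow> 'a::euclidean_space \<Rightarrow> ereal) \<Rightarrow> nat \<Rightarrow> 'a \<Rightarrow> ereal" where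
  "G_seq \<alpha> f = (\<lambda>j. G_fun \<alpha> (f j))"

definition bounded_operator ::
    "'f set \<Rightarrow> ('f \<Rightarrow> ennreal) \<Rightarrow> 'g set \<Rightarrow> ('g \<Rightarrow> ennreal) \<Rightarrow> ('f \<Rightarrow> 'g) \<Rightarrow> bool" where
  "bounded_operator X norm_X Y norm_Y T \<longleftrightarrow>
     (\<exists>C::real. C > 0 \<and> (\<forall>f\<in>X. T f \<in> Y \<and> norm_Y (T f) \<le> ennreal C * norm_X f))"

end

theory Submission
  imports Defs
begin

text \<open>
  The proof consists of three reductions: from the Morrey spaces to one weighted estimate on the
  whole space, from there to finitely many dyadic grids, and within a grid to two classical
  mechanisms, Calderon--Zygmund decomposition and sparse domination.

  From Morrey spaces to the whole space. Fix a ball \<open>B = B(x0, r)\<close> and split \<open>f\<close> at the ball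
  \<open>2B\<close>. The part inside \<open>2B\<close> is estimated by the global inequality (\<open>global_strong\<close> if \<open>p > 1\<close>,
  \<open>global_weak\<close> if \<open>p = 1\<close>). The part outside is seen from \<open>B\<close> at heights \<open>t > r / 2\<close> only;
  there \<open>A_fun\<close> is at most a constant times the mean of \<open>\<bar>f\<bar>\<close> over \<open>B(x0, 4t)\<close>, and the
  Muckenhoupt condition bounds that mean by \<open>v(4t)\<close>, where \<open>v(t)\<close> is the \<open>L^p(w)\<close> norm of \<open>f\<close> on
  \<open>B(x0, t)\<close> divided by \<open>w(B(x0, t))^(1/p)\<close>. As \<open>w\<close> is doubling, \<open>v(t) \<le> C v(s)\<close> for
  \<open>t \<le> s \<le> 2t\<close>, so that the integral of \<open>v(t)^2 / t\<close> is controlled by the square of \<open>V\<close>, the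
  integral of \<open>v(t) / t\<close> over \<open>t > r\<close>. Thus the norm of the square function on \<open>B\<close> is at most
  \<open>C w(B)^(1/p) V\<close> (\<open>local_strong\<close>, \<open>local_weak\<close>). Finally the norm of \<open>f\<close> on \<open>B(x0, t)\<close>
  increases with \<open>t\<close>, hence is bounded by the Morrey norm times the essential infimum of
  \<open>\<phi>1(x0, s) w(B(x0, s))^(1/p)\<close> over \<open>s > t\<close>, and the hypothesis on \<open>\<phi>1, \<phi>2\<close> then says that \<open>V\<close>
  is at most \<open>C \<phi>2(x0, r)\<close> times the Morrey norm (\<open>tail_le_Morrey\<close>).

  From the whole space to dyadic grids. Let \<open>Q\<close> be a dyadic cube of side \<open>l\<close> that contains the
  ball of radius \<open>l / 8\<close> around \<open>x\<close>. For \<open>t\<close> between \<open>l / 32\<close> and \<open>l / 16\<close> and \<open>\<bar>x - y\<bar> < t\<close>,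
  every function \<open>\<lambda>z. dilate \<phi> t (y - z)\<close> is a fixed multiple of a test function of \<open>Q\<close>: it
  lives on \<open>Q\<close>, is bounded by \<open>1 / \<bar>Q\<bar>\<close>, has mean zero, and oscillates by at most
  \<open>2 powr (-\<alpha> k) / \<bar>Q\<bar>\<close> on cubes that are \<open>k\<close> levels finer. One almost extremal test function
  \<open>\<psi>\<close> per cube and component therefore controls the supremum over \<open>C_class\<close> and all such
  \<open>(y, t)\<close> at once (\<open>near_extremal\<close>, \<open>energy_domination\<close>), so that \<open>G_fun\<close>, truncated to
  finitely many levels and components, is dominated by a linear square function; monotone
  convergence removes the truncation. By the one third trick \<open>2 ^ n\<close> shifted grids provide a
  suitable cube for every \<open>x\<close> and every level. The choice of \<open>\<psi>\<close> depends on \<open>f\<close>, but all bounds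
  for the dyadic square function are uniform in \<open>\<psi>\<close>.

  Within a grid. Mean zero against small oscillation gives almost orthogonality, hence the
  unweighted \<open>L^2\<close> bound (\<open>L2_bound_scalar\<close>). A Calderon--Zygmund decomposition of finite depth
  turns an \<open>L^2(w)\<close> bound and a dyadic \<open>A_1\<close> condition into a weak type inequality
  (\<open>weak_type\<close>). With \<open>w = 1\<close> that inequality shows that the square function is dominated by the
  means of \<open>\<bar>f\<bar>\<close> over a sparse family of stopping cubes; the \<open>A_p\<close> condition and the Carleson
  embedding, used for both \<open>w\<close> and its dual weight, then yield the \<open>L^p(w)\<close> bound for all
  \<open>p > 1\<close> (\<open>weighted_Lp\<close>). For an \<open>A_1\<close> weight, which is an \<open>A_2\<close> weight, this supplies the
  \<open>L^2(w)\<close> bound with which the weak type inequality is applied a second time (\<open>weak_type_A1\<close>).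
\<close>

section \<open>Integrals over partitions and dyadic filtrations\<close>

lemma indicator_blocks:
  assumes fin: "finite (P ` Q)"
    and P: "\<And>z. z \<in> Q \<Longrightarrow> z \<in> P z \<and> P z \<subseteq> Q"
    and eq: "\<And>z y. z \<in> Q \<Longrightarrow> y \<in> P z \<Longrightarrow> P y = P z"
  shows "(indicator Q x :: 'b::semiring_1) = (\<Sum>B\<in>P ` Q. indicator B x)"
proof (cases "x \<in> Q")
  case True
  have "indicator B x = (0::'b)" if "B \<in> P ` Q - {P x}" for B
  proof -
    from that obtain z where z: "z \<in> Q" "B = P z" "P z \<noteq> P x" by auto
    then have "x \<notin> P z" using eq[OF z(1)] by metis
    then show ?thesis by (simp add: z)
  qed
  then have "(\<Sum>B\<in>P ` Q. indicator B x :: 'b) = (\<Sum>B\<in>{P x}. indicator B x)"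
    using fin True by (intro sum.mono_neutral_right) auto
  then show ?thesis using True P[OF True] by simp
next
  case False
  then have "\<And>B. B \<in> P ` Q \<Longrightarrow> x \<notin> B" using P by blast
  then show ?thesis using False by (simp add: sum.neutral)
qed

text \<open>
  The blocks are given by a map \<open>P\<close> that is constant on each of them, because stopping cubes,
  whose level varies from point to point, come as such a map.
\<close>

lemma block_integral_le:
  fixes G H :: "'a \<Rightarrow> real"
  assumes fin: "finite (P ` Q)"
    and P: "\<And>z. z \<in> Q \<Longrightarrow> z \<in> P z \<and> P z \<subseteq> Q \<and> P z \<in> sets M"
    and eq: "\<And>z y. z \<in> Q \<Longrightarrow> y \<in> P z \<Longrightarrow> P y = P z"
    and int: "integrable M G" "integrable M H"
    and le: "\<And>z. z \<in> Q \<Longrightarrow> \<bar>LINT x|M. indicator (P z) x * G x\<bar> \<le> (LINT x|M. indicator (P z) x * H x)"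
  shows "\<bar>LINT x|M. indicator Q x * G x\<bar> \<le> (LINT x|M. indicator Q x * H x)"
proof -
  have ind: "indicator Q x = (\<Sum>B\<in>P ` Q. indicator B x :: real)" for x
    by (rule indicator_blocks[OF fin]) (use P eq in blast)+
  have *: "(LINT x|M. indicator Q x * F x) = (\<Sum>B\<in>P ` Q. LINT x|M. indicator B x * F x)"
    if "integrable M F" for F :: "'a \<Rightarrow> real"
    unfolding ind sum_distrib_right
    by (rule Bochner_Integration.integral_sum)
      (use that P in \<open>auto intro!: integrable_mult_indicator[where 'b=real, unfolded real_scaleR_def]\<close>)
  have "\<bar>LINT x|M. indicator Q x * G x\<bar> \<le> (\<Sum>B\<in>P ` Q. \<bar>LINT x|M. indicator B x * G x\<bar>)"
    unfolding *[OF int(1)] by (rule sum_abs)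
  also have "\<dots> \<le> (\<Sum>B\<in>P ` Q. LINT x|M. indicator B x * H x)"
    by (rule sum_mono) (use le in auto)
  finally show ?thesis unfolding *[OF int(2)] .
qed

lemma block_nn_integral_le:
  fixes G H :: "'a \<Rightarrow> ennreal"
  assumes fin: "finite (P ` Q)"
    and P: "\<And>z. z \<in> Q \<Longrightarrow> z \<in> P z \<and> P z \<subseteq> Q \<and> P z \<in> sets M"
    and eq: "\<And>z y. z \<in> Q \<Longrightarrow> y \<in> P z \<Longrightarrow> P y = P z"
    and meas: "G \<in> borel_measurable M" "H \<in> borel_measurable M"
    and le: "\<And>z. z \<in> Q \<Longrightarrow> (\<integral>\<^sup>+x\<in>P z. G x \<partial>M) \<le> (\<integral>\<^sup>+x\<in>P z. H x \<partial>M)"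
  shows "(\<integral>\<^sup>+x\<in>Q. G x \<partial>M) \<le> (\<integral>\<^sup>+x\<in>Q. H x \<partial>M)"
proof -
  have ind: "indicator Q x = (\<Sum>B\<in>P ` Q. indicator B x :: ennreal)" for x
    by (rule indicator_blocks[OF fin]) (use P eq in blast)+
  have *: "(\<integral>\<^sup>+x\<in>Q. F x \<partial>M) = (\<Sum>B\<in>P ` Q. \<integral>\<^sup>+x\<in>B. F x \<partial>M)"
    if "F \<in> borel_measurable M" for F
    unfolding ind sum_distrib_left
    by (rule nn_integral_sum) (use that P in \<open>auto intro!: borel_measurable_times_ennreal borel_measurable_indicator\<close>)
  show ?thesis unfolding *[OF meas(1)] *[OF meas(2)]
    by (rule sum_mono) (use le in auto)
qed

text \<open>
  Minkowski's inequality: the vector of the integrals is paired with itself, and Cauchy--Schwarz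
  is applied under the integral sign.
\<close>

lemma L2_set_integral_le:
  fixes u :: "'i \<Rightarrow> 'a \<Rightarrow> real"
  assumes fin: "finite K"
    and int: "\<And>k. k \<in> K \<Longrightarrow> integrable M (u k)" "integrable M H"
    and le: "\<And>x. x \<in> space M \<Longrightarrow> L2_set (\<lambda>k. u k x) K \<le> H x"
  shows "L2_set (\<lambda>k. LINT x|M. u k x) K \<le> (LINT x|M. H x)"
proof -
  define c where "c k = (LINT x|M. u k x)" for k
  have "(L2_set c K)\<^sup>2 = (\<Sum>k\<in>K. c k * (LINT x|M. u k x))"
    by (simp add: L2_set_def c_def power2_eq_square sum_nonneg)
  also have "\<dots> = (LINT x|M. (\<Sum>k\<in>K. c k * u k x))"
    using int by (simp add: Bochner_Integration.integral_sum)
  also have "\<dots> \<le> (LINT x|M. L2_set c K * H x)"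
  proof (rule integral_mono)
    fix x assume x: "x \<in> space M"
    have "(\<Sum>k\<in>K. c k * u k x) \<le> (\<Sum>k\<in>K. \<bar>c k\<bar> * \<bar>u k x\<bar>)"
      by (rule sum_mono) (metis abs_ge_self abs_mult)
    also have "\<dots> \<le> L2_set c K * L2_set (\<lambda>k. u k x) K" by (rule L2_set_mult_ineq)
    also have "\<dots> \<le> L2_set c K * H x" by (intro mult_left_mono le x L2_set_nonneg)
    finally show "(\<Sum>k\<in>K. c k * u k x) \<le> L2_set c K * H x" .
  qed (use int in auto)
  also have "\<dots> = L2_set c K * (LINT x|M. H x)" by simp
  finally have *: "(L2_set c K)\<^sup>2 \<le> L2_set c K * (LINT x|M. H x)" .
  show ?thesis
  proof (cases "L2_set c K = 0")
    case True
    have "0 \<le> (LINT x|M. H x)"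
      by (rule integral_nonneg_AE, rule AE_I2) (use le L2_set_nonneg order_trans in blast)
    then show ?thesis using True by (simp add: c_def[abs_def])
  next
    case False
    then show ?thesis using * L2_set_nonneg[of c K] by (simp add: power2_eq_square c_def[abs_def] less_le)
  qed
qed

text \<open>
  \<open>cube j x\<close> is the cube of level \<open>j\<close> that contains \<open>x\<close>. The measure is finite and every level
  has finitely many cubes, so a function that depends on the cubes of one level only (\<open>adapted\<close>,
  below) takes finitely many values and is measurable, bounded and integrable.
\<close>

locale dyadic_filtration = finite_measure M
  for M :: "'a measure" +
  fixes cube :: "nat \<Rightarrow> 'a \<Rightarrow> 'a set" and N :: real
  assumes cube_self: "x \<in> space M \<Longrightarrow> x \<in> cube j x"
    and cube_eq: "x \<in> space M \<Longrightarrow> y \<in> cube j x \<Longrightarrow> cube j y = cube j x"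
    and cube_sets: "x \<in> space M \<Longrightarrow> cube j x \<in> sets M"
    and cube_Suc: "x \<in> space M \<Longrightarrow> cube (Suc j) x \<subseteq> cube j x"
    and cube_pos: "x \<in> space M \<Longrightarrow> 0 < measure M (cube j x)"
    and cube_doubling: "x \<in> space M \<Longrightarrow> measure M (cube j x) \<le> N * measure M (cube (Suc j) x)"
    and finite_cubes: "finite (cube j ` space M)"
    and N_ge_1: "1 \<le> N"
begin

lemma cube_space: "x \<in> space M \<Longrightarrow> cube j x \<subseteq> space M"
  using cube_sets sets.sets_into_space by blast

lemma cube_in_space: "x \<in> space M \<Longrightarrow> y \<in> cube j x \<Longrightarrow> y \<in> space M"
  using cube_space by blast

lemma cube_mono: "x \<in> space M \<Longrightarrow> i \<le> j \<Longrightarrow> cube j x \<subseteq> cube i x"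
  by (induction j) (use cube_Suc le_Suc_eq in blast)+

lemma cube_eq_coarser: "x \<in> space M \<Longrightarrow> y \<in> cube j x \<Longrightarrow> i \<le> j \<Longrightarrow> cube i y = cube i x"
  using cube_mono cube_eq by blast

definition adapted :: "nat \<Rightarrow> ('a \<Rightarrow> 'b) \<Rightarrow> bool" where
  "adapted j u \<longleftrightarrow> (\<forall>x\<in>space M. \<forall>y\<in>cube j x. u y = u x)"

lemma adapted_finite_range:
  assumes "adapted j u" shows "finite (u ` space M)"
proof -
  have "u ` space M \<subseteq> (\<lambda>Q. u (SOME x. x \<in> Q)) ` (cube j ` space M)"
  proof clarify
    fix x assume x: "x \<in> space M"
    have "(SOME y. y \<in> cube j x) \<in> cube j x" using cube_self[OF x] by (rule someI)
    then have "u x = u (SOME y. y \<in> cube j x)" using assms x unfolding adapted_def by force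
    then show "u x \<in> (\<lambda>Q. u (SOME x. x \<in> Q)) ` cube j ` space M" using x by blast
  qed
  then show ?thesis using finite_cubes finite_subset by blast
qed

lemma adapted_measurable:
  assumes "adapted j u" "u \<in> space M \<rightarrow> space N'" shows "u \<in> measurable M N'"
proof (rule measurableI)
  show "\<And>x. x \<in> space M \<Longrightarrow> u x \<in> space N'" using assms by auto
  fix A
  have "u -` A \<inter> space M = \<Union>{Q \<in> cube j ` space M. Q \<subseteq> u -` A}"
  proof (intro equalityI subsetI)
    fix x assume "x \<in> u -` A \<inter> space M"
    then have x: "x \<in> space M" "u x \<in> A" by auto
    have "cube j x \<subseteq> u -` A"
    proof
      fix y assume "y \<in> cube j x"
      then have "u y = u x" using assms(1) x(1) unfolding adapted_def by blast
      then show "y \<in> u -` A" using x(2) by simp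
    qed
    then show "x \<in> \<Union>{Q \<in> cube j ` space M. Q \<subseteq> u -` A}" using x(1) cube_self[OF x(1), of j] by blast
  next
    fix x assume "x \<in> \<Union>{Q \<in> cube j ` space M. Q \<subseteq> u -` A}"
    then show "x \<in> u -` A \<inter> space M" using cube_space by blast
  qed
  moreover have "\<Union>{Q \<in> cube j ` space M. Q \<subseteq> u -` A} \<in> sets M"
    by (rule sets.finite_Union) (use finite_cubes[of j] cube_sets in \<open>auto intro: finite_subset\<close>)
  ultimately show "u -` A \<inter> space M \<in> sets M" by simp
qed

lemma adapted_borel: "adapted j u \<Longrightarrow> u \<in> borel_measurable M"
  by (rule adapted_measurable) auto

lemma adapted_mono: "adapted i u \<Longrightarrow> i \<le> j \<Longrightarrow> adapted j u"
  unfolding adapted_def using cube_mono by blast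

lemma adapted_comp: "adapted j u \<Longrightarrow> adapted j (\<lambda>x. F (u x))"
  unfolding adapted_def by auto
lemma adapted_comp2: "adapted j u \<Longrightarrow> adapted j v \<Longrightarrow> adapted j (\<lambda>x. F (u x) (v x))"
  unfolding adapted_def by auto
lemma adapted_sum: "(\<And>i. i \<in> I \<Longrightarrow> adapted j (u i)) \<Longrightarrow> adapted j (\<lambda>x. \<Sum>i\<in>I. u i x)"
  unfolding adapted_def by (intro ballI sum.cong) auto
lemma adapted_cube: "i \<le> j \<Longrightarrow> adapted j (\<lambda>x. F (cube i x))"
  unfolding adapted_def using cube_eq_coarser by metis

lemma adapted_bounded:
  assumes "adapted j (u :: 'a \<Rightarrow> real)" obtains B where "\<And>x. x \<in> space M \<Longrightarrow> \<bar>u x\<bar> \<le> B"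
proof -
  have "finite ((\<lambda>x. \<bar>u x\<bar>) ` space M)" using adapted_finite_range[OF adapted_comp[OF assms]] .
  then have "\<And>x. x \<in> space M \<Longrightarrow> \<bar>u x\<bar> \<le> Max ((\<lambda>x. \<bar>u x\<bar>) ` space M)" by auto
  then show ?thesis using that by blast
qed

lemma adapted_integrable:
  assumes "adapted j (u :: 'a \<Rightarrow> real)" shows "integrable M u"
proof -
  obtain B where "\<And>x. x \<in> space M \<Longrightarrow> \<bar>u x\<bar> \<le> B" using adapted_bounded[OF assms] by blast
  then show ?thesis by (intro integrable_const_bound[where B=B] adapted_borel[OF assms]) auto
qed

definition avg :: "('a \<Rightarrow> real) \<Rightarrow> 'a set \<Rightarrow> real" where
  "avg u Q = (LINT x|M. indicator Q x * u x) / measure M Q"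

lemma integrable_ind: "integrable M u \<Longrightarrow> Q \<in> sets M \<Longrightarrow> integrable M (\<lambda>x. indicator Q x * u x :: real)"
  using integrable_mult_indicator[of Q M u] by simp

lemma integral_ind_const: "x \<in> space M \<Longrightarrow> (LINT y|M. indicator (cube j x) y * c) = measure M (cube j x) * (c::real)"
  using cube_sets[of x j] sets.sets_into_space[of "cube j x" M] by (simp add: Int_absorb2)

end

text \<open>
  Subtracting the constant \<open>g0\<close> from \<open>g\<close> does not change the integral, because \<open>v\<close> has mean zero
  on \<open>P\<close>; only the oscillation of \<open>g\<close> is left.
\<close>

section \<open>Dyadic square functions and almost orthogonality\<close>

lemma osc_integral:
  fixes v g :: "'a \<Rightarrow> real"
  assumes P: "P \<in> sets M" and v: "integrable M v" and v0: "(LINT x|M. indicator P x * v x) = 0"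
    and g: "g \<in> borel_measurable M" and osc: "\<And>x. x \<in> P \<Longrightarrow> \<bar>g x - g0\<bar> \<le> c"
  shows "\<bar>LINT x|M. indicator P x * (v x * g x)\<bar> \<le> (LINT x|M. indicator P x * (c * \<bar>v x\<bar>))"
proof -
  have iv: "integrable M (\<lambda>x. indicator P x * v x)"
    using integrable_mult_indicator[OF P v] by simp
  have iva: "integrable M (\<lambda>x. indicator P x * \<bar>v x\<bar>)"
    using integrable_mult_indicator[OF P integrable_abs[OF v]] by simp
  have i1: "integrable M (\<lambda>x. indicator P x * (c * \<bar>v x\<bar>))"
    using integrable_mult_right[OF iva, of c] by (simp add: algebra_simps)
  have pw: "\<bar>v x\<bar> * \<bar>g x - g0\<bar> \<le> \<bar>c\<bar> * \<bar>v x\<bar>" "\<bar>v x\<bar> * \<bar>g x - g0\<bar> \<le> c * \<bar>v x\<bar>" if "x \<in> P" for x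
    using mult_right_mono[OF osc[OF that], of "\<bar>v x\<bar>"] mult_right_mono[OF abs_ge_self[of c], of "\<bar>v x\<bar>"]
    by (simp_all add: mult.commute)
  have i2: "integrable M (\<lambda>x. indicator P x * (v x * (g x - g0)))"
  proof (rule Bochner_Integration.integrable_bound[OF i1])
    show "(\<lambda>x. indicator P x * (v x * (g x - g0))) \<in> borel_measurable M"
      using v g P by measurable
    show "AE x in M. norm (indicator P x * (v x * (g x - g0))) \<le> norm (indicator P x * (c * \<bar>v x\<bar>))"
    proof (rule AE_I2)
      fix x
      show "norm (indicator P x * (v x * (g x - g0))) \<le> norm (indicator P x * (c * \<bar>v x\<bar>))"
        using pw[of x] by (cases "x \<in> P") (auto simp: abs_mult)
    qed
  qed
  have "(LINT x|M. indicator P x * (v x * g x)) = (LINT x|M. indicator P x * (v x * (g x - g0)) + g0 * (indicator P x * v x))"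
    by (simp add: algebra_simps)
  also have "\<dots> = (LINT x|M. indicator P x * (v x * (g x - g0)))"
    using i2 iv v0 by (simp)
  finally have "\<bar>LINT x|M. indicator P x * (v x * g x)\<bar> = \<bar>LINT x|M. indicator P x * (v x * (g x - g0))\<bar>" by simp
  also have "\<dots> \<le> (LINT x|M. \<bar>indicator P x * (v x * (g x - g0))\<bar>)" by (rule integral_abs_bound)
  also have "\<dots> \<le> (LINT x|M. indicator P x * (c * \<bar>v x\<bar>))"
  proof (rule integral_mono)
    fix x
    show "\<bar>indicator P x * (v x * (g x - g0))\<bar> \<le> indicator P x * (c * \<bar>v x\<bar>)"
      using pw[of x] by (cases "x \<in> P") (auto simp: abs_mult)
  qed (use i1 i2 in auto)
  finally show ?thesis .
qed

lemma sum_power_inj_le: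
  fixes s :: real
  assumes "0 \<le> s" "s < 1" "finite A" "inj_on g A"
  shows "(\<Sum>i\<in>A. s ^ g i) \<le> 1 / (1 - s)"
proof -
  have "(\<Sum>i\<in>A. s ^ g i) = (\<Sum>l\<in>g ` A. s ^ l)" using assms by (simp add: sum.reindex)
  also have "\<dots> \<le> (\<Sum>l. s ^ l)" using assms by (intro sum_le_suminf) auto
  also have "\<dots> = 1 / (1 - s)" using assms by (simp add: suminf_geometric)
  finally show ?thesis .
qed

context dyadic_filtration
begin

text \<open>
  Bumps adapted to \<open>Q\<close> in the normalisation of \<open>L^1\<close>. The last clause is Hoelder continuity
  expressed by dyadic cubes, with \<open>s\<close> in the role of \<open>2 powr (-\<alpha>)\<close>.
\<close>

definition test_fun :: "real \<Rightarrow> nat \<Rightarrow> 'a set \<Rightarrow> ('a \<Rightarrow> real) \<Rightarrow> bool" where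
  "test_fun s j Q \<psi> \<longleftrightarrow> \<psi> \<in> borel_measurable M \<and> (\<forall>y\<in>space M - Q. \<psi> y = 0)
     \<and> (\<forall>y\<in>Q. \<bar>\<psi> y\<bar> \<le> 1 / measure M Q) \<and> (LINT y|M. \<psi> y) = 0
     \<and> (\<forall>i\<ge>j. \<forall>y\<in>Q. \<forall>z\<in>cube i y. \<bar>\<psi> y - \<psi> z\<bar> \<le> s ^ (i - j) / measure M Q)"

end

text \<open>
  The test functions are indexed by components \<open>k\<close> as well as by cubes, because linearising a
  supremum requires a different choice for each component of a sequence. No constant below
  depends on \<open>\<psi>\<close> or on the number \<open>m\<close> of components; only this uniformity makes the
  linearisation legitimate.
\<close>

locale dyadic_square = dyadic_filtration M cube N
  for M :: "'a measure" and cube N +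
  fixes s :: real and \<psi> :: "nat \<Rightarrow> nat \<Rightarrow> 'a set \<Rightarrow> 'a \<Rightarrow> real" and m :: nat
  assumes s: "0 \<le> s" "s < 1"
    and test: "x \<in> space M \<Longrightarrow> test_fun s j (cube j x) (\<psi> k j (cube j x))"
begin

lemma psi_meas [measurable]: "x \<in> space M \<Longrightarrow> \<psi> k j (cube j x) \<in> borel_measurable M"
  and psi_supp: "x \<in> space M \<Longrightarrow> y \<in> space M \<Longrightarrow> y \<notin> cube j x \<Longrightarrow> \<psi> k j (cube j x) y = 0"
  and psi_bound: "x \<in> space M \<Longrightarrow> y \<in> cube j x \<Longrightarrow> \<bar>\<psi> k j (cube j x) y\<bar> \<le> 1 / measure M (cube j x)"
  and psi_mean: "x \<in> space M \<Longrightarrow> (LINT y|M. \<psi> k j (cube j x) y) = 0"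
  and psi_osc: "x \<in> space M \<Longrightarrow> y \<in> cube j x \<Longrightarrow> j \<le> i \<Longrightarrow> z \<in> cube i y \<Longrightarrow>
     \<bar>\<psi> k j (cube j x) y - \<psi> k j (cube j x) z\<bar> \<le> s ^ (i - j) / measure M (cube j x)"
  using test[of x j k] unfolding test_fun_def by blast+

definition T :: "nat \<Rightarrow> nat \<Rightarrow> ('a \<Rightarrow> real) \<Rightarrow> 'a \<Rightarrow> real" where
  "T k j f x = (LINT y|M. f y * \<psi> k j (cube j x) y)"

lemma adapted_T: "j \<le> i \<Longrightarrow> adapted i (T k j f)"
  unfolding T_def by (rule adapted_cube)

lemma psi_bound': "x \<in> space M \<Longrightarrow> y \<in> space M \<Longrightarrow> \<bar>\<psi> k j (cube j x) y\<bar> \<le> indicator (cube j x) y / measure M (cube j x)"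
  using psi_bound[of x y j k] psi_supp[of x y j k] by (cases "y \<in> cube j x") auto

lemma integrable_T:
  assumes "x \<in> space M" "integrable M f"
  shows "integrable M (\<lambda>y. f y * \<psi> k j (cube j x) y)"
proof (rule Bochner_Integration.integrable_bound)
  show "integrable M (\<lambda>y. f y / measure M (cube j x))" using assms by auto
  show "(\<lambda>y. f y * \<psi> k j (cube j x) y) \<in> borel_measurable M"
    using assms by measurable
  show "AE y in M. norm (f y * \<psi> k j (cube j x) y) \<le> norm (f y / measure M (cube j x))"
  proof (rule AE_I2)
    fix y assume "y \<in> space M"
    then have "\<bar>\<psi> k j (cube j x) y\<bar> \<le> 1 / measure M (cube j x)"
      using psi_bound'[OF assms(1), of y k j] by (auto simp: indicator_def split: if_splits intro: order_trans)
    then show "norm (f y * \<psi> k j (cube j x) y) \<le> norm (f y / measure M (cube j x))"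
      using mult_left_mono[of "\<bar>\<psi> k j (cube j x) y\<bar>" "1 / measure M (cube j x)" "\<bar>f y\<bar>"] by (simp add: abs_mult)
  qed
qed

lemma T_diff:
  assumes "x \<in> space M" "integrable M f" "integrable M g"
  shows "T k j (\<lambda>y. f y - g y) x = T k j f x - T k j g x"
  unfolding T_def left_diff_distrib using assms by (intro Bochner_Integration.integral_diff integrable_T)

lemma T_bound:
  assumes "x \<in> space M" "integrable M f"
  shows "\<bar>T k j f x\<bar> \<le> avg (\<lambda>y. \<bar>f y\<bar>) (cube j x)"
proof -
  have "\<bar>T k j f x\<bar> \<le> (LINT y|M. \<bar>f y * \<psi> k j (cube j x) y\<bar>)"
    unfolding T_def by (rule integral_abs_bound)
  also have "\<dots> \<le> (LINT y|M. (indicator (cube j x) y * \<bar>f y\<bar>) / measure M (cube j x))"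
  proof (rule integral_mono)
    show "integrable M (\<lambda>y. indicator (cube j x) y * \<bar>f y\<bar> / measure M (cube j x))"
      using integrable_ind[of "\<lambda>y. \<bar>f y\<bar>" "cube j x"] assms cube_sets by auto
    fix y assume "y \<in> space M"
    from mult_left_mono[OF psi_bound'[OF assms(1) this, of k j], of "\<bar>f y\<bar>"]
    show "\<bar>f y * \<psi> k j (cube j x) y\<bar> \<le> indicator (cube j x) y * \<bar>f y\<bar> / measure M (cube j x)"
      by (simp add: abs_mult mult_ac)
  qed (use integrable_T assms in auto)
  finally show ?thesis by (simp add: avg_def)
qed

text \<open>
  The test function of the cube of level \<open>j\<close> around \<open>z\<close>, rescaled to height one. In terms of it
  the coefficient \<open>T k j f\<close> is a mean of \<open>f\<close> times one globally defined function.
\<close>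

definition profile :: "nat \<Rightarrow> nat \<Rightarrow> 'a \<Rightarrow> real" where
  "profile k j z = measure M (cube j z) * \<psi> k j (cube j z) z"

lemma profile_eq: "x \<in> space M \<Longrightarrow> z \<in> cube j x \<Longrightarrow> profile k j z = measure M (cube j x) * \<psi> k j (cube j x) z"
  unfolding profile_def using cube_eq by simp

lemma profile_bound: "z \<in> space M \<Longrightarrow> \<bar>profile k j z\<bar> \<le> 1"
  unfolding profile_def using psi_bound[OF _ cube_self, of z k j] cube_pos[of z j]
  by (simp add: abs_mult field_simps)

lemma profile_measurable [measurable]: "profile k j \<in> borel_measurable M"
proof -
  have "profile k j z = (\<Sum>Q\<in>cube j ` space M. indicator Q z * (measure M Q * \<psi> k j Q z))" if z: "z \<in> space M" for z
  proof -
    have "(\<Sum>Q\<in>cube j ` space M. indicator Q z * (measure M Q * \<psi> k j Q z)) = (\<Sum>Q\<in>{cube j z}. indicator Q z * (measure M Q * \<psi> k j Q z))"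
    proof (rule sum.mono_neutral_right)
      show "\<forall>Q\<in>cube j ` space M - {cube j z}. indicator Q z * (measure M Q * \<psi> k j Q z) = 0"
        using cube_eq[of _ z j] by (auto simp: indicator_def)
    qed (use finite_cubes z in auto)
    then show ?thesis using cube_self[OF z] by (simp add: profile_def)
  qed
  moreover have "(\<lambda>z. \<Sum>Q\<in>cube j ` space M. indicator Q z * (measure M Q * \<psi> k j Q z)) \<in> borel_measurable M"
    using cube_sets by (intro borel_measurable_sum borel_measurable_times borel_measurable_indicator) auto
  ultimately show ?thesis by (simp cong: measurable_cong)
qed

lemma integral_profile: "x \<in> space M \<Longrightarrow> (LINT z|M. indicator (cube j x) z * profile k j z) = 0"
proof -
  assume x: "x \<in> space M"
  have "(LINT z|M. indicator (cube j x) z * profile k j z) = (LINT z|M. measure M (cube j x) * \<psi> k j (cube j x) z)"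
    by (rule Bochner_Integration.integral_cong) (use x psi_supp[OF x] profile_eq[OF x] in \<open>auto simp: indicator_def\<close>)
  then show ?thesis using psi_mean[OF x] by simp
qed

lemma T_eq_profile: "x \<in> space M \<Longrightarrow> measure M (cube j x) * T k j f x = (LINT z|M. indicator (cube j x) z * (f z * profile k j z))"
proof -
  assume x: "x \<in> space M"
  have "(LINT z|M. indicator (cube j x) z * (f z * profile k j z)) = (LINT z|M. measure M (cube j x) * (f z * \<psi> k j (cube j x) z))"
    by (rule Bochner_Integration.integral_cong) (use x psi_supp[OF x] profile_eq[OF x] in \<open>auto simp: indicator_def\<close>)
  then show ?thesis by (simp add: T_def)
qed

text \<open>
  On a cube of the finer level \<open>i\<close> the function \<open>a\<close> is constant and \<open>profile k i\<close> has mean zero,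
  so that only the oscillation \<open>s ^ (i - j)\<close> of the coarser profile is seen.
\<close>

lemma cross_bound:
  assumes ji: "j \<le> i" and a: "adapted i a"
  shows "\<bar>LINT z|M. a z * (profile k i z * profile k j z)\<bar> \<le> s ^ (i - j) * (LINT z|M. \<bar>a z\<bar>)"
proof -
  have a': "integrable M a" "a \<in> borel_measurable M" using adapted_integrable adapted_borel a by auto
  have iu: "integrable M (profile k i)" for k i
    by (rule integrable_const_bound[where B=1]) (use profile_bound in auto)
  have ind: "(LINT z|M. indicator (space M) z * F z) = (LINT z|M. F z)" for F :: "'a \<Rightarrow> real"
    by (rule Bochner_Integration.integral_cong) auto
  have "\<bar>LINT z|M. indicator (space M) z * (a z * (profile k i z * profile k j z))\<bar> \<le> (LINT z|M. indicator (space M) z * (s ^ (i - j) * \<bar>a z\<bar>))"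
  proof (rule block_integral_le[where P="cube i"])
    show "finite (cube i ` space M)" by (rule finite_cubes)
    show "\<And>z. z \<in> space M \<Longrightarrow> z \<in> cube i z \<and> cube i z \<subseteq> space M \<and> cube i z \<in> sets M"
      using cube_self cube_space cube_sets by blast
    show "\<And>z y. z \<in> space M \<Longrightarrow> y \<in> cube i z \<Longrightarrow> cube i y = cube i z" by (rule cube_eq)
    show "integrable M (\<lambda>z. a z * (profile k i z * profile k j z))"
    proof (rule Bochner_Integration.integrable_bound[OF a'(1)])
      show "(\<lambda>z. a z * (profile k i z * profile k j z)) \<in> borel_measurable M" using a' by measurable
      show "AE z in M. norm (a z * (profile k i z * profile k j z)) \<le> norm (a z)"
      proof (rule AE_I2)
        fix z assume "z \<in> space M"
        then have "\<bar>profile k i z\<bar> * \<bar>profile k j z\<bar> \<le> 1" by (intro mult_le_one profile_bound) auto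
        then show "norm (a z * (profile k i z * profile k j z)) \<le> norm (a z)"
          using mult_left_mono[of "\<bar>profile k i z\<bar> * \<bar>profile k j z\<bar>" 1 "\<bar>a z\<bar>"] by (simp add: abs_mult)
      qed
    qed
    show "integrable M (\<lambda>z. s ^ (i - j) * \<bar>a z\<bar>)" using a' by auto
    fix z assume z: "z \<in> space M"
    have az: "a y = a z" if "y \<in> cube i z" for y using a z that unfolding adapted_def by blast
    have "(LINT y|M. indicator (cube i z) y * (a y * (profile k i y * profile k j y))) = (LINT y|M. a z * (indicator (cube i z) y * (profile k i y * profile k j y)))"
      by (rule Bochner_Integration.integral_cong) (auto simp: indicator_def az)
    then have "\<bar>LINT y|M. indicator (cube i z) y * (a y * (profile k i y * profile k j y))\<bar> = \<bar>a z\<bar> * \<bar>LINT y|M. indicator (cube i z) y * (profile k i y * profile k j y)\<bar>"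
      by (simp add: abs_mult)
    also have "\<dots> \<le> \<bar>a z\<bar> * (LINT y|M. indicator (cube i z) y * (s ^ (i - j) * \<bar>profile k i y\<bar>))"
    proof (intro mult_left_mono osc_integral[where ?g0.0="profile k j z"])
      fix y assume y: "y \<in> cube i z"
      then have yz: "y \<in> cube j z" using cube_mono[OF z ji] by blast
      have "\<bar>\<psi> k j (cube j z) z - \<psi> k j (cube j z) y\<bar> \<le> s ^ (i - j) / measure M (cube j z)"
        using psi_osc[OF z cube_self[OF z] ji y] .
      then have "measure M (cube j z) * \<bar>\<psi> k j (cube j z) z - \<psi> k j (cube j z) y\<bar> \<le> s ^ (i - j)"
        using cube_pos[OF z, of j] by (simp add: field_simps)
      moreover have "\<bar>profile k j y - profile k j z\<bar> = measure M (cube j z) * \<bar>\<psi> k j (cube j z) z - \<psi> k j (cube j z) y\<bar>"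
        unfolding profile_eq[OF z yz] profile_eq[OF z cube_self[OF z]] right_diff_distrib[symmetric] abs_mult
        by (simp add: abs_minus_commute)
      ultimately show "\<bar>profile k j y - profile k j z\<bar> \<le> s ^ (i - j)" by simp
    qed (use cube_sets z iu integral_profile in auto)
    also have "\<dots> \<le> \<bar>a z\<bar> * (LINT y|M. indicator (cube i z) y * s ^ (i - j))"
    proof (rule mult_left_mono, rule integral_mono)
      show "integrable M (\<lambda>y. indicator (cube i z) y * (s ^ (i - j) * \<bar>profile k i y\<bar>))"
        using iu cube_sets[OF z] by (intro integrable_ind) auto
      show "integrable M (\<lambda>y. indicator (cube i z) y * s ^ (i - j))"
        using cube_sets[OF z] by (intro integrable_ind) auto
      show "\<And>y. y \<in> space M \<Longrightarrow> indicator (cube i z) y * (s ^ (i - j) * \<bar>profile k i y\<bar>) \<le> indicator (cube i z) y * s ^ (i - j)"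
        using profile_bound s by (intro mult_left_mono mult_left_le) auto
    qed auto
    also have "\<dots> = (LINT y|M. \<bar>a z\<bar> * (indicator (cube i z) y * s ^ (i - j)))" by simp
    also have "\<dots> = (LINT y|M. indicator (cube i z) y * (s ^ (i - j) * \<bar>a y\<bar>))"
      by (rule Bochner_Integration.integral_cong) (auto simp: indicator_def az)
    finally show "\<bar>LINT y|M. indicator (cube i z) y * (a y * (profile k i y * profile k j y))\<bar> \<le> (LINT y|M. indicator (cube i z) y * (s ^ (i - j) * \<bar>a y\<bar>))" .
  qed
  then show ?thesis unfolding ind by simp
qed

text \<open>
  With \<open>a j = T k j f\<close>, the sum \<open>X\<close> of the square integrals of the coefficients equals the
  integral of \<open>f * F\<close>, where \<open>F\<close> is the sum of \<open>a j * profile k j\<close>. By \<open>cross_bound\<close> and a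
  geometric series the integral of \<open>F\<^sup>2\<close> is at most \<open>2 * \<kappa> * X\<close>, and Young's inequality closes
  the loop.
\<close>

lemma L2_bound_scalar:
  assumes f: "f \<in> borel_measurable M" and fB: "\<And>x. x \<in> space M \<Longrightarrow> \<bar>f x\<bar> \<le> B"
  shows "(LINT x|M. (\<Sum>j\<in>{i0..J}. (T k j f x)\<^sup>2)) \<le> 2 / (1 - s) * (LINT x|M. (f x)\<^sup>2)"
proof -
  define \<kappa> where "\<kappa> = 1 / (1 - s)"
  have \<kappa>: "\<kappa> > 0" using s by (simp add: \<kappa>_def)
  define a where "a j = T k j f" for j
  have aj: "adapted j (a j)" for j unfolding a_def by (rule adapted_T) simp
  have am [measurable]: "a j \<in> borel_measurable M" for j using adapted_borel[OF aj] .
  have ia2: "integrable M (\<lambda>x. (a j x)\<^sup>2)" for j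
    by (rule adapted_integrable[OF adapted_comp[OF aj]])
  define I where "I = {i0..J}"
  define X where "X = (\<Sum>j\<in>I. LINT x|M. (a j x)\<^sup>2)"
  have if2: "integrable M (\<lambda>x. (f x)\<^sup>2)"
  proof (rule integrable_const_bound)
    show "AE x in M. norm ((f x)\<^sup>2) \<le> B\<^sup>2"
      by (rule AE_I2) (use fB in \<open>auto simp: abs_le_square_iff[symmetric] intro: order_trans[OF fB]\<close>)
    show "(\<lambda>x. (f x)\<^sup>2) \<in> borel_measurable M" using f by measurable
  qed
  have au_bd: "\<exists>C. \<forall>x\<in>space M. \<bar>a j x * profile k j x\<bar> \<le> C" for j
  proof -
    obtain C where C: "\<And>x. x \<in> space M \<Longrightarrow> \<bar>a j x\<bar> \<le> C" using adapted_bounded[OF aj] by blast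
    have "\<bar>a j x * profile k j x\<bar> \<le> C" if "x \<in> space M" for x
      using mult_mono[OF C[OF that] profile_bound[OF that, of k j]] C[OF that] by (simp add: abs_mult)
    then show ?thesis by blast
  qed
  have iau: "integrable M (\<lambda>x. a j x * profile k j x)" for j
  proof -
    obtain C where "\<forall>x\<in>space M. \<bar>a j x * profile k j x\<bar> \<le> C" using au_bd by blast
    then show ?thesis by (intro integrable_const_bound[where B=C]) auto
  qed
  have iauau: "integrable M (\<lambda>x. (a j x * profile k j x) * (a i x * profile k i x))" for i j
  proof -
    obtain C where C: "\<forall>x\<in>space M. \<bar>a j x * profile k j x\<bar> \<le> C" using au_bd by blast
    obtain D where D: "\<forall>x\<in>space M. \<bar>a i x * profile k i x\<bar> \<le> D" using au_bd by blast
    have "\<bar>(a j x * profile k j x) * (a i x * profile k i x)\<bar> \<le> C * D" if "x \<in> space M" for x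
      unfolding abs_mult[of "a j x * profile k j x"] using C D that by (intro mult_mono) (auto intro: order_trans[OF abs_ge_zero])
    then show ?thesis by (intro integrable_const_bound[where B="C*D"]) auto
  qed
  have ifau: "integrable M (\<lambda>x. f x * (a j x * profile k j x))" for j
  proof -
    obtain C where C: "\<forall>x\<in>space M. \<bar>a j x * profile k j x\<bar> \<le> C" using au_bd by blast
    have "\<bar>f x * (a j x * profile k j x)\<bar> \<le> B * C" if "x \<in> space M" for x
      unfolding abs_mult[of "f x"] using C fB that by (intro mult_mono) (auto intro: order_trans[OF abs_ge_zero])
    then show ?thesis using f by (intro integrable_const_bound[where B="B*C"]) auto
  qed
  have if1: "integrable M f" using f fB by (intro integrable_const_bound[where B=B]) auto
  have ind: "(LINT z|M. indicator (space M) z * F z) = (LINT z|M. F z)" for F :: "'a \<Rightarrow> real"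
    by (rule Bochner_Integration.integral_cong) auto
  let ?Q = "\<lambda>j. LINT x|M. (a j x)\<^sup>2"
  have one: "(?Q j) \<le> (LINT x|M. f x * (a j x * profile k j x))" for j
  proof -
    have "\<bar>LINT x|M. indicator (space M) x * (a j x)\<^sup>2\<bar> \<le> (LINT x|M. indicator (space M) x * (f x * (a j x * profile k j x)))"
    proof (rule block_integral_le[where P="cube j"])
      show "finite (cube j ` space M)" by (rule finite_cubes)
      show "\<And>z. z \<in> space M \<Longrightarrow> z \<in> cube j z \<and> cube j z \<subseteq> space M \<and> cube j z \<in> sets M"
        using cube_self cube_space cube_sets by blast
      show "\<And>z y. z \<in> space M \<Longrightarrow> y \<in> cube j z \<Longrightarrow> cube j y = cube j z" by (rule cube_eq)
      fix z assume z: "z \<in> space M"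
      have az: "a j y = a j z" if "y \<in> cube j z" for y using aj z that unfolding adapted_def by blast
      have "(LINT x|M. indicator (cube j z) x * (a j x)\<^sup>2) = (LINT x|M. indicator (cube j z) x * (a j z)\<^sup>2)"
        by (rule Bochner_Integration.integral_cong) (auto simp: indicator_def az)
      also have "\<dots> = a j z * (measure M (cube j z) * T k j f z)"
        unfolding integral_ind_const[OF z] by (simp add: a_def power2_eq_square)
      also have "\<dots> = (LINT x|M. a j z * (indicator (cube j z) x * (f x * profile k j x)))"
        unfolding T_eq_profile[OF z] by simp
      also have "\<dots> = (LINT x|M. indicator (cube j z) x * (f x * (a j x * profile k j x)))"
        by (rule Bochner_Integration.integral_cong) (auto simp: indicator_def az)
      finally have eq: "(LINT x|M. indicator (cube j z) x * (a j x)\<^sup>2) = (LINT x|M. indicator (cube j z) x * (f x * (a j x * profile k j x)))" .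
      have "0 \<le> (LINT x|M. indicator (cube j z) x * (a j x)\<^sup>2)" by (rule integral_nonneg_AE) auto
      then show "\<bar>LINT x|M. indicator (cube j z) x * (a j x)\<^sup>2\<bar> \<le> (LINT x|M. indicator (cube j z) x * (f x * (a j x * profile k j x)))"
        using eq by simp
    qed (use ia2 ifau in auto)
    then show ?thesis unfolding ind by simp
  qed
  define F where "F x = (\<Sum>j\<in>I. a j x * profile k j x)" for x
  have F2: "(F x)\<^sup>2 = (\<Sum>j\<in>I. \<Sum>i\<in>I. (a j x * profile k j x) * (a i x * profile k i x))" for x
    unfolding F_def power2_eq_square sum_product ..
  have iF2: "integrable M (\<lambda>x. (F x)\<^sup>2)" unfolding F2 using iauau by auto
  have cross: "(LINT x|M. (a j x * profile k j x) * (a i x * profile k i x)) \<le> s ^ (i - j + (j - i)) * ((LINT x|M. (a i x)\<^sup>2) / 2 + (?Q j) / 2)" for i j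
  proof -
    have wlog: "(LINT x|M. (a j x * profile k j x) * (a i x * profile k i x)) \<le> s ^ (i - j) * ((LINT x|M. (a i x)\<^sup>2) / 2 + (?Q j) / 2)" if ji: "j \<le> i" for i j
    proof -
      have ad: "adapted i (\<lambda>x. a i x * a j x)" by (rule adapted_comp2[OF aj adapted_mono[OF aj ji]])
      have "(LINT x|M. (a j x * profile k j x) * (a i x * profile k i x)) = (LINT x|M. (a i x * a j x) * (profile k i x * profile k j x))"
        by (simp add: mult_ac)
      also have "\<dots> \<le> s ^ (i - j) * (LINT x|M. \<bar>a i x * a j x\<bar>)"
        using cross_bound[OF ji ad, of k] by simp
      also have "\<dots> \<le> s ^ (i - j) * (LINT x|M. (a i x)\<^sup>2 / 2 + (a j x)\<^sup>2 / 2)"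
      proof (intro mult_left_mono integral_mono)
        show "integrable M (\<lambda>x. \<bar>a i x * a j x\<bar>)" using adapted_integrable[OF ad] by auto
        show "\<bar>a i x * a j x\<bar> \<le> (a i x)\<^sup>2 / 2 + (a j x)\<^sup>2 / 2" for x
          using sum_squares_bound[of "\<bar>a i x\<bar>" "\<bar>a j x\<bar>"] by (simp add: abs_mult)
      qed (use ia2 s in auto)
      finally show ?thesis using ia2 by simp
    qed
    show ?thesis
    proof (cases "j \<le> i")
      case True then show ?thesis using wlog[OF True] by simp
    next
      case False
      then have "i \<le> j" by simp
      from wlog[OF this] show ?thesis using False by (simp add: mult_ac add_ac)
    qed
  qed
  have gs: "(\<Sum>i\<in>I. s ^ (i - j + (j - i))) \<le> 2 * \<kappa>" for j
  proof -
    have "(\<Sum>i\<in>I. s ^ (i - j + (j - i))) = (\<Sum>i\<in>I \<inter> {..j}. s ^ (i - j + (j - i))) + (\<Sum>i\<in>I - {..j}. s ^ (i - j + (j - i)))"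
      by (rule sum.Int_Diff) (simp add: I_def)
    also have "\<dots> \<le> \<kappa> + \<kappa>" unfolding \<kappa>_def
      by (intro add_mono sum_power_inj_le s) (auto simp: I_def inj_on_def)
    finally show ?thesis by simp
  qed
  have XF: "(LINT x|M. (F x)\<^sup>2) \<le> 2 * \<kappa> * X"
  proof -
    have "(LINT x|M. (F x)\<^sup>2) = (\<Sum>j\<in>I. \<Sum>i\<in>I. LINT x|M. (a j x * profile k j x) * (a i x * profile k i x))"
      unfolding F2 using iauau by simp
    also have "\<dots> \<le> (\<Sum>j\<in>I. \<Sum>i\<in>I. s ^ (i - j + (j - i)) * ((LINT x|M. (a i x)\<^sup>2) / 2 + (?Q j) / 2))"
      by (intro sum_mono cross)
    also have "\<dots> = (\<Sum>j\<in>I. \<Sum>i\<in>I. s ^ (i - j + (j - i)) * ((LINT x|M. (a i x)\<^sup>2) / 2)) + (\<Sum>j\<in>I. \<Sum>i\<in>I. s ^ (i - j + (j - i)) * ((?Q j) / 2))"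
      by (simp add: distrib_left sum.distrib)
    also have "(\<Sum>j\<in>I. \<Sum>i\<in>I. s ^ (i - j + (j - i)) * ((LINT x|M. (a i x)\<^sup>2) / 2)) = (\<Sum>j\<in>I. \<Sum>i\<in>I. s ^ (i - j + (j - i)) * ((?Q j) / 2))"
      by (subst sum.swap) (simp add: add.commute)
    also have "(\<Sum>j\<in>I. \<Sum>i\<in>I. s ^ (i - j + (j - i)) * ((?Q j) / 2)) = (\<Sum>j\<in>I. (\<Sum>i\<in>I. s ^ (i - j + (j - i))) * ((?Q j) / 2))"
      by (simp only: sum_distrib_right)
    also have "\<dots> \<le> (\<Sum>j\<in>I. (2 * \<kappa>) * ((?Q j) / 2))"
      by (intro sum_mono mult_right_mono gs) auto
    also have "\<dots> = \<kappa> * X" by (simp add: X_def sum_distrib_left)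
    finally show ?thesis by (simp add: mult_ac)
  qed
  have "X \<le> (\<Sum>j\<in>I. LINT x|M. f x * (a j x * profile k j x))"
    unfolding X_def by (intro sum_mono one)
  also have "\<dots> = (LINT x|M. f x * F x)"
    unfolding F_def sum_distrib_left using ifau by simp
  \<comment> \<open>The weights in Young's inequality are such that the term with \<open>F\<close> becomes
    \<open>X / 2\<close>.\<close>
  also have "\<dots> \<le> (LINT x|M. \<kappa> * (f x)\<^sup>2 + (F x)\<^sup>2 / (4 * \<kappa>))"
  proof (rule integral_mono)
    show "integrable M (\<lambda>x. f x * F x)" unfolding F_def sum_distrib_left using ifau by auto
    show "integrable M (\<lambda>x. \<kappa> * (f x)\<^sup>2 + (F x)\<^sup>2 / (4 * \<kappa>))" using if2 iF2 by auto
    show "f x * F x \<le> \<kappa> * (f x)\<^sup>2 + (F x)\<^sup>2 / (4 * \<kappa>)" for x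
    proof -
      have "0 \<le> (2 * \<kappa> * f x - F x)\<^sup>2 / (4 * \<kappa>)" using \<kappa> by simp
      also have "\<dots> = \<kappa> * (f x)\<^sup>2 + (F x)\<^sup>2 / (4 * \<kappa>) - f x * F x"
        using \<kappa> by (simp add: power2_eq_square field_simps)
      finally show ?thesis by simp
    qed
  qed
  also have "\<dots> = \<kappa> * (LINT x|M. (f x)\<^sup>2) + (LINT x|M. (F x)\<^sup>2) / (4 * \<kappa>)"
    using if2 iF2 by simp
  also have "\<dots> \<le> \<kappa> * (LINT x|M. (f x)\<^sup>2) + (2 * \<kappa> * X) / (4 * \<kappa>)"
    using XF \<kappa> by (intro add_left_mono divide_right_mono) auto
  also have "\<dots> = \<kappa> * (LINT x|M. (f x)\<^sup>2) + X / 2" using \<kappa> by simp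
  finally have "X \<le> 2 * \<kappa> * (LINT x|M. (f x)\<^sup>2)" by simp
  moreover have "(LINT x|M. (\<Sum>j\<in>{i0..J}. (T k j f x)\<^sup>2)) = X"
    unfolding X_def I_def[symmetric] a_def[symmetric] using ia2 by simp
  ultimately show ?thesis by (simp add: \<kappa>_def)
qed

end

section \<open>The weak type inequality\<close>

lemma ennreal_mult4:
  "0 \<le> a \<Longrightarrow> 0 \<le> b \<Longrightarrow> 0 \<le> c \<Longrightarrow> 0 \<le> d \<Longrightarrow> ennreal a * ennreal b * ennreal c * ennreal d = ennreal (a * b * c * d)"
  by (simp add: ennreal_mult)

context dyadic_square
begin

definition nrm :: "(nat \<Rightarrow> 'a \<Rightarrow> real) \<Rightarrow> 'a \<Rightarrow> real" where
  "nrm f x = L2_set (\<lambda>k. f k x) {..<m}"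

definition S2 :: "(nat \<Rightarrow> 'a \<Rightarrow> real) \<Rightarrow> nat \<Rightarrow> nat \<Rightarrow> 'a \<Rightarrow> real" where
  "S2 f i J x = (\<Sum>j\<in>{i..J}. \<Sum>k<m. (T k j (f k) x)\<^sup>2)"

lemma nrm_nonneg [simp]: "0 \<le> nrm f x" by (simp add: nrm_def)

lemma nrm_sq: "(nrm f x)\<^sup>2 = (\<Sum>k<m. (f k x)\<^sup>2)"
  by (simp add: nrm_def L2_set_def sum_nonneg)

lemma nrm_triangle: "nrm (\<lambda>k y. f k y - g k y) x \<le> nrm f x + nrm g x"
proof -
  have "nrm (\<lambda>k y. f k y - g k y) x = L2_set (\<lambda>k. f k x + (- g k x)) {..<m}" by (simp add: nrm_def)
  also have "\<dots> \<le> L2_set (\<lambda>k. f k x) {..<m} + L2_set (\<lambda>k. - g k x) {..<m}" by (rule L2_set_triangle_ineq)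
  also have "L2_set (\<lambda>k. - g k x) {..<m} = nrm g x" by (simp add: nrm_def L2_set_def)
  finally show ?thesis by (simp add: nrm_def)
qed

lemma nrm_measurable [measurable]:
  "(\<And>k. k < m \<Longrightarrow> f k \<in> borel_measurable M) \<Longrightarrow> nrm f \<in> borel_measurable M"
  unfolding nrm_def[abs_def] L2_set_def by (intro measurable_compose[OF _ borel_measurable_sqrt] borel_measurable_sum) auto

lemma nrm_integrable:
  assumes "\<And>k. k < m \<Longrightarrow> integrable M (f k)" shows "integrable M (nrm f)"
proof (rule Bochner_Integration.integrable_bound)
  show "integrable M (\<lambda>x. \<Sum>k<m. \<bar>f k x\<bar>)" using assms by auto
  show "nrm f \<in> borel_measurable M" using assms by (intro nrm_measurable) auto
  show "AE x in M. norm (nrm f x) \<le> norm (\<Sum>k<m. \<bar>f k x\<bar>)"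
    using L2_set_le_sum_abs[of "\<lambda>k. f k _" "{..<m}"] by (intro AE_I2) (simp add: nrm_def sum_nonneg)
qed

lemma avg_nonneg: "(\<And>x. 0 \<le> v x) \<Longrightarrow> 0 \<le> avg v Q"
  unfolding avg_def by (intro divide_nonneg_nonneg integral_nonneg_AE) auto

lemma L2_avg_le:
  assumes "Q \<in> sets M" "\<And>k. k < m \<Longrightarrow> integrable M (f k)" "integrable M v"
    and "\<And>x. x \<in> Q \<Longrightarrow> nrm f x \<le> v x"
  shows "L2_set (\<lambda>k. avg (f k) Q) {..<m} \<le> avg v Q"
proof -
  have "L2_set (\<lambda>k. LINT x|M. indicator Q x * f k x / measure M Q) {..<m} \<le> (LINT x|M. indicator Q x * v x / measure M Q)"
  proof (rule L2_set_integral_le)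
    fix x
    have "L2_set (\<lambda>k. indicator Q x * f k x / measure M Q) {..<m} = indicator Q x / measure M Q * nrm f x"
      unfolding nrm_def by (subst L2_set_right_distrib) (auto)
    also have "\<dots> \<le> indicator Q x / measure M Q * v x"
      using assms(4)[of x] by (cases "x \<in> Q") (auto intro!: divide_right_mono)
    finally show "L2_set (\<lambda>k. indicator Q x * f k x / measure M Q) {..<m} \<le> indicator Q x * v x / measure M Q" by simp
  qed (use assms in \<open>auto intro!: integrable_ind\<close>)
  then show ?thesis unfolding avg_def by simp
qed

lemma adapted_S2: "adapted J (S2 f i J)"
  unfolding S2_def[abs_def] by (intro adapted_sum, rule adapted_comp[OF adapted_T]) auto

lemma S2_nonneg: "0 \<le> S2 f i J x" unfolding S2_def by (intro sum_nonneg) auto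

text \<open>
  The dyadic \<open>A_1\<close> condition. Testing against all nonnegative \<open>v\<close> replaces the essential infimum
  of \<open>w\<close> over the cube.
\<close>

definition A1 :: "('a \<Rightarrow> ennreal) \<Rightarrow> real \<Rightarrow> bool" where
  "A1 w C \<longleftrightarrow> (\<forall>x\<in>space M. \<forall>j. \<forall>v\<in>borel_measurable M.
     (\<integral>\<^sup>+y\<in>cube j x. w y \<partial>M) * (\<integral>\<^sup>+y\<in>cube j x. v y \<partial>M) \<le> ennreal (C * measure M (cube j x)) * (\<integral>\<^sup>+y\<in>cube j x. (v y * w y) \<partial>M))"

lemma A1_avg:
  assumes A1: "A1 w C" and C: "0 \<le> C" and w: "w \<in> borel_measurable M" and v: "integrable M v" "\<And>x. 0 \<le> v x"
    and x: "x \<in> space M"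
  shows "ennreal (avg v (cube j x)) * (\<integral>\<^sup>+y\<in>cube j x. w y \<partial>M) \<le> ennreal C * (\<integral>\<^sup>+y\<in>cube j x. (ennreal (v y) * w y) \<partial>M)"
proof -
  let ?Q = "cube j x" and ?d = "measure M (cube j x)"
  have d: "?d > 0" using cube_pos x by auto
  have "(\<integral>\<^sup>+y\<in>?Q. ennreal (v y) \<partial>M) = (\<integral>\<^sup>+y. ennreal (indicator ?Q y * v y) \<partial>M)"
    by (rule nn_integral_cong) (auto simp: indicator_def)
  also have "\<dots> = ennreal (LINT y|M. indicator ?Q y * v y)"
    by (rule nn_integral_eq_integral) (use v cube_sets[OF x] in \<open>auto intro!: integrable_ind\<close>)
  also have "(LINT y|M. indicator ?Q y * v y) = ?d * avg v ?Q" unfolding avg_def using d by simp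
  also have "ennreal (?d * avg v ?Q) = ennreal ?d * ennreal (avg v ?Q)" using avg_nonneg v by (intro ennreal_mult) auto
  finally have *: "(\<integral>\<^sup>+y\<in>?Q. ennreal (v y) \<partial>M) = ennreal ?d * ennreal (avg v ?Q)" .
  have "(\<lambda>y. ennreal (v y)) \<in> borel_measurable M" using v by auto
  then have "(\<integral>\<^sup>+y\<in>?Q. w y \<partial>M) * (\<integral>\<^sup>+y\<in>?Q. ennreal (v y) \<partial>M) \<le> ennreal (C * ?d) * (\<integral>\<^sup>+y\<in>?Q. (ennreal (v y) * w y) \<partial>M)"
    using A1[unfolded A1_def, rule_format, OF x, of "\<lambda>y. ennreal (v y)" j] by simp
  then have "ennreal ?d * (ennreal (avg v ?Q) * (\<integral>\<^sup>+y\<in>?Q. w y \<partial>M)) \<le> ennreal ?d * (ennreal C * (\<integral>\<^sup>+y\<in>?Q. (ennreal (v y) * w y) \<partial>M))"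
    unfolding * using C by (simp add: ennreal_mult mult_ac)
  then show ?thesis using d by (subst (asm) ennreal_mult_le_mult_iff) auto
qed

text \<open>
  Replacing \<open>v\<close> by its means over disjoint cubes of varying levels \<open>t z\<close> costs only the \<open>A_1\<close>
  constant in \<open>L^1(w)\<close>.
\<close>

lemma A1_avg_blocks:
  assumes A1: "A1 w C" and C: "0 \<le> C" and w: "w \<in> borel_measurable M" and v: "integrable M v" "\<And>x. 0 \<le> v x"
    and P0: "P0 \<subseteq> space M" and fin: "finite ((\<lambda>z. cube (t z) z) ` P0)"
    and sub: "\<And>z. z \<in> P0 \<Longrightarrow> cube (t z) z \<subseteq> P0"
    and t: "\<And>z y. z \<in> P0 \<Longrightarrow> y \<in> cube (t z) z \<Longrightarrow> t y = t z"
    and am: "(\<lambda>z. avg v (cube (t z) z)) \<in> borel_measurable M"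
  shows "(\<integral>\<^sup>+z\<in>P0. (ennreal (avg v (cube (t z) z)) * w z) \<partial>M) \<le> ennreal C * (\<integral>\<^sup>+z\<in>P0. (ennreal (v z) * w z) \<partial>M)"
proof -
  have *: "cube (t y) y = cube (t z) z" if "z \<in> P0" "y \<in> cube (t z) z" for y z
    using t[OF that] cube_eq[of z y "t z"] that P0 by auto
  have "(\<integral>\<^sup>+z\<in>P0. (ennreal (avg v (cube (t z) z)) * w z) \<partial>M) \<le> (\<integral>\<^sup>+z\<in>P0. (ennreal C * (ennreal (v z) * w z)) \<partial>M)"
  proof (rule block_nn_integral_le[where P="\<lambda>z. cube (t z) z"])
    show "\<And>z. z \<in> P0 \<Longrightarrow> z \<in> cube (t z) z \<and> cube (t z) z \<subseteq> P0 \<and> cube (t z) z \<in> sets M"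
      using P0 sub cube_self cube_sets by blast
    fix z assume z: "z \<in> P0"
    then have zs: "z \<in> space M" using P0 by blast
    let ?Q = "cube (t z) z"
    have "(\<integral>\<^sup>+y\<in>?Q. (ennreal (avg v (cube (t y) y)) * w y) \<partial>M) = (\<integral>\<^sup>+y. ennreal (avg v ?Q) * (w y * indicator ?Q y) \<partial>M)"
      by (rule nn_integral_cong) (auto simp: indicator_def *[OF z])
    also have "\<dots> = ennreal (avg v ?Q) * (\<integral>\<^sup>+y\<in>?Q. w y \<partial>M)"
      using w cube_sets[OF zs] by (intro nn_integral_cmult) auto
    also have "\<dots> \<le> ennreal C * (\<integral>\<^sup>+y\<in>?Q. (ennreal (v y) * w y) \<partial>M)"
      by (rule A1_avg[OF A1 C w v zs])
    also have "\<dots> = (\<integral>\<^sup>+y. ennreal C * (ennreal (v y) * w y * indicator ?Q y) \<partial>M)"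
      using w v cube_sets[OF zs] by (intro nn_integral_cmult[symmetric] borel_measurable_times_ennreal borel_measurable_indicator) auto
    finally show "(\<integral>\<^sup>+y\<in>?Q. (ennreal (avg v (cube (t y) y)) * w y) \<partial>M) \<le> (\<integral>\<^sup>+y\<in>?Q. (ennreal C * (ennreal (v y) * w y)) \<partial>M)"
      by (simp add: mult.assoc)
    show "\<And>z y. z \<in> P0 \<Longrightarrow> y \<in> cube (t z) z \<Longrightarrow> cube (t y) y = cube (t z) z" by (rule *)
  qed (use fin w v am in auto)
  also have "\<dots> = (\<integral>\<^sup>+z. ennreal C * (ennreal (v z) * w z * indicator P0 z) \<partial>M)" by (simp add: mult.assoc)
  also have "\<dots> = ennreal C * (\<integral>\<^sup>+z\<in>P0. (ennreal (v z) * w z) \<partial>M)"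
  proof (rule nn_integral_cmult)
    have "P0 = \<Union>((\<lambda>z. cube (t z) z) ` P0)" using sub P0 cube_self by blast
    also have "\<dots> \<in> sets M" using fin P0 cube_sets by (intro sets.finite_Union) auto
    finally have "P0 \<in> sets M" .
    then show "(\<lambda>z. ennreal (v z) * w z * indicator P0 z) \<in> borel_measurable M" using v w by auto
  qed
  finally show ?thesis .
qed

text \<open>
  Bounded families suffice as the domain of the \<open>L^2(w)\<close> bound, because the family of means in a
  Calderon--Zygmund decomposition is bounded.
\<close>

definition L2w :: "('a \<Rightarrow> ennreal) \<Rightarrow> nat \<Rightarrow> real \<Rightarrow> bool" where
  "L2w w J C \<longleftrightarrow> (\<forall>g B. (\<forall>k<m. g k \<in> borel_measurable M) \<longrightarrow> (\<forall>x\<in>space M. nrm g x \<le> B) \<longrightarrow>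
     (\<integral>\<^sup>+x. (ennreal (S2 g 0 J x) * w x) \<partial>M) \<le> ennreal C * (\<integral>\<^sup>+x. (ennreal ((nrm g x)\<^sup>2) * w x) \<partial>M))"

lemma S2_mono_start: "S2 g i J x \<le> S2 g 0 J x"
  unfolding S2_def by (intro sum_mono2) (auto intro: sum_nonneg)

text \<open>
  A Calderon--Zygmund decomposition of finite depth. The stopping level \<open>t x\<close> is the first level
  from \<open>i0\<close> on at which the mean of \<open>\<bar>f\<bar>\<close> exceeds \<open>\<theta>\<close>, or the last level \<open>J\<close>. On each stopping
  cube \<open>f\<close> is split into its mean \<open>g\<close> and a remainder \<open>b\<close> of mean zero. By doubling \<open>\<bar>g\<bar>\<close> is at
  most \<open>N * \<theta>\<close>, so the square function of \<open>g\<close> is estimated in \<open>L^2(w)\<close>. At a point outside the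
  set \<open>E\<close> of large means, a coefficient of \<open>b\<close> of level \<open>j\<close> only meets stopping cubes of levels
  \<open>t \<ge> j\<close>; each of them contributes with the oscillation \<open>s ^ (t - j)\<close> of the test function, and
  summing over \<open>j\<close> gives a geometric series. So the square function of \<open>b\<close> is estimated in
  \<open>L^1(w)\<close>. The set \<open>E\<close> is estimated by the means themselves. The weight and its \<open>L^2(w)\<close> bound
  are parameters because the inequality is applied to the constant weight first, and later to
  \<open>A_1\<close> weights.
\<close>

lemma weak_type:
  assumes A1: "A1 w CA" and CA: "0 \<le> CA" and L2: "L2w w J C2" and C2: "0 \<le> C2"
    and w [measurable]: "w \<in> borel_measurable M"
    and f: "\<And>k. k < m \<Longrightarrow> integrable M (f k)"
    and x0: "x0 \<in> space M" and i0: "i0 \<le> J" and lam: "0 < \<theta>" and start: "avg (nrm f) (cube i0 x0) \<le> \<theta>"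
  shows "ennreal \<theta> * (\<integral>\<^sup>+x\<in>{x\<in>cube i0 x0. \<theta>\<^sup>2 < S2 f i0 J x}. w x \<partial>M)
    \<le> ennreal (CA + 4 * C2 * N * CA + 2 * CA * (1 / (1 - s)) * (1 + CA)) * (\<integral>\<^sup>+x\<in>cube i0 x0. (ennreal (nrm f x) * w x) \<partial>M)"
proof -
  define h where "h = nrm f"
  have h: "integrable M h" "\<And>x. 0 \<le> h x" unfolding h_def using nrm_integrable[of f, OF f] by auto
  then have [measurable]: "h \<in> borel_measurable M" by auto
  define mj where "mj j x = avg h (cube j x)" for j x
  define P0 where "P0 = cube i0 x0"
  have P0s [measurable]: "P0 \<in> sets M" and P0sp: "P0 \<subseteq> space M" unfolding P0_def using cube_sets cube_space x0 by auto
  have P0c: "cube i0 z = P0" if "z \<in> P0" for z using that cube_eq x0 unfolding P0_def by blast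
  define t where "t x = (LEAST j. i0 \<le> j \<and> (\<theta> < mj j x \<or> j = J))" for x
  have tprop: "i0 \<le> t x" "t x \<le> J" "\<theta> < mj (t x) x \<or> t x = J" for x
    using LeastI[of "\<lambda>j. i0 \<le> j \<and> (\<theta> < mj j x \<or> j = J)" J] Least_le[of "\<lambda>j. i0 \<le> j \<and> (\<theta> < mj j x \<or> j = J)" J] i0
    unfolding t_def by auto
  have tless: "mj i x \<le> \<theta>" if "i0 \<le> i" "i < t x" for i x
    using not_less_Least[of i "\<lambda>j. i0 \<le> j \<and> (\<theta> < mj j x \<or> j = J)"] that unfolding t_def by auto
  have mjeq: "mj i y = mj i z" if "z \<in> space M" "y \<in> cube j z" "i \<le> j" for i j y z
    unfolding mj_def using cube_eq_coarser[OF that] by simp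
  have teq: "t y = t z" if z: "z \<in> space M" and y: "y \<in> cube (t z) z" for y z
    unfolding t_def[of y]
  proof (rule Least_equality)
    show "i0 \<le> t z \<and> (\<theta> < mj (t z) y \<or> t z = J)" using tprop[of z] mjeq[OF z y, of "t z"] by auto
    fix j assume j: "i0 \<le> j \<and> (\<theta> < mj j y \<or> j = J)"
    show "t z \<le> j"
    proof (rule ccontr)
      assume "\<not> t z \<le> j"
      then have "j < t z" by simp
      then have "mj j y \<le> \<theta>" "j \<noteq> J" using tless[of j z] mjeq[OF z y, of j] j tprop(2)[of z] by auto
      then show False using j by auto
    qed
  qed
  have tJ: "adapted J t" unfolding adapted_def
  proof (intro ballI)
    fix x y assume "x \<in> space M" "y \<in> cube J x"
    then show "t y = t x" using teq[of x y] cube_mono[of x "t x" J] tprop(2)[of x] by blast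
  qed
  let ?Z = "{x\<in>P0. \<theta>\<^sup>2 < S2 f i0 J x}"
  define P where "P z = cube (t z) z" for z
  have Peq: "P y = P z" if "z \<in> space M" "y \<in> P z" for y z
  proof -
    have y: "y \<in> cube (t z) z" using that(2) by (simp only: P_def)
    show ?thesis unfolding P_def teq[OF that(1) y] by (rule cube_eq[OF that(1) y])
  qed
  have PJ: "adapted J P" unfolding adapted_def
  proof (intro ballI)
    fix x y assume "x \<in> space M" "y \<in> cube J x"
    then show "P y = P x" using Peq[of x y] cube_mono[of x "t x" J] tprop(2)[of x] unfolding P_def by blast
  qed
  have PP0: "P z \<subseteq> P0" if "z \<in> P0" for z
    using cube_mono[of z i0 "t z"] tprop(1)[of z] P0sp P0c[OF that] that unfolding P_def by blast
  have Pfin: "finite (P ` A)" if "A \<subseteq> space M" for A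
    using adapted_finite_range[OF PJ] that by (meson finite_subset image_mono)
  have Pself: "z \<in> P z" "P z \<subseteq> space M" "P z \<in> sets M" "0 < measure M (P z)" if "z \<in> space M" for z
    using cube_self cube_space cube_sets cube_pos that unfolding P_def by auto
  define mt where "mt z = avg h (P z)" for z
  have mtJ: "adapted J mt" unfolding mt_def[abs_def] by (rule adapted_comp[OF PJ])
  have mt0: "0 \<le> mt z" for z unfolding mt_def by (rule avg_nonneg) (rule h)
  have mtm [measurable]: "mt \<in> borel_measurable M" by (rule adapted_borel[OF mtJ])
  have mtl: "mt z = mj (t z) z" for z unfolding mt_def mj_def P_def ..
  have mtN: "mt z \<le> N * \<theta>" if z: "z \<in> P0" for z
  proof (cases "t z = i0")
    case True
    have "mt z \<le> \<theta>" unfolding mtl True mj_def P0c[OF z] h_def using start by (simp add: P0_def)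
    also have "\<dots> \<le> N * \<theta>" using N_ge_1 lam by simp
    finally show ?thesis .
  next
    case False
    then obtain i where i: "t z = Suc i" "i0 \<le> i" using tprop(1)[of z] by (cases "t z") auto
    have zs: "z \<in> space M" using z P0sp by blast
    let ?A = "cube (Suc i) z" and ?B = "cube i z"
    have le: "mj i z \<le> \<theta>" using tless[of i z] i by simp
    have "(LINT x|M. indicator ?A x * h x) \<le> (LINT x|M. indicator ?B x * h x)"
      using cube_Suc[OF zs, of i] h cube_sets[OF zs] by (intro integral_mono integrable_ind) (auto simp: indicator_def)
    also have "\<dots> = measure M ?B * mj i z" unfolding mj_def avg_def using cube_pos[OF zs, of i] by simp
    also have "\<dots> \<le> (N * measure M ?A) * \<theta>"
      using cube_doubling[OF zs, of i] le lam N_ge_1 avg_nonneg[OF h(2)] by (intro mult_mono) (auto simp: mj_def)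
    finally have "(LINT x|M. indicator ?A x * h x) \<le> (N * \<theta>) * measure M ?A" by (simp add: mult_ac)
    then show ?thesis unfolding mt_def P_def i avg_def using cube_pos[OF zs, of "Suc i"] by (simp add: divide_le_eq)
  qed
  define W where "W A = (\<integral>\<^sup>+x\<in>A. w x \<partial>M)" for A
  define H where "H = (\<integral>\<^sup>+x\<in>P0. (ennreal (h x) * w x) \<partial>M)"
  let ?Mt = "\<integral>\<^sup>+z\<in>P0. (ennreal (mt z) * w z) \<partial>M"
  have intmt: "?Mt \<le> ennreal CA * H"
    unfolding H_def mt_def P_def
    by (rule A1_avg_blocks[OF A1 CA w h P0sp])
      (use Pfin[OF P0sp] PP0 teq P0sp mtm in \<open>auto simp: P_def[abs_def] mt_def[abs_def]\<close>)
  \<comment> \<open>The test for \<open>P0\<close> is written in terms of \<open>cube i0 z\<close>, so that \<open>g\<close> is visibly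
    adapted to level \<open>J\<close>.\<close>
  define g where "g k z = (if cube i0 z = P0 then avg (f k) (P z) else 0)" for k z
  have gJ: "adapted J (g k)" for k
  proof -
    have 1: "adapted J (\<lambda>z. cube i0 z)" using adapted_cube[OF i0, of "\<lambda>Q. Q"] .
    show ?thesis unfolding g_def[abs_def] by (rule adapted_comp2[OF 1 PJ])
  qed
  have gP0: "g k z = avg (f k) (P z)" if "z \<in> P0" for k z using P0c[OF that] by (simp add: g_def)
  have gout: "g k z = 0" if "z \<in> space M" "z \<notin> P0" for k z using cube_self[OF that(1), of i0] that by (auto simp: g_def)
  have gi: "integrable M (g k)" for k by (rule adapted_integrable[OF gJ])
  have gn: "nrm g z \<le> mt z" if z: "z \<in> P0" for z
  proof -
    have zs: "z \<in> space M" using z P0sp by blast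
    have "nrm g z = L2_set (\<lambda>k. avg (f k) (P z)) {..<m}" unfolding nrm_def gP0[OF z] ..
    also have "\<dots> \<le> mt z" unfolding mt_def
      by (rule L2_avg_le) (use Pself[OF zs] f h in \<open>auto simp: h_def\<close>)
    finally show ?thesis .
  qed
  have gn0: "nrm g z = 0" if "z \<in> space M" "z \<notin> P0" for z
    unfolding nrm_def using gout[OF that] by (simp add: L2_set_def)
  define b where "b k z = f k z - g k z" for k z
  have bi: "integrable M (b k)" if "k < m" for k unfolding b_def[abs_def] using f[OF that] gi by auto
  have b0: "(LINT x|M. indicator (P z) x * b k x) = 0" if k: "k < m" and z: "z \<in> P0" for k z
  proof -
    have zs: "z \<in> space M" using z P0sp by blast
    have "(LINT x|M. indicator (P z) x * b k x) = (LINT x|M. indicator (P z) x * f k x - indicator (P z) x * avg (f k) (P z))"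
    proof (rule Bochner_Integration.integral_cong)
      fix x show "indicator (P z) x * b k x = indicator (P z) x * f k x - indicator (P z) x * avg (f k) (P z)"
        using gP0[of x k] Peq[OF zs, of x] PP0[OF z] by (cases "x \<in> P z") (auto simp: b_def)
    qed simp
    also have "\<dots> = (LINT x|M. indicator (P z) x * f k x) - (LINT x|M. indicator (P z) x * avg (f k) (P z))"
      using f[OF k] Pself[OF zs] by (intro Bochner_Integration.integral_diff integrable_ind) auto
    also have "(LINT x|M. indicator (P z) x * avg (f k) (P z)) = measure M (P z) * avg (f k) (P z)"
      unfolding P_def by (rule integral_ind_const[OF zs])
    also have "\<dots> = (LINT x|M. indicator (P z) x * f k x)" unfolding avg_def using Pself[OF zs] by simp
    finally show ?thesis by simp
  qed
  define E where "E = {x\<in>P0. \<theta> < mt x}"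
  let ?hm = "\<lambda>z. ennreal (h z) * w z * indicator P0 z + ennreal (mt z) * w z * indicator P0 z"
  have Es [measurable]: "E \<in> sets M" unfolding E_def using sets.sets_into_space by measurable
  have notE: "mj j x \<le> \<theta>" if "x \<in> P0 - E" "i0 \<le> j" "j \<le> J" for j x
  proof -
    have "mt x \<le> \<theta>" using that by (auto simp: E_def)
    then have "t x = J" using tprop(3)[of x] mtl[of x] by auto
    then show ?thesis using tless[of j x] \<open>mt x \<le> \<theta>\<close> mtl[of x] that by (cases "j = J") auto
  qed
  have tge: "j \<le> t z" if x: "x \<in> P0 - E" and j: "i0 \<le> j" "j \<le> J" and z: "z \<in> cube j x" for j x z
  proof (rule ccontr)
    assume "\<not> j \<le> t z"
    then have tz: "t z < j" by simp
    then have "\<theta> < mj (t z) z" using tprop(3)[of z] j by auto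
    also have "mj (t z) z = mj (t z) x" using mjeq[of x z j "t z"] x z tz P0sp by auto
    also have "\<dots> \<le> \<theta>" using notE[OF x, of "t z"] tprop[of z] by auto
    finally show False by simp
  qed
  \<comment> \<open>The decay factor for the stopping cube of \<open>z\<close> as seen from level \<open>j\<close>; coarser
    stopping cubes do not occur in the cubes considered below.\<close>
  define \<rho> where "\<rho> j z = (if j \<le> t z then s ^ (t z - j) else 0)" for j z
  have \<rho>J: "adapted J (\<rho> j)" for j unfolding \<rho>_def[abs_def] by (rule adapted_comp[OF tJ])
  have \<rho>01: "0 \<le> \<rho> j z" "\<rho> j z \<le> 1" for j z unfolding \<rho>_def using s by (auto intro: power_le_one)
  have \<rho>m [measurable]: "\<rho> j \<in> borel_measurable M" for j by (rule adapted_borel[OF \<rho>J])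
  have \<rho>b: "integrable M (\<lambda>z. \<rho> j z * v z)" if v: "integrable M v" for j and v :: "'a \<Rightarrow> real"
  proof (rule Bochner_Integration.integrable_bound[OF v])
    show "(\<lambda>z. \<rho> j z * v z) \<in> borel_measurable M" using v by auto
    show "AE x in M. norm (\<rho> j x * v x) \<le> norm (v x)"
      using \<rho>01 by (intro AE_I2) (auto simp: abs_mult intro: mult_left_le_one_le)
  qed
  have Tb: "\<bar>T k j (b k) x\<bar> \<le> avg (\<lambda>z. \<rho> j z * \<bar>b k z\<bar>) (cube j x)"
    if k: "k < m" and x: "x \<in> P0 - E" and j: "i0 \<le> j" "j \<le> J" for k j x
  proof -
    have xs: "x \<in> space M" using x P0sp by blast
    let ?Q = "cube j x" and ?\<psi> = "\<psi> k j (cube j x)"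
    have QP0: "?Q \<subseteq> P0" using cube_mono[OF xs j(1)] P0c x by auto
    have "T k j (b k) x = (LINT z|M. indicator ?Q z * (b k z * ?\<psi> z))"
      unfolding T_def by (rule Bochner_Integration.integral_cong) (use psi_supp[OF xs] in \<open>auto simp: indicator_def\<close>)
    also have "\<bar>\<dots>\<bar> \<le> (LINT z|M. indicator ?Q z * (\<rho> j z * \<bar>b k z\<bar> / measure M ?Q))"
    proof (rule block_integral_le[where P=P])
      show "finite (P ` ?Q)" by (rule Pfin) (use QP0 P0sp in auto)
      show "z \<in> P z \<and> P z \<subseteq> ?Q \<and> P z \<in> sets M" if z: "z \<in> ?Q" for z
      proof -
        have "z \<in> space M" using z QP0 P0sp by auto
        then show ?thesis using Pself[of z] cube_mono[of z j "t z"] tge[OF x j z] cube_eq[OF xs z] unfolding P_def by auto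
      qed
      show "P y = P z" if "z \<in> ?Q" "y \<in> P z" for z y using that Peq QP0 P0sp by blast
      show "integrable M (\<lambda>z. b k z * ?\<psi> z)" using bi[OF k] xs by (intro integrable_T)
      show "integrable M (\<lambda>z. \<rho> j z * \<bar>b k z\<bar> / measure M ?Q)" using \<rho>b[of "\<lambda>z. \<bar>b k z\<bar>"] bi[OF k] by auto
      fix z assume z: "z \<in> ?Q"
      then have zs: "z \<in> space M" and zP0: "z \<in> P0" using QP0 P0sp by auto
      have "\<bar>LINT y|M. indicator (P z) y * (b k y * ?\<psi> y)\<bar> \<le> (LINT y|M. indicator (P z) y * (s ^ (t z - j) / measure M ?Q * \<bar>b k y\<bar>))"
      proof (rule osc_integral[where ?g0.0="?\<psi> z"])
        fix y assume y: "y \<in> P z"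
        show "\<bar>?\<psi> y - ?\<psi> z\<bar> \<le> s ^ (t z - j) / measure M ?Q"
          using psi_osc[OF xs z tge[OF x j z], of y k] y by (simp add: P_def abs_minus_commute)
      qed (use Pself zs bi k b0 zP0 xs psi_meas in auto)
      also have "\<dots> = (LINT y|M. indicator (P z) y * (\<rho> j y * \<bar>b k y\<bar> / measure M ?Q))"
      proof (rule Bochner_Integration.integral_cong)
        fix y
        have "\<rho> j y = s ^ (t z - j)" if "y \<in> P z"
          using teq[OF zs, of y] that tge[OF x j z] by (auto simp: \<rho>_def P_def)
        then show "indicator (P z) y * (s ^ (t z - j) / measure M ?Q * \<bar>b k y\<bar>) = indicator (P z) y * (\<rho> j y * \<bar>b k y\<bar> / measure M ?Q)"
          by (auto simp: indicator_def)
      qed simp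
      finally show "\<bar>LINT y|M. indicator (P z) y * (b k y * ?\<psi> y)\<bar> \<le> (LINT y|M. indicator (P z) y * (\<rho> j y * \<bar>b k y\<bar> / measure M ?Q))" .
    qed
    finally show ?thesis unfolding avg_def by simp
  qed
  define bn where "bn = nrm b"
  have bni: "integrable M bn" unfolding bn_def by (rule nrm_integrable) (rule bi)
  have bn0: "0 \<le> bn z" for z by (simp add: bn_def)
  have bnm [measurable]: "bn \<in> borel_measurable M" using bni by auto
  have bnle: "bn z \<le> h z + mt z" if "z \<in> P0" for z
    using nrm_triangle[of f g z] gn[OF that] unfolding bn_def b_def[abs_def] h_def by linarith
  define \<beta> where "\<beta> j x = avg (\<lambda>z. \<rho> j z * bn z) (cube j x)" for j x
  have \<beta>0: "0 \<le> \<beta> j x" for j x unfolding \<beta>_def using \<rho>01 bn0 by (intro avg_nonneg) auto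
  have \<beta>m [measurable]: "\<beta> j \<in> borel_measurable M" for j
    unfolding \<beta>_def[abs_def] by (rule adapted_borel[of j], rule adapted_cube) simp
  have Tb2: "(\<Sum>k<m. (T k j (b k) x)\<^sup>2) \<le> (\<beta> j x)\<^sup>2" if x: "x \<in> P0 - E" and j: "i0 \<le> j" "j \<le> J" for j x
  proof -
    have xs: "x \<in> space M" using x P0sp by blast
    have "L2_set (\<lambda>k. T k j (b k) x) {..<m} = L2_set (\<lambda>k. \<bar>T k j (b k) x\<bar>) {..<m}" by (simp add: L2_set_def)
    also have "\<dots> \<le> L2_set (\<lambda>k. avg (\<lambda>z. \<rho> j z * \<bar>b k z\<bar>) (cube j x)) {..<m}"
      using Tb[OF _ x j] by (intro L2_set_mono) auto
    also have "\<dots> \<le> \<beta> j x" unfolding \<beta>_def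
    proof (rule L2_avg_le)
      fix z
      have "nrm (\<lambda>k z. \<rho> j z * \<bar>b k z\<bar>) z = \<rho> j z * L2_set (\<lambda>k. \<bar>b k z\<bar>) {..<m}"
        unfolding nrm_def using L2_set_right_distrib[of "\<rho> j z" "\<lambda>k. \<bar>b k z\<bar>" "{..<m}"] \<rho>01(1)[of j z] by simp
      also have "L2_set (\<lambda>k. \<bar>b k z\<bar>) {..<m} = bn z" by (simp add: bn_def nrm_def L2_set_def)
      finally show "nrm (\<lambda>k z. \<rho> j z * \<bar>b k z\<bar>) z \<le> \<rho> j z * bn z" by simp
    qed (use cube_sets[OF xs] \<rho>b bi bni in auto)
    finally have "(L2_set (\<lambda>k. T k j (b k) x) {..<m})\<^sup>2 \<le> (\<beta> j x)\<^sup>2" by (rule power_mono) simp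
    then show ?thesis by (simp add: L2_set_def sum_nonneg)
  qed
  have S2f: "S2 f i0 J x \<le> 2 * S2 g i0 J x + 2 * (\<Sum>j\<in>{i0..J}. \<beta> j x)\<^sup>2" if x: "x \<in> P0 - E" for x
  proof -
    have xs: "x \<in> space M" using x P0sp by blast
    have "(T k j (f k) x)\<^sup>2 \<le> 2 * (T k j (g k) x)\<^sup>2 + 2 * (T k j (b k) x)\<^sup>2" if "k < m" for k j
    proof -
      have "T k j (b k) x = T k j (f k) x - T k j (g k) x"
        unfolding b_def[abs_def] by (rule T_diff[OF xs f[OF that] gi])
      then have eq: "T k j (f k) x = T k j (g k) x + T k j (b k) x" by simp
      show ?thesis unfolding eq using sum_squares_bound[of "T k j (g k) x" "T k j (b k) x"] by (simp add: power2_sum)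
    qed
    then have "S2 f i0 J x \<le> (\<Sum>j\<in>{i0..J}. \<Sum>k<m. 2 * (T k j (g k) x)\<^sup>2 + 2 * (T k j (b k) x)\<^sup>2)"
      unfolding S2_def by (intro sum_mono) auto
    also have "\<dots> = 2 * S2 g i0 J x + 2 * (\<Sum>j\<in>{i0..J}. \<Sum>k<m. (T k j (b k) x)\<^sup>2)"
      unfolding S2_def by (simp add: sum.distrib sum_distrib_left)
    also have "(\<Sum>j\<in>{i0..J}. \<Sum>k<m. (T k j (b k) x)\<^sup>2) \<le> (\<Sum>j\<in>{i0..J}. (\<beta> j x)\<^sup>2)"
      using Tb2[OF x] by (intro sum_mono) auto
    also have "\<dots> \<le> (\<Sum>j\<in>{i0..J}. \<beta> j x)\<^sup>2"
    proof -
      have "sqrt (\<Sum>j\<in>{i0..J}. (\<beta> j x)\<^sup>2) \<le> (\<Sum>j\<in>{i0..J}. \<beta> j x)"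
        using L2_set_le_sum[of "{i0..J}" "\<lambda>j. \<beta> j x"] \<beta>0 by (simp add: L2_set_def)
      then show ?thesis using \<beta>0 by (simp add: sqrt_le_D)
    qed
    finally show ?thesis by simp
  qed
  \<comment> \<open>\<open>S2\<close> of \<open>f\<close> is at most twice that of \<open>g\<close> plus twice a squared sum; if these are
    at most \<open>\<theta>\<^sup>2 / 4\<close> and \<open>(\<theta> / 2)\<^sup>2\<close>, then it is at most \<open>\<theta>\<^sup>2\<close>.\<close>
  define G where "G = {x\<in>P0. \<theta>\<^sup>2 / 4 < S2 g i0 J x}"
  define B where "B = {x\<in>P0 - E. \<theta> / 2 < (\<Sum>j\<in>{i0..J}. \<beta> j x)}"
  have S2gm [measurable]: "S2 g i J \<in> borel_measurable M" for i by (rule adapted_borel[OF adapted_S2])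
  have Gs [measurable]: "G \<in> sets M" unfolding G_def by measurable
  have Bs [measurable]: "B \<in> sets M" unfolding B_def by measurable
  have cover: "?Z \<subseteq> E \<union> G \<union> B"
  proof (rule subsetI, rule ccontr)
    fix x assume "x \<in> ?Z" "x \<notin> E \<union> G \<union> B"
    then have x: "x \<in> P0" "\<theta>\<^sup>2 < S2 f i0 J x" "x \<notin> B" "x \<notin> E" "x \<notin> G" by auto
    then have "S2 g i0 J x \<le> \<theta>\<^sup>2 / 4" by (auto simp: G_def)
    moreover have "(\<Sum>j\<in>{i0..J}. \<beta> j x) \<le> \<theta> / 2" using x by (auto simp: B_def)
    then have "(\<Sum>j\<in>{i0..J}. \<beta> j x)\<^sup>2 \<le> (\<theta> / 2)\<^sup>2" using \<beta>0 by (intro power_mono sum_nonneg) auto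
    ultimately have "S2 f i0 J x \<le> \<theta>\<^sup>2" using S2f[of x] x by (simp add: power_divide)
    then show False using x by simp
  qed
  have WE: "ennreal \<theta> * W E \<le> ennreal CA * H"
  proof -
    have "ennreal \<theta> * W E = (\<integral>\<^sup>+x. ennreal \<theta> * (w x * indicator E x) \<partial>M)"
      unfolding W_def by (rule nn_integral_cmult[symmetric]) auto
    also have "\<dots> \<le> ?Mt"
      by (rule nn_integral_mono) (auto simp: E_def indicator_def intro!: mult_right_mono ennreal_leI)
    finally show ?thesis using intmt by simp
  qed
  have WG: "ennreal \<theta> * W G \<le> ennreal (4 * C2 * N * CA) * H"
  proof -
    have "ennreal \<theta> * W G = (\<integral>\<^sup>+x. ennreal \<theta> * (w x * indicator G x) \<partial>M)"
      unfolding W_def by (rule nn_integral_cmult[symmetric]) auto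
    also have "\<dots> \<le> (\<integral>\<^sup>+x. ennreal (4 / \<theta>) * (ennreal (S2 g 0 J x) * w x) \<partial>M)"
    proof (rule nn_integral_mono)
      fix x
      show "ennreal \<theta> * (w x * indicator G x) \<le> ennreal (4 / \<theta>) * (ennreal (S2 g 0 J x) * w x)"
      proof (cases "x \<in> G")
        case True
        then have "\<theta>\<^sup>2 / 4 \<le> S2 g 0 J x" using S2_mono_start[of g i0 J x] by (auto simp: G_def)
        then have "\<theta> \<le> 4 / \<theta> * S2 g 0 J x" using lam by (simp add: field_simps power2_eq_square)
        then have "ennreal \<theta> \<le> ennreal (4 / \<theta>) * ennreal (S2 g 0 J x)"
          using lam S2_nonneg by (subst ennreal_mult[symmetric]) (auto intro!: ennreal_leI)
        then show ?thesis using True by (simp add: mult.assoc[symmetric] mult_right_mono)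
      qed simp
    qed
    also have "\<dots> = ennreal (4 / \<theta>) * (\<integral>\<^sup>+x. (ennreal (S2 g 0 J x) * w x) \<partial>M)"
      by (rule nn_integral_cmult) measurable
    also have "\<dots> \<le> ennreal (4 / \<theta>) * (ennreal C2 * (\<integral>\<^sup>+x. (ennreal ((nrm g x)\<^sup>2) * w x) \<partial>M))"
    proof (rule mult_left_mono)
      have "\<forall>x\<in>space M. nrm g x \<le> N * \<theta>"
      proof
        fix x assume "x \<in> space M"
        then show "nrm g x \<le> N * \<theta>" using gn[of x] mtN[of x] gn0[of x] N_ge_1 lam by (cases "x \<in> P0") auto
      qed
      then show "(\<integral>\<^sup>+x. (ennreal (S2 g 0 J x) * w x) \<partial>M) \<le> ennreal C2 * (\<integral>\<^sup>+x. (ennreal ((nrm g x)\<^sup>2) * w x) \<partial>M)"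
        using L2 gi unfolding L2w_def by blast
    qed simp
    also have "(\<integral>\<^sup>+x. (ennreal ((nrm g x)\<^sup>2) * w x) \<partial>M) \<le> (\<integral>\<^sup>+x. ennreal (N * \<theta>) * (ennreal (mt x) * w x * indicator P0 x) \<partial>M)"
    proof (rule nn_integral_mono)
      fix x assume xs: "x \<in> space M"
      show "ennreal ((nrm g x)\<^sup>2) * w x \<le> ennreal (N * \<theta>) * (ennreal (mt x) * w x * indicator P0 x)"
      proof (cases "x \<in> P0")
        case True
        have "(nrm g x)\<^sup>2 \<le> (N * \<theta>) * mt x" unfolding power2_eq_square
          using gn[OF True] mtN[OF True] N_ge_1 \<open>0 < \<theta>\<close> by (intro mult_mono) (auto simp: mt0 intro: order_trans[OF nrm_nonneg])
        then have "ennreal ((nrm g x)\<^sup>2) \<le> ennreal (N * \<theta>) * ennreal (mt x)"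
          using N_ge_1 lam mt0 by (subst ennreal_mult[symmetric]) (auto intro!: ennreal_leI)
        then show ?thesis using True by (simp add: mult.assoc[symmetric] mult_right_mono)
      qed (simp add: gn0[OF xs])
    qed
    also have "\<dots> = ennreal (N * \<theta>) * ?Mt"
      by (rule nn_integral_cmult) measurable
    also have "\<dots> \<le> ennreal (N * \<theta>) * (ennreal CA * H)" by (intro mult_left_mono intmt) auto
    also have "ennreal (4 / \<theta>) * (ennreal C2 * (ennreal (N * \<theta>) * (ennreal CA * H))) = ennreal (4 * C2 * N * CA) * H"
    proof -
      have "ennreal (4 / \<theta>) * (ennreal C2 * (ennreal (N * \<theta>) * (ennreal CA * H))) = (ennreal (4 / \<theta>) * ennreal C2 * ennreal (N * \<theta>) * ennreal CA) * H"
        by (simp add: mult_ac)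
      also have "ennreal (4 / \<theta>) * ennreal C2 * ennreal (N * \<theta>) * ennreal CA = ennreal (4 / \<theta> * C2 * (N * \<theta>) * CA)"
        using lam C2 N_ge_1 CA by (intro ennreal_mult4) auto
      also have "4 / \<theta> * C2 * (N * \<theta>) * CA = 4 * C2 * N * CA" using lam by simp
      finally show ?thesis .
    qed
    finally show ?thesis by (simp add: mult_left_mono)
  qed
  let ?R = "\<lambda>j. \<integral>\<^sup>+z\<in>P0. (ennreal (\<rho> j z * bn z) * w z) \<partial>M"
  let ?S = "\<lambda>x. \<Sum>j\<in>{i0..J}. ennreal (\<beta> j x) * w x * indicator P0 x"
  have WB: "ennreal \<theta> * W B \<le> ennreal (2 * CA * (1 / (1 - s)) * (1 + CA)) * H"
  proof -
    have "ennreal \<theta> * W B = (\<integral>\<^sup>+x. ennreal \<theta> * (w x * indicator B x) \<partial>M)"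
      unfolding W_def by (rule nn_integral_cmult[symmetric]) auto
    also have "\<dots> \<le> (\<integral>\<^sup>+x. ennreal 2 * (?S x) \<partial>M)"
    proof (rule nn_integral_mono)
      fix x
      show "ennreal \<theta> * (w x * indicator B x) \<le> ennreal 2 * (?S x)"
      proof (cases "x \<in> B")
        case True
        then have "x \<in> P0" "\<theta> \<le> 2 * (\<Sum>j\<in>{i0..J}. \<beta> j x)" by (auto simp: B_def)
        then have "ennreal \<theta> \<le> ennreal 2 * (\<Sum>j\<in>{i0..J}. ennreal (\<beta> j x))"
          using \<beta>0 by (subst sum_ennreal, simp, subst ennreal_mult[symmetric]) (auto intro!: ennreal_leI sum_nonneg)
        then show ?thesis using True \<open>x \<in> P0\<close> by (simp add: sum_distrib_right[symmetric] mult.assoc[symmetric] mult_right_mono)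
      qed simp
    qed
    also have "\<dots> = ennreal 2 * (\<integral>\<^sup>+x. (?S x) \<partial>M)"
      by (rule nn_integral_cmult) measurable
    also have "(\<integral>\<^sup>+x. (?S x) \<partial>M) = (\<Sum>j\<in>{i0..J}. \<integral>\<^sup>+x\<in>P0. (ennreal (\<beta> j x) * w x) \<partial>M)"
      by (rule nn_integral_sum) measurable
    also have "\<dots> \<le> (\<Sum>j\<in>{i0..J}. ennreal CA * (?R j))"
    proof (rule sum_mono)
      fix j assume j: "j \<in> {i0..J}"
      show "(\<integral>\<^sup>+x\<in>P0. (ennreal (\<beta> j x) * w x) \<partial>M) \<le> ennreal CA * (?R j)"
        unfolding \<beta>_def
      proof (rule A1_avg_blocks[OF A1 CA w, where t="\<lambda>_. j"])
        show "finite (cube j ` P0)" using finite_cubes P0sp by (meson finite_subset image_mono)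
        show "\<And>z. z \<in> P0 \<Longrightarrow> cube j z \<subseteq> P0" using cube_mono[of _ i0 j] P0c P0sp j by (metis atLeastAtMost_iff subsetD)
        show "(\<lambda>z. avg (\<lambda>z. \<rho> j z * bn z) (cube j z)) \<in> borel_measurable M" using \<beta>m[of j] unfolding \<beta>_def[abs_def] .
      qed (use \<rho>b[OF bni] \<rho>01 bn0 P0sp in auto)
    qed
    also have "\<dots> = ennreal CA * (\<Sum>j\<in>{i0..J}. (?R j))"
      by (simp add: sum_distrib_left)
    also have "(\<Sum>j\<in>{i0..J}. (?R j)) = (\<integral>\<^sup>+z. (\<Sum>j\<in>{i0..J}. ennreal (\<rho> j z * bn z) * w z * indicator P0 z) \<partial>M)"
      by (rule nn_integral_sum[symmetric]) measurable
    also have "\<dots> \<le> (\<integral>\<^sup>+z. ennreal (1 / (1 - s)) * (?hm z) \<partial>M)"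
    proof (rule nn_integral_mono)
      fix z
      show "(\<Sum>j\<in>{i0..J}. ennreal (\<rho> j z * bn z) * w z * indicator P0 z) \<le> ennreal (1 / (1 - s)) * (?hm z)"
      proof (cases "z \<in> P0")
        case True
        have "(\<Sum>j\<in>{i0..J}. \<rho> j z) = (\<Sum>j\<in>{i0..J} \<inter> {..t z}. s ^ (t z - j))"
          unfolding \<rho>_def by (rule sum.mono_neutral_cong_right) auto
        also have "\<dots> \<le> 1 / (1 - s)" by (rule sum_power_inj_le[OF s]) (auto simp: inj_on_def)
        finally have r: "(\<Sum>j\<in>{i0..J}. \<rho> j z) \<le> 1 / (1 - s)" .
        have "(\<Sum>j\<in>{i0..J}. ennreal (\<rho> j z * bn z)) = ennreal ((\<Sum>j\<in>{i0..J}. \<rho> j z) * bn z)"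
          using \<rho>01 bn0 by (subst sum_ennreal) (auto simp: sum_distrib_right)
        also have "\<dots> \<le> ennreal (1 / (1 - s) * (h z + mt z))"
          using r bnle[OF True] \<rho>01 bn0 s by (intro ennreal_leI mult_mono) (auto intro: sum_nonneg)
        also have "\<dots> = ennreal (1 / (1 - s)) * (ennreal (h z) + ennreal (mt z))"
          by (subst ennreal_mult) (use s h mt0 in \<open>auto simp: ennreal_plus\<close>)
        finally have "(\<Sum>j\<in>{i0..J}. ennreal (\<rho> j z * bn z)) * w z \<le> ennreal (1 / (1 - s)) * (ennreal (h z) + ennreal (mt z)) * w z"
          by (rule mult_right_mono) simp
        then show ?thesis using True by (simp add: sum_distrib_right distrib_right mult.assoc)
      qed simp
    qed
    also have "\<dots> = ennreal (1 / (1 - s)) * (\<integral>\<^sup>+z. (?hm z) \<partial>M)"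
      by (rule nn_integral_cmult) measurable
    also have "(\<integral>\<^sup>+z. (?hm z) \<partial>M) = H + ?Mt"
      unfolding H_def by (rule nn_integral_add) measurable
    also have "\<dots> \<le> H + ennreal CA * H" by (intro add_left_mono intmt)
    also have "ennreal 2 * (ennreal CA * (ennreal (1 / (1 - s)) * (H + ennreal CA * H))) = ennreal (2 * CA * (1 / (1 - s)) * (1 + CA)) * H"
    proof -
      have "H + ennreal CA * H = ennreal (1 + CA) * H" using CA by (simp add: ennreal_plus distrib_right)
      then have "ennreal 2 * (ennreal CA * (ennreal (1 / (1 - s)) * (H + ennreal CA * H))) = ennreal 2 * ennreal CA * ennreal (1 / (1 - s)) * ennreal (1 + CA) * H"
        by (simp only: mult_ac)
      also have "ennreal 2 * ennreal CA * ennreal (1 / (1 - s)) * ennreal (1 + CA) = ennreal (2 * CA * (1 / (1 - s)) * (1 + CA))"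
        using CA s by (intro ennreal_mult4) auto
      finally show ?thesis .
    qed
    finally show ?thesis by (simp add: mult_left_mono)
  qed
  have "W ?Z \<le> W E + W G + W B"
  proof -
    have "W ?Z \<le> (\<integral>\<^sup>+x. w x * indicator E x + w x * indicator G x + w x * indicator B x \<partial>M)"
      unfolding W_def
    proof (rule nn_integral_mono)
      fix x show "w x * indicator ?Z x \<le> w x * indicator E x + w x * indicator G x + w x * indicator B x"
        using subsetD[OF cover, of x] by (cases "x \<in> ?Z") (auto simp: indicator_def)
    qed
    also have "\<dots> = W E + W G + W B" unfolding W_def by (simp add: nn_integral_add)
    finally show ?thesis .
  qed
  then have "ennreal \<theta> * W ?Z \<le> ennreal \<theta> * (W E + W G + W B)" by (rule mult_left_mono) simp
  also have "\<dots> \<le> ennreal CA * H + ennreal (4 * C2 * N * CA) * H + ennreal (2 * CA * (1 / (1 - s)) * (1 + CA)) * H"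
    unfolding distrib_left[of "ennreal \<theta>"] by (intro add_mono WE WG WB)
  also have "\<dots> = ennreal (CA + 4 * C2 * N * CA + 2 * CA * (1 / (1 - s)) * (1 + CA)) * H"
    using CA C2 N_ge_1 s by (simp add: ennreal_plus distrib_right)
  finally show ?thesis unfolding W_def P0_def H_def h_def .
qed

end

section \<open>Carleson embedding\<close>

text \<open>
  A maximal set of a finite laminar family is disjoint from all sets that it does not contain;
  splitting it off is the induction step. So no covering constant is lost.
\<close>

lemma laminar_union_le:
  fixes h :: "'a \<Rightarrow> ennreal"
  assumes "finite I" and meas: "\<And>i. i \<in> I \<Longrightarrow> B i \<in> sets \<nu>" and h: "h \<in> borel_measurable \<nu>"
    and lam: "\<And>i j. i \<in> I \<Longrightarrow> j \<in> I \<Longrightarrow> B i \<inter> B j = {} \<or> B i \<subseteq> B j \<or> B j \<subseteq> B i"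
    and le: "\<And>i. i \<in> I \<Longrightarrow> c * emeasure \<nu> (B i) \<le> (\<integral>\<^sup>+x\<in>B i. h x \<partial>\<nu>)"
  shows "c * emeasure \<nu> (\<Union>i\<in>I. B i) \<le> (\<integral>\<^sup>+x\<in>(\<Union>i\<in>I. B i). h x \<partial>\<nu>)"
  using assms
proof (induction I rule: finite_psubset_induct)
  case (psubset I)
  show ?case
  proof (cases "I = {}")
    case False
    obtain A where A: "A \<in> B ` I" "\<And>A'. A' \<in> B ` I \<Longrightarrow> A \<subseteq> A' \<Longrightarrow> A = A'"
      using finite_has_maximal[of "B ` I"] psubset.hyps False by auto
    then obtain i where i: "i \<in> I" "A = B i" by auto
    define I2 where "I2 = {j\<in>I. \<not> B j \<subseteq> B i}"
    have I2: "I2 \<subset> I" using i unfolding I2_def by auto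
    have disj: "B i \<inter> (\<Union>j\<in>I2. B j) = {}"
    proof -
      have "B i \<inter> B j = {}" if "j \<in> I2" for j
      proof -
        have j: "j \<in> I" "\<not> B j \<subseteq> B i" using that by (auto simp: I2_def)
        then have "\<not> B i \<subseteq> B j" using A(2)[of "B j"] i by auto
        then show ?thesis using psubset.prems(3)[OF i(1) j(1)] j by blast
      qed
      then show ?thesis by blast
    qed
    have U: "(\<Union>j\<in>I. B j) = B i \<union> (\<Union>j\<in>I2. B j)" using i by (auto simp: I2_def)
    have s1: "B i \<in> sets \<nu>" and s2: "(\<Union>j\<in>I2. B j) \<in> sets \<nu>"
      using psubset.prems(1) i I2 psubset.hyps by (auto intro!: sets.finite_UN intro: finite_subset)
    have "c * emeasure \<nu> (\<Union>j\<in>I. B j) = c * emeasure \<nu> (B i) + c * emeasure \<nu> (\<Union>j\<in>I2. B j)"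
      unfolding U by (subst plus_emeasure[symmetric, OF s1 s2 disj]) (simp add: distrib_left)
    also have "\<dots> \<le> (\<integral>\<^sup>+x\<in>B i. h x \<partial>\<nu>) + (\<integral>\<^sup>+x\<in>(\<Union>j\<in>I2. B j). h x \<partial>\<nu>)"
    proof (rule add_mono)
      show "c * emeasure \<nu> (B i) \<le> (\<integral>\<^sup>+x\<in>B i. h x \<partial>\<nu>)" by (rule psubset.prems(4)[OF i(1)])
      show "c * emeasure \<nu> (\<Union>j\<in>I2. B j) \<le> (\<integral>\<^sup>+x\<in>(\<Union>j\<in>I2. B j). h x \<partial>\<nu>)"
        by (rule psubset.IH[OF I2]) (use psubset.prems I2 in blast)+
    qed
    also have "\<dots> = (\<integral>\<^sup>+x. h x * indicator (B i) x + h x * indicator (\<Union>j\<in>I2. B j) x \<partial>\<nu>)"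
      using s1 s2 psubset.prems(2) by (intro nn_integral_add[symmetric]) auto
    also have "\<dots> = (\<integral>\<^sup>+x\<in>(\<Union>i\<in>I. B i). h x \<partial>\<nu>)"
      unfolding U by (rule nn_integral_cong) (use disj in \<open>auto simp: indicator_def\<close>)
    finally show ?thesis .
  qed simp
qed

lemma nn_integral_powr_interval:
  fixes c q :: real
  assumes "0 < q" "0 \<le> c"
  shows "(\<integral>\<^sup>+t. ennreal (q * t powr (q - 1)) * indicator {0..c} t \<partial>lborel) = ennreal (c powr q)"
proof -
  have "((\<lambda>x. x powr (q - 1)) has_integral (c powr (q - 1 + 1) / (q - 1 + 1))) {0..c}"
    by (rule has_integral_powr_from_0) (use assms in auto)
  then have "((\<lambda>x. q * x powr (q - 1)) has_integral (q * (c powr (q - 1 + 1) / (q - 1 + 1)))) {0..c}"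
    by (rule has_integral_mult_right)
  then have hi: "((\<lambda>x. q * x powr (q - 1)) has_integral (c powr q)) {0..c}" using assms by simp
  have "((\<lambda>x. if x \<in> {0..c} then q * x powr (q - 1) else 0) has_integral (c powr q)) UNIV"
    using hi by (simp only: has_integral_restrict_UNIV)
  then have "(\<integral>\<^sup>+t. ennreal (if t \<in> {0..c} then q * t powr (q - 1) else 0) \<partial>lborel) = ennreal (c powr q)"
    using assms by (intro nn_integral_has_integral_lborel) auto
  also have "(\<integral>\<^sup>+t. ennreal (if t \<in> {0..c} then q * t powr (q - 1) else 0) \<partial>lborel) = (\<integral>\<^sup>+t. ennreal (q * t powr (q - 1)) * indicator {0..c} t \<partial>lborel)"
    by (rule nn_integral_cong) (auto simp: indicator_def)
  finally show ?thesis .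
qed

lemma ennreal_lincomb:
  "0 \<le> a \<Longrightarrow> 0 \<le> b \<Longrightarrow> 0 \<le> A \<Longrightarrow> 0 \<le> B \<Longrightarrow> ennreal (a * A + b * B) = ennreal a * ennreal A + ennreal b * ennreal B"
  by (simp add: ennreal_mult ennreal_plus)

lemma ennreal_half_absorb:
  fixes X Y :: ennreal
  assumes "X \<le> ennreal (1/2) * X + Y" "X < \<infinity>"
  shows "X \<le> 2 * Y"
proof (cases Y)
  case (real y)
  obtain x where x: "X = ennreal x" "0 \<le> x" using assms(2) by (cases X) auto
  have "ennreal (1/2) * X + Y = ennreal (1/2 * x + y)"
    unfolding x(1) real(2) using x real ennreal_lincomb[of "1/2" 1 x y] by simp
  then have "ennreal x \<le> ennreal (1/2 * x + y)" using assms(1) x(1) by simp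
  then have "x \<le> 1/2 * x + y" using x real by (subst (asm) ennreal_le_iff) auto
  then have "x \<le> 2 * y" by simp
  then have "ennreal x \<le> ennreal (2 * y)" by (rule ennreal_leI)
  then show ?thesis using x real by (simp add: ennreal_mult)
qed (simp add: ennreal_mult_top)

text \<open>
  Doob's maximal inequality. Let \<open>F\<close> be the largest coefficient among the sets that contain a
  point. As the \<open>E i\<close> are disjoint, the sum is at most the integral \<open>X\<close> of \<open>F powr p\<close>. The
  superlevel sets of \<open>F\<close> are unions of members of the laminar family, which gives a weak type
  inequality for \<open>F\<close>. Integrating it over the levels bounds \<open>X\<close> by the integral of
  \<open>h * F powr (p - 1)\<close>, and Young's inequality absorbs half of \<open>X\<close>, which is finite because \<open>I\<close>
  is.
\<close>

lemma carleson_embedding: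
  fixes h :: "'a \<Rightarrow> real" and a :: "'i \<Rightarrow> real"
  assumes nu: "finite_measure \<nu>" and I: "finite I"
    and Bm: "\<And>i. i \<in> I \<Longrightarrow> B i \<in> sets \<nu>" and Em: "\<And>i. i \<in> I \<Longrightarrow> E i \<in> sets \<nu>"
    and EB: "\<And>i. i \<in> I \<Longrightarrow> E i \<subseteq> B i" and disj: "disjoint_family_on E I"
    and lam: "\<And>i j. i \<in> I \<Longrightarrow> j \<in> I \<Longrightarrow> B i \<inter> B j = {} \<or> B i \<subseteq> B j \<or> B j \<subseteq> B i"
    and h [measurable]: "h \<in> borel_measurable \<nu>" and h0: "\<And>x. x \<in> space \<nu> \<Longrightarrow> 0 \<le> h x" and p: "1 < p"
    and a0: "\<And>i. i \<in> I \<Longrightarrow> 0 \<le> a i"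
    and avg: "\<And>i. i \<in> I \<Longrightarrow> ennreal (a i) * emeasure \<nu> (B i) \<le> (\<integral>\<^sup>+x\<in>B i. ennreal (h x) \<partial>\<nu>)"
  shows "(\<Sum>i\<in>I. ennreal (a i powr p) * emeasure \<nu> (E i)) \<le> ennreal ((2 * (p / (p - 1))) powr p) * (\<integral>\<^sup>+x. ennreal (h x powr p) \<partial>\<nu>)"
proof -
  interpret finite_measure \<nu> by (rule nu)
  define q where "q = p / (p - 1)"
  have q: "1 < q" using p by (simp add: q_def)
  define F where "F x = Max (insert 0 (a ` {i\<in>I. x \<in> B i}))" for x
  have fin: "finite (insert 0 (a ` {i\<in>I. x \<in> B i}))" for x using I by auto
  have F0: "0 \<le> F x" for x unfolding F_def using fin by auto
  have Fge: "a i \<le> F x" if "i \<in> I" "x \<in> B i" for i x unfolding F_def using fin that by (intro Max_ge) auto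
  have Fle: "F x \<le> (\<Sum>i\<in>I. a i)" for x unfolding F_def
    using fin a0 I by (auto intro!: member_le_sum sum_nonneg)
  have Fset: "{x\<in>space \<nu>. t \<le> F x} = (\<Union>i\<in>{i\<in>I. t \<le> a i}. B i)" if "0 < t" for t
  proof -
    have "t \<le> F x \<longleftrightarrow> (\<exists>i\<in>I. t \<le> a i \<and> x \<in> B i)" for x
      unfolding F_def using Max_ge_iff[OF fin[of x], of t] that by auto
    then show ?thesis using Bm sets.sets_into_space by fastforce
  qed
  let ?box = "\<lambda>t x. indicator {0..} t * (if t \<le> F x then 1 else 0)"
  let ?L = "\<lambda>t. {x\<in>space \<nu>. t \<le> F x}"
  have Fm [measurable]: "F \<in> borel_measurable \<nu>"
  proof (rule borel_measurableI_ge)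
    fix t show "(?L t) \<in> sets \<nu>"
    proof (cases "0 < t")
      case True then show ?thesis using I Bm by (subst Fset) (auto intro!: sets.finite_UN)
    next
      case False
      then have "(?L t) = space \<nu>" using F0 by (auto intro: order_trans[of t 0])
      then show ?thesis by simp
    qed
  qed
  define X where "X = (\<integral>\<^sup>+x. ennreal (F x powr p) \<partial>\<nu>)"
  let ?dens = "\<lambda>t x. ennreal (p * t powr (p - 2)) * (?box t x)"
  have Xfin: "X < \<infinity>"
  proof -
    have "X \<le> (\<integral>\<^sup>+x. ennreal ((\<Sum>i\<in>I. a i) powr p) \<partial>\<nu>)"
      unfolding X_def using Fle F0 p by (intro nn_integral_mono ennreal_leI powr_mono2) auto
    also have "\<dots> < \<infinity>" by (simp add: emeasure_eq_measure ennreal_mult[symmetric])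
    finally show ?thesis .
  qed
  have sum_le: "(\<Sum>i\<in>I. ennreal (a i powr p) * emeasure \<nu> (E i)) \<le> X"
  proof -
    have "(\<Sum>i\<in>I. ennreal (a i powr p) * emeasure \<nu> (E i)) = (\<integral>\<^sup>+x. (\<Sum>i\<in>I. ennreal (a i powr p) * indicator (E i) x) \<partial>\<nu>)"
      using Em by (subst nn_integral_sum) (auto simp: nn_integral_cmult)
    also have "\<dots> \<le> X" unfolding X_def
    proof (rule nn_integral_mono)
      fix x
      show "(\<Sum>i\<in>I. ennreal (a i powr p) * indicator (E i) x) \<le> ennreal (F x powr p)"
      proof (cases "\<exists>i\<in>I. x \<in> E i")
        case True
        then obtain i where i: "i \<in> I" "x \<in> E i" by blast
        have "(\<Sum>j\<in>I. ennreal (a j powr p) * indicator (E j) x) = (\<Sum>j\<in>{i}. ennreal (a j powr p) * indicator (E j) x)"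
        proof (rule sum.mono_neutral_right)
          show "\<forall>j\<in>I - {i}. ennreal (a j powr p) * indicator (E j) x = 0"
            using disj i unfolding disjoint_family_on_def by (auto simp: indicator_def)
        qed (use I i in auto)
        also have "\<dots> \<le> ennreal (F x powr p)"
          using i Fge[of i x] EB a0 p by (auto intro!: ennreal_leI powr_mono2)
        finally show ?thesis .
      next
        case False then show ?thesis by (simp add: sum.neutral)
      qed
    qed
    finally show ?thesis .
  qed
  have weak: "ennreal t * emeasure \<nu> (?L t) \<le> (\<integral>\<^sup>+x. ennreal (h x) * indicator (?L t) x \<partial>\<nu>)" if t: "0 < t" for t
    unfolding Fset[OF t]
  proof (rule laminar_union_le)
    fix i assume i: "i \<in> {i\<in>I. t \<le> a i}"
    have "ennreal t * emeasure \<nu> (B i) \<le> ennreal (a i) * emeasure \<nu> (B i)" using i by (intro mult_right_mono ennreal_leI) auto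
    also have "\<dots> \<le> (\<integral>\<^sup>+x\<in>B i. ennreal (h x) \<partial>\<nu>)" using avg i by auto
    finally show "ennreal t * emeasure \<nu> (B i) \<le> (\<integral>\<^sup>+x\<in>B i. ennreal (h x) \<partial>\<nu>)" .
  qed (use I Bm lam in auto)
  interpret P: pair_sigma_finite lborel \<nu> ..
  have "X = (\<integral>\<^sup>+x. \<integral>\<^sup>+t. ennreal (p * t powr (p - 1)) * indicator {0..F x} t \<partial>lborel \<partial>\<nu>)"
    unfolding X_def using p F0 by (intro nn_integral_cong) (simp add: nn_integral_powr_interval)
  also have "\<dots> = (\<integral>\<^sup>+x. \<integral>\<^sup>+t. ennreal (p * t powr (p - 1)) * (?box t x) \<partial>lborel \<partial>\<nu>)"
    by (intro nn_integral_cong) (auto simp: indicator_def)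
  also have "\<dots> = (\<integral>\<^sup>+t. \<integral>\<^sup>+x. ennreal (p * t powr (p - 1)) * (?box t x) \<partial>\<nu> \<partial>lborel)"
    by (rule P.Fubini') measurable
  also have "\<dots> \<le> (\<integral>\<^sup>+t. \<integral>\<^sup>+x. ennreal (h x) * (?dens t x) \<partial>\<nu> \<partial>lborel)"
  proof (rule nn_integral_mono)
    fix t :: real
    show "(\<integral>\<^sup>+x. ennreal (p * t powr (p - 1)) * (?box t x) \<partial>\<nu>) \<le> (\<integral>\<^sup>+x. ennreal (h x) * (?dens t x) \<partial>\<nu>)"
    proof (cases "0 < t")
      case True
      have "(\<integral>\<^sup>+x. ennreal (p * t powr (p - 1)) * (?box t x) \<partial>\<nu>) = (\<integral>\<^sup>+x. ennreal (p * t powr (p - 1)) * indicator (?L t) x \<partial>\<nu>)"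
        using True by (intro nn_integral_cong) (auto simp: indicator_def)
      also have "\<dots> = ennreal (p * t powr (p - 1)) * emeasure \<nu> (?L t)"
        by (simp add: nn_integral_cmult)
      also have "\<dots> = ennreal (p * t powr (p - 2)) * (ennreal t * emeasure \<nu> (?L t))"
      proof -
        have "t powr (p - 1) = t powr (p - 2) * t" using True powr_add[of t "p - 2" 1] by simp
        then have "ennreal (p * t powr (p - 1)) = ennreal (p * t powr (p - 2)) * ennreal t"
          using True p by (simp add: ennreal_mult[symmetric] mult.assoc)
        then show ?thesis by (simp add: mult.assoc)
      qed
      also have "\<dots> \<le> ennreal (p * t powr (p - 2)) * (\<integral>\<^sup>+x. ennreal (h x) * indicator (?L t) x \<partial>\<nu>)"
        by (intro mult_left_mono weak True) simp
      also have "\<dots> = (\<integral>\<^sup>+x. ennreal (p * t powr (p - 2)) * (ennreal (h x) * indicator (?L t) x) \<partial>\<nu>)"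
        by (rule nn_integral_cmult[symmetric]) measurable
      also have "\<dots> = (\<integral>\<^sup>+x. ennreal (h x) * (?dens t x) \<partial>\<nu>)"
        using True by (intro nn_integral_cong) (auto simp: indicator_def mult_ac)
      finally show ?thesis .
    next
      case False
      then show ?thesis by (cases "t = 0") (auto simp: indicator_def)
    qed
  qed
  also have "\<dots> = (\<integral>\<^sup>+x. \<integral>\<^sup>+t. ennreal (h x) * (?dens t x) \<partial>lborel \<partial>\<nu>)"
    by (rule P.Fubini'[symmetric]) measurable
  also have "\<dots> = (\<integral>\<^sup>+x. ennreal (h x) * (ennreal q * ennreal (F x powr (p - 1))) \<partial>\<nu>)"
  proof (rule nn_integral_cong)
    fix x
    have "(\<integral>\<^sup>+t. ennreal (h x) * (?dens t x) \<partial>lborel)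
      = (\<integral>\<^sup>+t. (ennreal (h x) * ennreal q) * (ennreal ((p - 1) * t powr (p - 1 - 1)) * indicator {0..F x} t) \<partial>lborel)"
    proof (rule nn_integral_cong)
      fix t :: real
      have "ennreal (p * t powr (p - 2)) = ennreal q * ennreal ((p - 1) * t powr (p - 1 - 1))"
        using p q by (subst ennreal_mult[symmetric]) (auto simp: q_def)
      then show "ennreal (h x) * (?dens t x) = (ennreal (h x) * ennreal q) * (ennreal ((p - 1) * t powr (p - 1 - 1)) * indicator {0..F x} t)"
        by (auto simp: indicator_def mult_ac)
    qed
    also have "\<dots> = (ennreal (h x) * ennreal q) * (\<integral>\<^sup>+t. ennreal ((p - 1) * t powr (p - 1 - 1)) * indicator {0..F x} t \<partial>lborel)"
      by (rule nn_integral_cmult) measurable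
    also have "\<dots> = (ennreal (h x) * ennreal q) * ennreal (F x powr (p - 1))"
      using nn_integral_powr_interval[of "p - 1" "F x"] p F0 by simp
    finally show "(\<integral>\<^sup>+t. ennreal (h x) * (?dens t x) \<partial>lborel) = ennreal (h x) * (ennreal q * ennreal (F x powr (p - 1)))"
      by (simp add: mult.assoc)
  qed
  also have "\<dots> \<le> (\<integral>\<^sup>+x. ennreal (1/2) * ennreal (F x powr p) + ennreal ((2 * q) powr p / 2) * ennreal (h x powr p) \<partial>\<nu>)"
  proof (rule nn_integral_mono)
    fix x assume x: "x \<in> space \<nu>"
    have "h x * (q * F x powr (p - 1)) \<le> 1/2 * F x powr p + (2 * q) powr p / 2 * h x powr p"
    proof (cases "2 * q * h x \<le> F x")
      case True
      show ?thesis
      proof (cases "F x = 0")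
        case True then show ?thesis using p by simp
      next
        case False
        then have Fp: "0 < F x" using F0[of x] by simp
        have "h x * (q * F x powr (p - 1)) = (2 * q * h x) * F x powr (p - 1) / 2" by simp
        also have "\<dots> \<le> F x * F x powr (p - 1) / 2" using True by (intro divide_right_mono mult_right_mono) auto
        also have "F x * F x powr (p - 1) = F x powr p" using Fp powr_add[of "F x" 1 "p - 1"] by simp
        finally show ?thesis by (simp add: add_increasing2)
      qed
    next
      case False
      then have hp: "0 < h x" using F0[of x] q h0[OF x] by (cases "h x = 0") auto
      have "h x * (q * F x powr (p - 1)) \<le> h x * (q * (2 * q * h x) powr (p - 1))"
        using False F0 p hp q by (intro mult_left_mono powr_mono2) auto
      also have "\<dots> = (2 * q * h x) * (2 * q * h x) powr (p - 1) / 2" by simp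
      also have "(2 * q * h x) * (2 * q * h x) powr (p - 1) = (2 * q * h x) powr p"
        using hp q powr_add[of "2 * q * h x" 1 "p - 1"] by simp
      also have "\<dots> = (2 * q) powr p * h x powr p" using hp q by (simp add: powr_mult)
      finally show ?thesis by (simp add: add_increasing)
    qed
    then have "ennreal (h x * (q * F x powr (p - 1))) \<le> ennreal (1/2 * F x powr p + (2 * q) powr p / 2 * h x powr p)" by (rule ennreal_leI)
    moreover have "ennreal (h x * (q * F x powr (p - 1))) = ennreal (h x) * (ennreal q * ennreal (F x powr (p - 1)))"
      using h0[OF x] q by (simp add: ennreal_mult)
    moreover have "ennreal (1/2 * F x powr p + (2 * q) powr p / 2 * h x powr p) = ennreal (1/2) * ennreal (F x powr p) + ennreal ((2 * q) powr p / 2) * ennreal (h x powr p)"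
      by (rule ennreal_lincomb) auto
    ultimately show "ennreal (h x) * (ennreal q * ennreal (F x powr (p - 1))) \<le> ennreal (1/2) * ennreal (F x powr p) + ennreal ((2 * q) powr p / 2) * ennreal (h x powr p)"
      by simp
  qed
  also have "\<dots> = ennreal (1/2) * X + ennreal ((2 * q) powr p / 2) * (\<integral>\<^sup>+x. ennreal (h x powr p) \<partial>\<nu>)"
    unfolding X_def by (simp add: nn_integral_add nn_integral_cmult)
  finally have "X \<le> 2 * (ennreal ((2 * q) powr p / 2) * (\<integral>\<^sup>+x. ennreal (h x powr p) \<partial>\<nu>))"
    by (intro ennreal_half_absorb Xfin)
  also have "\<dots> = ennreal ((2 * q) powr p) * (\<integral>\<^sup>+x. ennreal (h x powr p) \<partial>\<nu>)"
  proof -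
    have "2 * ennreal ((2 * q) powr p / 2) = ennreal 2 * ennreal ((2 * q) powr p / 2)" by simp
    also have "\<dots> = ennreal ((2 * q) powr p)" by (subst ennreal_mult[symmetric]) auto
    finally show ?thesis by (simp add: mult.assoc[symmetric])
  qed
  finally show ?thesis using sum_le by (simp add: q_def)
qed

section \<open>Stopping levels\<close>

text \<open>
  The current stopping level is kept until the sum of \<open>A\<close> since that level exceeds \<open>K\<close> times the
  value of \<open>b\<close> there.
\<close>

fun stopidx :: "(nat \<Rightarrow> real) \<Rightarrow> (nat \<Rightarrow> real) \<Rightarrow> real \<Rightarrow> nat \<Rightarrow> nat" where
  "stopidx A b K 0 = 0"
| "stopidx A b K (Suc j) = (if K * b (stopidx A b K j) < sum A {stopidx A b K j..Suc j} then Suc j else stopidx A b K j)"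

lemma stopidx_le: "stopidx A b K j \<le> j"
  by (induction j) auto

lemma stopidx_idem: "stopidx A b K (stopidx A b K j) = stopidx A b K j"
  by (induction j) auto

lemma stopidx_cong:
  assumes "\<And>i. i \<le> j \<Longrightarrow> A i = A' i" "\<And>i. i \<le> j \<Longrightarrow> b i = b' i"
  shows "stopidx A b K j = stopidx A' b' K j"
  using assms
proof (induction j)
  case (Suc j)
  then have IH: "stopidx A b K j = stopidx A' b' K j" by simp
  have "sum A {stopidx A' b' K j..Suc j} = sum A' {stopidx A' b' K j..Suc j}" using Suc.prems by (intro sum.cong) auto
  moreover have "b (stopidx A' b' K j) = b' (stopidx A' b' K j)" using Suc.prems stopidx_le[of A' b' K j] by simp
  ultimately show ?case using IH by simp
qed simp

text \<open>
  Between two consecutive stops the sum of \<open>A\<close> is at most \<open>K\<close> times \<open>b\<close> at the earlier one. The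
  term that triggers the new stop is charged to the new stop itself, by \<open>A i \<le> b i\<close>.
\<close>

lemma stopidx_sum_le:
  assumes A: "\<And>i. 0 \<le> A i" "\<And>i. A i \<le> b i" and K: "1 \<le> K"
  shows "sum A {..j} \<le> K * sum b {i\<in>{..j}. stopidx A b K i = i}"
proof -
  have b0: "0 \<le> b i" for i using A(1)[of i] A(2)[of i] by linarith
  define \<pi> where "\<pi> = stopidx A b K"
  have inv: "sum A {\<pi> j..j} \<le> K * b (\<pi> j)" for j
  proof (induction j)
    case 0
    have "A 0 \<le> 1 * b 0" using A by simp
    also have "\<dots> \<le> K * b 0" using K b0 by (intro mult_right_mono) auto
    finally show ?case by (simp add: \<pi>_def)
  next
    case (Suc j)
    show ?case
    proof (cases "K * b (\<pi> j) < sum A {\<pi> j..Suc j}")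
      case True
      have "A (Suc j) \<le> 1 * b (Suc j)" using A by simp
      also have "\<dots> \<le> K * b (Suc j)" using K b0 by (intro mult_right_mono) auto
      finally show ?thesis using True by (simp add: \<pi>_def)
    qed (simp add: \<pi>_def)
  qed
  have \<pi>le: "\<pi> j \<le> j" "\<pi> (\<pi> j) = \<pi> j" for j by (simp_all add: \<pi>_def stopidx_le stopidx_idem)
  have main: "sum A {..<\<pi> j} \<le> K * sum b {i\<in>{..<\<pi> j}. \<pi> i = i}" for j
  proof (induction j)
    case (Suc j)
    show ?case
    proof (cases "\<pi> (Suc j) = \<pi> j")
      case False
      then have eq: "\<pi> (Suc j) = Suc j" by (auto simp: \<pi>_def split: if_splits)
      have U: "{..<Suc j} = {..<\<pi> j} \<union> {\<pi> j..j}" using \<pi>le[of j] by auto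
      have "sum A {..<Suc j} = sum A {..<\<pi> j} + sum A {\<pi> j..j}" unfolding U by (rule sum.union_disjoint) auto
      also have "\<dots> \<le> K * sum b {i\<in>{..<\<pi> j}. \<pi> i = i} + K * b (\<pi> j)" by (intro add_mono Suc inv)
      also have "\<dots> = K * sum b (insert (\<pi> j) {i\<in>{..<\<pi> j}. \<pi> i = i})" by (simp add: distrib_left)
      also have "\<dots> \<le> K * sum b {i\<in>{..<Suc j}. \<pi> i = i}"
        using K \<pi>le[of j] b0 by (intro mult_left_mono sum_mono2) auto
      finally show ?thesis unfolding eq .
    qed (use Suc in simp)
  qed (simp add: \<pi>_def)
  have U: "{..j} = {..<\<pi> j} \<union> {\<pi> j..j}" using \<pi>le[of j] by auto
  have "sum A {..j} = sum A {..<\<pi> j} + sum A {\<pi> j..j}" unfolding U by (rule sum.union_disjoint) auto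
  also have "\<dots> \<le> K * sum b {i\<in>{..<\<pi> j}. \<pi> i = i} + K * b (\<pi> j)" by (intro add_mono main inv)
  also have "\<dots> = K * sum b (insert (\<pi> j) {i\<in>{..<\<pi> j}. \<pi> i = i})" by (simp add: distrib_left)
  also have "\<dots> \<le> K * sum b {i\<in>{..j}. \<pi> i = i}"
    using K \<pi>le[of j] b0 by (intro mult_left_mono sum_mono2) auto
  finally show ?thesis by (simp add: \<pi>_def)
qed

text \<open>
  If a stopping level is ever left, then a partial sum of \<open>A\<close> from that level on is large. This
  is the event whose probability the weak type inequality controls.
\<close>

lemma stopidx_leave:
  assumes A: "\<And>i. 0 \<le> A i" and i: "stopidx A b K i = i" "i \<le> J" and J: "stopidx A b K J \<noteq> i"
  shows "K * b i < sum A {i..J}"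
proof -
  have "stopidx A b K (i + d) = i \<or> K * b i < sum A {i..i + d}" for d
  proof (induction d)
    case (Suc d)
    then show ?case
    proof
      assume "K * b i < sum A {i..i + d}"
      also have "\<dots> \<le> sum A {i..i + Suc d}" using A by (intro sum_mono2) auto
      finally show ?case by simp
    qed auto
  qed (use i in simp)
  from this[of "J - i"] show ?thesis using i J by simp
qed

section \<open>Strong type bounds for Muckenhoupt weights\<close>

text \<open>
  Young's inequality for a pair of dual weights: if \<open>f\<close> exceeds \<open>s * \<sigma>\<close>, then the factor
  \<open>(f / (s * \<sigma>)) powr (p - 1)\<close> is at least one, and duality turns \<open>\<sigma> powr (1 - p)\<close> into \<open>w\<close>.
\<close>

lemma young_split:
  fixes f \<sigma> w p s :: real
  assumes "0 \<le> f" "0 < \<sigma>" "0 < w" "\<sigma> powr (p - 1) * w = 1" "1 < p" "0 < s"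
  shows "f \<le> s * \<sigma> + s powr (1 - p) * (f powr p * w)"
proof (cases "f \<le> s * \<sigma>")
  case True
  have "0 \<le> s powr (1 - p) * (f powr p * w)" using assms by auto
  then show ?thesis using True by linarith
next
  case False
  have s\<sigma>: "0 < s * \<sigma>" using assms by simp
  then have f: "0 < f" using False by linarith
  have "f = f * (s powr (1 - p) * s powr (p - 1)) * (\<sigma> powr (p - 1) * w)"
    using assms by (simp add: powr_add[symmetric])
  also have "\<dots> = f * s powr (1 - p) * (s * \<sigma>) powr (p - 1) * w"
    using assms by (simp add: powr_mult mult_ac)
  also have "\<dots> \<le> f * s powr (1 - p) * f powr (p - 1) * w"
    using False s\<sigma> assms by (intro mult_right_mono mult_left_mono powr_mono2) auto
  also have "\<dots> = s powr (1 - p) * (f powr p * w)"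
    using f powr_add[of f 1 "p - 1"] by (simp add: mult_ac)
  finally show ?thesis using s\<sigma> by linarith
qed

text \<open>
  The choice \<open>s = (F / V) powr (1 / p)\<close> balances both terms. Together with \<open>young_split\<close> this is
  Hoelder's inequality.
\<close>

lemma young_split_optimize:
  fixes e V F p :: real
  assumes le: "\<And>s. 0 < s \<Longrightarrow> e \<le> s * V + s powr (1 - p) * F" and V: "0 < V" and F: "0 < F" and p: "1 < p"
  shows "e \<le> 2 * (F powr (1 / p) * V powr (1 - 1 / p))"
proof -
  define s where "s = (F / V) powr (1 / p)"
  have s: "0 < s" using V F by (simp add: s_def)
  have "s * V = F powr (1 / p) * V powr (1 - 1 / p)"
    using V F by (simp add: s_def powr_divide powr_diff)
  moreover have "s powr (1 - p) * F = F powr (1 / p) * V powr (1 - 1 / p)"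
  proof -
    have "s powr (1 - p) = (F / V) powr (1 / p - 1)" using p unfolding s_def powr_powr by (simp add: field_simps)
    also have "\<dots> = F powr (1 / p) / F * (V powr (1 - 1 / p))"
      using V F by (simp add: powr_divide powr_diff powr_minus field_simps)
    finally show ?thesis using F by simp
  qed
  ultimately show ?thesis using le[OF s] by simp
qed

text \<open>
  Here \<open>a, b\<close> are the masses of a cube for \<open>w\<close> and its dual weight, \<open>a', b'\<close> those of a subset
  that carries a fixed part of the Lebesgue measure \<open>q\<close> of the cube. The \<open>A_p\<close> condition and
  Hoelder's inequality on the subset (the last assumption) make \<open>a\<close> comparable to \<open>a'\<close> and \<open>b\<close>
  to \<open>b'\<close>, so that the subset can stand in for the cube.
\<close>

lemma weights_product_le:
  fixes a b a' b' q p D :: real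
  assumes p: "1 < p" and a: "0 < a'" "a' \<le> a" and b: "0 < b'" "b' \<le> b" and q: "0 < q" and D: "0 < D"
    and Ap: "a * b powr (p - 1) \<le> D * q powr p" and lower: "q \<le> 4 * (a' powr (1 / p) * b' powr (1 - 1 / p))"
  shows "a * b / q \<le> D powr (1 / p) * (D * 4 powr p) powr (1 - 1 / p) * (D * 4 powr p) powr (1 / (p * (p - 1))) * (b' powr (1 / p) * a' powr (1 - 1 / p))"
proof -
  define D' where "D' = D * 4 powr p"
  have D': "0 < D'" using D by (simp add: D'_def)
  have ab: "0 < a" "0 < b" using a b by auto
  have "q powr p \<le> (4 * (a' powr (1 / p) * b' powr (1 - 1 / p))) powr p"
    using lower q p by (intro powr_mono2) auto
  also have "\<dots> = 4 powr p * (a' * b' powr (p - 1))"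
    using a b p by (simp add: powr_mult powr_powr left_diff_distrib)
  finally have qp: "q powr p \<le> 4 powr p * (a' * b' powr (p - 1))" .
  then have "D * q powr p \<le> D * (4 powr p * (a' * b' powr (p - 1)))" using D by (intro mult_left_mono) auto
  then have main: "a * b powr (p - 1) \<le> D' * (a' * b' powr (p - 1))" using Ap unfolding D'_def by (simp add: mult_ac)
  have bb: "b' powr (p - 1) \<le> b powr (p - 1)" using b p by (intro powr_mono2) auto
  have aD: "a \<le> D' * a'"
  proof -
    have "a * b' powr (p - 1) \<le> a * b powr (p - 1)" using bb ab by (intro mult_left_mono) auto
    also note main
    finally have "a * b' powr (p - 1) \<le> (D' * a') * b' powr (p - 1)" by (simp add: mult_ac)
    then show ?thesis using b by (subst (asm) mult_le_cancel_right) auto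
  qed
  have bD: "b \<le> D' powr (1 / (p - 1)) * b'"
  proof -
    have "a' * b powr (p - 1) \<le> a * b powr (p - 1)" using a by (intro mult_right_mono) auto
    also note main
    finally have "a' * b powr (p - 1) \<le> a' * (D' * b' powr (p - 1))" by (simp add: mult_ac)
    then have "b powr (p - 1) \<le> D' * b' powr (p - 1)" using a by (subst (asm) mult_le_cancel_left) auto
    then have "(b powr (p - 1)) powr (1 / (p - 1)) \<le> (D' * b' powr (p - 1)) powr (1 / (p - 1))"
      using p by (intro powr_mono2) auto
    then show ?thesis using p ab b D' by (simp add: powr_mult powr_powr)
  qed
  have "(a * b powr (p - 1)) powr (1 / p) \<le> (D * q powr p) powr (1 / p)"
    using Ap ab p by (intro powr_mono2) auto
  then have root: "a powr (1 / p) * b powr (1 - 1 / p) \<le> D powr (1 / p) * q"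
    using ab p D q by (simp add: powr_mult powr_powr diff_divide_distrib)
  have "a * b = (a powr (1 / p) * b powr (1 - 1 / p)) * (a powr (1 - 1 / p) * b powr (1 / p))"
    using ab by (simp add: powr_diff)
  then have "a * b / q = (a powr (1 / p) * b powr (1 - 1 / p)) / q * (a powr (1 - 1 / p) * b powr (1 / p))" by simp
  also have "\<dots> \<le> D powr (1 / p) * (a powr (1 - 1 / p) * b powr (1 / p))"
    using root q by (intro mult_right_mono) (auto simp: divide_le_eq)
  also have "\<dots> \<le> D powr (1 / p) * ((D' * a') powr (1 - 1 / p) * (D' powr (1 / (p - 1)) * b') powr (1 / p))"
    using aD bD ab p by (intro mult_left_mono mult_mono powr_mono2) auto
  also have "\<dots> = D powr (1 / p) * D' powr (1 - 1 / p) * D' powr (1 / (p * (p - 1))) * (b' powr (1 / p) * a' powr (1 - 1 / p))"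
    using D' a b p by (simp add: powr_mult powr_powr mult_ac)
  finally show ?thesis by (simp add: D'_def)
qed

lemma young_delta:
  fixes u v p \<delta> :: real
  assumes "0 \<le> u" "0 \<le> v" "1 < p" "0 < \<delta>"
  shows "u * v \<le> \<delta> * v powr (p / (p - 1)) + \<delta> powr (1 - p) * u powr p"
proof -
  have q: "p / (p - 1) - 1 = 1 / (p - 1)" using assms by (simp add: field_simps)
  have nn: "0 \<le> \<delta> * v powr (p / (p - 1))" "0 \<le> \<delta> powr (1 - p) * u powr p" using assms by auto
  show ?thesis
  proof (cases "u = 0 \<or> v = 0")
    case False
    then have uv: "0 < u" "0 < v" using assms by auto
    show ?thesis
    proof (cases "u \<le> \<delta> * v powr (1 / (p - 1))")
      case True
      then have "u * v \<le> \<delta> * v powr (1 / (p - 1)) * v" using assms by (intro mult_right_mono) auto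
      also have "\<dots> = \<delta> * v powr (p / (p - 1))"
        using uv powr_add[of v "1 / (p - 1)" 1] q by (simp add: algebra_simps)
      finally show ?thesis using nn by linarith
    next
      case False
      then have "v powr (1 / (p - 1)) \<le> u / \<delta>" using assms by (simp add: field_simps)
      then have "(v powr (1 / (p - 1))) powr (p - 1) \<le> (u / \<delta>) powr (p - 1)" using assms by (intro powr_mono2) auto
      moreover have "(v powr (1 / (p - 1))) powr (p - 1) = v" using uv assms by (simp add: powr_powr)
      moreover have "(u / \<delta>) powr (p - 1) = u powr (p - 1) * \<delta> powr (1 - p)"
        using uv assms powr_minus[of \<delta> "p - 1"] by (simp add: powr_divide field_simps)
      ultimately have "v \<le> u powr (p - 1) * \<delta> powr (1 - p)" by simp
      then have "u * v \<le> u * (u powr (p - 1) * \<delta> powr (1 - p))" using uv by (intro mult_left_mono) auto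
      also have "\<dots> = \<delta> powr (1 - p) * u powr p" using uv powr_add[of u 1 "p - 1"] by (simp add: mult_ac)
      finally show ?thesis using nn by linarith
    qed
  qed (use nn in auto)
qed

context dyadic_square
begin

lemma A1_one: "A1 (\<lambda>_. 1) 1"
  unfolding A1_def
proof (intro ballI allI)
  fix x j and v :: "'a \<Rightarrow> ennreal" assume x: "x \<in> space M" and v: "v \<in> borel_measurable M"
  have "(\<integral>\<^sup>+y\<in>cube j x. 1 \<partial>M) = ennreal (measure M (cube j x))"
    using cube_sets[OF x] by (simp add: emeasure_eq_measure)
  then show "(\<integral>\<^sup>+y\<in>cube j x. 1 \<partial>M) * (\<integral>\<^sup>+y\<in>cube j x. v y \<partial>M) \<le> ennreal (1 * measure M (cube j x)) * (\<integral>\<^sup>+y\<in>cube j x. (v y * 1) \<partial>M)"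
    by simp
qed

lemma L2w_one: "L2w (\<lambda>_. 1) J (2 / (1 - s))"
  unfolding L2w_def
proof (intro allI impI)
  fix g :: "nat \<Rightarrow> 'a \<Rightarrow> real" and B assume g: "\<forall>k<m. g k \<in> borel_measurable M" and B: "\<forall>x\<in>space M. nrm g x \<le> B"
  have gB: "\<bar>g k x\<bar> \<le> B" if "k < m" "x \<in> space M" for k x
  proof -
    have "\<bar>g k x\<bar> \<le> L2_set (\<lambda>k. \<bar>g k x\<bar>) {..<m}" using that by (intro member_le_L2_set) auto
    also have "\<dots> = nrm g x" by (simp add: nrm_def L2_set_def)
    finally show ?thesis using B that by force
  qed
  have i2: "integrable M (\<lambda>x. (g k x)\<^sup>2)" if k: "k < m" for k
  proof (rule integrable_const_bound)
    show "AE x in M. norm ((g k x)\<^sup>2) \<le> B\<^sup>2"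
    proof (rule AE_I2)
      fix x assume "x \<in> space M"
      then have "\<bar>g k x\<bar> ^ 2 \<le> B ^ 2" using gB[OF k] by (intro power_mono) auto
      then show "norm ((g k x)\<^sup>2) \<le> B\<^sup>2" by simp
    qed
    show "(\<lambda>x. (g k x)\<^sup>2) \<in> borel_measurable M" using g k by auto
  qed
  have ad: "adapted J (\<lambda>x. \<Sum>j\<in>{0..J}. (T k j (g k) x)\<^sup>2)" for k
    by (intro adapted_sum, rule adapted_comp[OF adapted_T]) auto
  have "S2 g 0 J x = (\<Sum>k<m. \<Sum>j\<in>{0..J}. (T k j (g k) x)\<^sup>2)" for x unfolding S2_def by (rule sum.swap)
  then have "(LINT x|M. S2 g 0 J x) = (\<Sum>k<m. LINT x|M. (\<Sum>j\<in>{0..J}. (T k j (g k) x)\<^sup>2))"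
    using adapted_integrable[OF ad] by (simp add: Bochner_Integration.integral_sum)
  also have "\<dots> \<le> (\<Sum>k<m. 2 / (1 - s) * (LINT x|M. (g k x)\<^sup>2))"
    using g gB by (intro sum_mono L2_bound_scalar) auto
  also have "\<dots> = 2 / (1 - s) * (LINT x|M. (nrm g x)\<^sup>2)"
    unfolding nrm_sq using i2 by (simp add: Bochner_Integration.integral_sum sum_distrib_left)
  finally have *: "(LINT x|M. S2 g 0 J x) \<le> 2 / (1 - s) * (LINT x|M. (nrm g x)\<^sup>2)" .
  have "(\<integral>\<^sup>+x. ennreal (S2 g 0 J x) \<partial>M) = ennreal (LINT x|M. S2 g 0 J x)"
    by (intro nn_integral_eq_integral adapted_integrable[OF adapted_S2]) (auto simp: S2_nonneg)
  also have "\<dots> \<le> ennreal (2 / (1 - s) * (LINT x|M. (nrm g x)\<^sup>2))" by (rule ennreal_leI[OF *])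
  also have "\<dots> = ennreal (2 / (1 - s)) * ennreal (LINT x|M. (nrm g x)\<^sup>2)" using s by (intro ennreal_mult) auto
  also have "ennreal (LINT x|M. (nrm g x)\<^sup>2) = (\<integral>\<^sup>+x. ennreal ((nrm g x)\<^sup>2) \<partial>M)"
    unfolding nrm_sq using i2 by (intro nn_integral_eq_integral[symmetric]) (auto simp: sum_nonneg)
  finally show "(\<integral>\<^sup>+x. (ennreal (S2 g 0 J x) * 1) \<partial>M) \<le> ennreal (2 / (1 - s)) * (\<integral>\<^sup>+x. (ennreal ((nrm g x)\<^sup>2) * 1) \<partial>M)"
    by simp
qed

text \<open>
  Twice the constant of the weak type inequality for the weight one, so that the points at which
  a stopping cube is left fill at most half of it.
\<close>

definition stop_const :: real where
  "stop_const = 2 * (1 + 4 * (2 / (1 - s)) * N * 1 + 2 * 1 * (1 / (1 - s)) * (1 + 1))"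

lemma stop_const_ge_1: "1 \<le> stop_const"
proof -
  have "0 \<le> 4 * (2 / (1 - s)) * N" "0 \<le> 2 * 1 * (1 / (1 - s)) * (1 + 1)" using s N_ge_1 by auto
  then show ?thesis unfolding stop_const_def by simp
qed

definition level_square :: "(nat \<Rightarrow> 'a \<Rightarrow> real) \<Rightarrow> 'a \<Rightarrow> nat \<Rightarrow> real" where
  "level_square f x j = (\<Sum>k<m. (T k j (f k) x)\<^sup>2)"

definition mean_square :: "(nat \<Rightarrow> 'a \<Rightarrow> real) \<Rightarrow> 'a \<Rightarrow> nat \<Rightarrow> real" where
  "mean_square f x j = (avg (nrm f) (cube j x))\<^sup>2"

definition stop_level :: "(nat \<Rightarrow> 'a \<Rightarrow> real) \<Rightarrow> nat \<Rightarrow> 'a \<Rightarrow> nat" where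
  "stop_level f j x = stopidx (level_square f x) (mean_square f x) (stop_const\<^sup>2) j"

lemma level_square_nonneg: "0 \<le> level_square f x j" by (simp add: level_square_def sum_nonneg)

lemma level_square_le_mean_square:
  assumes "\<And>k. k < m \<Longrightarrow> integrable M (f k)" "x \<in> space M" shows "level_square f x j \<le> mean_square f x j"
proof -
  have "L2_set (\<lambda>k. T k j (f k) x) {..<m} = L2_set (\<lambda>k. \<bar>T k j (f k) x\<bar>) {..<m}" by (simp add: L2_set_def)
  also have "\<dots> \<le> L2_set (\<lambda>k. avg (\<lambda>y. \<bar>f k y\<bar>) (cube j x)) {..<m}"
    using T_bound assms by (intro L2_set_mono) auto
  also have "\<dots> \<le> avg (nrm f) (cube j x)"
  proof (rule L2_avg_le)
    show "nrm (\<lambda>k y. \<bar>f k y\<bar>) y \<le> nrm f y" for y by (simp add: nrm_def L2_set_def)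
  qed (use assms cube_sets nrm_integrable in auto)
  finally have "(L2_set (\<lambda>k. T k j (f k) x) {..<m})\<^sup>2 \<le> mean_square f x j" unfolding mean_square_def by (intro power_mono) auto
  then show ?thesis by (simp add: L2_set_def sum_nonneg level_square_def)
qed

lemma adapted_stop_level: "j \<le> J \<Longrightarrow> adapted J (stop_level f j)"
  unfolding adapted_def
proof (intro ballI)
  fix x y assume jJ: "j \<le> J" and x: "x \<in> space M" and y: "y \<in> cube J x"
  have "cube i y = cube i x" if "i \<le> j" for i using cube_eq_coarser[OF x y] that jJ by simp
  then show "stop_level f j y = stop_level f j x"
    unfolding stop_level_def by (intro stopidx_cong) (auto simp: level_square_def mean_square_def T_def)
qed

text \<open>
  Sparseness of the stopping cubes. Where the stopping level \<open>i\<close> is left, the square function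
  from level \<open>i\<close> on exceeds \<open>stop_const\<close> times the mean of \<open>\<bar>f\<bar>\<close> over the cube; by the weak type
  inequality such points fill at most half of the cube.
\<close>

lemma sparse_half:
  assumes f: "\<And>k. k < m \<Longrightarrow> integrable M (f k)" and x: "x \<in> space M" and i: "i \<le> J" "stop_level f i x = i"
  shows "measure M (cube i x) \<le> 2 * measure M {y\<in>cube i x. stop_level f J y = i}"
proof -
  let ?Q = "cube i x"
  define a where "a = avg (nrm f) ?Q"
  define B where "B = {y\<in>?Q. (stop_const * a)\<^sup>2 < S2 f i J y}"
  have ni: "integrable M (nrm f)" using f by (rule nrm_integrable)
  have [measurable]: "?Q \<in> sets M" using cube_sets[OF x] .
  have [measurable]: "S2 f i J \<in> borel_measurable M" by (rule adapted_borel[OF adapted_S2])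
  have Bm [measurable]: "B \<in> sets M" unfolding B_def using sets.sets_into_space by measurable
  have stm: "stop_level f J \<in> measurable M (count_space UNIV)" by (rule adapted_measurable[OF adapted_stop_level[OF order_refl]]) auto
  have Em: "{y\<in>?Q. stop_level f J y = i} \<in> sets M"
  proof -
    have "{y\<in>?Q. stop_level f J y = i} = ?Q \<inter> (stop_level f J -` {i} \<inter> space M)" using cube_space[OF x] by auto
    then show ?thesis using measurable_sets[OF stm, of "{i}"] by auto
  qed
  have sub: "?Q - {y\<in>?Q. stop_level f J y = i} \<subseteq> B"
  proof
    fix y assume "y \<in> ?Q - {y\<in>?Q. stop_level f J y = i}"
    then have y: "y \<in> ?Q" "stop_level f J y \<noteq> i" by auto
    have "stop_level f i y = i" using adapted_stop_level[OF order_refl, of i f] x y(1) i(2) unfolding adapted_def by auto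
    then have "stop_const\<^sup>2 * mean_square f y i < sum (level_square f y) {i..J}"
      using y i by (intro stopidx_leave) (auto simp: stop_level_def level_square_nonneg)
    also have "sum (level_square f y) {i..J} = S2 f i J y" unfolding S2_def level_square_def ..
    finally show "y \<in> B" using y cube_eq[OF x y(1)] by (simp add: B_def a_def mean_square_def power_mult_distrib)
  qed
  have a0: "0 \<le> a" unfolding a_def by (rule avg_nonneg) simp
  have BQ: "measure M B \<le> measure M ?Q / 2"
  proof (cases "a = 0")
    \<comment> \<open>Vanishing mean: the threshold zero is not admissible in the weak type
      inequality, but all terms of the square function vanish.\<close>
    case True
    have "S2 f i J y \<le> 0" if y: "y \<in> ?Q" for y
    proof -
      have ys: "y \<in> space M" using y cube_space[OF x] by auto
      have "level_square f y j \<le> 0" if j: "i \<le> j" for j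
      proof -
        have "avg (nrm f) (cube j y) = 0"
        proof -
          have "cube j y \<subseteq> ?Q" using cube_mono[OF ys j] cube_eq[OF x y] by simp
          then have "(LINT z|M. indicator (cube j y) z * nrm f z) \<le> (LINT z|M. indicator ?Q z * nrm f z)"
            using ni cube_sets[OF ys] by (intro integral_mono integrable_ind) (auto simp: indicator_def)
          also have "\<dots> = 0" using True cube_pos[OF x, of i] by (simp add: a_def avg_def)
          finally have "avg (nrm f) (cube j y) \<le> 0" unfolding avg_def by (simp add: divide_nonpos_nonneg)
          then show ?thesis using avg_nonneg[of "nrm f" "cube j y"] by simp
        qed
        then show ?thesis using level_square_le_mean_square[where f=f and x=y and j=j, OF f ys] by (simp add: mean_square_def)
      qed
      then show ?thesis unfolding S2_def level_square_def[symmetric] by (intro sum_nonpos) auto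
    qed
    then have "B = {}" using True by (force simp: B_def)
    then show ?thesis by simp
  next
    case False
    then have a: "0 < a" using a0 by simp
    have "ennreal (stop_const * a) * (\<integral>\<^sup>+y\<in>{y\<in>?Q. (stop_const * a)\<^sup>2 < S2 f i J y}. 1 \<partial>M) \<le> ennreal (1 + 4 * (2 / (1 - s)) * N * 1 + 2 * 1 * (1 / (1 - s)) * (1 + 1)) * (\<integral>\<^sup>+y\<in>?Q. (ennreal (nrm f y) * 1) \<partial>M)"
    proof (rule weak_type[OF A1_one _ L2w_one])
      show "0 < stop_const * a" using stop_const_ge_1 a by simp
      show "avg (nrm f) ?Q \<le> stop_const * a" using stop_const_ge_1 a by (simp add: a_def[symmetric])
    qed (use s f x i in auto)
    also have "(\<integral>\<^sup>+y\<in>?Q. (ennreal (nrm f y) * 1) \<partial>M) = (\<integral>\<^sup>+y. ennreal (indicator ?Q y * nrm f y) \<partial>M)"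
      by (rule nn_integral_cong) (auto simp: indicator_def)
    also have "\<dots> = ennreal (LINT y|M. indicator ?Q y * nrm f y)"
      by (rule nn_integral_eq_integral) (auto intro!: integrable_ind ni)
    also have "(LINT y|M. indicator ?Q y * nrm f y) = measure M ?Q * a" unfolding a_def avg_def using cube_pos[OF x, of i] by simp
    also have "(\<integral>\<^sup>+y\<in>{y\<in>?Q. (stop_const * a)\<^sup>2 < S2 f i J y}. 1 \<partial>M) = ennreal (measure M B)"
      unfolding B_def[symmetric] by (simp add: emeasure_eq_measure)
    also have "1 + 4 * (2 / (1 - s)) * N * 1 + 2 * 1 * (1 / (1 - s)) * (1 + 1) = stop_const / 2" unfolding stop_const_def by simp
    finally have "ennreal (stop_const * a * measure M B) \<le> ennreal (stop_const / 2 * (measure M ?Q * a))"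
      using a stop_const_ge_1 by (simp add: ennreal_mult[symmetric])
    then have "stop_const * a * measure M B \<le> stop_const / 2 * (measure M ?Q * a)"
      using a stop_const_ge_1 by (subst (asm) ennreal_le_iff) auto
    then have "(stop_const * a) * measure M B \<le> (stop_const * a) * (measure M ?Q / 2)" by (simp add: mult_ac)
    then show ?thesis using a stop_const_ge_1 by (subst (asm) mult_le_cancel_left) auto
  qed
  have "measure M ?Q \<le> measure M ({y\<in>?Q. stop_level f J y = i} \<union> B)"
    using sub Em by (intro finite_measure_mono) auto
  also have "\<dots> \<le> measure M {y\<in>?Q. stop_level f J y = i} + measure M B" by (rule measure_Un_le[OF Em Bm])
  finally show ?thesis using BQ by simp
qed

definition Ap_const :: "real \<Rightarrow> real \<Rightarrow> real" where
  "Ap_const p D = D powr (1 / p) * (D * 4 powr p) powr (1 - 1 / p) * (D * 4 powr p) powr (1 / (p * (p - 1)))"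

definition Lp_const :: "real \<Rightarrow> real \<Rightarrow> real" where
  "Lp_const p D = stop_const powr p * (2 * (Ap_const p D * (1 / (2 * Ap_const p D * (2 * p) powr (p / (p - 1)))) powr (1 - p) * (2 * (p / (p - 1))) powr p))"

text \<open>
  By \<open>stopidx_sum_le\<close> the square function is bounded by \<open>stop_const\<close> times the sum \<open>AA\<close> of the
  means of \<open>h = \<bar>f\<bar>\<close> over the stopping cubes around a point. The \<open>L^p(w)\<close> norm of \<open>AA\<close> is
  computed by pairing \<open>AA\<close> with \<open>G = AA powr (p - 1)\<close>, which gives a sum over stopping cubes
  \<open>B i\<close> of the mean of \<open>h\<close> times the \<open>w\<close>-integral of \<open>G\<close>. Both factors are written as means,
  \<open>a i\<close> of \<open>h / \<sigma>\<close> with respect to \<open>\<sigma>\<close> and \<open>b i\<close> of \<open>G\<close> with respect to \<open>w\<close>. The \<open>A_p\<close> condition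
  and sparseness then replace the masses of \<open>B i\<close> by those of the disjoint sets \<open>E i\<close> of points
  that stop at \<open>B i\<close> for good, and the Carleson embedding applies to either mean.
\<close>

lemma weighted_Lp:
  fixes w \<sigma> :: "'a \<Rightarrow> real"
  assumes f: "\<And>k. k < m \<Longrightarrow> integrable M (f k)" and p: "1 < p" and D: "0 < D"
    and wm [measurable]: "w \<in> borel_measurable M" and \<sigma>m [measurable]: "\<sigma> \<in> borel_measurable M"
    and wp: "\<And>x. 0 < w x" and \<sigma>p: "\<And>x. 0 < \<sigma> x" and dual: "\<And>x. \<sigma> x powr (p - 1) * w x = 1"
    and wi: "integrable M w" and \<sigma>i: "integrable M \<sigma>"
    and Ap: "\<And>x j. x \<in> space M \<Longrightarrow> (LINT y|M. indicator (cube j x) y * w y) * (LINT y|M. indicator (cube j x) y * \<sigma> y) powr (p - 1) \<le> D * measure M (cube j x) powr p"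
  shows "(\<integral>\<^sup>+x. ennreal (S2 f 0 J x powr (p / 2) * w x) \<partial>M) \<le> ennreal (Lp_const p D) * (\<integral>\<^sup>+x. ennreal (nrm f x powr p * w x) \<partial>M)"
proof -
  have w0 [simp]: "0 \<le> w x" and \<sigma>0 [simp]: "0 \<le> \<sigma> x" for x using wp[of x] \<sigma>p[of x] by auto
  have iw0 [simp]: "0 \<le> indicator A x * w x" and i\<sigma>0 [simp]: "0 \<le> indicator A x * \<sigma> x" for A x by (auto simp: indicator_def)
  define q where "q = p / (p - 1)"
  have q: "1 < q" using p by (simp add: q_def)
  define h where "h = nrm f"
  have hi: "integrable M h" unfolding h_def using f by (rule nrm_integrable)
  have [measurable]: "h \<in> borel_measurable M" using hi by auto
  have h0: "0 \<le> h x" for x by (simp add: h_def)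
  define \<mu> where "\<mu> = density M (\<lambda>x. ennreal (w x))"
  define \<nu> where "\<nu> = density M (\<lambda>x. ennreal (\<sigma> x))"
  define W where "W A = (LINT y|M. indicator A y * w y)" for A
  define V where "V A = (LINT y|M. indicator A y * \<sigma> y)" for A
  have sets\<mu> [simp]: "sets \<mu> = sets M" "space \<mu> = space M" and sets\<nu> [simp]: "sets \<nu> = sets M" "space \<nu> = space M"
    by (simp_all add: \<mu>_def \<nu>_def)
  have e\<mu>: "emeasure \<mu> A = ennreal (W A)" if A: "A \<in> sets M" for A
  proof -
    have "emeasure \<mu> A = (\<integral>\<^sup>+x. ennreal (indicator A x * w x) \<partial>M)"
      unfolding \<mu>_def using A by (subst emeasure_density) (auto intro!: nn_integral_cong simp: indicator_def)
    also have "\<dots> = ennreal (W A)" unfolding W_def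
      using A wp by (intro nn_integral_eq_integral integrable_ind wi) (auto intro: less_imp_le)
    finally show ?thesis .
  qed
  have e\<nu>: "emeasure \<nu> A = ennreal (V A)" if A: "A \<in> sets M" for A
  proof -
    have "emeasure \<nu> A = (\<integral>\<^sup>+x. ennreal (indicator A x * \<sigma> x) \<partial>M)"
      unfolding \<nu>_def using A by (subst emeasure_density) (auto intro!: nn_integral_cong simp: indicator_def)
    also have "\<dots> = ennreal (V A)" unfolding V_def
      using A \<sigma>p by (intro nn_integral_eq_integral integrable_ind \<sigma>i) (auto intro: less_imp_le)
    finally show ?thesis .
  qed
  have fin\<mu>: "finite_measure \<mu>" by (rule finite_measureI) (simp add: e\<mu>)
  have fin\<nu>: "finite_measure \<nu>" by (rule finite_measureI) (simp add: e\<nu>)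
  have Wmono: "W A \<le> W B" if "A \<in> sets M" "B \<in> sets M" "A \<subseteq> B" for A B
    unfolding W_def using that wp by (intro integral_mono integrable_ind wi) (auto simp: indicator_def intro: less_imp_le)
  have Vmono: "V A \<le> V B" if "A \<in> sets M" "B \<in> sets M" "A \<subseteq> B" for A B
    unfolding V_def using that \<sigma>p by (intro integral_mono integrable_ind \<sigma>i) (auto simp: indicator_def intro: less_imp_le)
  have Wpos: "0 < W A" if A: "A \<in> sets M" "0 < measure M A" for A
  proof -
    have "W A \<noteq> 0"
    proof
      assume "W A = 0"
      then have "AE x in M. indicator A x * w x = 0" unfolding W_def
        using A wp by (subst (asm) integral_nonneg_eq_0_iff_AE) (auto intro!: integrable_ind wi less_imp_le)
      then have "AE x in M. x \<notin> A"
        by (rule AE_mp) (use wp in \<open>auto intro!: AE_I2 simp: indicator_def less_le split: if_splits\<close>)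
      then have "A \<in> null_sets M" using A AE_iff_null_sets by auto
      then show False using A by (auto simp: measure_def)
    qed
    moreover have "0 \<le> W A" unfolding W_def using wp by (intro integral_nonneg_AE) (auto intro: less_imp_le)
    ultimately show ?thesis by simp
  qed
  have Vpos: "0 < V A" if A: "A \<in> sets M" "0 < measure M A" for A
  proof -
    have "V A \<noteq> 0"
    proof
      assume "V A = 0"
      then have "AE x in M. indicator A x * \<sigma> x = 0" unfolding V_def
        using A \<sigma>p by (subst (asm) integral_nonneg_eq_0_iff_AE) (auto intro!: integrable_ind \<sigma>i less_imp_le)
      then have "AE x in M. x \<notin> A"
        by (rule AE_mp) (use \<sigma>p in \<open>auto intro!: AE_I2 simp: indicator_def less_le split: if_splits\<close>)
      then have "A \<in> null_sets M" using A AE_iff_null_sets by auto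
      then show False using A by (auto simp: measure_def)
    qed
    moreover have "0 \<le> V A" unfolding V_def using \<sigma>p by (intro integral_nonneg_AE) (auto intro: less_imp_le)
    ultimately show ?thesis by simp
  qed
  have holder: "measure M A \<le> 2 * (W A powr (1 / p) * V A powr (1 - 1 / p))" if A: "A \<in> sets M" "0 < measure M A" for A
  proof (rule young_split_optimize)
    fix t :: real assume t: "0 < t"
    have "measure M A = (LINT y|M. indicator A y * 1)" using A sets.sets_into_space[of A M] by (simp add: Int_absorb2)
    also have "\<dots> \<le> (LINT y|M. t * (indicator A y * \<sigma> y) + t powr (1 - p) * (indicator A y * w y))"
    proof (rule integral_mono)
      fix y
      have "1 \<le> t * \<sigma> y + t powr (1 - p) * w y"
        using young_split[of 1 "\<sigma> y" "w y" p t] \<sigma>p wp dual p t by simp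
      then show "indicator A y * 1 \<le> t * (indicator A y * \<sigma> y) + t powr (1 - p) * (indicator A y * w y)"
        by (auto simp: indicator_def)
      show "integrable M (\<lambda>y. indicator A y * 1 :: real)" by (rule integrable_ind) (use A in auto)
    qed (use A in \<open>auto intro!: integrable_ind wi \<sigma>i Bochner_Integration.integrable_add integrable_mult_right\<close>)
    also have "\<dots> = t * V A + t powr (1 - p) * W A" unfolding V_def W_def
      using integrable_ind[OF wi A(1)] integrable_ind[OF \<sigma>i A(1)] by simp
    finally show "measure M A \<le> t * V A + t powr (1 - p) * W A" .
  qed (use Wpos Vpos A p in auto)
  define I where "I = (SIGMA j:{..J}. {Q. \<exists>x\<in>space M. Q = cube j x \<and> stop_level f j x = j})"
  have Iin: "\<exists>j x. i = (j, cube j x) \<and> x \<in> space M \<and> j \<le> J \<and> stop_level f j x = j" if "i \<in> I" for i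
    using that unfolding I_def by auto
  have Ifin: "finite I" unfolding I_def
  proof (rule finite_SigmaI)
    fix j
    have "{Q. \<exists>x\<in>space M. Q = cube j x \<and> stop_level f j x = j} \<subseteq> cube j ` space M" by auto
    then show "finite {Q. \<exists>x\<in>space M. Q = cube j x \<and> stop_level f j x = j}" using finite_cubes finite_subset by blast
  qed simp
  define B where "B i = (snd i :: 'a set)" for i :: "nat \<times> 'a set"
  define E where "E i = {y\<in>snd i. stop_level f J y = fst i}" for i :: "nat \<times> 'a set"
  have stm: "stop_level f J \<in> measurable M (count_space UNIV)" by (rule adapted_measurable[OF adapted_stop_level[OF order_refl]]) auto
  have Bm: "B i \<in> sets M" if "i \<in> I" for i using Iin[OF that] cube_sets by (auto simp: B_def)
  have Em: "E i \<in> sets M" if "i \<in> I" for i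
  proof -
    have "E i = B i \<inter> (stop_level f J -` {fst i} \<inter> space M)" using sets.sets_into_space[OF Bm[OF that]] by (auto simp: E_def B_def)
    then show ?thesis using measurable_sets[OF stm, of "{fst i}"] Bm[OF that] by auto
  qed
  have EB: "E i \<subseteq> B i" for i by (auto simp: E_def B_def)
  have Edisj: "disjoint_family_on E I"
    unfolding disjoint_family_on_def
  proof (intro ballI impI)
    fix i i' assume i: "i \<in> I" and i': "i' \<in> I" and ne: "i \<noteq> i'"
    obtain j x where j: "i = (j, cube j x)" "x \<in> space M" using Iin[OF i] by blast
    obtain j' x' where j': "i' = (j', cube j' x')" "x' \<in> space M" using Iin[OF i'] by blast
    show "E i \<inter> E i' = {}"
    proof (rule ccontr)
      assume "E i \<inter> E i' \<noteq> {}"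
      then obtain y where "y \<in> E i" "y \<in> E i'" by blast
      then have y: "y \<in> cube j x" "y \<in> cube j' x'" "j = j'" using j j' by (auto simp: E_def)
      then have "cube j x = cube j' x'" using cube_eq[OF j(2) y(1)] cube_eq[OF j'(2) y(2)] by simp
      then show False using ne j j' y by simp
    qed
  qed
  have lam: "B i \<inter> B i' = {} \<or> B i \<subseteq> B i' \<or> B i' \<subseteq> B i" if i: "i \<in> I" and i': "i' \<in> I" for i i'
  proof -
    obtain j x where j: "i = (j, cube j x)" "x \<in> space M" using Iin[OF i] by blast
    obtain j' x' where j': "i' = (j', cube j' x')" "x' \<in> space M" using Iin[OF i'] by blast
    have "cube j x \<subseteq> cube j' x' \<or> cube j' x' \<subseteq> cube j x" if y: "y \<in> cube j x" "y \<in> cube j' x'" for y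
    proof -
      have ys: "y \<in> space M" using cube_in_space[OF j(2) y(1)] .
      then show ?thesis using cube_eq[OF j(2) y(1)] cube_eq[OF j'(2) y(2)] cube_mono[OF ys, of j j'] cube_mono[OF ys, of j' j]
        by (cases "j \<le> j'") auto
    qed
    then show ?thesis using j j' by (auto simp: B_def)
  qed
  have half: "measure M (B i) \<le> 2 * measure M (E i)" "0 < measure M (B i)" if i: "i \<in> I" for i
  proof -
    obtain j x where j: "i = (j, cube j x)" "x \<in> space M" "j \<le> J" "stop_level f j x = j" using Iin[OF i] by blast
    show "measure M (B i) \<le> 2 * measure M (E i)" using sparse_half[of f x j J, OF f j(2,3,4)] j(1) by (simp add: B_def E_def)
    show "0 < measure M (B i)" using cube_pos j by (simp add: B_def)
  qed
  \<comment> \<open>Pointwise, the sum \<open>AA\<close> of the means over the stopping cubes controls the square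
    function.\<close>
  define mi where "mi i = avg h (B i)" for i
  have mi0: "0 \<le> mi i" for i unfolding mi_def by (rule avg_nonneg[OF h0])
  let ?J = "\<lambda>x. {j\<in>{..J}. stop_level f j x = j}"
  define AA where "AA x = (\<Sum>j\<in>(?J x). avg h (cube j x))" for x
  have AA0: "0 \<le> AA x" for x unfolding AA_def by (intro sum_nonneg avg_nonneg h0)
  have AAI: "AA x = (\<Sum>i\<in>I. mi i * indicator (B i) x)" if x: "x \<in> space M" for x
  proof -
    have "(\<Sum>i\<in>I. mi i * indicator (B i) x) = (\<Sum>i\<in>(\<lambda>j. (j, cube j x)) ` (?J x). mi i * indicator (B i) x)"
    proof (rule sum.mono_neutral_right[OF Ifin])
      show "(\<lambda>j. (j, cube j x)) ` (?J x) \<subseteq> I" using x by (auto simp: I_def)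
      show "\<forall>i\<in>I - (\<lambda>j. (j, cube j x)) ` (?J x). mi i * indicator (B i) x = 0"
      proof
        fix i assume i: "i \<in> I - (\<lambda>j. (j, cube j x)) ` (?J x)"
        then obtain j z where j: "i = (j, cube j z)" "z \<in> space M" "j \<le> J" "stop_level f j z = j" using Iin[of i] by blast
        have "x \<notin> cube j z"
        proof
          assume xz: "x \<in> cube j z"
          have "cube j x = cube j z" using cube_eq[OF j(2) xz] .
          moreover have "stop_level f j x = j" using adapted_stop_level[OF order_refl, of j f] xz j unfolding adapted_def by auto
          ultimately show False using i j by auto
        qed
        then show "mi i * indicator (B i) x = 0" using j by (simp add: B_def)
      qed
    qed
    also have "\<dots> = (\<Sum>j\<in>(?J x). mi (j, cube j x) * indicator (B (j, cube j x)) x)"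
      by (subst sum.reindex) (auto simp: inj_on_def)
    also have "\<dots> = AA x" unfolding AA_def using cube_self[OF x] by (intro sum.cong) (auto simp: mi_def B_def)
    finally show ?thesis by simp
  qed
  have AAm [measurable]: "AA \<in> borel_measurable M"
  proof -
    have "(\<lambda>x. \<Sum>i\<in>I. mi i * indicator (B i) x) \<in> borel_measurable M"
      using Bm by (intro borel_measurable_sum borel_measurable_times borel_measurable_indicator) auto
    then show ?thesis using AAI by (simp cong: measurable_cong)
  qed
  have AAb: "AA x \<le> (\<Sum>i\<in>I. mi i)" if "x \<in> space M" for x
    unfolding AAI[OF that] using mi0 by (intro sum_mono) (auto simp: indicator_def)
  have S2AA: "S2 f 0 J x \<le> stop_const\<^sup>2 * (AA x)\<^sup>2" if x: "x \<in> space M" for x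
  proof -
    have "S2 f 0 J x = sum (level_square f x) {..J}" by (simp add: S2_def level_square_def atLeast0AtMost)
    also have "\<dots> \<le> stop_const\<^sup>2 * sum (mean_square f x) (?J x)"
      unfolding stop_level_def using stop_const_ge_1 by (intro stopidx_sum_le level_square_nonneg level_square_le_mean_square f x) (auto simp: one_le_power)
    also have "sum (mean_square f x) (?J x) \<le> (AA x)\<^sup>2"
    proof -
      have "sqrt (\<Sum>j\<in>(?J x). (avg h (cube j x))\<^sup>2) \<le> AA x"
        unfolding AA_def using L2_set_le_sum[of "(?J x)" "\<lambda>j. avg h (cube j x)"] avg_nonneg[OF h0] by (simp add: L2_set_def)
      then show ?thesis unfolding mean_square_def h_def using AA0 by (simp add: sqrt_le_D)
    qed
    finally show ?thesis using stop_const_ge_1 by (simp add: mult_left_mono)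
  qed
  define G where "G x = AA x powr (p - 1)" for x
  have Gm [measurable]: "G \<in> borel_measurable M" unfolding G_def[abs_def] by measurable
  have Gm\<mu> [measurable]: "G \<in> borel_measurable \<mu>" unfolding \<mu>_def by simp
  have G0: "0 \<le> G x" for x by (simp add: G_def)
  define X where "X = (\<integral>\<^sup>+x. ennreal (AA x powr p) \<partial>\<mu>)"
  have Xfin: "X < \<infinity>"
  proof -
    have "X \<le> (\<integral>\<^sup>+x. ennreal ((\<Sum>i\<in>I. mi i) powr p) \<partial>\<mu>)"
      unfolding X_def using AAb AA0 p by (intro nn_integral_mono ennreal_leI powr_mono2) auto
    also have "\<dots> < \<infinity>" by (simp add: e\<mu> ennreal_mult_less_top)
    finally show ?thesis .
  qed
  have GBfin: "(\<integral>\<^sup>+x\<in>B i. ennreal (G x) \<partial>\<mu>) < \<infinity>" for i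
  proof -
    have "(\<integral>\<^sup>+x\<in>B i. ennreal (G x) \<partial>\<mu>) \<le> (\<integral>\<^sup>+x. ennreal ((\<Sum>i\<in>I. mi i) powr (p - 1)) \<partial>\<mu>)"
      unfolding G_def using AAb AA0 p by (intro nn_integral_mono) (auto simp: indicator_def intro!: ennreal_leI powr_mono2)
    also have "\<dots> < \<infinity>" by (simp add: e\<mu> ennreal_mult_less_top)
    finally show ?thesis .
  qed
  let ?GB = "\<lambda>i. \<integral>\<^sup>+x\<in>B i. ennreal (G x) \<partial>\<mu>"
  define b where "b i = enn2real (?GB i) / W (B i)" for i
  define a where "a i = mi i * measure M (B i) / V (B i)" for i
  have WB: "0 < W (B i)" "0 < V (B i)" if "i \<in> I" for i using Wpos Vpos Bm half that by auto
  have b0: "0 \<le> b i" "0 \<le> a i" if "i \<in> I" for i using WB[OF that] mi0[of i] by (auto simp: b_def a_def)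
  have bW: "ennreal (b i) * ennreal (W (B i)) = (?GB i)" if i: "i \<in> I" for i
    using WB[OF i] GBfin[of i] b0[OF i] by (simp add: ennreal_mult[symmetric] b_def)
  have aV: "ennreal (a i) * emeasure \<nu> (B i) = (\<integral>\<^sup>+x\<in>B i. ennreal (h x / \<sigma> x) \<partial>\<nu>)" if i: "i \<in> I" for i
  proof -
    have "(\<integral>\<^sup>+x\<in>B i. ennreal (h x / \<sigma> x) \<partial>\<nu>) = (\<integral>\<^sup>+x. ennreal (\<sigma> x) * (ennreal (h x / \<sigma> x) * indicator (B i) x) \<partial>M)"
      unfolding \<nu>_def using Bm[OF i] by (intro nn_integral_density) auto
    also have "\<dots> = (\<integral>\<^sup>+x. ennreal (indicator (B i) x * h x) \<partial>M)"
    proof (rule nn_integral_cong)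
      fix x
      have "ennreal (\<sigma> x) * ennreal (h x / \<sigma> x) = ennreal (h x)" using \<sigma>p[of x] h0[of x] by (simp add: ennreal_mult[symmetric] less_imp_le)
      then show "ennreal (\<sigma> x) * (ennreal (h x / \<sigma> x) * indicator (B i) x) = ennreal (indicator (B i) x * h x)"
        by (auto simp: indicator_def)
    qed
    also have "\<dots> = ennreal (LINT x|M. indicator (B i) x * h x)"
      using Bm[OF i] h0 by (intro nn_integral_eq_integral integrable_ind hi) auto
    also have "(LINT x|M. indicator (B i) x * h x) = a i * V (B i)"
      using WB[OF i] half(2)[OF i] by (simp add: a_def mi_def avg_def)
    finally show ?thesis using e\<nu>[OF Bm[OF i]] b0(2)[OF i] WB[OF i] by (simp add: ennreal_mult)
  qed
  have GBm: "(\<lambda>x. ennreal (G x) * indicator (B i) x) \<in> borel_measurable \<mu>" if "i \<in> I" for i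
    using Bm[OF that] Gm\<mu> by (intro borel_measurable_times_ennreal borel_measurable_indicator) auto
  have XI: "X = (\<Sum>i\<in>I. ennreal (mi i * (b i * W (B i))))"
  proof -
    have "X = (\<integral>\<^sup>+x. (\<Sum>i\<in>I. ennreal (mi i) * (ennreal (G x) * indicator (B i) x)) \<partial>\<mu>)"
      unfolding X_def
    proof (rule nn_integral_cong)
      fix x assume "x \<in> space \<mu>"
      then have x: "x \<in> space M" by simp
      have "AA x powr p = AA x * G x"
        using AA0[of x] powr_add[of "AA x" 1 "p - 1"] by (cases "AA x = 0") (auto simp: G_def)
      also have "\<dots> = (\<Sum>i\<in>I. mi i * (G x * indicator (B i) x))"
        by (simp add: AAI[OF x] sum_distrib_left mult_ac)
      also have "ennreal \<dots> = (\<Sum>i\<in>I. ennreal (mi i * (G x * indicator (B i) x)))"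
        using mi0 G0 by (intro sum_ennreal[symmetric]) auto
      also have "\<dots> = (\<Sum>i\<in>I. ennreal (mi i) * (ennreal (G x) * indicator (B i) x))"
        using mi0 G0 by (intro sum.cong) (auto simp: ennreal_mult indicator_def)
      finally show "ennreal (AA x powr p) = (\<Sum>i\<in>I. ennreal (mi i) * (ennreal (G x) * indicator (B i) x))" .
    qed
    also have "\<dots> = (\<Sum>i\<in>I. \<integral>\<^sup>+x. ennreal (mi i) * (ennreal (G x) * indicator (B i) x) \<partial>\<mu>)"
      by (intro nn_integral_sum borel_measurable_times_ennreal borel_measurable_const GBm)
    also have "\<dots> = (\<Sum>i\<in>I. ennreal (mi i * (b i * W (B i))))"
    proof (rule sum.cong[OF refl])
      fix i assume i: "i \<in> I"
      have "(\<integral>\<^sup>+x. ennreal (mi i) * (ennreal (G x) * indicator (B i) x) \<partial>\<mu>) = ennreal (mi i) * (ennreal (b i) * ennreal (W (B i)))"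
        unfolding bW[OF i] by (rule nn_integral_cmult[OF GBm[OF i]])
      then show "(\<integral>\<^sup>+x. ennreal (mi i) * (ennreal (G x) * indicator (B i) x) \<partial>\<mu>) = ennreal (mi i * (b i * W (B i)))"
        using mi0 b0[OF i] WB[OF i] by (simp add: ennreal_mult)
    qed
    finally show ?thesis .
  qed
  define C0 where "C0 = Ap_const p D"
  have C0: "0 < C0" unfolding C0_def Ap_const_def using D by simp
  \<comment> \<open>This weight in Young's inequality makes the Carleson sum of the \<open>b i\<close> at most
    \<open>X / 2\<close>.\<close>
  define \<delta> where "\<delta> = 1 / (2 * C0 * (2 * p) powr q)"
  have \<delta>: "0 < \<delta>" unfolding \<delta>_def using C0 p by simp
  let ?c1 = "C0 * \<delta> powr (1 - p)"
  let ?c2 = "(2 * (p / (p - 1))) powr p"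
  have term_le: "mi i * (b i * W (B i)) \<le> C0 * \<delta> * (b i powr q * W (E i)) + C0 * \<delta> powr (1 - p) * (a i powr p * V (E i))" if i: "i \<in> I" for i
  proof -
    have E: "E i \<in> sets M" "0 < measure M (E i)" using Em half[OF i] i by auto
    note pos = WB[OF i] Wpos[OF E] Vpos[OF E]
    obtain j x where j: "i = (j, cube j x)" "x \<in> space M" using Iin[OF i] by blast
    have Ai: "W (B i) * V (B i) powr (p - 1) \<le> D * measure M (B i) powr p"
      using Ap[OF j(2), of j] j(1) by (simp add: W_def V_def B_def)
    have low: "measure M (B i) \<le> 4 * (W (E i) powr (1 / p) * V (E i) powr (1 - 1 / p))"
      using half(1)[OF i] holder[OF E] by linarith
    have prod: "W (B i) * V (B i) / measure M (B i) \<le> C0 * (V (E i) powr (1 / p) * W (E i) powr (1 - 1 / p))"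
      unfolding C0_def Ap_const_def
      by (rule weights_product_le[OF p _ _ _ _ half(2)[OF i] D Ai low])
        (use pos Wmono Vmono E Bm i EB in auto)
    have "mi i * (b i * W (B i)) = a i * b i * (W (B i) * V (B i) / measure M (B i))"
      using pos half(2)[OF i] by (simp add: a_def)
    also have "\<dots> \<le> a i * b i * (C0 * (V (E i) powr (1 / p) * W (E i) powr (1 - 1 / p)))"
      using b0[OF i] by (intro mult_left_mono prod) auto
    also have "\<dots> = C0 * ((a i * V (E i) powr (1 / p)) * (b i * W (E i) powr (1 - 1 / p)))" by (simp add: mult_ac)
    also have "\<dots> \<le> C0 * (\<delta> * (b i * W (E i) powr (1 - 1 / p)) powr (p / (p - 1)) + \<delta> powr (1 - p) * (a i * V (E i) powr (1 / p)) powr p)"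
      using C0 b0[OF i] p \<delta> by (intro mult_left_mono young_delta) auto
    also have "(b i * W (E i) powr (1 - 1 / p)) powr (p / (p - 1)) = b i powr q * W (E i)"
    proof -
      have e: "(1 - 1 / p) * q = 1" using p by (simp add: q_def field_simps)
      show ?thesis unfolding q_def[symmetric] using pos b0[OF i] by (simp only: powr_mult powr_powr e) simp
    qed
    also have "(a i * V (E i) powr (1 / p)) powr p = a i powr p * V (E i)"
      using pos b0[OF i] p by (simp add: powr_mult powr_powr)
    finally show ?thesis by (simp add: algebra_simps)
  qed
  define Y where "Y = (\<integral>\<^sup>+x. ennreal (h x powr p * w x) \<partial>M)"
  have sumb: "(\<Sum>i\<in>I. ennreal (b i powr q) * emeasure \<mu> (E i)) \<le> ennreal ((2 * p) powr q) * X"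
  proof -
    have "(\<Sum>i\<in>I. ennreal (b i powr q) * emeasure \<mu> (E i)) \<le> ennreal ((2 * (q / (q - 1))) powr q) * (\<integral>\<^sup>+x. ennreal (G x powr q) \<partial>\<mu>)"
    proof (rule carleson_embedding[OF fin\<mu> Ifin, where B=B])
      show "ennreal (b i) * emeasure \<mu> (B i) \<le> (?GB i)" if "i \<in> I" for i
        using bW[OF that] e\<mu>[OF Bm[OF that]] by simp
    qed (use Bm Em EB Edisj lam G0 q b0 in auto)
    also have "q / (q - 1) = p" using p by (simp add: q_def field_simps)
    also have "(\<integral>\<^sup>+x. ennreal (G x powr q) \<partial>\<mu>) = X"
      unfolding X_def G_def powr_powr q_def using p by simp
    finally show ?thesis .
  qed
  have suma: "(\<Sum>i\<in>I. ennreal (a i powr p) * emeasure \<nu> (E i)) \<le> ennreal ?c2 * Y"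
  proof -
    have "(\<Sum>i\<in>I. ennreal (a i powr p) * emeasure \<nu> (E i)) \<le> ennreal ?c2 * (\<integral>\<^sup>+x. ennreal ((h x / \<sigma> x) powr p) \<partial>\<nu>)"
    proof (rule carleson_embedding[OF fin\<nu> Ifin, where B=B])
      show "ennreal (a i) * emeasure \<nu> (B i) \<le> (\<integral>\<^sup>+x\<in>B i. ennreal (h x / \<sigma> x) \<partial>\<nu>)" if "i \<in> I" for i
        using aV[OF that] by simp
      show "(\<lambda>x. h x / \<sigma> x) \<in> borel_measurable \<nu>" unfolding \<nu>_def by simp
      show "0 \<le> h x / \<sigma> x" for x using h0[of x] \<sigma>p[of x] by simp
    qed (use Bm Em EB Edisj lam p b0 in auto)
    also have "(\<integral>\<^sup>+x. ennreal ((h x / \<sigma> x) powr p) \<partial>\<nu>) = (\<integral>\<^sup>+x. ennreal (\<sigma> x) * ennreal ((h x / \<sigma> x) powr p) \<partial>M)"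
      unfolding \<nu>_def by (intro nn_integral_density) auto
    also have "\<dots> = Y" unfolding Y_def
    proof (rule nn_integral_cong)
      fix x
      have "\<sigma> x powr p = \<sigma> x * \<sigma> x powr (p - 1)" using \<sigma>p[of x] powr_add[of "\<sigma> x" 1 "p - 1"] by simp
      then have "\<sigma> x powr p * w x = \<sigma> x" using dual[of x] by (simp add: mult.assoc)
      then have "\<sigma> x / \<sigma> x powr p = w x" using \<sigma>p[of x] by (simp add: field_simps)
      then have "\<sigma> x * (h x / \<sigma> x) powr p = h x powr p * w x"
        using h0[of x] \<sigma>p[of x] by (simp add: powr_divide) (simp add: field_simps)
      then show "ennreal (\<sigma> x) * ennreal ((h x / \<sigma> x) powr p) = ennreal (h x powr p * w x)"
        using \<sigma>p[of x] by (simp add: ennreal_mult[symmetric] less_imp_le)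
    qed
    finally show ?thesis .
  qed
  have "X \<le> (\<Sum>i\<in>I. ennreal (C0 * \<delta> * (b i powr q * W (E i)) + C0 * \<delta> powr (1 - p) * (a i powr p * V (E i))))"
    unfolding XI using term_le by (intro sum_mono ennreal_leI) auto
  also have "\<dots> = (\<Sum>i\<in>I. ennreal (C0 * \<delta>) * (ennreal (b i powr q) * emeasure \<mu> (E i)) + ennreal ?c1 * (ennreal (a i powr p) * emeasure \<nu> (E i)))"
  proof (rule sum.cong[OF refl])
    fix i assume i: "i \<in> I"
    have E: "E i \<in> sets M" "0 < measure M (E i)" using Em half[OF i] i by auto
    note pos = Wpos[OF E] Vpos[OF E]
    show "ennreal (C0 * \<delta> * (b i powr q * W (E i)) + C0 * \<delta> powr (1 - p) * (a i powr p * V (E i))) = ennreal (C0 * \<delta>) * (ennreal (b i powr q) * emeasure \<mu> (E i)) + ennreal ?c1 * (ennreal (a i powr p) * emeasure \<nu> (E i))"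
      using C0 \<delta> pos by (subst ennreal_lincomb) (auto simp: e\<mu>[OF E(1)] e\<nu>[OF E(1)] ennreal_mult)
  qed
  also have "\<dots> = ennreal (C0 * \<delta>) * (\<Sum>i\<in>I. ennreal (b i powr q) * emeasure \<mu> (E i)) + ennreal ?c1 * (\<Sum>i\<in>I. ennreal (a i powr p) * emeasure \<nu> (E i))"
    by (simp add: sum.distrib sum_distrib_left)
  also have "\<dots> \<le> ennreal (C0 * \<delta>) * (ennreal ((2 * p) powr q) * X) + ennreal ?c1 * (ennreal ?c2 * Y)"
    by (intro add_mono mult_left_mono sumb suma) auto
  also have "ennreal (C0 * \<delta>) * (ennreal ((2 * p) powr q) * X) = ennreal (1/2) * X"
  proof -
    have e: "C0 * \<delta> * (2 * p) powr q = 1/2" using C0 p by (simp add: \<delta>_def)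
    have "ennreal (C0 * \<delta>) * ennreal ((2 * p) powr q) = ennreal (C0 * \<delta> * (2 * p) powr q)"
      using C0 \<delta> by (intro ennreal_mult[symmetric]) auto
    then have "ennreal (C0 * \<delta>) * ennreal ((2 * p) powr q) = ennreal (1/2)" unfolding e .
    then show ?thesis by (simp only: mult.assoc[symmetric])
  qed
  finally have "X \<le> 2 * (ennreal ?c1 * (ennreal ?c2 * Y))"
    by (rule ennreal_half_absorb) (rule Xfin)
  also have "\<dots> = ennreal 1 * ennreal 2 * ennreal ?c1 * ennreal ?c2 * Y"
    by (simp add: mult.assoc)
  also have "ennreal 1 * ennreal 2 * ennreal ?c1 * ennreal ?c2 = ennreal (1 * 2 * ?c1 * (2 * (p / (p - 1))) powr p)"
    using C0 by (intro ennreal_mult4) auto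
  also have "1 * 2 * ?c1 * (2 * (p / (p - 1))) powr p = 2 * (C0 * \<delta> powr (1 - p) * (2 * (p / (p - 1))) powr p)" by simp
  finally have XY: "X \<le> ennreal (2 * (C0 * \<delta> powr (1 - p) * (2 * (p / (p - 1))) powr p)) * Y" .
  have "(\<integral>\<^sup>+x. ennreal (S2 f 0 J x powr (p / 2) * w x) \<partial>M) \<le> (\<integral>\<^sup>+x. ennreal (stop_const powr p) * (ennreal (w x) * ennreal (AA x powr p)) \<partial>M)"
  proof (rule nn_integral_mono)
    fix x assume x: "x \<in> space M"
    have "S2 f 0 J x powr (p / 2) \<le> (stop_const\<^sup>2 * (AA x)\<^sup>2) powr (p / 2)"
      using S2AA[OF x] p by (intro powr_mono2 S2_nonneg) auto
    also have "\<dots> = stop_const powr p * AA x powr p"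
    proof -
      have "(y\<^sup>2) powr (p / 2) = y powr p" if "0 \<le> y" for y :: real
        using that by (cases "y = 0") (simp_all add: powr_powr flip: powr_numeral)
      then show ?thesis using stop_const_ge_1 AA0[of x] by (simp add: powr_mult)
    qed
    finally have "S2 f 0 J x powr (p / 2) * w x \<le> stop_const powr p * AA x powr p * w x" using wp[of x] by (intro mult_right_mono) auto
    then have "ennreal (S2 f 0 J x powr (p / 2) * w x) \<le> ennreal (stop_const powr p * AA x powr p * w x)" by (rule ennreal_leI)
    also have "\<dots> = ennreal (stop_const powr p) * (ennreal (w x) * ennreal (AA x powr p))"
      using wp[of x] by (simp add: ennreal_mult[symmetric] mult_ac less_imp_le)
    finally show "ennreal (S2 f 0 J x powr (p / 2) * w x) \<le> ennreal (stop_const powr p) * (ennreal (w x) * ennreal (AA x powr p))" .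
  qed
  also have "\<dots> = ennreal (stop_const powr p) * (\<integral>\<^sup>+x. ennreal (w x) * ennreal (AA x powr p) \<partial>M)"
    by (rule nn_integral_cmult) measurable
  also have "(\<integral>\<^sup>+x. ennreal (w x) * ennreal (AA x powr p) \<partial>M) = X"
    unfolding X_def \<mu>_def by (rule nn_integral_density[symmetric]) auto
  also have "ennreal (stop_const powr p) * X \<le> ennreal (stop_const powr p) * (ennreal (2 * (C0 * \<delta> powr (1 - p) * (2 * (p / (p - 1))) powr p)) * Y)"
    by (intro mult_left_mono XY) simp
  also have "\<dots> = ennreal (stop_const powr p) * ennreal (2 * (C0 * \<delta> powr (1 - p) * (2 * (p / (p - 1))) powr p)) * Y" by (simp only: mult.assoc)
  also have "ennreal (stop_const powr p) * ennreal (2 * (C0 * \<delta> powr (1 - p) * (2 * (p / (p - 1))) powr p)) = ennreal (Lp_const p D)"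
    unfolding Lp_const_def C0_def[symmetric] q_def[symmetric] \<delta>_def[symmetric] using C0 by (subst ennreal_mult[symmetric]) auto
  finally show ?thesis unfolding Y_def h_def .
qed

end

section \<open>Weak type bounds for dyadic A1 weights\<close>

context dyadic_square
begin

definition weak_const :: "real \<Rightarrow> real" where
  "weak_const C = C + 4 * Lp_const 2 C * N * C + 2 * C * (1 / (1 - s)) * (1 + C)"

lemma Lp_const_nonneg: "0 \<le> Lp_const p D"
  unfolding Lp_const_def Ap_const_def by (intro mult_nonneg_nonneg powr_ge_zero) auto

text \<open>
  Testing the \<open>A_1\<close> condition with \<open>v = 1 / w\<close> gives the \<open>A_2\<close> condition with dual weight
  \<open>1 / w\<close>; so \<open>weighted_Lp\<close> for \<open>p = 2\<close> provides the \<open>L^2(w)\<close> bound that \<open>weak_type\<close> requires.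
  The latter also requires the mean over the top cube to be at most \<open>\<theta>\<close>; otherwise the \<open>A_1\<close>
  condition on the top cube bounds even \<open>\<theta> * w(top cube)\<close>.
\<close>

lemma weak_type_A1:
  fixes w :: "'a \<Rightarrow> real"
  assumes f: "\<And>k. k < m \<Longrightarrow> integrable M (f k)" and C: "0 < C"
    and wm [measurable]: "w \<in> borel_measurable M" and wp: "\<And>x. 0 < w x" and wi: "integrable M w"
    and A1: "A1 (\<lambda>x. ennreal (w x)) C" and top_cube: "\<And>x. x \<in> space M \<Longrightarrow> cube 0 x = space M"
    and \<theta>: "0 < \<theta>"
  shows "ennreal \<theta> * (\<integral>\<^sup>+x\<in>{x\<in>space M. \<theta>\<^sup>2 < S2 f 0 J x}. ennreal (w x) \<partial>M) \<le> ennreal (weak_const C) * (\<integral>\<^sup>+x. ennreal (nrm f x * w x) \<partial>M)"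
proof (cases "space M = {}")
  case True
  have "(\<integral>\<^sup>+x\<in>{x\<in>space M. \<theta>\<^sup>2 < S2 f 0 J x}. ennreal (w x) \<partial>M) = (\<integral>\<^sup>+x. 0 \<partial>M)"
    by (rule nn_integral_cong) (use True in auto)
  then show ?thesis by simp
next
  case False
  then obtain x0 where x0: "x0 \<in> space M" by blast
  have w0 [simp]: "0 \<le> w x" for x using wp[of x] by simp
  have ind_space: "(\<integral>\<^sup>+x\<in>space M. F x \<partial>M) = (\<integral>\<^sup>+x. F x \<partial>M)" for F :: "'a \<Rightarrow> ennreal"
    by (rule nn_integral_cong) auto
  let ?V = "\<lambda>j x. \<integral>\<^sup>+y\<in>cube j x. ennreal (1 / w y) \<partial>M"
  let ?U = "\<lambda>j x. \<integral>\<^sup>+y\<in>cube j x. ennreal (w y) \<partial>M"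
  let ?V1 = "\<lambda>j x. LINT y|M. indicator (cube j x) y * (1 / w y)"
  let ?U1 = "\<lambda>j x. LINT y|M. indicator (cube j x) y * w y"
  have finw: "(\<integral>\<^sup>+x. ennreal (w x) \<partial>M) = ennreal (LINT x|M. w x)"
    by (rule nn_integral_eq_integral[OF wi]) auto
  have posw: "(\<integral>\<^sup>+x. ennreal (w x) \<partial>M) \<noteq> 0"
  proof
    assume "(\<integral>\<^sup>+x. ennreal (w x) \<partial>M) = 0"
    then have "AE x in M. ennreal (w x) = 0" by (subst (asm) nn_integral_0_iff_AE) auto
    then have "AE x in M. False" by (rule AE_mp) (use wp in \<open>auto intro!: AE_I2 simp: ennreal_eq_0_iff not_le[symmetric]\<close>)
    then have "emeasure M (space M) = 0" by (simp add: AE_iff_measurable[of "space M"])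
    then have "measure M (space M) = 0" by (simp add: measure_def)
    then show False using cube_pos[OF x0, of 0] top_cube[OF x0] by simp
  qed
  have A1v: "(?U j x) * (?V j x) \<le> ennreal (C * measure M (cube j x)) * ennreal (measure M (cube j x))"
    if x: "x \<in> space M" for x j
  proof -
    have "(?U j x) * (?V j x) \<le> ennreal (C * measure M (cube j x)) * (\<integral>\<^sup>+y\<in>cube j x. (ennreal (1 / w y) * ennreal (w y)) \<partial>M)"
      using A1[unfolded A1_def, rule_format, OF x, of "\<lambda>y. ennreal (1 / w y)" j] by simp
    also have "(\<integral>\<^sup>+y\<in>cube j x. (ennreal (1 / w y) * ennreal (w y)) \<partial>M) = (\<integral>\<^sup>+y. indicator (cube j x) y \<partial>M)"
      by (rule nn_integral_cong) (use wp in \<open>auto simp: ennreal_mult[symmetric] less_imp_neq[symmetric]\<close>)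
    also have "\<dots> = ennreal (measure M (cube j x))" using cube_sets[OF x] by (simp add: emeasure_eq_measure)
    finally show ?thesis .
  qed
  have vi: "integrable M (\<lambda>x. 1 / w x)"
  proof (rule integrableI_bounded)
    have "(\<integral>\<^sup>+x. ennreal (w x) \<partial>M) * (\<integral>\<^sup>+x. ennreal (1 / w x) \<partial>M) \<le> ennreal (C * measure M (cube 0 x0)) * ennreal (measure M (cube 0 x0))"
      using A1v[OF x0, of 0] by (simp add: top_cube[OF x0] ind_space)
    also have "\<dots> < \<infinity>" by (simp add: ennreal_mult_less_top)
    finally have "(\<integral>\<^sup>+x. ennreal (1 / w x) \<partial>M) < \<infinity>" using posw by (auto simp: ennreal_mult_less_top)
    then show "(\<integral>\<^sup>+x. ennreal (norm (1 / w x)) \<partial>M) < \<infinity>" by simp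
  qed measurable
  have L2: "L2w (\<lambda>x. ennreal (w x)) J (Lp_const 2 C)"
    unfolding L2w_def
  proof (intro allI impI)
    fix g :: "nat \<Rightarrow> 'a \<Rightarrow> real" and B assume g: "\<forall>k<m. g k \<in> borel_measurable M" and B: "\<forall>x\<in>space M. nrm g x \<le> B"
    have gi: "integrable M (g k)" if k: "k < m" for k
    proof (rule integrable_const_bound[where B=B])
      show "AE x in M. norm (g k x) \<le> B"
      proof (rule AE_I2)
        fix x assume x: "x \<in> space M"
        have "\<bar>g k x\<bar> \<le> L2_set (\<lambda>k. \<bar>g k x\<bar>) {..<m}" using k by (intro member_le_L2_set) auto
        also have "\<dots> = nrm g x" by (simp add: nrm_def L2_set_def)
        finally show "norm (g k x) \<le> B" using B x by force
      qed
    qed (use g k in auto)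
    have "(\<integral>\<^sup>+x. ennreal (S2 g 0 J x powr (2 / 2) * w x) \<partial>M) \<le> ennreal (Lp_const 2 C) * (\<integral>\<^sup>+x. ennreal (nrm g x powr 2 * w x) \<partial>M)"
    proof (rule weighted_Lp[where \<sigma>="\<lambda>x. 1 / w x"])
      fix x j assume x: "x \<in> space M"
      have "ennreal (?U1 j x) = (\<integral>\<^sup>+y. ennreal (indicator (cube j x) y * w y) \<partial>M)"
        using cube_sets[OF x] wi by (intro nn_integral_eq_integral[symmetric] integrable_ind) (auto simp: indicator_def)
      also have "\<dots> = (?U j x)" by (rule nn_integral_cong) (auto simp: indicator_def)
      finally have 1: "ennreal (?U1 j x) = (?U j x)" .
      have "ennreal (?V1 j x) = (\<integral>\<^sup>+y. ennreal (indicator (cube j x) y * (1 / w y)) \<partial>M)"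
        using cube_sets[OF x] vi by (intro nn_integral_eq_integral[symmetric] integrable_ind) (auto simp: indicator_def)
      also have "\<dots> = (?V j x)" by (rule nn_integral_cong) (auto simp: indicator_def)
      finally have 2: "ennreal (?V1 j x) = (?V j x)" .
      have nn: "0 \<le> (?U1 j x)" "0 \<le> (?V1 j x)"
        by (auto intro!: integral_nonneg_AE simp: indicator_def)
      have "ennreal ((?U1 j x) * (?V1 j x)) \<le> ennreal (C * measure M (cube j x) * measure M (cube j x))"
        using A1v[OF x, of j] nn C unfolding 1[symmetric] 2[symmetric] by (simp add: ennreal_mult)
      then have "(?U1 j x) * (?V1 j x) \<le> C * measure M (cube j x) * measure M (cube j x)"
        using C by (subst (asm) ennreal_le_iff) auto
      then show "(?U1 j x) * (?V1 j x) powr (2 - 1) \<le> C * measure M (cube j x) powr 2"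
        using nn cube_pos[OF x, of j] by (simp add: power2_eq_square mult.assoc)
    next
      show "(1 / w x) powr (2 - 1) * w x = 1" for x using wp[of x] by simp
    qed (use gi C wp wi vi in auto)
    also have "(\<integral>\<^sup>+x. ennreal (S2 g 0 J x powr (2 / 2) * w x) \<partial>M) = (\<integral>\<^sup>+x. (ennreal (S2 g 0 J x) * ennreal (w x)) \<partial>M)"
      by (rule nn_integral_cong) (simp add: S2_nonneg ennreal_mult)
    also have "(\<integral>\<^sup>+x. ennreal (nrm g x powr 2 * w x) \<partial>M) = (\<integral>\<^sup>+x. (ennreal ((nrm g x)\<^sup>2) * ennreal (w x)) \<partial>M)"
      by (rule nn_integral_cong) (simp add: ennreal_mult powr_numeral)
    finally show "(\<integral>\<^sup>+x. (ennreal (S2 g 0 J x) * ennreal (w x)) \<partial>M) \<le> ennreal (Lp_const 2 C) * (\<integral>\<^sup>+x. (ennreal ((nrm g x)\<^sup>2) * ennreal (w x)) \<partial>M)" .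
  qed
  have nw: "(\<integral>\<^sup>+x. (ennreal (nrm f x) * ennreal (w x)) \<partial>M) = (\<integral>\<^sup>+x. ennreal (nrm f x * w x) \<partial>M)"
    by (simp add: ennreal_mult)
  show ?thesis
  proof (cases "avg (nrm f) (cube 0 x0) \<le> \<theta>")
    case True
    from weak_type[OF A1 _ L2 _ _ f x0 _ \<theta> True] C Lp_const_nonneg
    have "ennreal \<theta> * (\<integral>\<^sup>+x\<in>{x\<in>cube 0 x0. \<theta>\<^sup>2 < S2 f 0 J x}. ennreal (w x) \<partial>M) \<le> ennreal (weak_const C) * (\<integral>\<^sup>+x\<in>cube 0 x0. (ennreal (nrm f x) * ennreal (w x)) \<partial>M)"
      unfolding weak_const_def by simp
    then show ?thesis unfolding top_cube[OF x0] ind_space nw .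
  next
    case False
    have "ennreal \<theta> * (\<integral>\<^sup>+x\<in>{x\<in>space M. \<theta>\<^sup>2 < S2 f 0 J x}. ennreal (w x) \<partial>M) \<le> ennreal (avg (nrm f) (cube 0 x0)) * (\<integral>\<^sup>+x. ennreal (w x) \<partial>M)"
      using False by (intro mult_mono ennreal_leI nn_integral_mono) (auto simp: indicator_def)
    also have "\<dots> \<le> ennreal C * (\<integral>\<^sup>+x. (ennreal (nrm f x) * ennreal (w x)) \<partial>M)"
      using A1_avg[OF A1 _ _ nrm_integrable[of f, OF f] _ x0, of 0] C unfolding top_cube[OF x0] ind_space by simp
    also have "\<dots> \<le> ennreal (weak_const C) * (\<integral>\<^sup>+x. ennreal (nrm f x * w x) \<partial>M)"
    proof -
      have "0 \<le> 4 * Lp_const 2 C * N * C" "0 \<le> 2 * C * (1 / (1 - s)) * (1 + C)"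
        using C s N_ge_1 Lp_const_nonneg[of 2 C] by auto
      then have "C \<le> weak_const C" unfolding weak_const_def by simp
      then show ?thesis unfolding nw by (intro mult_right_mono ennreal_leI) auto
    qed
    finally show ?thesis .
  qed
qed

end

section \<open>Shifted dyadic grids\<close>

definition root_cube :: "'a::euclidean_space \<Rightarrow> real \<Rightarrow> 'a set" where
  "root_cube a L = {y. \<forall>i\<in>Basis. a \<bullet> i \<le> y \<bullet> i \<and> y \<bullet> i < a \<bullet> i + L}"

text \<open>
  The cube around \<open>x\<close> of side \<open>L / 2 ^ j\<close> in the grid with corner \<open>a\<close>. Comparing floors makes
  nestedness and the partition property immediate.
\<close>

definition grid_cube :: "'a::euclidean_space \<Rightarrow> real \<Rightarrow> nat \<Rightarrow> 'a \<Rightarrow> 'a set" where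
  "grid_cube a L j x = {y. \<forall>i\<in>Basis. \<lfloor>2 ^ j * ((y \<bullet> i - a \<bullet> i) / L)\<rfloor> = \<lfloor>2 ^ j * ((x \<bullet> i - a \<bullet> i) / L)\<rfloor>}"

lemma emeasure_root_cube:
  fixes a :: "'a::euclidean_space"
  assumes "0 \<le> L"
  shows "root_cube a L \<in> sets borel" "emeasure lborel (root_cube a L) = ennreal (L ^ DIM('a))"
proof -
  have eq: "root_cube a L = (\<Inter>i\<in>Basis. {y. a \<bullet> i \<le> y \<bullet> i} \<inter> {y. y \<bullet> i < a \<bullet> i + L})"
    by (auto simp: root_cube_def)
  show m: "root_cube a L \<in> sets borel" unfolding eq
    by (intro sets.finite_INT sets.Int borel_closed borel_open closed_halfspace_component_ge open_halfspace_component_lt) auto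
  let ?b = "a + L *\<^sub>R One"
  have ab: "a \<bullet> i \<le> ?b \<bullet> i" "?b \<bullet> i - a \<bullet> i = L" if "i \<in> Basis" for i using that assms by (auto simp: inner_add_left)
  have "emeasure lborel (box a ?b) \<le> emeasure lborel (root_cube a L)"
    using m ab by (intro emeasure_mono) (force simp: root_cube_def box_def inner_add_left)+
  moreover have "emeasure lborel (root_cube a L) \<le> emeasure lborel (cbox a ?b)"
    using m ab by (intro emeasure_mono) (force simp: root_cube_def cbox_def inner_add_left)+
  moreover have "emeasure lborel (box a ?b) = ennreal (L ^ DIM('a))" "emeasure lborel (cbox a ?b) = ennreal (L ^ DIM('a))"
    using ab by (subst emeasure_lborel_box emeasure_lborel_cbox; simp add: inner_add_left)+
  ultimately show "emeasure lborel (root_cube a L) = ennreal (L ^ DIM('a))" by simp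
qed

lemma grid_cube_eq_root:
  assumes L: "0 < L"
  shows "grid_cube a L j x = root_cube (a + (\<Sum>i\<in>Basis. (real_of_int \<lfloor>2 ^ j * ((x \<bullet> i - a \<bullet> i) / L)\<rfloor> * (L / 2 ^ j)) *\<^sub>R i)) (L / 2 ^ j)"
proof -
  have "(\<lfloor>2 ^ j * ((y - b) / L)\<rfloor> = k) \<longleftrightarrow> b + real_of_int k * (L / 2 ^ j) \<le> y \<and> y < b + real_of_int k * (L / 2 ^ j) + L / 2 ^ j" for y b k
    using L unfolding floor_eq_iff by (simp add: field_simps)
  then show ?thesis unfolding grid_cube_def root_cube_def by (simp add: inner_add_left)
qed

lemma floor_double_eq: "\<lfloor>2 * u\<rfloor> = \<lfloor>2 * v\<rfloor> \<Longrightarrow> \<lfloor>u\<rfloor> = \<lfloor>v\<rfloor>" for u v :: real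
proof -
  assume eq: "\<lfloor>2 * u\<rfloor> = \<lfloor>2 * v\<rfloor>"
  have "\<lfloor>r\<rfloor> = \<lfloor>2 * r\<rfloor> div 2" for r :: real
    using floor_divide_real_eq_div[of 2 "2 * r"] by simp
  then show ?thesis using eq by metis
qed

lemma grid_cube_Suc: "grid_cube a L (Suc j) x \<subseteq> grid_cube a L j x"
proof -
  have "\<lfloor>2 ^ Suc j * u\<rfloor> = \<lfloor>2 ^ Suc j * v\<rfloor> \<Longrightarrow> \<lfloor>2 ^ j * u\<rfloor> = \<lfloor>2 ^ j * v\<rfloor>" for u v :: real
    using floor_double_eq[of "2 ^ j * u" "2 ^ j * v"] by (simp add: mult.assoc)
  then show ?thesis unfolding grid_cube_def by blast
qed

lemma grid_cube_0:
  assumes L: "0 < L" and x: "x \<in> root_cube a L" shows "grid_cube a L 0 x = root_cube a L"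
proof -
  have "\<lfloor>(y - b) / L\<rfloor> = 0 \<longleftrightarrow> b \<le> y \<and> y < b + L" for y b :: real
    using L unfolding floor_eq_iff by (simp add: field_simps)
  note * = this
  have f0: "\<lfloor>2 ^ 0 * ((x \<bullet> i - a \<bullet> i) / L)\<rfloor> = 0" if "i \<in> Basis" for i using x that by (simp add: * root_cube_def)
  show ?thesis unfolding grid_cube_def root_cube_def
    by (rule Collect_cong, rule ball_cong[OF refl], subst f0) (simp_all add: *)
qed

lemma grid_cube_sub_root: "0 < L \<Longrightarrow> x \<in> root_cube a L \<Longrightarrow> grid_cube a L j x \<subseteq> root_cube a L"
  using grid_cube_0[of L x a] grid_cube_Suc[of a L] by (induction j) blast+

lemma emeasure_grid_cube:
  fixes a :: "'a::euclidean_space"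
  assumes "0 < L"
  shows "grid_cube a L j x \<in> sets borel" "emeasure lborel (grid_cube a L j x) = ennreal ((L / 2 ^ j) ^ DIM('a))"
  unfolding grid_cube_eq_root[OF assms] using emeasure_root_cube[of "L / 2 ^ j"] assms by auto

definition root_space :: "'a::euclidean_space \<Rightarrow> real \<Rightarrow> 'a measure" where
  "root_space a L = restrict_space lebesgue (root_cube a L)"

lemma space_root_space [simp]: "space (root_space a L) = root_cube a L"
  by (simp add: root_space_def space_restrict_space)

lemma root_cube_lebesgue [simp]: "0 \<le> L \<Longrightarrow> root_cube a L \<in> sets lebesgue"
  using emeasure_root_cube(1)[of L a] by simp

lemma measure_root_space:
  assumes "0 < L" "x \<in> root_cube a L"
  shows "measure (root_space a L) (grid_cube a L j x) = (L / 2 ^ j) ^ DIM('a::euclidean_space)"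
    and "emeasure (root_space a L) (grid_cube a L j (x::'a)) = ennreal ((L / 2 ^ j) ^ DIM('a))"
proof -
  show "emeasure (root_space a L) (grid_cube a L j x) = ennreal ((L / 2 ^ j) ^ DIM('a))"
    unfolding root_space_def using assms grid_cube_sub_root[OF assms] emeasure_grid_cube[OF assms(1), of a j x]
    by (subst emeasure_restrict_space) auto
  then show "measure (root_space a L) (grid_cube a L j x) = (L / 2 ^ j) ^ DIM('a)" using assms by (simp add: measure_def)
qed

lemma dyadic_grid:
  fixes a :: "'a::euclidean_space"
  assumes L: "0 < L"
  shows "dyadic_filtration (root_space a L) (grid_cube a L) (2 ^ DIM('a))"
proof -
  interpret finite_measure "root_space a L"
  proof (rule finite_measureI)
    have "emeasure (root_space a L) (root_cube a L) = ennreal (L ^ DIM('a))"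
      unfolding root_space_def using L emeasure_root_cube[of L a] by (subst emeasure_restrict_space) auto
    then show "emeasure (root_space a L) (space (root_space a L)) \<noteq> \<infinity>" by simp
  qed
  show ?thesis
  proof
    fix x j assume "x \<in> space (root_space a L)"
    then have x: "x \<in> root_cube a L" by simp
    show "x \<in> grid_cube a L j x" by (simp add: grid_cube_def)
    show "grid_cube a L j y = grid_cube a L j x" if "y \<in> grid_cube a L j x" for y using that by (simp add: grid_cube_def)
    show "grid_cube a L j x \<in> sets (root_space a L)"
      unfolding root_space_def using L grid_cube_sub_root[OF L x, of j] emeasure_grid_cube(1)[OF L, of a j x] by (subst sets_restrict_space_iff) auto
    show "grid_cube a L (Suc j) x \<subseteq> grid_cube a L j x" by (rule grid_cube_Suc)
    show "0 < measure (root_space a L) (grid_cube a L j x)" using measure_root_space(1)[OF L x] L by simp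
    show "measure (root_space a L) (grid_cube a L j x) \<le> 2 ^ DIM('a) * measure (root_space a L) (grid_cube a L (Suc j) x)"
      unfolding measure_root_space(1)[OF L x] by (simp add: power_divide power_mult_distrib)
  next
    fix j
    let ?F = "\<lambda>k. {y. \<forall>i\<in>Basis. \<lfloor>2 ^ j * ((y \<bullet> i - a \<bullet> i) / L)\<rfloor> = k i}"
    have "grid_cube a L j ` space (root_space a L) \<subseteq> ?F ` (PiE Basis (\<lambda>_. {0..<2 ^ j}))"
    proof clarify
      fix x assume "x \<in> space (root_space a L)"
      then have x: "x \<in> root_cube a L" by simp
      let ?k = "restrict (\<lambda>i. \<lfloor>2 ^ j * ((x \<bullet> i - a \<bullet> i) / L)\<rfloor>) Basis"
      have "\<lfloor>2 ^ j * ((x \<bullet> i - a \<bullet> i) / L)\<rfloor> \<in> {0..<2 ^ j}" if i: "i \<in> Basis" for i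
      proof -
        define r where "r = (x \<bullet> i - a \<bullet> i) / L"
        have "0 \<le> r" "r < 1" using x i L by (auto simp: root_cube_def r_def)
        then have "0 \<le> 2 ^ j * r" "2 ^ j * r < 2 ^ j * 1"
          by (intro mult_nonneg_nonneg mult_strict_left_mono; simp)+
        then have "0 \<le> 2 ^ j * ((x \<bullet> i - a \<bullet> i) / L)" "2 ^ j * ((x \<bullet> i - a \<bullet> i) / L) < 2 ^ j" unfolding r_def by auto
        then show ?thesis by (auto simp: floor_less_iff)
      qed
      then have "?k \<in> PiE Basis (\<lambda>_. {0..<2 ^ j})" by auto
      moreover have "grid_cube a L j x = ?F ?k" by (auto simp: grid_cube_def)
      ultimately show "grid_cube a L j x \<in> ?F ` (PiE Basis (\<lambda>_. {0..<2 ^ j}))" by blast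
    qed
    then show "finite (grid_cube a L j ` space (root_space a L))"
      by (rule finite_subset) (intro finite_imageI finite_PiE, auto)
  qed simp
qed

lemma floor_neq_near_int:
  fixes u v :: real
  assumes "\<lfloor>v\<rfloor> \<noteq> \<lfloor>u\<rfloor>" "\<bar>v - u\<bar> < d"
  obtains k :: int where "\<bar>real_of_int k - u\<bar> \<le> d"
proof (cases "\<lfloor>u\<rfloor> < \<lfloor>v\<rfloor>")
  case True
  have "\<bar>real_of_int \<lfloor>v\<rfloor> - u\<bar> \<le> d" using True assms by linarith
  then show ?thesis by (rule that)
next
  case False
  have "\<bar>real_of_int \<lfloor>u\<rfloor> - u\<bar> \<le> d" using False assms by linarith
  then show ?thesis by (rule that)
qed

text \<open>
  If both floors could change, then \<open>u\<close> and \<open>u - 2 ^ j / 3\<close> would be within \<open>1/8\<close> of an integer,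
  and \<open>2 ^ j / 3\<close> would be within \<open>1/4\<close> of an integer, but its distance to the integers is
  \<open>1/3\<close>.
\<close>

lemma one_third_trick:
  fixes u :: real and j :: nat
  shows "(\<forall>v. \<bar>v - u\<bar> < 1/8 \<longrightarrow> \<lfloor>v\<rfloor> = \<lfloor>u\<rfloor>) \<or> (\<forall>v. \<bar>v - u\<bar> < 1/8 \<longrightarrow> \<lfloor>v - 2 ^ j / 3\<rfloor> = \<lfloor>u - 2 ^ j / 3\<rfloor>)"
proof (rule ccontr)
  assume "\<not> ?thesis"
  then obtain v v' where v: "\<bar>v - u\<bar> < 1/8" "\<lfloor>v\<rfloor> \<noteq> \<lfloor>u\<rfloor>" and v': "\<bar>v' - u\<bar> < 1/8" "\<lfloor>v' - 2 ^ j / 3\<rfloor> \<noteq> \<lfloor>u - 2 ^ j / 3\<rfloor>" by blast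
  obtain k :: int where k: "\<bar>real_of_int k - u\<bar> \<le> 1/8" by (rule floor_neq_near_int[OF v(2,1)])
  have "\<bar>(v' - 2 ^ j / 3) - (u - 2 ^ j / 3)\<bar> < 1/8" using v' by simp
  from floor_neq_near_int[OF v'(2) this] obtain k' :: int where k': "\<bar>real_of_int k' - (u - 2 ^ j / 3)\<bar> \<le> 1/8" .
  have "\<bar>real_of_int (3 * (k - k') - 2 ^ j)\<bar> < 1" using k k' by (simp add: abs_if split: if_splits)
  then have "3 * (k - k') - 2 ^ j = 0" by linarith
  then have "(3::int) dvd 2 ^ j" by (metis dvd_triv_left eq_iff_diff_eq_0)
  then have "(3::int) dvd 2" by (rule prime_dvd_power[rotated]) simp
  then show False by simp
qed

text \<open>
  The root cube centred at the origin is moved by a third of its side in the directions from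
  \<open>I\<close>. On level \<open>j\<close> this is a shift by \<open>2 ^ j / 3\<close> sides of cubes.
\<close>

definition shifted_corner :: "real \<Rightarrow> 'a set \<Rightarrow> 'a::euclidean_space" where
  "shifted_corner L I = (\<Sum>i\<in>Basis. (if i \<in> I then - L / 2 + L / 3 else - L / 2) *\<^sub>R i)"

abbreviation shifted_space :: "real \<Rightarrow> 'a set \<Rightarrow> 'a::euclidean_space measure" where
  "shifted_space L I \<equiv> root_space (shifted_corner L I) L"

abbreviation shifted_grid :: "real \<Rightarrow> 'a set \<Rightarrow> nat \<Rightarrow> 'a::euclidean_space \<Rightarrow> 'a set" where
  "shifted_grid L I \<equiv> grid_cube (shifted_corner L I) L"

lemma shifted_corner_inner: "i \<in> Basis \<Longrightarrow> shifted_corner L I \<bullet> i = (if i \<in> I then - L / 2 + L / 3 else - L / 2)"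
  by (simp add: shifted_corner_def)

lemma ball_sub_root:
  assumes L: "0 < L" shows "ball 0 (L / 6) \<subseteq> root_cube (shifted_corner L I) L"
proof
  fix x :: 'a assume "x \<in> ball 0 (L / 6)"
  then have x: "norm x < L / 6" by simp
  have b: "\<bar>x \<bullet> i\<bar> < L / 6" if "i \<in> Basis" for i using Basis_le_norm[OF that, of x] x by linarith
  have "- (L / 6) < x \<bullet> i" "x \<bullet> i < L / 6" if "i \<in> Basis" for i using b[OF that] by linarith+
  then have "shifted_corner L I \<bullet> i \<le> x \<bullet> i \<and> x \<bullet> i < shifted_corner L I \<bullet> i + L" if "i \<in> Basis" for i
    unfolding shifted_corner_inner[OF that] using that L by (cases "i \<in> I") fastforce+
  then show "x \<in> root_cube (shifted_corner L I) L" unfolding root_cube_def by blast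
qed

lemma ball_sub_grid_cube:
  fixes x :: "'a::euclidean_space"
  assumes L: "0 < L"
  shows "\<exists>I\<subseteq>Basis. ball x (L / 2 ^ j / 8) \<subseteq> shifted_grid L I j x"
proof -
  define u where "u i = 2 ^ j * ((x \<bullet> i + L / 2) / L)" for i
  define I where "I = {i\<in>Basis. \<not> (\<forall>v. \<bar>v - u i\<bar> < 1/8 \<longrightarrow> \<lfloor>v\<rfloor> = \<lfloor>u i\<rfloor>)}"
  have "z \<in> shifted_grid L I j x" if "z \<in> ball x (L / 2 ^ j / 8)" for z
    unfolding grid_cube_def
  proof (clarify)
    fix i :: 'a assume i: "i \<in> Basis"
    have "\<bar>z \<bullet> i - x \<bullet> i\<bar> < L / 2 ^ j / 8"
      using Basis_le_norm[OF i, of "z - x"] that by (simp add: dist_norm norm_minus_commute inner_diff_left)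
    then have "\<bar>z \<bullet> i - x \<bullet> i\<bar> * (2 ^ j / L) < (L / 2 ^ j / 8) * (2 ^ j / L)" using L by (intro mult_strict_right_mono) auto
    then have d: "\<bar>z \<bullet> i - x \<bullet> i\<bar> * (2 ^ j / L) < 1/8" using L by simp
    define v where "v = 2 ^ j * ((z \<bullet> i + L / 2) / L)"
    have "v - u i = (z \<bullet> i - x \<bullet> i) * (2 ^ j / L)" using L by (simp add: v_def u_def field_simps)
    then have vu: "\<bar>v - u i\<bar> < 1/8" using d L by (simp add: abs_mult)
    show "\<lfloor>2 ^ j * ((z \<bullet> i - shifted_corner L I \<bullet> i) / L)\<rfloor> = \<lfloor>2 ^ j * ((x \<bullet> i - shifted_corner L I \<bullet> i) / L)\<rfloor>"
    proof (cases "i \<in> I")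
      case True
      then have "\<lfloor>v - 2 ^ j / 3\<rfloor> = \<lfloor>u i - 2 ^ j / 3\<rfloor>" using one_third_trick[of "u i" j] vu by (auto simp: I_def)
      moreover have "2 ^ j * ((z \<bullet> i - shifted_corner L I \<bullet> i) / L) = v - 2 ^ j / 3" "2 ^ j * ((x \<bullet> i - shifted_corner L I \<bullet> i) / L) = u i - 2 ^ j / 3"
        using True L by (simp_all add: shifted_corner_inner[OF i] v_def u_def field_simps)
      ultimately show ?thesis by simp
    next
      case False
      then have "\<lfloor>v\<rfloor> = \<lfloor>u i\<rfloor>" using i vu unfolding I_def by blast
      moreover have "2 ^ j * ((z \<bullet> i - shifted_corner L I \<bullet> i) / L) = v" "2 ^ j * ((x \<bullet> i - shifted_corner L I \<bullet> i) / L) = u i"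
        using False L by (simp_all add: shifted_corner_inner[OF i] v_def u_def field_simps)
      ultimately show ?thesis by simp
    qed
  qed
  then show ?thesis by (intro exI[of _ I]) (auto simp: I_def)
qed

section \<open>Domination of the intrinsic square function\<close>

text \<open>
  A point of norm two, where \<open>\<phi>\<close> vanishes, is at distance at most three from every point of the
  unit ball.
\<close>

lemma C_class_bound:
  fixes \<phi> :: "'a::euclidean_space \<Rightarrow> real"
  assumes \<phi>: "\<phi> \<in> C_class \<alpha>" and \<alpha>: "0 < \<alpha>" "\<alpha> \<le> 1"
  shows "\<bar>\<phi> u\<bar> \<le> 3"
proof (cases "norm u > 1")
  case True then show ?thesis using \<phi> by (simp add: C_class_def)
next
  case False
  obtain e :: 'a where e: "e \<in> Basis" using nonempty_Basis by blast
  have n2: "norm (2 *\<^sub>R e) = 2" using e by simp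
  then have z: "\<phi> (2 *\<^sub>R e) = 0" using \<phi> unfolding C_class_def by auto
  have "norm (u - 2 *\<^sub>R e) \<le> 3" using norm_triangle_ineq4[of u "2 *\<^sub>R e"] n2 False by linarith
  moreover have "norm (u - 2 *\<^sub>R e) \<ge> 1" using norm_triangle_ineq2[of "2 *\<^sub>R e" u] n2 False by (simp add: norm_minus_commute)
  ultimately have "norm (u - 2 *\<^sub>R e) powr \<alpha> \<le> 3"
    using powr_mono[of \<alpha> 1 "norm (u - 2 *\<^sub>R e)"] \<alpha> by simp
  moreover have "\<bar>\<phi> u - \<phi> (2 *\<^sub>R e)\<bar> \<le> norm (u - 2 *\<^sub>R e) powr \<alpha>" using \<phi> unfolding C_class_def by blast
  ultimately show ?thesis using z by simp
qed

lemma C_class_continuous: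
  fixes \<phi> :: "'a::euclidean_space \<Rightarrow> real"
  assumes \<phi>: "\<phi> \<in> C_class \<alpha>" and \<alpha>: "0 < \<alpha>"
  shows "continuous_on UNIV \<phi>"
  unfolding continuous_on_eq_continuous_at[OF open_UNIV]
proof
  fix x :: 'a
  have "((\<lambda>y. norm (y - x) powr \<alpha>) \<longlongrightarrow> 0 powr \<alpha>) (at x)"
    by (rule tendsto_powr2) (use \<alpha> in \<open>auto intro!: tendsto_eq_intros\<close>)
  then have "((\<lambda>y. norm (y - x) powr \<alpha>) \<longlongrightarrow> 0) (at x)" using \<alpha> by simp
  then have "((\<lambda>y. \<phi> y - \<phi> x) \<longlongrightarrow> 0) (at x)"
    by (rule Lim_null_comparison[rotated]) (use \<phi> in \<open>auto simp: C_class_def\<close>)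
  then show "isCont \<phi> x" unfolding isCont_def using LIM_zero_iff by blast
qed

lemma C_class_borel:
  fixes \<phi> :: "'a::euclidean_space \<Rightarrow> real"
  shows "\<phi> \<in> C_class \<alpha> \<Longrightarrow> 0 < \<alpha> \<Longrightarrow> \<phi> \<in> borel_measurable borel"
  using C_class_continuous by (rule borel_measurable_continuous_onI)

lemma dilate_supp:
  fixes \<phi> :: "'a::euclidean_space \<Rightarrow> real"
  assumes "\<phi> \<in> C_class \<alpha>" "0 < t" "t < norm u" shows "dilate \<phi> t u = 0"
proof -
  have "norm (u /\<^sub>R t) > 1" using assms by (simp add: field_simps)
  then show ?thesis using assms unfolding dilate_def C_class_def by simp
qed

lemma integral_dilate_reflect:
  fixes \<phi> :: "'a::euclidean_space \<Rightarrow> real"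
  assumes \<phi>: "\<phi> \<in> C_class \<alpha>" and \<alpha>: "0 < \<alpha>" and t: "0 < t"
  shows "(LINT z|lebesgue. dilate \<phi> t (y - z)) = 0"
proof -
  have [measurable]: "\<phi> \<in> borel_measurable borel" using \<phi> \<alpha> by (rule C_class_borel)
  have dm [measurable]: "(\<lambda>z. dilate \<phi> t (y - z)) \<in> borel_measurable borel" unfolding dilate_def by measurable
  have "(LINT z|lebesgue. dilate \<phi> t (y - z)) = (LINT z|lborel. dilate \<phi> t (y - z))"
    by (rule integral_completion) simp
  also have "\<dots> = (LINT z|density (distr lborel borel (\<lambda>x. y + (- t) *\<^sub>R x)) (\<lambda>_. ennreal (\<bar>- t\<bar> ^ DIM('a))). dilate \<phi> t (y - z))"
    using t by (subst lborel_affine[of "- t" y]) auto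
  also have "\<dots> = (LINT z|distr lborel borel (\<lambda>x. y + (- t) *\<^sub>R x). t ^ DIM('a) * dilate \<phi> t (y - z))"
    using t by (subst integral_density) auto
  also have "\<dots> = (LINT u|lborel. t ^ DIM('a) * dilate \<phi> t (y - (y + (- t) *\<^sub>R u)))"
    by (subst integral_distr) auto
  also have "\<dots> = (LINT u|lborel. \<phi> u)"
    using t by (simp add: dilate_def)
  also have "\<dots> = (LINT u|lebesgue. \<phi> u)" by (rule integral_completion[symmetric]) simp
  also have "\<dots> = 0" using \<phi> by (simp add: C_class_def)
  finally show ?thesis .
qed

lemma grid_cube_norm_le:
  fixes z :: "'a::euclidean_space"
  assumes L: "0 < L" and z': "z' \<in> grid_cube a L i z"
  shows "norm (z - z') \<le> real DIM('a) * (L / 2 ^ i)"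
proof -
  have "\<bar>(z - z') \<bullet> e\<bar> \<le> L / 2 ^ i" if e: "e \<in> Basis" for e
  proof -
    have "\<lfloor>2 ^ i * ((z' \<bullet> e - a \<bullet> e) / L)\<rfloor> = \<lfloor>2 ^ i * ((z \<bullet> e - a \<bullet> e) / L)\<rfloor>" using z' e by (simp add: grid_cube_def)
    then have "\<bar>2 ^ i * ((z \<bullet> e - a \<bullet> e) / L) - 2 ^ i * ((z' \<bullet> e - a \<bullet> e) / L)\<bar> \<le> 1" by linarith
    moreover have "2 ^ i * ((z \<bullet> e - a \<bullet> e) / L) - 2 ^ i * ((z' \<bullet> e - a \<bullet> e) / L) = (2 ^ i / L) * ((z - z') \<bullet> e)"
      using L by (simp add: inner_diff_left field_simps)
    ultimately have "(2 ^ i / L) * \<bar>(z - z') \<bullet> e\<bar> \<le> 1" using L by (simp add: abs_mult)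
    then show ?thesis using L by (simp add: field_simps)
  qed
  then have "(\<Sum>e\<in>Basis. \<bar>(z - z') \<bullet> e\<bar>) \<le> (\<Sum>e\<in>(Basis::'a set). L / 2 ^ i)" by (intro sum_mono) auto
  then show ?thesis using norm_le_l1[of "z - z'"] by simp
qed

text \<open>
  The height \<open>t\<close> may be as small as one thirty-second of the side of the cube. This costs
  \<open>32 ^ n\<close> in the size of a dilate and \<open>32 * n\<close> in its Hoelder constant, where \<open>n\<close> also bounds
  the diameter of a cube of side one.
\<close>

definition osc_const :: "'a::euclidean_space itself \<Rightarrow> real" where
  "osc_const _ = 32 ^ DIM('a) * (32 * real DIM('a))"

lemma osc_const_pos: "0 < osc_const TYPE('a::euclidean_space)"
  by (simp add: osc_const_def)

text \<open>
  The dilate is supported within distance \<open>2 * t\<close> of \<open>x\<close>, hence in the cube. The decay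
  \<open>2 powr (-\<alpha>)\<close> per level comes from the Hoelder exponent in \<open>C_class\<close>.
\<close>

lemma test_of_C_class:
  fixes \<phi> :: "'a::euclidean_space \<Rightarrow> real"
  assumes \<phi>: "\<phi> \<in> C_class \<alpha>" and \<alpha>: "0 < \<alpha>" "\<alpha> \<le> 1" and L: "0 < L" and x: "x \<in> root_cube a L"
    and t: "L / 2 ^ j / 32 < t" "t \<le> L / 2 ^ j / 16" and y: "norm (x - y) < t"
    and Q: "ball x (L / 2 ^ j / 8) \<subseteq> grid_cube a L j x"
  shows "dyadic_filtration.test_fun (root_space a L) (grid_cube a L) (2 powr (- \<alpha>)) j (grid_cube a L j x)
      (\<lambda>z. dilate \<phi> t (y - z) / osc_const TYPE('a))"
    and "\<And>z. z \<notin> grid_cube a L j x \<Longrightarrow> dilate \<phi> t (y - z) = 0"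
proof -
  interpret dyadic_filtration "root_space a L" "grid_cube a L" "2 ^ DIM('a)" by (rule dyadic_grid[OF L])
  let ?Q = "grid_cube a L j x" and ?n = "DIM('a)" and ?c = "osc_const TYPE('a)"
  have c: "0 < ?c" by (rule osc_const_pos)
  have t0: "0 < t" using t L by (auto intro: less_trans[rotated])
  have [measurable]: "\<phi> \<in> borel_measurable borel" using \<phi> \<alpha>(1) by (rule C_class_borel)
  show supp: "dilate \<phi> t (y - z) = 0" if "z \<notin> ?Q" for z
  proof -
    have "z \<notin> ball x (L / 2 ^ j / 8)" using Q that by blast
    then have "L / 2 ^ j / 8 \<le> norm (x - z)" by (simp add: dist_norm)
    moreover have "norm (x - z) \<le> norm (x - y) + norm (y - z)" using norm_triangle_ineq[of "x - y" "y - z"] by simp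
    moreover have "2 * t \<le> L / 2 ^ j / 8" using t by simp
    ultimately have "2 * t \<le> norm (x - y) + norm (y - z)" by simp
    then have "t < norm (y - z)" using y by simp
    then show ?thesis using dilate_supp[OF \<phi> t0] by blast
  qed
  have mQ: "measure (root_space a L) ?Q = (L / 2 ^ j) ^ ?n" by (rule measure_root_space(1)[OF L x])
  have mQ0: "0 < (L / 2 ^ j) ^ ?n" using L by simp
  have tn: "1 / t ^ ?n \<le> 32 ^ ?n / (L / 2 ^ j) ^ ?n"
  proof -
    have "(L / 2 ^ j / 32) ^ ?n \<le> t ^ ?n" using t L by (intro power_mono) auto
    then have "1 / t ^ ?n \<le> 1 / (L / 2 ^ j / 32) ^ ?n" using L by (intro divide_left_mono) (auto intro!: mult_pos_pos zero_less_power t0)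
    also have "\<dots> = 32 ^ ?n / (L / 2 ^ j) ^ ?n" by (simp add: power_divide)
    finally show ?thesis .
  qed
  let ?\<eta> = "\<lambda>z. dilate \<phi> t (y - z) / ?c"
  show "test_fun (2 powr (- \<alpha>)) j ?Q ?\<eta>"
    unfolding test_fun_def
  proof (intro conjI ballI allI impI)
    have "?\<eta> \<in> borel_measurable borel" unfolding dilate_def by measurable
    then show "?\<eta> \<in> borel_measurable (root_space a L)" unfolding root_space_def
      by (intro measurable_restrict_space1 measurable_completion) simp
    show "?\<eta> z = 0" if "z \<in> space (root_space a L) - ?Q" for z using supp that by simp
    show "\<bar>?\<eta> z\<bar> \<le> 1 / measure (root_space a L) ?Q" if "z \<in> ?Q" for z
    proof -
      have "\<bar>dilate \<phi> t (y - z)\<bar> \<le> 3 * (1 / t ^ ?n)"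
        using C_class_bound[OF \<phi> \<alpha>, of "(y - z) /\<^sub>R t"] t0 by (simp add: dilate_def abs_mult divide_right_mono)
      also have "\<dots> \<le> (32 * real ?n) * (32 ^ ?n / (L / 2 ^ j) ^ ?n)"
      proof (rule mult_mono)
        have "1 \<le> real ?n" using DIM_positive[where 'a='a] by linarith
        then show "3 \<le> (32 * real ?n)" by linarith
      qed (use tn t0 in auto)
      also have "\<dots> = ?c / (L / 2 ^ j) ^ ?n" by (simp add: osc_const_def)
      finally show ?thesis unfolding mQ using c by (simp add: abs_divide field_simps)
    qed
    have "(LINT z|root_space a L. ?\<eta> z) = (LINT z|lebesgue. indicator (root_cube a L) z *\<^sub>R ?\<eta> z)"
      unfolding root_space_def using L by (intro integral_restrict_space) auto
    also have "\<dots> = (LINT z|lebesgue. ?\<eta> z)"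
      using supp grid_cube_sub_root[OF L x, of j] by (intro Bochner_Integration.integral_cong) (auto simp: indicator_def)
    also have "\<dots> = 0" using integral_dilate_reflect[OF \<phi> \<alpha>(1) t0, of y] by simp
    finally show "(LINT z|root_space a L. ?\<eta> z) = 0" .
  next
    fix i z z' assume ij: "j \<le> i" and z: "z \<in> ?Q" and z': "z' \<in> grid_cube a L i z"
    define d where "d = i - j"
    have "\<bar>dilate \<phi> t (y - z) - dilate \<phi> t (y - z')\<bar> = \<bar>\<phi> ((y - z) /\<^sub>R t) - \<phi> ((y - z') /\<^sub>R t)\<bar> * (1 / t ^ ?n)"
      using t0 by (simp add: dilate_def diff_divide_distrib[symmetric] abs_divide)
    also have "\<dots> \<le> (32 * real ?n * (2 powr (- \<alpha>)) ^ d) * (32 ^ ?n / (L / 2 ^ j) ^ ?n)"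
    proof (rule mult_mono[OF _ tn])
      have "\<bar>\<phi> ((y - z) /\<^sub>R t) - \<phi> ((y - z') /\<^sub>R t)\<bar> \<le> norm ((y - z) /\<^sub>R t - (y - z') /\<^sub>R t) powr \<alpha>"
        using \<phi> unfolding C_class_def by blast
      also have "(y - z) /\<^sub>R t - (y - z') /\<^sub>R t = (z' - z) /\<^sub>R t" by (simp add: scaleR_diff_right[symmetric])
      also have "norm ((z' - z) /\<^sub>R t) \<le> 32 * real ?n * (1 / 2 ^ d)"
      proof -
        have "norm ((z' - z) /\<^sub>R t) = norm (z - z') / t" using t0 by (simp add: norm_minus_commute divide_inverse mult.commute)
        also have "\<dots> \<le> (real ?n * (L / 2 ^ i)) / (L / 2 ^ j / 32)"
          using grid_cube_norm_le[OF L z'] t t0 L by (intro frac_le) auto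
        also have "\<dots> = 32 * real ?n * (1 / 2 ^ d)"
          using L ij by (simp add: d_def power_diff field_simps)
        finally show ?thesis .
      qed
      then have "norm ((z' - z) /\<^sub>R t) powr \<alpha> \<le> (32 * real ?n * (1 / 2 ^ d)) powr \<alpha>" using \<alpha> by (intro powr_mono2) auto
      also have "\<dots> = (32 * real ?n) powr \<alpha> * (1 / 2 ^ d) powr \<alpha>" by (rule powr_mult)
      also have "(1 / 2 ^ d) powr \<alpha> = (2 powr (- \<alpha>)) ^ d"
      proof -
        have "(1 / 2 ^ d) powr \<alpha> = (2 powr (- real d)) powr \<alpha>" by (simp add: powr_minus powr_realpow divide_inverse)
        also have "\<dots> = (2 powr (- \<alpha>)) powr real d" by (simp add: powr_powr mult.commute)
        also have "\<dots> = (2 powr (- \<alpha>)) ^ d" by (rule powr_realpow) simp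
        finally show ?thesis .
      qed
      also have "(32 * real ?n) powr \<alpha> \<le> (32 * real ?n) powr 1"
      proof (rule powr_mono)
        have "1 \<le> real ?n" using DIM_positive[where 'a='a] by linarith
        then show "1 \<le> 32 * real ?n" by linarith
      qed (use \<alpha> in auto)
      finally show "\<bar>\<phi> ((y - z) /\<^sub>R t) - \<phi> ((y - z') /\<^sub>R t)\<bar> \<le> 32 * real ?n * (2 powr (- \<alpha>)) ^ d"
        by (simp add: mult_right_mono)
    qed (use t0 in auto)
    also have "\<dots> = ?c * ((2 powr (- \<alpha>)) ^ d / (L / 2 ^ j) ^ ?n)" by (simp add: osc_const_def)
    finally have "\<bar>dilate \<phi> t (y - z) - dilate \<phi> t (y - z')\<bar> / ?c \<le> (2 powr (- \<alpha>)) ^ d / (L / 2 ^ j) ^ ?n"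
      using c by (simp add: pos_divide_le_eq mult.commute)
    then show "\<bar>?\<eta> z - ?\<eta> z'\<bar> \<le> (2 powr (- \<alpha>)) ^ (i - j) / measure (root_space a L) ?Q"
      unfolding mQ d_def using c by (simp add: diff_divide_distrib[symmetric] abs_divide)
  qed
qed

context dyadic_filtration
begin

text \<open>
  The pairings with test functions are bounded by the mean of \<open>\<bar>g\<bar>\<close> over the cube. Their
  supremum may not be attained, but some test function reaches half of it.
\<close>

lemma near_extremal:
  assumes g: "integrable M g" and x: "x \<in> space M" and s: "0 \<le> s"
  shows "\<exists>\<psi>. test_fun s j (cube j x) \<psi> \<and> (\<forall>\<eta>. test_fun s j (cube j x) \<eta> \<longrightarrow> \<bar>LINT y|M. g y * \<eta> y\<bar> \<le> 2 * \<bar>LINT y|M. g y * \<psi> y\<bar>)"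
proof -
  let ?V = "(\<lambda>\<eta>. \<bar>LINT y|M. g y * \<eta> y\<bar>) ` {\<eta>. test_fun s j (cube j x) \<eta>}"
  have test0: "test_fun s j (cube j x) (\<lambda>_. 0)" using s by (simp add: test_fun_def)
  have bdd: "bdd_above ?V"
  proof (rule bdd_aboveI2)
    fix \<eta> assume "\<eta> \<in> {\<eta>. test_fun s j (cube j x) \<eta>}"
    then have tf: "test_fun s j (cube j x) \<eta>" by simp
    have \<eta>1: "\<eta> \<in> borel_measurable M" using tf unfolding test_fun_def by blast
    have \<eta>2: "\<bar>\<eta> y\<bar> \<le> 1 / measure M (cube j x)" if y: "y \<in> space M" for y
      using tf y unfolding test_fun_def by (cases "y \<in> cube j x") auto
    note \<eta> = \<eta>1 \<eta>2
    have i2: "integrable M (\<lambda>y. g y * \<eta> y)"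
    proof (rule Bochner_Integration.integrable_bound)
      show "integrable M (\<lambda>y. g y / measure M (cube j x))" using g by auto
      show "(\<lambda>y. g y * \<eta> y) \<in> borel_measurable M" using g \<eta> by auto
      show "AE y in M. norm (g y * \<eta> y) \<le> norm (g y / measure M (cube j x))"
        using mult_left_mono[OF \<eta>(2), of _ "\<bar>g _\<bar>"] by (intro AE_I2) (simp add: abs_mult)
    qed
    have "\<bar>LINT y|M. g y * \<eta> y\<bar> \<le> (LINT y|M. \<bar>g y * \<eta> y\<bar>)" by (rule integral_abs_bound)
    also have "\<dots> \<le> (LINT y|M. \<bar>g y\<bar> / measure M (cube j x))"
    proof (rule integral_mono)
      show "integrable M (\<lambda>y. \<bar>g y * \<eta> y\<bar>)" using i2 by auto
      show "\<bar>g y * \<eta> y\<bar> \<le> \<bar>g y\<bar> / measure M (cube j x)" if "y \<in> space M" for y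
        using mult_left_mono[OF \<eta>(2)[OF that], of "\<bar>g y\<bar>"] by (simp add: abs_mult)
    qed (use g in auto)
    finally show "\<bar>LINT y|M. g y * \<eta> y\<bar> \<le> (LINT y|M. \<bar>g y\<bar> / measure M (cube j x))" .
  qed
  have ne: "?V \<noteq> {}" using test0 by auto
  show ?thesis
  proof (cases "Sup ?V \<le> 0")
    case True
    then have "\<bar>LINT y|M. g y * \<eta> y\<bar> \<le> 0" if "test_fun s j (cube j x) \<eta>" for \<eta>
      using cSup_upper[OF _ bdd, of "\<bar>LINT y|M. g y * \<eta> y\<bar>"] that by force
    then show ?thesis using test0 by (intro exI[of _ "\<lambda>_. 0"]) auto
  next
    case False
    then have "Sup ?V / 2 < Sup ?V" by simp
    then obtain v where v: "v \<in> ?V" "Sup ?V / 2 < v" using less_cSup_iff[OF ne bdd] by blast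
    then obtain \<psi> where \<psi>: "test_fun s j (cube j x) \<psi>" "v = \<bar>LINT y|M. g y * \<psi> y\<bar>" by auto
    have "\<bar>LINT y|M. g y * \<eta> y\<bar> \<le> 2 * \<bar>LINT y|M. g y * \<psi> y\<bar>" if "test_fun s j (cube j x) \<eta>" for \<eta>
      using cSup_upper[OF _ bdd, of "\<bar>LINT y|M. g y * \<eta> y\<bar>"] that v \<psi> by force
    then show ?thesis using \<psi> by blast
  qed
qed

end

definition trunc_energy :: "real \<Rightarrow> (nat \<Rightarrow> 'a::euclidean_space \<Rightarrow> ereal) \<Rightarrow> nat \<Rightarrow> real \<Rightarrow> real \<Rightarrow> 'a \<Rightarrow> ennreal" where
  "trunc_energy \<alpha> f m \<delta> R x = (\<Sum>k<m. \<integral>\<^sup>+z\<in>cone x \<inter> {(y, t). \<delta> < t \<and> t \<le> R}. (case z of (y, t) \<Rightarrow>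
        (A_fun \<alpha> (f k) t y)\<^sup>2 * ennreal (1 / t ^ (DIM('a) + 1))) \<partial>lebesgue)"

lemma level_exists:
  fixes L t :: real
  assumes L: "0 < L" and t: "L / 2 ^ J / 32 < t" "t \<le> L / 16"
  shows "\<exists>j\<le>J. L / 2 ^ j / 32 < t \<and> t \<le> L / 2 ^ j / 16"
proof -
  define j where "j = (LEAST j. L / 2 ^ j / 32 < t)"
  have j: "L / 2 ^ j / 32 < t" unfolding j_def by (rule LeastI[of _ J]) (rule t)
  have jJ: "j \<le> J" unfolding j_def by (rule Least_le) (rule t)
  have "t \<le> L / 2 ^ j / 16"
  proof (cases j)
    case 0 then show ?thesis using t by simp
  next
    case (Suc i)
    then have "\<not> L / 2 ^ i / 32 < t" unfolding j_def by (intro not_less_Least) (simp add: j_def)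
    then show ?thesis by (simp add: Suc)
  qed
  then show ?thesis using j jJ by blast
qed

text \<open>
  \<open>(2 * osc_const)\<^sup>2\<close> comes from the linearisation; the rest is the measure
  \<open>dy dt / t ^ (n + 1)\<close> of the slab over \<open>ball x (l / 16)\<close> between the heights \<open>l / 32\<close> and
  \<open>l / 16\<close>, with the denominator replaced by its minimum.
\<close>

definition dom_const :: "'a::euclidean_space itself \<Rightarrow> real" where
  "dom_const _ = 4 * (osc_const TYPE('a))\<^sup>2 * (unit_ball_vol DIM('a) * 2 ^ DIM('a))"

lemma emeasure_lborel_box_slab:
  fixes x :: "'a::euclidean_space"
  assumes "0 \<le> r" "a \<le> b"
  shows "emeasure lborel (ball x r \<times> {a<..b}) = ennreal (unit_ball_vol DIM('a) * r ^ DIM('a) * (b - a))"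
proof -
  have "emeasure lborel (ball x r \<times> {a<..b}) = emeasure (lborel \<Otimes>\<^sub>M lborel) (ball x r \<times> {a<..b})"
    by (simp add: lborel_prod)
  also have "\<dots> = emeasure lborel (ball x r) * emeasure lborel {a<..b}"
    by (rule lborel.emeasure_pair_measure_Times) auto
  also have "\<dots> = ennreal (unit_ball_vol DIM('a) * r ^ DIM('a)) * ennreal (b - a)"
    using assms by (simp add: emeasure_ball)
  finally show ?thesis using assms by (simp add: ennreal_mult)
qed

text \<open>
  For each grid, component and cube an almost extremal test function is chosen for the function
  at hand. Over a point \<open>(y, t)\<close> of the cone of \<open>x\<close> with \<open>t\<close> in the range of level \<open>j\<close>, one of
  the shifted grids contains the ball of radius \<open>l / 8\<close> around \<open>x\<close> in its cube of level \<open>j\<close>;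
  summing the squared coefficients over all grids makes the bound independent of the choice of
  the grid. Each level then contributes the measure of one slab of heights.
\<close>

lemma energy_domination:
  fixes f :: "nat \<Rightarrow> 'a::euclidean_space \<Rightarrow> ereal"
  assumes \<alpha>: "0 < \<alpha>" "\<alpha> \<le> 1" and L: "0 < L"
    and int: "\<And>I k. integrable (shifted_space L I) (\<lambda>z. real_of_ereal (f k z))"
  obtains \<psi> where "\<And>I. dyadic_square (shifted_space L I) (shifted_grid L I) (2 ^ DIM('a)) (2 powr (- \<alpha>)) (\<psi> I)"
    and "\<And>x m J. x \<in> ball 0 (L / 6) \<Longrightarrow> trunc_energy \<alpha> f m (L / 2 ^ J / 32) (L / 16) x
       \<le> ennreal (dom_const TYPE('a) * (\<Sum>I\<in>Pow Basis. dyadic_square.S2 (shifted_space L I) (shifted_grid L I) (\<psi> I) m (\<lambda>k z. real_of_ereal (f k z)) 0 J x))"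
proof -
  define s where "s = 2 powr (- \<alpha>)"
  have s: "0 \<le> s" "s < 1" unfolding s_def using \<alpha> powr_less_mono[of "- \<alpha>" 0 "2::real"] by auto
  define M where "M I = (shifted_space L I :: 'a measure)" for I
  define cb where "cb I = (shifted_grid L I :: nat \<Rightarrow> 'a \<Rightarrow> 'a set)" for I
  define g where "g k z = real_of_ereal (f k z)" for k z
  have gi: "integrable (M I) (g k)" for I k unfolding M_def g_def[abs_def] by (rule int)
  have fil: "dyadic_filtration (M I) (cb I) (2 ^ DIM('a))" for I unfolding M_def cb_def by (rule dyadic_grid[OF L])
  define good where "good I k j Q \<psi> \<longleftrightarrow> dyadic_filtration.test_fun (M I) (cb I) s j Q \<psi> \<and>
     (\<forall>\<eta>. dyadic_filtration.test_fun (M I) (cb I) s j Q \<eta> \<longrightarrow> \<bar>LINT y|M I. g k y * \<eta> y\<bar> \<le> 2 * \<bar>LINT y|M I. g k y * \<psi> y\<bar>)" for I k j Q \<psi>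
  define \<psi> where "\<psi> I k j Q = (SOME \<psi>. good I k j Q \<psi>)" for I k j Q
  have good: "good I k j (cb I j x) (\<psi> I k j (cb I j x))" if "x \<in> space (M I)" for I k j x
  proof -
    interpret dyadic_filtration "M I" "cb I" "2 ^ DIM('a)" by (rule fil)
    have "\<exists>\<psi>. good I k j (cb I j x) \<psi>" unfolding good_def by (rule near_extremal[OF gi that s(1)])
    then show ?thesis unfolding \<psi>_def by (rule someI_ex)
  qed
  have ds: "dyadic_square (M I) (cb I) (2 ^ DIM('a)) s (\<psi> I)" for I
  proof -
    interpret dyadic_filtration "M I" "cb I" "2 ^ DIM('a)" by (rule fil)
    show ?thesis
      by unfold_locales (use s good good_def in auto)
  qed
  let ?c = "osc_const TYPE('a)" and ?n = "DIM('a)"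
  have c: "0 < ?c" by (rule osc_const_pos)
  have Tdef: "dyadic_square.T (M I) (cb I) (\<psi> I) k j (g k) x = (LINT y|M I. g k y * \<psi> I k j (cb I j x) y)" for I k j x
    using dyadic_square.T_def[OF ds] by simp
  have dom: "trunc_energy \<alpha> f m (L / 2 ^ J / 32) (L / 16) x
       \<le> ennreal (dom_const TYPE('a) * (\<Sum>I\<in>Pow Basis. dyadic_square.S2 (M I) (cb I) (\<psi> I) m g 0 J x))"
    if x: "x \<in> ball 0 (L / 6)" for x m J
  proof -
    have xr: "x \<in> root_cube (shifted_corner L I) L" for I using ball_sub_root[OF L] x by blast
    define TT where "TT I k j = dyadic_square.T (M I) (cb I) (\<psi> I) k j (g k) x" for I k j
    have Abound: "(A_fun \<alpha> (f k) t y)\<^sup>2 \<le> ennreal (4 * ?c\<^sup>2 * (\<Sum>I\<in>Pow Basis. (TT I k j)\<^sup>2))"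
      if t: "L / 2 ^ j / 32 < t" "t \<le> L / 2 ^ j / 16" and y: "norm (x - y) < t" for k j t y
    proof -
      obtain I where I: "I \<subseteq> Basis" "ball x (L / 2 ^ j / 8) \<subseteq> cb I j x"
        unfolding cb_def using ball_sub_grid_cube[OF L, of x j] by blast
      have "A_fun \<alpha> (f k) t y \<le> ennreal (2 * ?c * \<bar>TT I k j\<bar>)"
        unfolding A_fun_def
      proof (rule SUP_least)
        fix \<phi> :: "'a \<Rightarrow> real" assume \<phi>: "\<phi> \<in> C_class \<alpha>"
        let ?\<eta> = "\<lambda>z. dilate \<phi> t (y - z) / ?c"
        have test: "dyadic_filtration.test_fun (M I) (cb I) s j (cb I j x) ?\<eta>"
          and supp: "\<And>z. z \<notin> cb I j x \<Longrightarrow> dilate \<phi> t (y - z) = 0"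
          using test_of_C_class[OF \<phi> \<alpha> L xr[of I] t y I(2)[unfolded cb_def]] unfolding M_def cb_def s_def by auto
        have "convol (f k) (dilate \<phi> t) y = (LINT z|lebesgue. indicator (root_cube (shifted_corner L I) L) z *\<^sub>R (g k z * dilate \<phi> t (y - z)))"
          unfolding convol_def g_def
          using supp grid_cube_sub_root[OF L xr[of I], of j] by (intro Bochner_Integration.integral_cong) (auto simp: indicator_def cb_def)
        also have "\<dots> = (LINT z|M I. g k z * dilate \<phi> t (y - z))"
          unfolding M_def root_space_def using L by (intro integral_restrict_space[symmetric]) auto
        also have "\<dots> = (LINT z|M I. ?c * (g k z * ?\<eta> z))" using c by simp
        also have "\<dots> = ?c * (LINT z|M I. g k z * ?\<eta> z)" by simp
        finally have "\<bar>convol (f k) (dilate \<phi> t) y\<bar> = ?c * \<bar>LINT z|M I. g k z * ?\<eta> z\<bar>" using c by (simp add: abs_mult)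
        also have "\<dots> \<le> ?c * (2 * \<bar>LINT z|M I. g k z * \<psi> I k j (cb I j x) z\<bar>)"
          using good[of x I k j] test xr[of I] c unfolding good_def by (intro mult_left_mono) (auto simp: M_def)
        also have "\<dots> = 2 * ?c * \<bar>TT I k j\<bar>" unfolding TT_def Tdef by simp
        finally show "ennreal \<bar>convol (f k) (dilate \<phi> t) y\<bar> \<le> ennreal (2 * ?c * \<bar>TT I k j\<bar>)" by (rule ennreal_leI)
      qed
      then have "(A_fun \<alpha> (f k) t y)\<^sup>2 \<le> (ennreal (2 * ?c * \<bar>TT I k j\<bar>))\<^sup>2" by (rule power_mono) simp
      also have "\<dots> = ennreal ((2 * ?c * \<bar>TT I k j\<bar>)\<^sup>2)" using c by (intro ennreal_power) auto
      also have "(2 * ?c * \<bar>TT I k j\<bar>)\<^sup>2 = 4 * ?c\<^sup>2 * (TT I k j)\<^sup>2" by (simp add: power_mult_distrib)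
      also have "ennreal \<dots> \<le> ennreal (4 * ?c\<^sup>2 * (\<Sum>I\<in>Pow Basis. (TT I k j)\<^sup>2))"
        using I c by (intro ennreal_leI mult_left_mono member_le_sum) auto
      finally show ?thesis .
    qed
    define a where "a k j = 4 * ?c\<^sup>2 * (\<Sum>I\<in>Pow (Basis::'a set). (TT I k j)\<^sup>2)" for k j
    have a0: "0 \<le> a k j" for k j unfolding a_def by (intro mult_nonneg_nonneg sum_nonneg) auto
    define slab where "slab j = ball x (L / 2 ^ j / 16) \<times> {L / 2 ^ j / 32<..L / 2 ^ j / 16}" for j
    have one: "(\<integral>\<^sup>+z\<in>cone x \<inter> {(y, t). L / 2 ^ J / 32 < t \<and> t \<le> L / 16}. (case z of (y, t) \<Rightarrow>
        (A_fun \<alpha> (f k) t y)\<^sup>2 * ennreal (1 / t ^ (?n + 1))) \<partial>lebesgue) \<le> (\<Sum>j\<in>{0..J}. ennreal (a k j * (unit_ball_vol ?n * 2 ^ ?n)))" for k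
    proof -
      have "(\<integral>\<^sup>+z\<in>cone x \<inter> {(y, t). L / 2 ^ J / 32 < t \<and> t \<le> L / 16}. (case z of (y, t) \<Rightarrow>
        (A_fun \<alpha> (f k) t y)\<^sup>2 * ennreal (1 / t ^ (?n + 1))) \<partial>lebesgue)
        \<le> (\<integral>\<^sup>+z. (\<Sum>j\<in>{0..J}. ennreal (a k j * (32 / (L / 2 ^ j)) ^ (?n + 1)) * indicator (slab j) z) \<partial>lebesgue)"
      proof (rule nn_integral_mono, clarify)
        fix y :: 'a and t :: real
        show "(A_fun \<alpha> (f k) t y)\<^sup>2 * ennreal (1 / t ^ (?n + 1)) * indicator (cone x \<inter> {(y, t). L / 2 ^ J / 32 < t \<and> t \<le> L / 16}) (y, t)
          \<le> (\<Sum>j\<in>{0..J}. ennreal (a k j * (32 / (L / 2 ^ j)) ^ (?n + 1)) * indicator (slab j) (y, t))"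
        proof (cases "(y, t) \<in> cone x \<inter> {(y, t). L / 2 ^ J / 32 < t \<and> t \<le> L / 16}")
          case True
          then have t: "0 < t" "norm (x - y) < t" "L / 2 ^ J / 32 < t" "t \<le> L / 16" by (auto simp: cone_def)
          obtain j where j: "j \<le> J" "L / 2 ^ j / 32 < t" "t \<le> L / 2 ^ j / 16" using level_exists[OF L t(3,4)] by blast
          have "1 / t ^ (?n + 1) \<le> (32 / (L / 2 ^ j)) ^ (?n + 1)"
          proof -
            have "1 / t \<le> 32 / (L / 2 ^ j)" using j(2) t(1) L by (simp add: field_simps)
            then have "(1 / t) ^ (?n + 1) \<le> (32 / (L / 2 ^ j)) ^ (?n + 1)" using t(1) by (intro power_mono) auto
            then show ?thesis by (simp add: power_one_over)
          qed
          then have "(A_fun \<alpha> (f k) t y)\<^sup>2 * ennreal (1 / t ^ (?n + 1)) \<le> ennreal (a k j) * ennreal ((32 / (L / 2 ^ j)) ^ (?n + 1))"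
            using Abound[OF j(2,3) t(2), of k] unfolding a_def by (intro mult_mono ennreal_leI) auto
          also have "\<dots> = ennreal (a k j * (32 / (L / 2 ^ j)) ^ (?n + 1)) * indicator (slab j) (y, t)"
          proof -
            have "(y, t) \<in> slab j" using j t by (simp add: slab_def dist_norm)
            then show ?thesis using ennreal_mult[OF a0[of k j], of "(32 / (L / 2 ^ j)) ^ (?n + 1)"] L by simp
          qed
          also have "\<dots> \<le> (\<Sum>j\<in>{0..J}. ennreal (a k j * (32 / (L / 2 ^ j)) ^ (?n + 1)) * indicator (slab j) (y, t))"
            using j by (intro member_le_sum) auto
          finally show ?thesis using True by simp
        qed simp
      qed
      also have "\<dots> = (\<integral>\<^sup>+z. (\<Sum>j\<in>{0..J}. ennreal (a k j * (32 / (L / 2 ^ j)) ^ (?n + 1)) * indicator (slab j) z) \<partial>lborel)"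
        by (rule nn_integral_completion)
      also have "\<dots> = (\<Sum>j\<in>{0..J}. ennreal (a k j * (32 / (L / 2 ^ j)) ^ (?n + 1)) * emeasure lborel (slab j))"
      proof -
        have sm: "slab j \<in> sets lborel" for j
          unfolding slab_def using pair_measureI[of "ball x (L / 2 ^ j / 16)" lborel "{L / 2 ^ j / 32<..L / 2 ^ j / 16}" lborel] by (simp only: lborel_prod) simp
        then show ?thesis by (subst nn_integral_sum) (auto simp: nn_integral_cmult)
      qed
      also have "\<dots> = (\<Sum>j\<in>{0..J}. ennreal (a k j * (unit_ball_vol ?n * 2 ^ ?n)))"
      proof (rule sum.cong[OF refl])
        fix j
        define l where "l = L / 2 ^ j"
        have l: "0 < l" using L by (simp add: l_def)
        have em: "emeasure lborel (slab j) = ennreal (unit_ball_vol ?n * (l / 16) ^ ?n * (l / 32))"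
          unfolding slab_def l_def[symmetric] using l by (subst emeasure_lborel_box_slab) auto
        have "ennreal (a k j * (32 / l) ^ (?n + 1)) * emeasure lborel (slab j) = ennreal (a k j * (32 / l) ^ (?n + 1) * (unit_ball_vol ?n * (l / 16) ^ ?n * (l / 32)))"
          unfolding em by (rule ennreal_mult[symmetric]) (use l a0 in auto)
        also have "a k j * (32 / l) ^ (?n + 1) * (unit_ball_vol ?n * (l / 16) ^ ?n * (l / 32)) = a k j * (unit_ball_vol ?n * ((32 / l) * (l / 16)) ^ ?n * ((32 / l) * (l / 32)))"
          unfolding power_mult_distrib by (simp add: mult_ac)
        also have "\<dots> = a k j * (unit_ball_vol ?n * 2 ^ ?n)" using l by simp
        finally show "ennreal (a k j * (32 / (L / 2 ^ j)) ^ (?n + 1)) * emeasure lborel (slab j) = ennreal (a k j * (unit_ball_vol ?n * 2 ^ ?n))"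
          unfolding l_def .
      qed
      finally show ?thesis .
    qed
    have "trunc_energy \<alpha> f m (L / 2 ^ J / 32) (L / 16) x \<le> (\<Sum>k<m. \<Sum>j\<in>{0..J}. ennreal (a k j * (unit_ball_vol ?n * 2 ^ ?n)))"
      unfolding trunc_energy_def by (intro sum_mono one)
    also have "\<dots> = ennreal (\<Sum>k<m. \<Sum>j\<in>{0..J}. a k j * (unit_ball_vol ?n * 2 ^ ?n))"
      using a0 by (simp add: sum_nonneg)
    also have "(\<Sum>k<m. \<Sum>j\<in>{0..J}. a k j * (unit_ball_vol ?n * 2 ^ ?n)) = dom_const TYPE('a) * (\<Sum>k<m. \<Sum>j\<in>{0..J}. \<Sum>I\<in>Pow Basis. (TT I k j)\<^sup>2)"
      unfolding a_def dom_const_def by (simp add: sum_distrib_left sum_distrib_right mult_ac)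
    also have "(\<Sum>k<m. \<Sum>j\<in>{0..J}. \<Sum>I\<in>Pow (Basis::'a set). (TT I k j)\<^sup>2) = (\<Sum>I\<in>Pow (Basis::'a set). \<Sum>j\<in>{0..J}. \<Sum>k<m. (TT I k j)\<^sup>2)"
    proof -
      have "(\<Sum>k<m. \<Sum>j\<in>{0..J}. \<Sum>I\<in>Pow (Basis::'a set). (TT I k j)\<^sup>2) = (\<Sum>j\<in>{0..J}. \<Sum>k<m. \<Sum>I\<in>Pow (Basis::'a set). (TT I k j)\<^sup>2)" by (rule sum.swap)
      also have "\<dots> = (\<Sum>j\<in>{0..J}. \<Sum>I\<in>Pow (Basis::'a set). \<Sum>k<m. (TT I k j)\<^sup>2)" by (intro sum.cong refl sum.swap)
      also have "\<dots> = (\<Sum>I\<in>Pow (Basis::'a set). \<Sum>j\<in>{0..J}. \<Sum>k<m. (TT I k j)\<^sup>2)" by (rule sum.swap)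
      finally show ?thesis .
    qed
    also have "\<dots> = (\<Sum>I\<in>Pow Basis. dyadic_square.S2 (M I) (cb I) (\<psi> I) m g 0 J x)"
      by (intro sum.cong refl) (simp add: dyadic_square.S2_def[OF ds] TT_def)
    finally show ?thesis .
  qed
  show ?thesis
  proof (rule that)
    show "\<And>I. dyadic_square (shifted_space L I) (shifted_grid L I) (2 ^ DIM('a)) (2 powr (- \<alpha>)) (\<psi> I)"
      using ds unfolding M_def cb_def s_def .
    show "\<And>x m J. x \<in> ball 0 (L / 6) \<Longrightarrow> trunc_energy \<alpha> f m (L / 2 ^ J / 32) (L / 16) x
       \<le> ennreal (dom_const TYPE('a) * (\<Sum>I\<in>Pow Basis. dyadic_square.S2 (shifted_space L I) (shifted_grid L I) (\<psi> I) m (\<lambda>k z. real_of_ereal (f k z)) 0 J x))"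
      using dom unfolding M_def cb_def g_def .
  qed
qed

section \<open>Real powers on the extended half line\<close>

lemma epowr_ennreal: "0 \<le> x \<Longrightarrow> 0 < a \<Longrightarrow> epowr (ennreal x) a = ennreal (x powr a)"
  by (auto simp: epowr_def)

lemma epowr_top: "0 < a \<Longrightarrow> epowr \<infinity> a = \<infinity>" and epowr_zero: "0 < a \<Longrightarrow> epowr 0 a = 0"
  by (auto simp: epowr_def)

lemma epowr_mono: "0 < a \<Longrightarrow> x \<le> y \<Longrightarrow> epowr x a \<le> epowr y a"
proof -
  assume a: "0 < a" and xy: "x \<le> y"
  show ?thesis
  proof (cases y)
    case (real r)
    then obtain q where q: "x = ennreal q" "0 \<le> q" using xy by (cases x) (auto simp: top_unique)
    then have "q \<le> r" using xy real by (simp add: ennreal_le_iff)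
    then show ?thesis using real q a by (auto simp: epowr_ennreal intro!: ennreal_leI powr_mono2)
  next
    case top then show ?thesis using a by (simp add: epowr_top[simplified])
  qed
qed

lemma epowr_epowr: "0 < a \<Longrightarrow> 0 < b \<Longrightarrow> epowr (epowr x a) b = epowr x (a * b)"
  by (cases x) (auto simp: epowr_ennreal epowr_top[simplified] powr_powr)

lemma epowr_1 [simp]: "epowr x 1 = x"
  by (cases x) (auto simp: epowr_ennreal epowr_top[simplified])

lemma epowr_mult: "0 < a \<Longrightarrow> epowr (x * y) a = epowr x a * epowr y a"
proof -
  assume a: "0 < a"
  show ?thesis
  proof (cases "x = 0 \<or> y = 0")
    case True then show ?thesis using a by (auto simp: epowr_zero)
  next
    case False
    show ?thesis
    proof (cases "x = \<infinity> \<or> y = \<infinity>")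
      case True
      then have "epowr x a \<noteq> 0" "epowr y a \<noteq> 0" using a False by (auto simp: epowr_def enn2real_eq_0_iff)
      then show ?thesis using a True False by (auto simp: epowr_top[simplified] ennreal_mult_eq_top_iff ennreal_top_mult ennreal_mult_top)
    next
      case False
      then obtain r q where "x = ennreal r" "0 \<le> r" "y = ennreal q" "0 \<le> q" by (cases x; cases y) auto
      then show ?thesis using a by (simp add: ennreal_mult[symmetric] epowr_ennreal powr_mult)
    qed
  qed
qed

lemma epowr_2: "epowr x 2 = x\<^sup>2"
  by (cases x) (auto simp: epowr_ennreal epowr_top[simplified] ennreal_power powr_numeral)

lemma epowr_measurable [measurable]: "(\<lambda>x. epowr x a) \<in> borel_measurable borel"
  unfolding epowr_def by measurable

text \<open>
  A positive power has an increasing inverse, the reciprocal power, and therefore commutes with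
  suprema.
\<close>

lemma epowr_SUP:
  assumes a: "0 < a" shows "epowr (SUP i::nat. Y i) a = (SUP i. epowr (Y i) a)"
proof (rule antisym)
  define Z where "Z = (SUP i. epowr (Y i) a)"
  have "Y i \<le> epowr Z (1 / a)" for i
  proof -
    have "Y i = epowr (epowr (Y i) a) (1 / a)" using a by (simp add: epowr_epowr)
    also have "\<dots> \<le> epowr Z (1 / a)" using a by (intro epowr_mono) (auto simp: Z_def intro: SUP_upper)
    finally show ?thesis .
  qed
  then have "(SUP i. Y i) \<le> epowr Z (1 / a)" by (rule SUP_least)
  then have "epowr (SUP i. Y i) a \<le> epowr (epowr Z (1 / a)) a" using a by (intro epowr_mono) auto
  also have "\<dots> = Z" using a by (simp add: epowr_epowr)
  finally show "epowr (SUP i. Y i) a \<le> (SUP i. epowr (Y i) a)" by (simp add: Z_def)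
  show "(SUP i. epowr (Y i) a) \<le> epowr (SUP i. Y i) a"
    using a by (intro SUP_least epowr_mono SUP_upper) auto
qed

section \<open>Local integrability and measurability\<close>

definition locint :: "('a::euclidean_space \<Rightarrow> real) \<Rightarrow> bool" where
  "locint g \<longleftrightarrow> (\<forall>R. integrable lebesgue (\<lambda>z. indicator (ball 0 R) z * g z))"

lemma locint_bounded:
  assumes g: "locint g" and E: "E \<in> sets lebesgue" "bounded E"
  shows "integrable lebesgue (\<lambda>z. indicator E z * g z)"
proof -
  obtain R where R: "E \<subseteq> ball 0 R" using E(2) by (meson bounded_subset_ballD)
  have "integrable lebesgue (\<lambda>z. indicator (ball 0 R) z * g z)" using g unfolding locint_def by blast
  from integrable_mult_indicator[OF E(1) this]
  have "integrable lebesgue (\<lambda>z. indicator E z * (indicator (ball 0 R) z * g z))" by simp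
  moreover have "indicator E z * (indicator (ball 0 R) z * g z) = indicator E z * g z" for z using R by (auto simp: indicator_def)
  ultimately show ?thesis by simp
qed

lemma bounded_root_cube: "0 \<le> L \<Longrightarrow> bounded (root_cube a L)"
proof -
  assume L: "0 \<le> L"
  have "root_cube a L \<subseteq> cbox a (a + L *\<^sub>R One)" by (auto simp: root_cube_def cbox_def inner_add_left less_imp_le)
  then show ?thesis using bounded_cbox bounded_subset by blast
qed

lemma locint_root_space:
  assumes "locint g" "0 < L" shows "integrable (root_space a L) g"
  unfolding root_space_def using locint_bounded[OF assms(1) root_cube_lebesgue[of L a] bounded_root_cube] assms(2)
  by (subst integrable_restrict_space) auto

text \<open>
  Dominated convergence: for \<open>(y, t)\<close> near a given point the integrands live on a common ball
  and are bounded there by a constant times \<open>\<bar>f\<bar>\<close>.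
\<close>

lemma convol_continuous:
  fixes f :: "'a::euclidean_space \<Rightarrow> ereal"
  assumes fm: "f \<in> borel_measurable lebesgue" and f: "locint (\<lambda>z. real_of_ereal (f z))" and \<phi>: "\<phi> \<in> C_class \<alpha>" and \<alpha>: "0 < \<alpha>" "\<alpha> \<le> 1"
  shows "continuous_on (UNIV \<times> {0<..}) (\<lambda>(y, t). convol f (dilate \<phi> t) y)"
proof -
  define g where "g z = real_of_ereal (f z)" for z
  have gm [measurable]: "g \<in> borel_measurable lebesgue" unfolding g_def using fm by measurable
  have [measurable]: "\<phi> \<in> borel_measurable borel" using \<phi> \<alpha>(1) by (rule C_class_borel)
  have \<phi>c: "isCont \<phi> u" for u using C_class_continuous[OF \<phi> \<alpha>(1)] by (simp add: continuous_on_eq_continuous_at)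
  have open_S: "open (ball y0 1 \<times> {t0 / 2<..<2 * t0})" for y0 :: 'a and t0 :: real by (intro open_Times) auto
  have loc: "continuous_on (ball y0 1 \<times> {t0 / 2<..<2 * t0}) (\<lambda>(y, t). convol f (dilate \<phi> t) y)" if t0: "0 < t0" for y0 t0
    unfolding continuous_on_sequentially
  proof (intro allI impI ballI, elim conjE)
    fix x :: "nat \<Rightarrow> 'a \<times> real" and a assume a: "a \<in> ball y0 1 \<times> {t0 / 2<..<2 * t0}" and x: "\<forall>n. x n \<in> ball y0 1 \<times> {t0 / 2<..<2 * t0}" and lim: "x \<longlonglongrightarrow> a"
    define K where "K z = (3 / (t0 / 2) ^ DIM('a)) * (indicator (cball y0 (1 + 2 * t0)) z * \<bar>g z\<bar>)" for z
    have dm: "(\<lambda>z. dilate \<phi> t (y - z)) \<in> borel_measurable lebesgue" for t y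
      by (rule measurable_completion) (unfold dilate_def, measurable)
    have bd: "\<bar>g z * dilate \<phi> t (y - z)\<bar> \<le> K z" if yt: "(y, t) \<in> ball y0 1 \<times> {t0 / 2<..<2 * t0}" for y t z
    proof (cases "z \<in> cball y0 (1 + 2 * t0)")
      case True
      have t: "t0 / 2 < t" "0 < t" using yt t0 by auto
      have "\<bar>dilate \<phi> t (y - z)\<bar> \<le> 3 / t ^ DIM('a)"
        using C_class_bound[OF \<phi> \<alpha>, of "(y - z) /\<^sub>R t"] t by (simp add: dilate_def divide_right_mono)
      also have "\<dots> \<le> 3 / (t0 / 2) ^ DIM('a)" using t t0 by (intro divide_left_mono power_mono) (auto intro!: mult_pos_pos)
      finally have "\<bar>dilate \<phi> t (y - z)\<bar> \<le> 3 / (t0 / 2) ^ DIM('a)" .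
      from mult_left_mono[OF this, of "\<bar>g z\<bar>"] show ?thesis using True by (simp add: K_def abs_mult mult.commute)
    next
      case False
      then have "1 + 2 * t0 < norm (y0 - z)" by (simp add: dist_norm)
      moreover have "norm (y0 - z) \<le> norm (y0 - y) + norm (y - z)" using norm_triangle_ineq[of "y0 - y" "y - z"] by simp
      ultimately have "t < norm (y - z)" using yt by (simp add: dist_norm)
      then show ?thesis using dilate_supp[OF \<phi>] yt t0 False by (simp add: K_def)
    qed
    obtain ya ta where at: "a = (ya, ta)" by fastforce
    have ta: "0 < ta" using a at t0 by auto
    have "(\<lambda>n. LINT z|lebesgue. g z * dilate \<phi> (snd (x n)) (fst (x n) - z)) \<longlonglongrightarrow> (LINT z|lebesgue. g z * dilate \<phi> ta (ya - z))"
    proof (rule integral_dominated_convergence[where w=K])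
      show "integrable lebesgue K" unfolding K_def
        using integrable_abs[OF locint_bounded[OF f[folded g_def], of "cball y0 (1 + 2 * t0)"]]
        by (intro integrable_mult_right) (simp add: abs_mult)
      show "AE z in lebesgue. (\<lambda>n. g z * dilate \<phi> (snd (x n)) (fst (x n) - z)) \<longlonglongrightarrow> g z * dilate \<phi> ta (ya - z)"
      proof (rule AE_I2)
        fix z
        have l1: "(\<lambda>n. fst (x n)) \<longlonglongrightarrow> ya" "(\<lambda>n. snd (x n)) \<longlonglongrightarrow> ta" using tendsto_fst[OF lim] tendsto_snd[OF lim] at by auto
        have "(\<lambda>n. (fst (x n) - z) /\<^sub>R snd (x n)) \<longlonglongrightarrow> (ya - z) /\<^sub>R ta" using l1 ta by (intro tendsto_intros) auto
        then have "(\<lambda>n. \<phi> ((fst (x n) - z) /\<^sub>R snd (x n))) \<longlonglongrightarrow> \<phi> ((ya - z) /\<^sub>R ta)" by (rule isCont_tendsto_compose[OF \<phi>c])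
        then show "(\<lambda>n. g z * dilate \<phi> (snd (x n)) (fst (x n) - z)) \<longlonglongrightarrow> g z * dilate \<phi> ta (ya - z)"
          unfolding dilate_def using l1 ta by (intro tendsto_intros) auto
      qed
      show "AE z in lebesgue. norm (g z * dilate \<phi> (snd (x n)) (fst (x n) - z)) \<le> K z" for n
        using bd[of "fst (x n)" "snd (x n)"] x by (intro AE_I2) auto
    qed (use dm gm in auto)
    then show "((\<lambda>(y, t). convol f (dilate \<phi> t) y) \<circ> x) \<longlonglongrightarrow> (\<lambda>(y, t). convol f (dilate \<phi> t) y) a"
      unfolding convol_def g_def at by (simp add: o_def case_prod_beta)
  qed
  have "isCont (\<lambda>(y, t). convol f (dilate \<phi> t) y) (y, t)" if "0 < t" for y t
  proof -
    have "(y, t) \<in> ball y 1 \<times> {t / 2<..<2 * t}" using that by auto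
    then show ?thesis using loc[OF that, of y] open_S[of y t] by (simp add: continuous_on_eq_continuous_at)
  qed
  then show ?thesis by (intro continuous_at_imp_continuous_on) auto
qed

text \<open>
  The supremum is over an uncountable family, but each member is continuous in \<open>(y, t)\<close>, so that
  the superlevel sets are open.
\<close>

lemma A_fun_measurable:
  fixes f :: "'a::euclidean_space \<Rightarrow> ereal"
  assumes "f \<in> borel_measurable lebesgue" "locint (\<lambda>z. real_of_ereal (f z))" and \<alpha>: "0 < \<alpha>" "\<alpha> \<le> 1"
  shows "(\<lambda>(y, t). if 0 < t then A_fun \<alpha> f t y else 0) \<in> borel_measurable borel"
proof (rule borel_measurableI_greater)
  fix c :: ennreal
  let ?U = "UNIV \<times> {0<..} :: ('a \<times> real) set"
  have eq: "{z \<in> space borel. c < (\<lambda>(y, t). if 0 < t then A_fun \<alpha> f t y else 0) z}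
     = (\<Union>\<phi>\<in>C_class \<alpha>. ?U \<inter> (\<lambda>(y, t). convol f (dilate \<phi> t) y) -` {v. c < ennreal \<bar>v\<bar>})"
    by (auto simp: A_fun_def less_SUP_iff split: if_splits)
  have op: "open (?U \<inter> (\<lambda>(y, t). convol f (dilate \<phi> t) y) -` {v. c < ennreal \<bar>v\<bar>})" if \<phi>: "\<phi> \<in> C_class \<alpha>" for \<phi>
  proof (rule continuous_open_preimage[OF convol_continuous[OF assms(1,2) \<phi> \<alpha>]])
    show "open ?U" by (intro open_Times) auto
    show "open {v::real. c < ennreal \<bar>v\<bar>}"
      by (rule open_Collect_less) (auto intro!: continuous_intros continuous_on_ennreal)
  qed
  show "{z \<in> space borel. c < (\<lambda>(y, t). if 0 < t then A_fun \<alpha> f t y else 0) z} \<in> sets borel"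
    unfolding eq by (intro borel_open open_UN ballI op)
qed

definition kernel :: "real \<Rightarrow> ('a::euclidean_space \<Rightarrow> ereal) \<Rightarrow> 'a \<times> real \<Rightarrow> ennreal" where
  "kernel \<alpha> f = (\<lambda>(y, t). if 0 < t then (A_fun \<alpha> f t y)\<^sup>2 * ennreal (1 / t ^ (DIM('a) + 1)) else 0)"

lemma kernel_measurable:
  fixes f :: "'a::euclidean_space \<Rightarrow> ereal"
  assumes "f \<in> borel_measurable lebesgue" "locint (\<lambda>z. real_of_ereal (f z))" and \<alpha>: "0 < \<alpha>" "\<alpha> \<le> 1"
  shows "kernel \<alpha> f \<in> borel_measurable borel"
proof -
  have 1 [measurable]: "(\<lambda>(y, t). if 0 < t then A_fun \<alpha> f t y else 0) \<in> borel_measurable (borel :: ('a \<times> real) measure)"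
    by (rule A_fun_measurable[OF assms])
  have eq: "kernel \<alpha> f = (\<lambda>z. ((\<lambda>(y, t). if 0 < t then A_fun \<alpha> f t y else 0) z)\<^sup>2 * ennreal (1 / (snd z) ^ (DIM('a) + 1)))"
    by (auto simp: kernel_def fun_eq_iff)
  have [measurable]: "snd \<in> borel_measurable (borel :: ('a \<times> real) measure)"
    by (intro borel_measurable_continuous_onI continuous_intros)
  show ?thesis unfolding eq by measurable
qed

text \<open>
  The condition \<open>P\<close> on the heights lets the square of \<open>G_fun\<close> and its truncations share one
  definition.
\<close>

definition energy1 :: "real \<Rightarrow> ('a::euclidean_space \<Rightarrow> ereal) \<Rightarrow> (real \<Rightarrow> bool) \<Rightarrow> 'a \<Rightarrow> ennreal" where
  "energy1 \<alpha> f P x = (\<integral>\<^sup>+z. kernel \<alpha> f z * indicator {(y, t). norm (x - y) < t \<and> P t} z \<partial>lborel)"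

lemma trunc_energy_eq: "trunc_energy \<alpha> f m \<delta> R x = (\<Sum>k<m. energy1 \<alpha> (f k) (\<lambda>t. \<delta> < t \<and> t \<le> R) x)"
  unfolding trunc_energy_def energy1_def nn_integral_completion
  by (intro sum.cong nn_integral_cong refl) (auto simp: kernel_def cone_def indicator_def intro: le_less_trans[OF norm_ge_zero])

lemma G_fun_eq: "G_fun \<alpha> f x = enn2ereal (epowr (energy1 \<alpha> f (\<lambda>_. True) x) (1/2))"
proof -
  have "(\<integral>\<^sup>+z\<in>cone x. (case z of (y, t) \<Rightarrow> (A_fun \<alpha> f t y)\<^sup>2 * ennreal (1 / t ^ (DIM('a) + 1))) \<partial>lebesgue) = energy1 \<alpha> f (\<lambda>_. True) x"
    unfolding energy1_def nn_integral_completion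
    by (intro nn_integral_cong) (auto simp: kernel_def cone_def indicator_def intro: le_less_trans[OF norm_ge_zero])
  then show ?thesis unfolding G_fun_def by simp
qed

lemma energy1_measurable:
  fixes f :: "'a::euclidean_space \<Rightarrow> ereal"
  assumes "f \<in> borel_measurable lebesgue" "locint (\<lambda>z. real_of_ereal (f z))" and \<alpha>: "0 < \<alpha>" "\<alpha> \<le> 1" and P: "Measurable.pred borel P"
  shows "energy1 \<alpha> f P \<in> borel_measurable borel"
proof -
  have [measurable]: "kernel \<alpha> f \<in> borel_measurable borel" by (rule kernel_measurable[OF assms(1-4)])
  have [measurable]: "Measurable.pred borel P" by (rule P)
  have [measurable]: "snd \<in> borel_measurable (borel :: ('a \<times> real) measure)" "fst \<in> borel_measurable (borel :: ('a \<times> real) measure)"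
    by (intro borel_measurable_continuous_onI continuous_intros)+
  have eq: "energy1 \<alpha> f P = (\<lambda>x. \<integral>\<^sup>+z. kernel \<alpha> f z * (if norm (x - fst z) < snd z \<and> P (snd z) then 1 else 0) \<partial>lborel)"
    unfolding energy1_def by (intro ext nn_integral_cong) (auto simp: indicator_def)
  have "(\<lambda>x. \<integral>\<^sup>+z. kernel \<alpha> f z * (if norm (x - fst z) < snd z \<and> P (snd z) then 1 else 0) \<partial>lborel) \<in> borel_measurable borel"
  proof (rule lborel.borel_measurable_nn_integral)
    show "(\<lambda>(x, z). kernel \<alpha> f z * (if norm (x - fst z) < snd z \<and> P (snd z) then 1 else 0)) \<in> borel_measurable (borel \<Otimes>\<^sub>M lborel)"
      unfolding case_prod_beta by measurable
  qed
  then show ?thesis unfolding eq .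
qed

lemma energy1_mono: "(\<And>t. P t \<Longrightarrow> Q t) \<Longrightarrow> energy1 \<alpha> f P x \<le> energy1 \<alpha> f Q x"
  unfolding energy1_def by (intro nn_integral_mono mult_left_mono) (auto simp: indicator_def)

definition energy :: "real \<Rightarrow> (nat \<Rightarrow> 'a::euclidean_space \<Rightarrow> ereal) \<Rightarrow> 'a \<Rightarrow> ennreal" where
  "energy \<alpha> f x = (\<Sum>k. energy1 \<alpha> (f k) (\<lambda>_. True) x)"

definition sqsum :: "(nat \<Rightarrow> 'a \<Rightarrow> ereal) \<Rightarrow> 'a \<Rightarrow> ennreal" where
  "sqsum f x = (\<Sum>j. (e2ennreal \<bar>f j x\<bar>)\<^sup>2)"

lemma l2_norm_sqsum: "l2_norm f x = epowr (sqsum f x) (1/2)"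
  by (simp add: l2_norm_def sqsum_def)

lemma sqsum_G_seq: "sqsum (G_seq \<alpha> f) x = energy \<alpha> f x"
proof -
  have "e2ennreal \<bar>enn2ereal v\<bar> = v" for v by (simp add: abs_of_nonneg)
  then have "(e2ennreal \<bar>G_seq \<alpha> f j x\<bar>)\<^sup>2 = energy1 \<alpha> (f j) (\<lambda>_. True) x" for j
    unfolding G_seq_def G_fun_eq by (simp add: epowr_2[symmetric] epowr_epowr)
  then show ?thesis unfolding sqsum_def energy_def by simp
qed

section \<open>Global weighted estimates\<close>

text \<open>
  The bound of \<open>energy_domination\<close> with side \<open>2 ^ i\<close> and \<open>2 * i\<close> levels: the heights from
  \<open>2 ^ (-i) / 32\<close> to \<open>2 ^ i / 16\<close>, the first \<open>i\<close> components and a ball of radius comparable to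
  \<open>2 ^ i\<close> are all exhausted as \<open>i\<close> grows.
\<close>

definition approx :: "real \<Rightarrow> (nat \<Rightarrow> 'a::euclidean_space \<Rightarrow> ereal) \<Rightarrow> nat \<Rightarrow> 'a \<Rightarrow> ennreal" where
  "approx \<alpha> f i x = trunc_energy \<alpha> f i (2 ^ i / 2 ^ (2 * i) / 32) (2 ^ i / 16) x * indicator (ball 0 (2 ^ i / 6)) x"

lemma approx_range_mono: "i \<le> i' \<Longrightarrow> 2 ^ i / 2 ^ (2 * i) / 32 < t \<and> t \<le> 2 ^ i / 16 \<Longrightarrow> 2 ^ i' / 2 ^ (2 * i') / 32 < t \<and> t \<le> (2 ^ i' :: real) / 16"
proof -
  assume ii: "i \<le> i'" and t: "2 ^ i / 2 ^ (2 * i) / 32 < t \<and> t \<le> (2::real) ^ i / 16"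
  have e: "2 ^ j / 2 ^ (2 * j) = 1 / (2::real) ^ j" for j by (simp add: power_add mult_2)
  have "(2::real) ^ i \<le> 2 ^ i'" using ii by simp
  then have "1 / (2::real) ^ i' \<le> 1 / 2 ^ i" by (intro divide_left_mono) auto
  then have "1 / (2::real) ^ i' / 32 \<le> 1 / 2 ^ i / 32" by (intro divide_right_mono) auto
  moreover have "(2::real) ^ i / 16 \<le> 2 ^ i' / 16" using \<open>(2::real) ^ i \<le> 2 ^ i'\<close> by simp
  ultimately show ?thesis using t unfolding e by (intro conjI; elim conjE; linarith)
qed

lemma approx_mono: "incseq (\<lambda>i. approx \<alpha> f i x)"
proof (rule incseq_SucI)
  fix i
  have "trunc_energy \<alpha> f i (2 ^ i / 2 ^ (2 * i) / 32) (2 ^ i / 16) x \<le> trunc_energy \<alpha> f (Suc i) (2 ^ Suc i / 2 ^ (2 * Suc i) / 32) (2 ^ Suc i / 16) x"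
    unfolding trunc_energy_eq
    by (rule order_trans[OF sum_mono[OF energy1_mono] sum_mono2]) (use approx_range_mono[of i "Suc i"] in auto)
  moreover have "ball (0::'a) (2 ^ i / 6) \<subseteq> ball 0 (2 ^ Suc i / 6)" by (rule subset_ball) simp
  then have "(indicator (ball 0 (2 ^ i / 6)) x :: ennreal) \<le> indicator (ball 0 (2 ^ Suc i / 6)) x"
    by (auto simp: indicator_def)
  ultimately show "approx \<alpha> f i x \<le> approx \<alpha> f (Suc i) x" unfolding approx_def by (rule mult_mono) auto
qed

lemma approx_SUP:
  fixes f :: "nat \<Rightarrow> 'a::euclidean_space \<Rightarrow> ereal"
  assumes f: "\<And>k. f k \<in> borel_measurable lebesgue" "\<And>k. locint (\<lambda>z. real_of_ereal (f k z))" and \<alpha>: "0 < \<alpha>" "\<alpha> \<le> 1"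
  shows "energy \<alpha> f x = (SUP i. approx \<alpha> f i x)"
proof (rule antisym)
  show "(SUP i. approx \<alpha> f i x) \<le> energy \<alpha> f x"
  proof (rule SUP_least)
    fix i
    have "approx \<alpha> f i x \<le> trunc_energy \<alpha> f i (2 ^ i / 2 ^ (2 * i) / 32) (2 ^ i / 16) x"
      unfolding approx_def by (auto simp: indicator_def)
    also have "\<dots> \<le> (\<Sum>k<i. energy1 \<alpha> (f k) (\<lambda>_. True) x)" unfolding trunc_energy_eq by (intro sum_mono energy1_mono) auto
    also have "\<dots> \<le> energy \<alpha> f x" unfolding energy_def by (rule sum_le_suminf) auto
    finally show "approx \<alpha> f i x \<le> energy \<alpha> f x" .
  qed
  let ?P = "\<lambda>i t. 2 ^ i / 2 ^ (2 * i) / 32 < t \<and> t \<le> (2::real) ^ i / 16"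
  have e1: "energy1 \<alpha> (f k) (\<lambda>_. True) x = (SUP i. energy1 \<alpha> (f k) (?P i) x)" for k
  proof -
    have km [measurable]: "kernel \<alpha> (f k) \<in> borel_measurable borel" by (rule kernel_measurable[OF f \<alpha>])
    have [measurable]: "snd \<in> borel_measurable (borel :: ('a \<times> real) measure)" "fst \<in> borel_measurable (borel :: ('a \<times> real) measure)"
      by (intro borel_measurable_continuous_onI continuous_intros)+
    let ?F = "\<lambda>i z. kernel \<alpha> (f k) z * indicator {(y, t). norm (x - y) < t \<and> ?P i t} z"
    have Fm: "?F i \<in> borel_measurable lborel" for i
    proof -
      have "{(y, t). norm (x - y) < t \<and> ?P i t} = {z. norm (x - fst z) < snd z \<and> ?P i (snd z)}" by auto
      moreover have "{z::'a \<times> real. norm (x - fst z) < snd z \<and> ?P i (snd z)} \<in> sets borel" by measurable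
      ultimately show ?thesis by simp
    qed
    have inc: "incseq ?F"
    proof (rule incseq_SucI)
      fix i
      have P: "?P i t \<Longrightarrow> ?P (Suc i) t" for t by (rule approx_range_mono) auto
      show "?F i \<le> ?F (Suc i)"
        by (rule le_funI, rule mult_left_mono) (use P in \<open>auto simp: indicator_def\<close>)
    qed
    have sup: "kernel \<alpha> (f k) z * indicator {(y, t). norm (x - y) < t \<and> True} z = (SUP i. ?F i z)" for z
    proof (rule antisym)
      show "(SUP i. ?F i z) \<le> kernel \<alpha> (f k) z * indicator {(y, t). norm (x - y) < t \<and> True} z"
        by (intro SUP_least mult_left_mono) (auto simp: indicator_def)
      obtain y t where z: "z = (y, t)" by fastforce
      show "kernel \<alpha> (f k) z * indicator {(y, t). norm (x - y) < t \<and> True} z \<le> (SUP i. ?F i z)"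
      proof (cases "norm (x - y) < t")
        case True
        then have t: "0 < t" using norm_ge_zero[of "x - y"] by linarith
        obtain i where i: "16 * t + 1 / t < (2::real) ^ i" using real_arch_pow[of 2] by auto
        have i16: "16 * t < 2 ^ i" and "1 / t < 2 ^ i" using i t divide_pos_pos[of 1 t] by linarith+
        then have small: "1 / (2::real) ^ i < t" using t by (simp add: field_simps)
        have div32: "r / 32 < t" if "0 < r" "r < t" for r :: real using that by linarith
        have "1 / (2::real) ^ i / 32 < t" by (rule div32[OF _ small]) simp
        moreover have "2 ^ i / 2 ^ (2 * i) = 1 / (2::real) ^ i" by (simp add: power_add mult_2)
        ultimately have "?P i t" using i16 by simp
        then have "kernel \<alpha> (f k) z * indicator {(y, t). norm (x - y) < t \<and> True} z \<le> ?F i z" using z True by simp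
        then show ?thesis by (rule order_trans) (rule SUP_upper, simp)
      qed (simp add: z)
    qed
    show ?thesis unfolding energy1_def sup
      by (rule nn_integral_monotone_convergence_SUP[OF inc Fm])
  qed
  have mono1: "incseq (\<lambda>i. energy1 \<alpha> (f k) (?P i) x)" for k
    by (rule incseq_SucI, rule energy1_mono, rule approx_range_mono) auto
  show "energy \<alpha> f x \<le> (SUP i. approx \<alpha> f i x)"
    unfolding energy_def suminf_eq_SUP
  proof (rule SUP_least)
    fix n
    have "(\<Sum>k<n. energy1 \<alpha> (f k) (\<lambda>_. True) x) = (\<Sum>k<n. SUP i. energy1 \<alpha> (f k) (?P i) x)" unfolding e1 ..
    also have "\<dots> = (SUP i. \<Sum>k<n. energy1 \<alpha> (f k) (?P i) x)"
      by (rule ennreal_SUP_sum[symmetric]) (rule mono1)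
    also have "\<dots> \<le> (SUP i. approx \<alpha> f i x)"
    proof (rule SUP_least)
      fix i
      obtain i0 where i0: "6 * norm x < (2::real) ^ i0" using real_arch_pow[of 2] by auto
      define j where "j = max (max i n) i0"
      have j: "i \<le> j" "n \<le> j" "i0 \<le> j" by (auto simp: j_def)
      have "(2::real) ^ i0 \<le> 2 ^ j" using j by simp
      from less_le_trans[OF i0 this] have xb: "x \<in> ball 0 (2 ^ j / 6)" by simp
      have "(\<Sum>k<n. energy1 \<alpha> (f k) (?P i) x) \<le> (\<Sum>k<n. energy1 \<alpha> (f k) (?P j) x)"
        by (intro sum_mono incseqD[OF mono1] j)
      also have "\<dots> \<le> (\<Sum>k<j. energy1 \<alpha> (f k) (?P j) x)" using j by (intro sum_mono2) auto
      also have "\<dots> = approx \<alpha> f j x" unfolding approx_def trunc_energy_eq using xb by simp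
      also have "\<dots> \<le> (SUP i. approx \<alpha> f i x)" by (rule SUP_upper) simp
      finally show "(\<Sum>k<n. energy1 \<alpha> (f k) (?P i) x) \<le> (SUP i. approx \<alpha> f i x)" .
    qed
    finally show "(\<Sum>k<n. energy1 \<alpha> (f k) (\<lambda>_. True) x) \<le> (SUP i. approx \<alpha> f i x)" .
  qed
qed

lemma approx_measurable:
  fixes f :: "nat \<Rightarrow> 'a::euclidean_space \<Rightarrow> ereal"
  assumes f: "\<And>k. f k \<in> borel_measurable lebesgue" "\<And>k. locint (\<lambda>z. real_of_ereal (f k z))" and \<alpha>: "0 < \<alpha>" "\<alpha> \<le> 1"
  shows "approx \<alpha> f i \<in> borel_measurable lebesgue"
proof -
  have "(\<lambda>x. (\<Sum>k<i. energy1 \<alpha> (f k) (\<lambda>t. 2 ^ i / 2 ^ (2 * i) / 32 < t \<and> t \<le> 2 ^ i / 16) x) * indicator (ball 0 (2 ^ i / 6)) x) \<in> borel_measurable borel"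
    by (intro borel_measurable_times_ennreal borel_measurable_sum energy1_measurable f \<alpha> borel_measurable_indicator) auto
  then have "approx \<alpha> f i \<in> borel_measurable borel" unfolding approx_def[abs_def] trunc_energy_eq .
  then show ?thesis by (intro measurable_completion) simp
qed

lemma G_fun_measurable:
  fixes f :: "'a::euclidean_space \<Rightarrow> ereal"
  assumes f: "f \<in> borel_measurable lebesgue" "locint (\<lambda>z. real_of_ereal (f z))" and \<alpha>: "0 < \<alpha>" "\<alpha> \<le> 1"
  shows "G_fun \<alpha> f \<in> borel_measurable lebesgue"
proof -
  have [measurable]: "energy1 \<alpha> f (\<lambda>_. True) \<in> borel_measurable borel" by (rule energy1_measurable[OF f \<alpha>]) simp
  have "G_fun \<alpha> f \<in> borel_measurable borel" unfolding G_fun_eq[abs_def] by measurable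
  then show ?thesis by (intro measurable_completion) simp
qed

lemma sum_powr_le:
  fixes u :: "'i \<Rightarrow> real"
  assumes "finite A" "\<And>i. i \<in> A \<Longrightarrow> 0 \<le> u i" "0 < q"
  shows "(\<Sum>i\<in>A. u i) powr q \<le> real (card A) powr q * (\<Sum>i\<in>A. u i powr q)"
proof (cases "A = {}")
  case False
  define b where "b = Max (u ` A)"
  have "b \<in> u ` A" unfolding b_def using assms False by (intro Max_in) auto
  then obtain i where i: "i \<in> A" "b = u i" by blast
  have b0: "0 \<le> b" using i assms by auto
  have "(\<Sum>i\<in>A. u i) \<le> (\<Sum>i\<in>A. b)" using assms by (intro sum_mono) (auto simp: b_def)
  then have "(\<Sum>i\<in>A. u i) powr q \<le> (real (card A) * b) powr q" using assms by (intro powr_mono2 sum_nonneg) auto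
  also have "\<dots> = real (card A) powr q * b powr q" using b0 by (simp add: powr_mult)
  also have "b powr q \<le> (\<Sum>i\<in>A. u i powr q)" unfolding i(2) using assms i by (intro member_le_sum) auto
  finally show ?thesis by (simp add: mult_left_mono)
qed simp

lemma L2_powr_le_sqsum:
  assumes "0 < p"
  shows "ennreal (L2_set (\<lambda>k. real_of_ereal (f k x)) {..<m} powr p) \<le> epowr (sqsum f x) (p / 2)"
proof -
  let ?S = "\<Sum>k<m. (real_of_ereal (f k x))\<^sup>2"
  have S0: "0 \<le> ?S" by (intro sum_nonneg) auto
  have "L2_set (\<lambda>k. real_of_ereal (f k x)) {..<m} powr p = ?S powr (p / 2)"
    using S0 by (simp add: L2_set_def powr_half_sqrt[symmetric] powr_powr)
  also have "ennreal \<dots> = epowr (ennreal ?S) (p / 2)" using S0 assms by (simp add: epowr_ennreal)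
  also have "\<dots> \<le> epowr (sqsum f x) (p / 2)"
  proof (rule epowr_mono)
    have "ennreal ((real_of_ereal v)\<^sup>2) \<le> (e2ennreal \<bar>v\<bar>)\<^sup>2" for v :: ereal
    proof (cases v)
      case (real r)
      have "ennreal (r\<^sup>2) = (ennreal \<bar>r\<bar>)\<^sup>2" by (simp add: ennreal_power)
      then show ?thesis by (simp add: real ennreal.abs_eq[symmetric] e2ennreal_ereal)
    qed auto
    note * = this
    have "ennreal ?S = (\<Sum>k<m. ennreal ((real_of_ereal (f k x))\<^sup>2))" by (rule sum_ennreal[symmetric]) simp
    also have "\<dots> \<le> (\<Sum>k<m. (e2ennreal \<bar>f k x\<bar>)\<^sup>2)" by (intro sum_mono *)
    also have "\<dots> \<le> sqsum f x" unfolding sqsum_def by (rule sum_le_suminf) auto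
    finally show "ennreal ?S \<le> sqsum f x" .
  qed (use assms in simp)
  finally show ?thesis .
qed

lemma grid_cube_sub_ball:
  fixes x :: "'a::euclidean_space"
  assumes L: "0 < L" and z: "z \<in> grid_cube a L j x"
  shows "grid_cube a L j x \<subseteq> ball z (2 * real DIM('a) * (L / 2 ^ j))"
proof
  fix y assume "y \<in> grid_cube a L j x"
  then have "y \<in> grid_cube a L j z" using z by (simp add: grid_cube_def)
  from grid_cube_norm_le[OF L this] have le: "dist z y \<le> real DIM('a) * (L / 2 ^ j)" unfolding dist_norm .
  define r where "r = real DIM('a) * (L / 2 ^ j)"
  have "0 < r" using L by (simp add: r_def)
  then have "dist z y < 2 * r" using le unfolding r_def[symmetric] by linarith
  then show "y \<in> ball z (2 * real DIM('a) * (L / 2 ^ j))" unfolding r_def by (simp add: mult.assoc)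
qed

lemma measure_ball_grid:
  fixes x :: "'a::euclidean_space"
  assumes "0 < L"
  shows "measure lebesgue (ball x (2 * real DIM('a) * (L / 2 ^ j))) = unit_ball_vol DIM('a) * (2 * real DIM('a)) ^ DIM('a) * (L / 2 ^ j) ^ DIM('a)"
  using assms by (simp add: content_ball power_mult_distrib power_divide)

lemma root_space_integral_ind:
  fixes F :: "'a::euclidean_space \<Rightarrow> real"
  assumes "0 < L" "Q \<subseteq> root_cube a L"
  shows "(LINT y|root_space a L. indicator Q y * F y) = (LINT y|lebesgue. indicator Q y * F y)"
  unfolding root_space_def using assms
  by (subst integral_restrict_space) (auto intro!: Bochner_Integration.integral_cong simp: indicator_def)

lemma root_space_measurable:
  "F \<in> borel_measurable lebesgue \<Longrightarrow> F \<in> borel_measurable (root_space a L)"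
  unfolding root_space_def by (rule measurable_restrict_space1)

lemma root_space_nn_le:
  fixes F :: "'a::euclidean_space \<Rightarrow> ennreal"
  assumes "0 < L" shows "(\<integral>\<^sup>+x. F x \<partial>root_space a L) \<le> (\<integral>\<^sup>+x. F x \<partial>lebesgue)"
  unfolding root_space_def using assms
  by (subst nn_integral_restrict_space) (auto intro!: nn_integral_mono simp: indicator_def)

lemma root_space_ind_measurable:
  fixes F :: "'a::euclidean_space \<Rightarrow> ennreal"
  assumes "0 < L" "F \<in> borel_measurable (root_space a L)"
  shows "(\<lambda>x. F x * indicator (root_cube a L) x) \<in> borel_measurable lebesgue"
  using assms borel_measurable_restrict_space_iff_ennreal[of "root_cube a L" lebesgue F] unfolding root_space_def by simp

text \<open>
  For each \<open>i\<close> the truncation \<open>approx \<alpha> f i\<close> is dominated by the dyadic square functions of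
  finitely many grids, to which \<open>weighted_Lp\<close> applies: a cube lies in a ball of comparable
  measure, so that it inherits the \<open>A_p\<close> condition. The constants do not depend on \<open>i\<close>, and
  monotone convergence concludes.
\<close>

lemma global_strong:
  fixes w \<sigma> :: "'a::euclidean_space \<Rightarrow> real"
  assumes \<alpha>: "0 < \<alpha>" "\<alpha> \<le> 1" and p: "1 < p" and D: "0 < D"
    and wm [measurable]: "w \<in> borel_measurable lebesgue" and \<sigma>m [measurable]: "\<sigma> \<in> borel_measurable lebesgue"
    and wp: "\<And>x. 0 < w x" and \<sigma>p: "\<And>x. 0 < \<sigma> x" and dual: "\<And>x. \<sigma> x powr (p - 1) * w x = 1"
    and wi: "locint w" and \<sigma>i: "locint \<sigma>"
    and Ap: "\<And>x r. 0 < r \<Longrightarrow> (LINT y|lebesgue. indicator (ball x r) y * w y) * (LINT y|lebesgue. indicator (ball x r) y * \<sigma> y) powr (p - 1) \<le> D * measure lebesgue (ball x r) powr p"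
  shows "\<exists>C::real. 0 < C \<and> (\<forall>f. (\<forall>k. f k \<in> borel_measurable lebesgue) \<longrightarrow> (\<forall>k. locint (\<lambda>z. real_of_ereal (f k z))) \<longrightarrow>
    (\<integral>\<^sup>+x. epowr (energy \<alpha> f x) (p / 2) * ennreal (w x) \<partial>lebesgue) \<le> ennreal C * (\<integral>\<^sup>+x. epowr (sqsum f x) (p / 2) * ennreal (w x) \<partial>lebesgue))"
proof -
  define s where "s = 2 powr (- \<alpha>)"
  define \<Omega> where "\<Omega> = unit_ball_vol DIM('a) * (2 * real DIM('a)) ^ DIM('a)"
  have \<Omega>: "0 < \<Omega>" by (simp add: \<Omega>_def)
  define D' where "D' = D * \<Omega> powr p"
  have D': "0 < D'" using D \<Omega> by (simp add: D'_def)
  define K where "K = dyadic_square.Lp_const (2 ^ DIM('a)) s p D'"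
  let ?n = "real (card (Pow (Basis::'a set)))"
  define c where "c = (dom_const TYPE('a)) powr (p / 2) * real (card (Pow (Basis :: 'a set))) powr (p / 2)"
  define C where "C = c * real (card (Pow (Basis :: 'a set))) * \<bar>K\<bar> + 1"
  have c0: "0 \<le> c" by (simp add: c_def)
  have dc: "0 \<le> dom_const TYPE('a)" by (simp add: dom_const_def)
  have C: "0 < C" unfolding C_def using c0 by (intro add_nonneg_pos mult_nonneg_nonneg) auto
  have main: "(\<integral>\<^sup>+x. epowr (energy \<alpha> f x) (p / 2) * ennreal (w x) \<partial>lebesgue) \<le> ennreal C * (\<integral>\<^sup>+x. epowr (sqsum f x) (p / 2) * ennreal (w x) \<partial>lebesgue)"
    if f: "\<And>k. f k \<in> borel_measurable lebesgue" "\<And>k. locint (\<lambda>z. real_of_ereal (f k z))" for f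
  proof -
    let ?R = "\<integral>\<^sup>+x. epowr (sqsum f x) (p / 2) * ennreal (w x) \<partial>lebesgue"
    let ?e = "\<lambda>i x. epowr (approx \<alpha> f i x) (p / 2) * ennreal (w x)"
    have step: "(\<integral>\<^sup>+x. (?e i x) \<partial>lebesgue) \<le> ennreal C * ?R" for i
    proof -
      define L where "L = (2::real) ^ i"
      have L: "0 < L" by (simp add: L_def)
      let ?g = "\<lambda>k z. real_of_ereal (f k z)"
      obtain \<psi> where ds: "\<And>I. dyadic_square (shifted_space L I :: 'a measure) (shifted_grid L I) (2 ^ DIM('a)) (2 powr (- \<alpha>)) (\<psi> I)"
        and dom: "\<And>x m J. x \<in> ball 0 (L / 6) \<Longrightarrow> trunc_energy \<alpha> f m (L / 2 ^ J / 32) (L / 16) x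
       \<le> ennreal (dom_const TYPE('a) * (\<Sum>I\<in>Pow Basis. dyadic_square.S2 (shifted_space L I) (shifted_grid L I) (\<psi> I) m ?g 0 J x))"
        using energy_domination[OF \<alpha> L, of f] locint_root_space[OF f(2) L] by blast
      define S where "S I x = dyadic_square.S2 (shifted_space L I :: 'a measure) (shifted_grid L I) (\<psi> I) i ?g 0 (2 * i) x" for I x
      define X where "X I = root_cube (shifted_corner L I :: 'a) L" for I
      let ?s = "\<lambda>I x. ennreal (S I x powr (p / 2) * w x) * indicator (X I) x"
      let ?d = "\<lambda>x. dom_const TYPE('a) * (\<Sum>I\<in>Pow Basis. S I x)"
      have S0: "0 \<le> S I x" for I x unfolding S_def by (rule dyadic_square.S2_nonneg[OF ds])
      have Sm: "S I \<in> borel_measurable (shifted_space L I :: 'a measure)" for I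
      proof -
        interpret dyadic_square "(shifted_space L I :: 'a measure)" "shifted_grid L I" "2 ^ DIM('a)" "2 powr (- \<alpha>)" "\<psi> I" i by (rule ds)
        show ?thesis unfolding S_def[abs_def] by (rule adapted_borel[OF adapted_S2])
      qed
      have Sb: "(\<integral>\<^sup>+x. ennreal (S I x powr (p / 2) * w x) \<partial>shifted_space L I) \<le> ennreal K * ?R" for I
      proof -
        interpret dyadic_square "(shifted_space L I :: 'a measure)" "shifted_grid L I" "2 ^ DIM('a)" "2 powr (- \<alpha>)" "\<psi> I" i by (rule ds)
        have "(\<integral>\<^sup>+x. ennreal (S I x powr (p / 2) * w x) \<partial>shifted_space L I) \<le> ennreal (Lp_const p D') * (\<integral>\<^sup>+x. ennreal (nrm ?g x powr p * w x) \<partial>shifted_space L I)"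
          unfolding S_def
        proof (rule weighted_Lp[where \<sigma>=\<sigma>])
          show "integrable (shifted_space L I) (?g k)" for k by (rule locint_root_space[OF f(2) L])
          show "integrable (shifted_space L I) w" "integrable (shifted_space L I) \<sigma>"
            by (rule locint_root_space[OF wi L], rule locint_root_space[OF \<sigma>i L])
          show "w \<in> borel_measurable (shifted_space L I)" "\<sigma> \<in> borel_measurable (shifted_space L I)"
            by (rule root_space_measurable[OF wm], rule root_space_measurable[OF \<sigma>m])
          fix x j assume "x \<in> space (shifted_space L I :: 'a measure)"
          then have x: "x \<in> root_cube (shifted_corner L I) L" by simp
          let ?Q = "shifted_grid L I j x" and ?r = "2 * real DIM('a) * (L / 2 ^ j)"
          have sub: "?Q \<subseteq> root_cube (shifted_corner L I) L" by (rule grid_cube_sub_root[OF L x])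
          have r: "0 < ?r" using L by simp
          have Qb: "?Q \<subseteq> ball x ?r" by (rule grid_cube_sub_ball[OF L]) (simp add: grid_cube_def)
          have Qm: "?Q \<in> sets lebesgue" using emeasure_grid_cube(1)[OF L, of "shifted_corner L I" j x] by simp
          have Qi: "bounded ?Q" using Qb bounded_ball bounded_subset by blast
          have le: "0 \<le> (LINT y|lebesgue. indicator ?Q y * v y)" "(LINT y|lebesgue. indicator ?Q y * v y) \<le> (LINT y|lebesgue. indicator (ball x ?r) y * v y)"
            if v: "locint v" "\<And>y. 0 < v y" for v :: "'a \<Rightarrow> real"
          proof -
            have v0: "0 \<le> v y" for y using v(2)[of y] by simp
            show "0 \<le> (LINT y|lebesgue. indicator ?Q y * v y)" by (rule integral_nonneg_AE) (simp add: v0)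
            show "(LINT y|lebesgue. indicator ?Q y * v y) \<le> (LINT y|lebesgue. indicator (ball x ?r) y * v y)"
              using locint_bounded[OF v(1) Qm Qi] locint_bounded[OF v(1), of "ball x ?r"] Qb v0
              by (intro integral_mono) (auto simp: indicator_def)
          qed
          have "(LINT y|lebesgue. indicator ?Q y * w y) * (LINT y|lebesgue. indicator ?Q y * \<sigma> y) powr (p - 1) \<le> (LINT y|lebesgue. indicator (ball x ?r) y * w y) * (LINT y|lebesgue. indicator (ball x ?r) y * \<sigma> y) powr (p - 1)"
            using le[OF wi wp] le[OF \<sigma>i \<sigma>p] p by (intro mult_mono powr_mono2) auto
          also have "\<dots> \<le> D * measure lebesgue (ball x ?r) powr p" by (rule Ap[OF r])
          also have "measure lebesgue (ball x ?r) = \<Omega> * measure (shifted_space L I) ?Q"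
            unfolding measure_ball_grid[OF L] measure_root_space(1)[OF L x] \<Omega>_def ..
          also have "D * (\<Omega> * measure (shifted_space L I) ?Q) powr p = D' * measure (shifted_space L I) ?Q powr p"
            using \<Omega> by (simp add: powr_mult D'_def)
          finally show "(LINT y|shifted_space L I. indicator ?Q y * w y) * (LINT y|shifted_space L I. indicator ?Q y * \<sigma> y) powr (p - 1) \<le> D' * measure (shifted_space L I) ?Q powr p"
            unfolding root_space_integral_ind[OF L sub] .
        qed (use p D' wp \<sigma>p dual in auto)
        also have "Lp_const p D' = K" unfolding K_def s_def ..
        also have "(\<integral>\<^sup>+x. ennreal (nrm ?g x powr p * w x) \<partial>shifted_space L I) \<le> (\<integral>\<^sup>+x. ennreal (nrm ?g x powr p * w x) \<partial>lebesgue)"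
          by (rule root_space_nn_le[OF L])
        also have "\<dots> \<le> ?R"
        proof (rule nn_integral_mono)
          fix x
          have "ennreal (nrm ?g x powr p * w x) = ennreal (nrm ?g x powr p) * ennreal (w x)"
            using wp[of x] by (intro ennreal_mult) auto
          also have "\<dots> \<le> epowr (sqsum f x) (p / 2) * ennreal (w x)"
            unfolding nrm_def using p by (intro mult_right_mono L2_powr_le_sqsum) auto
          finally show "ennreal (nrm ?g x powr p * w x) \<le> epowr (sqsum f x) (p / 2) * ennreal (w x)" .
        qed
        finally show ?thesis by (simp add: mult_left_mono)
      qed
      have pw: "(?e i x) \<le> (\<Sum>I\<in>Pow Basis. ennreal c * (?s I x))" for x
      proof (cases "x \<in> ball 0 (2 ^ i / 6)")
        case True
        then have x: "x \<in> ball 0 (L / 6)" by (simp add: L_def)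
        have "approx \<alpha> f i x \<le> ennreal (?d x)"
          using dom[OF x, of i "2 * i"] True unfolding approx_def S_def L_def by simp
        then have "epowr (approx \<alpha> f i x) (p / 2) \<le> epowr (ennreal (?d x)) (p / 2)"
          using p by (intro epowr_mono) auto
        also have "\<dots> = ennreal ((?d x) powr (p / 2))"
          using S0 dc p by (intro epowr_ennreal mult_nonneg_nonneg sum_nonneg) auto
        also have "\<dots> \<le> ennreal (c * (\<Sum>I\<in>Pow Basis. S I x powr (p / 2)))"
        proof (rule ennreal_leI)
          have "(?d x) powr (p / 2) = dom_const TYPE('a) powr (p / 2) * (\<Sum>I\<in>Pow Basis. S I x) powr (p / 2)"
            using dc S0 by (simp add: powr_mult sum_nonneg)
          also have "\<dots> \<le> dom_const TYPE('a) powr (p / 2) * (?n powr (p / 2) * (\<Sum>I\<in>Pow Basis. S I x powr (p / 2)))"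
            using S0 p by (intro mult_left_mono sum_powr_le) auto
          finally show "(?d x) powr (p / 2) \<le> c * (\<Sum>I\<in>Pow Basis. S I x powr (p / 2))"
            by (simp add: c_def mult.assoc)
        qed
        finally have "(?e i x) \<le> ennreal (c * (\<Sum>I\<in>Pow Basis. S I x powr (p / 2))) * ennreal (w x)"
          by (rule mult_right_mono) simp
        also have "\<dots> = ennreal (\<Sum>I\<in>Pow Basis. c * (S I x powr (p / 2) * w x))"
          using c0 wp[of x] by (subst ennreal_mult[symmetric]) (auto intro!: sum_nonneg simp: sum_distrib_left sum_distrib_right mult.assoc)
        also have "\<dots> = (\<Sum>I\<in>Pow Basis. ennreal (c * (S I x powr (p / 2) * w x)))"
          using c0 wp[of x] by (intro sum_ennreal[symmetric]) auto
        also have "\<dots> = (\<Sum>I\<in>Pow Basis. ennreal c * (?s I x))"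
        proof (intro sum.cong refl)
          fix I :: "'a set"
          have "x \<in> X I" using ball_sub_root[OF L, of I] x by (auto simp: X_def)
          then show "ennreal (c * (S I x powr (p / 2) * w x)) = ennreal c * (?s I x)"
            using c0 wp[of x] by (simp add: ennreal_mult)
        qed
        finally show ?thesis .
      next
        case False
        then show ?thesis using p by (simp add: approx_def epowr_zero)
      qed
      let ?s = "\<lambda>I x. ennreal (S I x powr (p / 2) * w x) * indicator (X I) x"
      have Fm: "(\<lambda>x. (?s I x)) \<in> borel_measurable lebesgue" for I
        unfolding X_def using Sm[of I] root_space_measurable[OF wm, of "shifted_corner L I" L] by (intro root_space_ind_measurable[OF L]) measurable
      have "(\<integral>\<^sup>+x. (?e i x) \<partial>lebesgue) \<le> (\<integral>\<^sup>+x. (\<Sum>I\<in>Pow Basis. ennreal c * (?s I x)) \<partial>lebesgue)"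
        by (rule nn_integral_mono) (rule pw)
      also have "\<dots> = (\<Sum>I\<in>Pow Basis. \<integral>\<^sup>+x. ennreal c * (?s I x) \<partial>lebesgue)"
        using Fm by (intro nn_integral_sum) auto
      also have "\<dots> \<le> (\<Sum>I\<in>Pow (Basis::'a set). ennreal c * (ennreal K * ?R))"
      proof (rule sum_mono)
        fix I :: "'a set"
        have "(\<integral>\<^sup>+x. ennreal c * (?s I x) \<partial>lebesgue) = ennreal c * (\<integral>\<^sup>+x. (?s I x) \<partial>lebesgue)"
          by (rule nn_integral_cmult[OF Fm])
        also have "(\<integral>\<^sup>+x. (?s I x) \<partial>lebesgue) = (\<integral>\<^sup>+x. ennreal (S I x powr (p / 2) * w x) \<partial>shifted_space L I)"
          unfolding root_space_def X_def using L by (intro nn_integral_restrict_space[symmetric]) simp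
        also have "\<dots> \<le> ennreal K * ?R" by (rule Sb)
        finally show "(\<integral>\<^sup>+x. ennreal c * (?s I x) \<partial>lebesgue) \<le> ennreal c * (ennreal K * ?R)"
          by (simp add: mult_left_mono)
      qed
      also have "\<dots> = ennreal (?n) * (ennreal c * (ennreal K * ?R))" by (simp add: ennreal_of_nat_eq_real_of_nat)
      also have "\<dots> = (ennreal (?n) * ennreal c * ennreal K) * ?R" by (simp only: mult.assoc)
      also have "\<dots> \<le> ennreal C * ?R"
      proof (rule mult_right_mono)
        have "ennreal (?n) * ennreal c * ennreal K \<le> ennreal (?n) * ennreal c * ennreal \<bar>K\<bar>"
          by (intro mult_left_mono ennreal_leI) auto
        also have "\<dots> = ennreal (?n * c * \<bar>K\<bar>)" using c0 by (simp add: ennreal_mult)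
        also have "\<dots> \<le> ennreal C" unfolding C_def by (intro ennreal_leI) (simp add: mult_ac)
        finally show "ennreal (?n) * ennreal c * ennreal K \<le> ennreal C" .
      qed simp
      finally show ?thesis .
    qed
    have "(\<integral>\<^sup>+x. epowr (energy \<alpha> f x) (p / 2) * ennreal (w x) \<partial>lebesgue) = (\<integral>\<^sup>+x. (SUP i. (?e i x)) \<partial>lebesgue)"
      using p by (intro nn_integral_cong) (simp add: approx_SUP[OF f \<alpha>] epowr_SUP SUP_mult_right_ennreal)
    also have "\<dots> = (SUP i. \<integral>\<^sup>+x. (?e i x) \<partial>lebesgue)"
    proof (rule nn_integral_monotone_convergence_SUP)
      show "incseq (\<lambda>i x. (?e i x))"
        using p by (intro incseq_SucI le_funI mult_right_mono epowr_mono incseq_SucD[OF approx_mono]) auto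
      show "(\<lambda>x. (?e i x)) \<in> borel_measurable lebesgue" for i
      proof -
        have [measurable]: "approx \<alpha> f i \<in> borel_measurable lebesgue" by (rule approx_measurable[OF f \<alpha>])
        show ?thesis by measurable
      qed
    qed
    also have "\<dots> \<le> ennreal C * ?R" by (rule SUP_least) (rule step)
    finally show ?thesis .
  qed
  show ?thesis using C main by blast
qed

text \<open>
  The \<open>A_1\<close> condition, tested on all sets that are contained in a ball of given radius around
  each of their points. It covers balls and dyadic cubes alike.
\<close>

definition fat_A1 :: "('a::euclidean_space \<Rightarrow> real) \<Rightarrow> real \<Rightarrow> bool" where
  "fat_A1 w C \<longleftrightarrow> (\<forall>E \<rho>. E \<in> sets lebesgue \<longrightarrow> 0 < \<rho> \<longrightarrow> (\<forall>y\<in>E. E \<subseteq> ball y \<rho>) \<longrightarrow> (\<forall>v\<in>borel_measurable lebesgue.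
     (\<integral>\<^sup>+y\<in>E. ennreal (w y) \<partial>lebesgue) * (\<integral>\<^sup>+y\<in>E. v y \<partial>lebesgue) \<le> ennreal (C * measure lebesgue (ball (0::'a) \<rho>)) * (\<integral>\<^sup>+y\<in>E. (v y * ennreal (w y)) \<partial>lebesgue)))"

text \<open>
  As for the strong type bound, with \<open>weak_type_A1\<close> in each grid. If the energy exceeds \<open>\<theta>\<^sup>2\<close>,
  then \<open>S2\<close> of one of the finitely many grids exceeds \<open>(\<theta> / c)\<^sup>2\<close> for the constant \<open>c\<close> below.
\<close>

lemma global_weak:
  fixes w :: "'a::euclidean_space \<Rightarrow> real"
  assumes \<alpha>: "0 < \<alpha>" "\<alpha> \<le> 1" and D: "0 < D"
    and wm [measurable]: "w \<in> borel_measurable lebesgue" and wp: "\<And>x. 0 < w x" and wi: "locint w" and A1w: "fat_A1 w D"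
  shows "\<exists>C::real. 0 < C \<and> (\<forall>f \<theta>. (\<forall>k. f k \<in> borel_measurable lebesgue) \<longrightarrow> (\<forall>k. locint (\<lambda>z. real_of_ereal (f k z))) \<longrightarrow> 0 < \<theta> \<longrightarrow>
    ennreal \<theta> * (\<integral>\<^sup>+x\<in>{x. ennreal (\<theta>\<^sup>2) < energy \<alpha> f x}. ennreal (w x) \<partial>lebesgue) \<le> ennreal C * (\<integral>\<^sup>+x. epowr (sqsum f x) (1 / 2) * ennreal (w x) \<partial>lebesgue))"
proof -
  define s where "s = 2 powr (- \<alpha>)"
  define \<Omega> where "\<Omega> = unit_ball_vol DIM('a) * (2 * real DIM('a)) ^ DIM('a)"
  have \<Omega>: "0 < \<Omega>" by (simp add: \<Omega>_def)
  define D' where "D' = D * \<Omega>"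
  have D': "0 < D'" using D \<Omega> by (simp add: D'_def)
  define K where "K = dyadic_square.weak_const (2 ^ DIM('a)) s D'"
  define P where "P = Pow (Basis :: 'a set)"
  have P: "finite P" "P \<noteq> {}" by (auto simp: P_def)
  have cP: "0 < real (card P)" using P by (simp add: card_gt_0_iff)
  define c where "c = sqrt ((dom_const TYPE('a) + 1) * real (card P))"
  have dc: "0 \<le> dom_const TYPE('a)" by (simp add: dom_const_def)
  have c0: "0 < c" unfolding c_def using dc cP by (intro real_sqrt_gt_zero mult_pos_pos) auto
  define C where "C = c * real (card P) * \<bar>K\<bar> + 1"
  have C: "0 < C" unfolding C_def using c0 by (intro add_nonneg_pos mult_nonneg_nonneg) auto
  have main: "ennreal \<theta> * (\<integral>\<^sup>+x\<in>{x. ennreal (\<theta>\<^sup>2) < energy \<alpha> f x}. ennreal (w x) \<partial>lebesgue) \<le> ennreal C * (\<integral>\<^sup>+x. epowr (sqsum f x) (1 / 2) * ennreal (w x) \<partial>lebesgue)"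
    if f: "\<And>k. f k \<in> borel_measurable lebesgue" "\<And>k. locint (\<lambda>z. real_of_ereal (f k z))" and \<theta>: "0 < \<theta>" for f \<theta>
  proof -
    let ?R = "\<integral>\<^sup>+x. epowr (sqsum f x) (1 / 2) * ennreal (w x) \<partial>lebesgue"
    let ?E = "\<integral>\<^sup>+x\<in>{x. ennreal (\<theta>\<^sup>2) < energy \<alpha> f x}. ennreal (w x) \<partial>lebesgue"
    let ?A = "\<lambda>i. \<integral>\<^sup>+x\<in>{x. ennreal (\<theta>\<^sup>2) < approx \<alpha> f i x}. ennreal (w x) \<partial>lebesgue"
    let ?S = "\<lambda>i. {x. ennreal (\<theta>\<^sup>2) < approx \<alpha> f i x}"
    have step: "ennreal \<theta> * (?A i) \<le> ennreal C * ?R" for i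
    proof -
      define L where "L = (2::real) ^ i"
      have L: "0 < L" by (simp add: L_def)
      let ?g = "\<lambda>k z. real_of_ereal (f k z)"
      obtain \<psi> where ds: "\<And>I. dyadic_square (shifted_space L I :: 'a measure) (shifted_grid L I) (2 ^ DIM('a)) (2 powr (- \<alpha>)) (\<psi> I)"
        and dom: "\<And>x m J. x \<in> ball 0 (L / 6) \<Longrightarrow> trunc_energy \<alpha> f m (L / 2 ^ J / 32) (L / 16) x
       \<le> ennreal (dom_const TYPE('a) * (\<Sum>I\<in>Pow Basis. dyadic_square.S2 (shifted_space L I) (shifted_grid L I) (\<psi> I) m ?g 0 J x))"
        using energy_domination[OF \<alpha> L, of f] locint_root_space[OF f(2) L] by blast
      define S where "S I x = dyadic_square.S2 (shifted_space L I :: 'a measure) (shifted_grid L I) (\<psi> I) i ?g 0 (2 * i) x" for I x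
      define X where "X I = root_cube (shifted_corner L I :: 'a) L" for I
      have S0: "0 \<le> S I x" for I x unfolding S_def by (rule dyadic_square.S2_nonneg[OF ds])
      have Sm: "S I \<in> borel_measurable (shifted_space L I :: 'a measure)" for I
      proof -
        interpret dyadic_square "(shifted_space L I :: 'a measure)" "shifted_grid L I" "2 ^ DIM('a)" "2 powr (- \<alpha>)" "\<psi> I" i by (rule ds)
        show ?thesis unfolding S_def[abs_def] by (rule adapted_borel[OF adapted_S2])
      qed
      define \<eta> where "\<eta> = \<theta> / c"
      have \<eta>: "0 < \<eta>" using \<theta> c0 by (simp add: \<eta>_def)
      have Sb: "ennreal \<eta> * (\<integral>\<^sup>+x\<in>{x\<in>X I. \<eta>\<^sup>2 < S I x}. ennreal (w x) \<partial>shifted_space L I) \<le> ennreal K * ?R" for I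
      proof -
        interpret dyadic_square "(shifted_space L I :: 'a measure)" "shifted_grid L I" "2 ^ DIM('a)" "2 powr (- \<alpha>)" "\<psi> I" i by (rule ds)
        have "ennreal \<eta> * (\<integral>\<^sup>+x\<in>{x\<in>space (shifted_space L I). \<eta>\<^sup>2 < S I x}. ennreal (w x) \<partial>shifted_space L I) \<le> ennreal (weak_const D') * (\<integral>\<^sup>+x. ennreal (nrm ?g x * w x) \<partial>shifted_space L I)"
          unfolding S_def
        proof (rule weak_type_A1)
          show "integrable (shifted_space L I) (?g k)" for k by (rule locint_root_space[OF f(2) L])
          show "integrable (shifted_space L I) w" by (rule locint_root_space[OF wi L])
          show "w \<in> borel_measurable (shifted_space L I)" by (rule root_space_measurable[OF wm])
          show "shifted_grid L I 0 x = space (shifted_space L I)" if "x \<in> space (shifted_space L I :: 'a measure)" for x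
            using grid_cube_0[OF L, of x "shifted_corner L I"] that by simp
          show "A1 (\<lambda>x. ennreal (w x)) D'" unfolding A1_def
          proof (intro ballI allI)
            fix x j and v :: "'a \<Rightarrow> ennreal" assume "x \<in> space (shifted_space L I :: 'a measure)" and v: "v \<in> borel_measurable (shifted_space L I)"
            then have x: "x \<in> root_cube (shifted_corner L I) L" by simp
            let ?Q = "shifted_grid L I j x" and ?r = "2 * real DIM('a) * (L / 2 ^ j)"
            have sub: "?Q \<subseteq> root_cube (shifted_corner L I) L" by (rule grid_cube_sub_root[OF L x])
            have Qm: "?Q \<in> sets lebesgue" using emeasure_grid_cube(1)[OF L, of "shifted_corner L I" j x] by simp
            define v' where "v' y = v y * indicator (root_cube (shifted_corner L I) L) y" for y
            have v'm: "v' \<in> borel_measurable lebesgue" unfolding v'_def by (rule root_space_ind_measurable[OF L v])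
            have r: "0 < ?r" using L by simp
            have "(\<integral>\<^sup>+y\<in>?Q. ennreal (w y) \<partial>lebesgue) * (\<integral>\<^sup>+y\<in>?Q. v' y \<partial>lebesgue) \<le> ennreal (D * measure lebesgue (ball (0::'a) ?r)) * (\<integral>\<^sup>+y\<in>?Q. (v' y * ennreal (w y)) \<partial>lebesgue)"
              using A1w[unfolded fat_A1_def, rule_format, OF Qm r _ v'm] grid_cube_sub_ball[OF L] by blast
            also have "D * measure lebesgue (ball (0::'a) ?r) = D' * measure (shifted_space L I) ?Q"
              unfolding measure_ball_grid[OF L] measure_root_space(1)[OF L x] D'_def \<Omega>_def by simp
            finally have *: "(\<integral>\<^sup>+y\<in>?Q. ennreal (w y) \<partial>lebesgue) * (\<integral>\<^sup>+y\<in>?Q. v' y \<partial>lebesgue) \<le> ennreal (D' * measure (shifted_space L I) ?Q) * (\<integral>\<^sup>+y\<in>?Q. (v' y * ennreal (w y)) \<partial>lebesgue)" .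
            have tr: "(\<integral>\<^sup>+y\<in>?Q. F y \<partial>shifted_space L I) = (\<integral>\<^sup>+y\<in>?Q. F y \<partial>lebesgue)" for F :: "'a \<Rightarrow> ennreal"
              unfolding root_space_def using L sub by (subst nn_integral_restrict_space) (auto intro!: nn_integral_cong simp: indicator_def)
            have e1: "(\<integral>\<^sup>+y\<in>?Q. v' y \<partial>lebesgue) = (\<integral>\<^sup>+y\<in>?Q. v y \<partial>lebesgue)" "(\<integral>\<^sup>+y\<in>?Q. (v' y * ennreal (w y)) \<partial>lebesgue) = (\<integral>\<^sup>+y\<in>?Q. (v y * ennreal (w y)) \<partial>lebesgue)"
              using sub by (auto intro!: nn_integral_cong simp: v'_def indicator_def)
            show "(\<integral>\<^sup>+y\<in>?Q. ennreal (w y) \<partial>shifted_space L I) * (\<integral>\<^sup>+y\<in>?Q. v y \<partial>shifted_space L I) \<le> ennreal (D' * measure (shifted_space L I) ?Q) * (\<integral>\<^sup>+y\<in>?Q. (v y * ennreal (w y)) \<partial>shifted_space L I)"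
              using * unfolding tr e1 .
          qed
        qed (use D' wp \<eta> in auto)
        also have "weak_const D' = K" unfolding K_def s_def ..
        also have "(\<integral>\<^sup>+x. ennreal (nrm ?g x * w x) \<partial>shifted_space L I) \<le> (\<integral>\<^sup>+x. ennreal (nrm ?g x * w x) \<partial>lebesgue)"
          by (rule root_space_nn_le[OF L])
        also have "\<dots> \<le> ?R"
        proof (rule nn_integral_mono)
          fix x
          have "ennreal (nrm ?g x * w x) = ennreal (nrm ?g x powr 1) * ennreal (w x)"
            using wp[of x] by (subst ennreal_mult[symmetric]) auto
          also have "\<dots> \<le> epowr (sqsum f x) (1 / 2) * ennreal (w x)"
            unfolding nrm_def by (intro mult_right_mono L2_powr_le_sqsum) auto
          finally show "ennreal (nrm ?g x * w x) \<le> epowr (sqsum f x) (1 / 2) * ennreal (w x)" .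
        qed
        finally show ?thesis by (simp add: mult_left_mono X_def)
      qed
      let ?i = "\<lambda>I x. ennreal (w x) * indicator {x\<in>X I. \<eta>\<^sup>2 < S I x} x * indicator (X I) x"
      have pw: "ennreal (w x) * indicator (?S i) x \<le> (\<Sum>I\<in>P. (?i I x))" for x
      proof (cases "ennreal (\<theta>\<^sup>2) < approx \<alpha> f i x")
        case True
        have x: "x \<in> ball 0 (L / 6)"
        proof (rule ccontr)
          assume "x \<notin> ball 0 (L / 6)"
          then have "approx \<alpha> f i x = 0" by (simp add: approx_def L_def)
          then show False using True by simp
        qed
        have "approx \<alpha> f i x \<le> ennreal (dom_const TYPE('a) * (\<Sum>I\<in>P. S I x))"
          using dom[OF x, of i "2 * i"] x unfolding approx_def S_def L_def P_def by simp
        with True have "ennreal (\<theta>\<^sup>2) < ennreal (dom_const TYPE('a) * (\<Sum>I\<in>P. S I x))" by (rule less_le_trans)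
        then have lt: "\<theta>\<^sup>2 < dom_const TYPE('a) * (\<Sum>I\<in>P. S I x)" using \<theta> by (subst (asm) ennreal_less_iff) auto
        have "\<exists>I\<in>P. \<eta>\<^sup>2 < S I x"
        proof (rule ccontr)
          assume "\<not> (\<exists>I\<in>P. \<eta>\<^sup>2 < S I x)"
          then have "(\<Sum>I\<in>P. S I x) \<le> (\<Sum>I\<in>P. \<eta>\<^sup>2)" by (intro sum_mono) (auto simp: not_less)
          then have "dom_const TYPE('a) * (\<Sum>I\<in>P. S I x) \<le> (dom_const TYPE('a) + 1) * (real (card P) * \<eta>\<^sup>2)"
            using dc S0 by (intro mult_mono sum_nonneg) auto
          also have "\<dots> = c\<^sup>2 * \<eta>\<^sup>2" unfolding c_def using dc by (subst real_sqrt_pow2) (auto simp: mult.assoc)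
          also have "\<dots> = \<theta>\<^sup>2" using c0 by (simp add: \<eta>_def power_divide)
          finally show False using lt by simp
        qed
        then obtain I where I: "I \<in> P" "\<eta>\<^sup>2 < S I x" by blast
        have xI: "x \<in> X I" using ball_sub_root[OF L] x unfolding X_def by blast
        have "(?i I x) \<le> (\<Sum>I\<in>P. (?i I x))"
          using I P by (intro member_le_sum) auto
        then show ?thesis using True I xI by simp
      qed simp
      have Fm: "(\<lambda>x. (?i I x)) \<in> borel_measurable lebesgue" for I
      proof -
        have [measurable]: "S I \<in> borel_measurable (shifted_space L I :: 'a measure)" "w \<in> borel_measurable (shifted_space L I)"
          using Sm root_space_measurable[OF wm] by auto
        have "{x\<in>space (shifted_space L I). \<eta>\<^sup>2 < S I x} \<in> sets (shifted_space L I)" by measurable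
        then have [measurable]: "{x\<in>X I. \<eta>\<^sup>2 < S I x} \<in> sets (shifted_space L I)" by (simp add: X_def)
        show ?thesis unfolding X_def[of I, symmetric] using root_space_ind_measurable[OF L, of "\<lambda>x. ennreal (w x) * indicator {x\<in>X I. \<eta>\<^sup>2 < S I x} x" "shifted_corner L I"]
          unfolding X_def[of I, symmetric] by simp
      qed
      have "(?A i) \<le> (\<integral>\<^sup>+x. (\<Sum>I\<in>P. (?i I x)) \<partial>lebesgue)"
        by (rule nn_integral_mono) (rule pw)
      also have "\<dots> = (\<Sum>I\<in>P. \<integral>\<^sup>+x. (?i I x) \<partial>lebesgue)"
        by (rule nn_integral_sum) (rule Fm)
      finally have "ennreal \<theta> * (?A i) \<le> ennreal \<theta> * (\<Sum>I\<in>P. \<integral>\<^sup>+x. (?i I x) \<partial>lebesgue)"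
        by (rule mult_left_mono) simp
      also have "\<dots> = ennreal c * (\<Sum>I\<in>P. ennreal \<eta> * (\<integral>\<^sup>+x. (?i I x) \<partial>lebesgue))"
      proof -
        have "ennreal \<theta> = ennreal c * ennreal \<eta>" using c0 \<eta> by (subst ennreal_mult[symmetric]) (auto simp: \<eta>_def)
        then show ?thesis by (simp add: sum_distrib_left mult.assoc)
      qed
      also have "\<dots> \<le> ennreal c * (\<Sum>I\<in>P. ennreal K * ?R)"
      proof (intro mult_left_mono sum_mono)
        fix I :: "'a set"
        have "(\<integral>\<^sup>+x. (?i I x) \<partial>lebesgue) = (\<integral>\<^sup>+x\<in>{x\<in>X I. \<eta>\<^sup>2 < S I x}. ennreal (w x) \<partial>shifted_space L I)"
          unfolding root_space_def X_def using L by (intro nn_integral_restrict_space[symmetric]) simp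
        then show "ennreal \<eta> * (\<integral>\<^sup>+x. (?i I x) \<partial>lebesgue) \<le> ennreal K * ?R"
          using Sb[of I] by simp
      qed simp
      also have "\<dots> = (ennreal c * ennreal (real (card P)) * ennreal K) * ?R"
        by (simp add: ennreal_of_nat_eq_real_of_nat mult.assoc)
      also have "\<dots> \<le> ennreal C * ?R"
      proof (rule mult_right_mono)
        have "ennreal c * ennreal (real (card P)) * ennreal K \<le> ennreal c * ennreal (real (card P)) * ennreal \<bar>K\<bar>"
          by (intro mult_left_mono ennreal_leI) auto
        also have "\<dots> = ennreal (c * real (card P) * \<bar>K\<bar>)" using c0 by (simp add: ennreal_mult)
        also have "\<dots> \<le> ennreal C" unfolding C_def by (intro ennreal_leI) simp
        finally show "ennreal c * ennreal (real (card P)) * ennreal K \<le> ennreal C" .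
      qed simp
      finally show ?thesis .
    qed
    let ?B = "\<lambda>x. SUP i. ennreal (w x) * indicator (?S i) x"
    have am [measurable]: "approx \<alpha> f i \<in> borel_measurable lebesgue" for i by (rule approx_measurable[OF f \<alpha>])
    have "?E = (\<integral>\<^sup>+x. (?B x) \<partial>lebesgue)"
    proof (rule nn_integral_cong)
      fix x
      show "ennreal (w x) * indicator {x. ennreal (\<theta>\<^sup>2) < energy \<alpha> f x} x = (?B x)"
      proof (cases "\<exists>i. ennreal (\<theta>\<^sup>2) < approx \<alpha> f i x")
        case True
        then obtain i where i: "ennreal (\<theta>\<^sup>2) < approx \<alpha> f i x" by blast
        have "ennreal (\<theta>\<^sup>2) < energy \<alpha> f x" unfolding approx_SUP[OF f \<alpha>] using i by (auto simp: less_SUP_iff)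
        then have "ennreal (w x) * indicator {x. ennreal (\<theta>\<^sup>2) < energy \<alpha> f x} x = ennreal (w x) * indicator (?S i) x" using i by simp
        also have "\<dots> \<le> (?B x)" by (rule SUP_upper) simp
        finally have 1: "ennreal (w x) * indicator {x. ennreal (\<theta>\<^sup>2) < energy \<alpha> f x} x \<le> (?B x)" .
        have "(?B x) \<le> ennreal (w x)" by (rule SUP_least) (auto simp: indicator_def)
        then show ?thesis using 1 \<open>ennreal (\<theta>\<^sup>2) < energy \<alpha> f x\<close> by (intro antisym) auto
      next
        case False
        then have "\<not> ennreal (\<theta>\<^sup>2) < energy \<alpha> f x" unfolding approx_SUP[OF f \<alpha>] by (auto simp: less_SUP_iff)
        then show ?thesis using False by simp
      qed
    qed
    also have "\<dots> = (SUP i. \<integral>\<^sup>+x\<in>(?S i). ennreal (w x) \<partial>lebesgue)"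
    proof (rule nn_integral_monotone_convergence_SUP)
      have "(?S i) \<subseteq> {x. ennreal (\<theta>\<^sup>2) < approx \<alpha> f (Suc i) x}" for i
        by (auto intro: less_le_trans[OF _ incseq_SucD[OF approx_mono]])
      then show "incseq (\<lambda>i x. ennreal (w x) * indicator (?S i) x)"
        by (intro incseq_SucI le_funI mult_left_mono) (auto simp: indicator_def)
    qed measurable
    finally have eq: "?E = (SUP i. \<integral>\<^sup>+x\<in>(?S i). ennreal (w x) \<partial>lebesgue)" .
    show ?thesis unfolding eq by (subst SUP_mult_left_ennreal) (intro SUP_least step)
  qed
  show ?thesis using C main by blast
qed

section \<open>Muckenhoupt weights\<close>

text \<open>
  The value one is put on the null set where the weight vanishes or is infinite.
\<close>

lemma weight_real:
  fixes w :: "'a::euclidean_space \<Rightarrow> ennreal"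
  assumes w: "weight w"
  obtains v :: "'a \<Rightarrow> real" where "v \<in> borel_measurable lebesgue" "\<And>x. 0 < v x" "AE x in lebesgue. w x = ennreal (v x)" "locint v"
proof -
  define v where "v x = (if 0 < w x \<and> w x < \<infinity> then enn2real (w x) else 1)" for x
  have [measurable]: "w \<in> borel_measurable lebesgue" using w by (simp add: weight_def)
  have vm [measurable]: "v \<in> borel_measurable lebesgue" unfolding v_def by measurable
  have vp: "0 < v x" for x by (auto simp: v_def enn2real_positive_iff)
  have ae: "AE x in lebesgue. w x = ennreal (v x)"
  proof -
    have "AE x in lebesgue. 0 < w x \<and> w x < \<infinity>" using w by (simp add: weight_def)
    then show ?thesis by (rule AE_mp) (auto intro!: AE_I2 simp: v_def)
  qed
  have "integrable lebesgue (\<lambda>z. indicator (ball 0 R) z * v z)" for R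
  proof (rule integrableI_bounded)
    have "(\<integral>\<^sup>+z. ennreal (norm (indicator (ball 0 R) z * v z)) \<partial>lebesgue) \<le> (\<integral>\<^sup>+z\<in>cball 0 R. w z \<partial>lebesgue)"
    proof (rule nn_integral_mono_AE, rule AE_mp[OF ae], rule AE_I2, rule impI)
      fix z assume "w z = ennreal (v z)"
      then show "ennreal (norm (indicator (ball 0 R) z * v z)) \<le> w z * indicator (cball 0 R) z"
        using vp[of z] by (auto simp: indicator_def)
    qed
    also have "\<dots> < \<infinity>" using w compact_cball[of 0 R] unfolding weight_def by blast
    finally show "(\<integral>\<^sup>+z. ennreal (norm (indicator (ball 0 R) z * v z)) \<partial>lebesgue) < \<infinity>" .
    show "(\<lambda>z. indicator (ball 0 R) z * v z) \<in> borel_measurable lebesgue"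
      by (intro borel_measurable_times borel_measurable_indicator vm) simp
  qed
  then have "locint v" by (simp add: locint_def)
  then show ?thesis using that vm vp ae by blast
qed

lemma nn_integral_AE_weight:
  assumes "AE x in lebesgue. w x = ennreal (v x)"
  shows "(\<integral>\<^sup>+x. F x * w x \<partial>lebesgue) = (\<integral>\<^sup>+x. F x * ennreal (v x) \<partial>lebesgue)"
    and "(\<integral>\<^sup>+x\<in>E. w x \<partial>lebesgue) = (\<integral>\<^sup>+x\<in>E. ennreal (v x) \<partial>lebesgue)"
    and "(\<integral>\<^sup>+x\<in>E. (F x * w x) \<partial>lebesgue) = (\<integral>\<^sup>+x\<in>E. (F x * ennreal (v x)) \<partial>lebesgue)"
  by (rule nn_integral_cong_AE, use assms in auto)+

lemma locint_nn_integral_ball: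
  fixes v :: "'a::euclidean_space \<Rightarrow> real"
  assumes v: "locint v" "\<And>x. 0 < v x"
  shows "(\<integral>\<^sup>+y\<in>ball x r. ennreal (v y) \<partial>lebesgue) = ennreal (LINT y|lebesgue. indicator (ball x r) y * v y)"
proof -
  have "(\<integral>\<^sup>+y\<in>ball x r. ennreal (v y) \<partial>lebesgue) = (\<integral>\<^sup>+y. ennreal (indicator (ball x r) y * v y) \<partial>lebesgue)"
    by (rule nn_integral_cong) (auto simp: indicator_def)
  also have "\<dots> = ennreal (LINT y|lebesgue. indicator (ball x r) y * v y)"
    using v(2) by (intro nn_integral_eq_integral locint_bounded[OF v(1)]) (auto simp: indicator_def less_imp_le)
  finally show ?thesis .
qed

lemma locint_integral_ball_pos:
  fixes v :: "'a::euclidean_space \<Rightarrow> real"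
  assumes v: "locint v" "\<And>x. 0 < v x" and r: "0 < r"
  shows "0 < (LINT y|lebesgue. indicator (ball x r) y * v y)"
proof -
  have i: "integrable lebesgue (\<lambda>y. indicator (ball x r) y * v y)" by (rule locint_bounded[OF v(1)]) auto
  have nn: "0 \<le> indicator (ball x r) y * v y" for y using v(2)[of y] by (auto simp: indicator_def)
  have "(LINT y|lebesgue. indicator (ball x r) y * v y) \<noteq> 0"
  proof
    assume "(LINT y|lebesgue. indicator (ball x r) y * v y) = 0"
    then have "AE y in lebesgue. indicator (ball x r) y * v y = 0"
      by (subst (asm) integral_nonneg_eq_0_iff_AE[OF i]) (use nn in auto)
    then have "AE y in lebesgue. y \<notin> ball x r"
    proof (rule AE_mp, intro AE_I2 impI)
      fix y assume "indicator (ball x r) y * v y = 0"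
      then show "y \<notin> ball x r" using v(2)[of y] by (auto simp: indicator_def split: if_splits)
    qed
    then have "ball x r \<in> null_sets lebesgue" by (subst (asm) AE_iff_null_sets[symmetric]) auto
    then have "emeasure lebesgue (ball x r) = 0" by auto
    then show False using r unit_ball_vol_pos[of "real DIM('a)"] by (simp add: emeasure_ball)
  qed
  moreover have "0 \<le> (LINT y|lebesgue. indicator (ball x r) y * v y)" by (rule integral_nonneg_AE) (use nn in auto)
  ultimately show ?thesis by simp
qed

lemma wmeas_ball:
  fixes w :: "'a::euclidean_space \<Rightarrow> ennreal"
  assumes w: "weight w" and r: "0 < r"
  shows "0 < wmeas w (ball x r)" "wmeas w (ball x r) < \<infinity>"
proof -
  obtain v where v: "v \<in> borel_measurable lebesgue" "\<And>x. 0 < v x" "AE x in lebesgue. w x = ennreal (v x)" "locint v"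
    using weight_real[OF w] by blast
  have "wmeas w (ball x r) = ennreal (LINT y|lebesgue. indicator (ball x r) y * v y)"
    unfolding wmeas_def nn_integral_AE_weight(2)[OF v(3)] by (rule locint_nn_integral_ball[OF v(4,2)])
  then show "0 < wmeas w (ball x r)" "wmeas w (ball x r) < \<infinity>" using locint_integral_ball_pos[OF v(4,2) r] by auto
qed

text \<open>
  The dual weight is \<open>\<sigma> = v powr (1 - p')\<close>. Its integrals over balls are finite, since otherwise
  the supremum in the \<open>A_p\<close> condition would be infinite.
\<close>

lemma Muckenhoupt_dual:
  fixes w :: "'a::euclidean_space \<Rightarrow> ennreal"
  assumes p: "1 < p" and w: "w \<in> Muckenhoupt p"
    and v: "v \<in> borel_measurable lebesgue" "\<And>x. 0 < v x" "AE x in lebesgue. w x = ennreal (v x)" "locint v"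
  obtains \<sigma> :: "'a \<Rightarrow> real" and D :: real where "0 < D" "\<sigma> \<in> borel_measurable lebesgue" "\<And>x. 0 < \<sigma> x" "\<And>x. \<sigma> x powr (p - 1) * v x = 1" "locint \<sigma>"
    "\<And>x r. 0 < r \<Longrightarrow> (LINT y|lebesgue. indicator (ball x r) y * v y) * (LINT y|lebesgue. indicator (ball x r) y * \<sigma> y) powr (p - 1) \<le> D * measure lebesgue (ball x r) powr p"
proof -
  define e where "e = 1 - conj_exponent p"
  have e: "e * (p - 1) = - 1" "e \<noteq> 0" using p by (auto simp: e_def conj_exponent_def field_simps)
  define \<sigma> where "\<sigma> x = v x powr e" for x
  have \<sigma>m [measurable]: "\<sigma> \<in> borel_measurable lebesgue" unfolding \<sigma>_def[abs_def] using v(1) by measurable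
  have \<sigma>p: "0 < \<sigma> x" for x using v(2)[of x] by (simp add: \<sigma>_def)
  have dual: "\<sigma> x powr (p - 1) * v x = 1" for x
    using v(2)[of x] by (simp add: \<sigma>_def powr_powr e powr_minus)
  define S where "S = (SUP x. SUP r\<in>{0<..}. ball_mean w x r * epowr (ball_mean (\<lambda>y. epowr (w y) e) x r) (p - 1))"
  have S: "S < \<infinity>" using w p unfolding Muckenhoupt_def S_def e_def by auto
  let ?V = "\<lambda>x r. \<integral>\<^sup>+y\<in>ball x r. ennreal (\<sigma> y) \<partial>lebesgue"
  define W where "W x r = (LINT y|lebesgue. indicator (ball x r) y * v y)" for x r
  define B where "B r = measure lebesgue (ball (0::'a) r)" for r
  have Bx: "measure lebesgue (ball x r) = B r" "emeasure lebesgue (ball x r) = ennreal (B r)" if "0 < r" for x :: 'a and r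
    using that unfolding B_def by (simp_all add: content_ball emeasure_ball)
  have B0: "0 < B r" if "0 < r" for r using that unfolding B_def by (simp add: content_ball)
  have W0: "0 < W x r" if "0 < r" for x r unfolding W_def using locint_integral_ball_pos[OF v(4,2) that] .
  have mw: "ball_mean w x r = ennreal (W x r / B r)" if r: "0 < r" for x r
    unfolding ball_mean_def nn_integral_AE_weight(2)[OF v(3)] locint_nn_integral_ball[OF v(4,2)] Bx[OF r] W_def[symmetric]
    using W0[OF r, of x] B0[OF r] by (simp add: divide_ennreal)
  have s\<sigma>: "(\<integral>\<^sup>+y\<in>ball x r. epowr (w y) e \<partial>lebesgue) = (?V x r)" for x r
  proof (rule nn_integral_cong_AE, rule AE_mp[OF v(3)], intro AE_I2 impI)
    fix y assume "w y = ennreal (v y)"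
    then show "epowr (w y) e * indicator (ball x r) y = ennreal (\<sigma> y) * indicator (ball x r) y"
      using v(2)[of y] e by (simp add: epowr_def \<sigma>_def)
  qed
  have le: "ennreal (W x r / B r) * epowr ((?V x r) / ennreal (B r)) (p - 1) \<le> S" if r: "0 < r" for x r
  proof -
    have "ball_mean w x r * epowr (ball_mean (\<lambda>y. epowr (w y) e) x r) (p - 1) \<le> S"
      unfolding S_def by (rule SUP_upper2[where i=x], simp, rule SUP_upper2[where i=r]) (use r in auto)
    moreover have "ball_mean (\<lambda>y. epowr (w y) e) x r = (?V x r) / ennreal (B r)"
      unfolding ball_mean_def s\<sigma> Bx[OF r] ..
    ultimately show ?thesis by (simp add: mw[OF r])
  qed
  have fin: "(?V x r) < \<infinity>" if r: "0 < r" for x r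
  proof (rule ccontr)
    assume "\<not> ?thesis"
    then have inf: "(?V x r) = \<infinity>" by (simp add: less_top[symmetric])
    have "ennreal (W x r / B r) * epowr (\<infinity> / ennreal (B r)) (p - 1) \<le> S" using le[OF r, of x] unfolding inf .
    moreover have "epowr (\<infinity> / ennreal (B r)) (p - 1) = \<infinity>" using p by (simp add: ennreal_top_divide epowr_top[simplified])
    moreover have "ennreal (W x r / B r) \<noteq> 0" using W0[OF r, of x] B0[OF r] by simp
    ultimately show False using S by (simp add: ennreal_mult_top top_unique)
  qed
  have \<sigma>l: "locint \<sigma>"
    unfolding locint_def
  proof
    fix R :: real
    show "integrable lebesgue (\<lambda>z. indicator (ball 0 R) z * \<sigma> z)"
    proof (rule integrableI_bounded)
      have "(\<integral>\<^sup>+z. ennreal (norm (indicator (ball 0 R) z * \<sigma> z)) \<partial>lebesgue) \<le> (\<integral>\<^sup>+y\<in>ball 0 (max R 1). ennreal (\<sigma> y) \<partial>lebesgue)"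
        using \<sigma>p by (intro nn_integral_mono) (auto simp: indicator_def abs_of_pos)
      also have "\<dots> < \<infinity>" by (rule fin) simp
      finally show "(\<integral>\<^sup>+z. ennreal (norm (indicator (ball 0 R) z * \<sigma> z)) \<partial>lebesgue) < \<infinity>" .
      show "(\<lambda>z. indicator (ball 0 R) z * \<sigma> z) \<in> borel_measurable lebesgue"
        by (intro borel_measurable_times borel_measurable_indicator \<sigma>m) simp
    qed
  qed
  define D where "D = enn2real S + 1"
  have D: "0 < D" by (simp add: D_def add_nonneg_pos)
  have SD: "S \<le> ennreal D" using S unfolding D_def by (cases S) (auto intro!: ennreal_leI)
  have "W x r * (LINT y|lebesgue. indicator (ball x r) y * \<sigma> y) powr (p - 1) \<le> D * measure lebesgue (ball x r) powr p" if r: "0 < r" for x r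
  proof -
    define V where "V = (LINT y|lebesgue. indicator (ball x r) y * \<sigma> y)"
    have V: "0 < V" unfolding V_def by (rule locint_integral_ball_pos[OF \<sigma>l \<sigma>p r])
    have "ennreal (W x r / B r) * epowr (ennreal V / ennreal (B r)) (p - 1) \<le> S"
      using le[OF r, of x] unfolding locint_nn_integral_ball[OF \<sigma>l \<sigma>p] V_def .
    also have "ennreal V / ennreal (B r) = ennreal (V / B r)" using V B0[OF r] by (simp add: divide_ennreal)
    also have "epowr (ennreal (V / B r)) (p - 1) = ennreal ((V / B r) powr (p - 1))" using V B0[OF r] p by (intro epowr_ennreal) auto
    also have "ennreal (W x r / B r) * \<dots> = ennreal (W x r / B r * (V / B r) powr (p - 1))"
      using W0[OF r, of x] B0[OF r] by (intro ennreal_mult[symmetric]) auto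
    finally have "ennreal (W x r / B r * (V / B r) powr (p - 1)) \<le> ennreal D" using SD by (rule order_trans)
    then have "W x r / B r * (V / B r) powr (p - 1) \<le> D" using D by (subst (asm) ennreal_le_iff) auto
    then have "W x r * V powr (p - 1) / (B r * B r powr (p - 1)) \<le> D" using V B0[OF r] by (simp add: powr_divide)
    moreover have "B r * B r powr (p - 1) = B r powr p" using B0[OF r] powr_add[of "B r" 1 "p - 1"] by simp
    ultimately have "W x r * V powr (p - 1) / B r powr p \<le> D" by simp
    then have "W x r * V powr (p - 1) \<le> D * B r powr p" using B0[OF r] by (simp add: divide_le_eq)
    then show ?thesis unfolding V_def Bx(1)[OF r] .
  qed
  then show ?thesis using that[OF D \<sigma>m \<sigma>p dual \<sigma>l] unfolding W_def by blast
qed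

text \<open>
  For \<open>y \<in> E\<close> the mass of \<open>E\<close> is at most that of \<open>ball y \<rho>\<close>, which the maximal function at \<open>y\<close>
  controls.
\<close>

lemma Muckenhoupt_1_fat_A1:
  fixes w :: "'a::euclidean_space \<Rightarrow> ennreal"
  assumes w: "w \<in> Muckenhoupt 1"
    and v: "v \<in> borel_measurable lebesgue" "\<And>x. 0 < v x" "AE x in lebesgue. w x = ennreal (v x)"
  obtains D :: real where "0 < D" "fat_A1 v D"
proof -
  obtain C :: real where C: "AE x in lebesgue. HL_maximal w x \<le> ennreal C * w x" using w unfolding Muckenhoupt_def by auto
  define D where "D = max C 1"
  have "fat_A1 v D" unfolding fat_A1_def
  proof (intro allI impI ballI)
    fix E :: "'a set" and \<rho> :: real and u :: "'a \<Rightarrow> ennreal"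
    assume E: "E \<in> sets lebesgue" and \<rho>: "0 < \<rho>" and sub: "\<forall>y\<in>E. E \<subseteq> ball y \<rho>" and u: "u \<in> borel_measurable lebesgue"
    let ?W = "\<integral>\<^sup>+y\<in>E. ennreal (v y) \<partial>lebesgue" and ?B = "measure lebesgue (ball (0::'a) \<rho>)"
    have B: "emeasure lebesgue (ball y \<rho>) = ennreal ?B" for y :: 'a using \<rho> by (simp add: content_ball emeasure_ball)
    have B0: "0 < ?B" using \<rho> by (simp add: content_ball)
    have pt: "?W \<le> ennreal (D * ?B) * ennreal (v y)" if y: "y \<in> E" "HL_maximal w y \<le> ennreal C * w y" "w y = ennreal (v y)" for y
    proof -
      have "?W = (\<integral>\<^sup>+y\<in>E. w y \<partial>lebesgue)" using nn_integral_AE_weight(2)[OF v(3)] by simp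
      also have "\<dots> \<le> (\<integral>\<^sup>+z\<in>ball y \<rho>. w z \<partial>lebesgue)" using bspec[OF sub y(1)] by (intro nn_integral_mono) (auto simp: indicator_def)
      also have "\<dots> = ball_mean w y \<rho> * ennreal ?B"
        unfolding ball_mean_def B using B0 by (simp add: ennreal_divide_times)
      also have "\<dots> \<le> HL_maximal w y * ennreal ?B"
        unfolding HL_maximal_def using \<rho> by (intro mult_right_mono SUP_upper) auto
      also have "\<dots> \<le> (ennreal D * ennreal (v y)) * ennreal ?B"
        using y by (intro mult_right_mono order_trans[OF y(2)]) (auto simp: D_def intro!: mult_right_mono ennreal_leI)
      also have "\<dots> = ennreal (D * ?B) * ennreal (v y)" by (simp add: ennreal_mult D_def mult_ac)
      finally show ?thesis .
    qed
    have "?W * (\<integral>\<^sup>+y\<in>E. u y \<partial>lebesgue) = (\<integral>\<^sup>+y. ?W * (u y * indicator E y) \<partial>lebesgue)"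
      using E u by (intro nn_integral_cmult[symmetric]) auto
    also have "\<dots> \<le> (\<integral>\<^sup>+y. ennreal (D * ?B) * (u y * ennreal (v y) * indicator E y) \<partial>lebesgue)"
    proof (rule nn_integral_mono_AE, rule AE_mp[OF C], rule AE_mp[OF v(3)], intro AE_I2 impI)
      fix y assume "w y = ennreal (v y)" "HL_maximal w y \<le> ennreal C * w y"
      then have "?W * u y \<le> ennreal (D * ?B) * ennreal (v y) * u y" if "y \<in> E" using pt[OF that] by (intro mult_right_mono) auto
      then show "?W * (u y * indicator E y) \<le> ennreal (D * ?B) * (u y * ennreal (v y) * indicator E y)"
        by (auto simp: indicator_def mult_ac)
    qed
    also have "\<dots> = ennreal (D * ?B) * (\<integral>\<^sup>+y\<in>E. (u y * ennreal (v y)) \<partial>lebesgue)"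
      using E u v(1) by (intro nn_integral_cmult) auto
    finally show "?W * (\<integral>\<^sup>+y\<in>E. u y \<partial>lebesgue) \<le> ennreal (D * ?B) * (\<integral>\<^sup>+y\<in>E. (u y * ennreal (v y)) \<partial>lebesgue)" .
  qed
  then show ?thesis using that[of D] by (simp add: D_def)
qed

text \<open>
  Means are bounded by weighted \<open>L^p\<close> means. The local estimates below use the Muckenhoupt
  condition through this inequality and through the global bound only.
\<close>

definition avg_ineq :: "real \<Rightarrow> ('a::euclidean_space \<Rightarrow> ennreal) \<Rightarrow> real \<Rightarrow> bool" where
  "avg_ineq p w A \<longleftrightarrow> (\<forall>x r. 0 < r \<longrightarrow> (\<forall>u\<in>borel_measurable lebesgue.
     (\<integral>\<^sup>+y\<in>ball x r. u y \<partial>lebesgue) * epowr (wmeas w (ball x r)) (1 / p)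
     \<le> ennreal (A * measure lebesgue (ball x r)) * epowr (\<integral>\<^sup>+y\<in>ball x r. (epowr (u y) p * w y) \<partial>lebesgue) (1 / p)))"

lemma avg_ineq_1:
  fixes w :: "'a::euclidean_space \<Rightarrow> ennreal"
  assumes v: "AE x in lebesgue. w x = ennreal (v x)" and A1: "fat_A1 v D" and D: "0 < D"
  shows "avg_ineq 1 w (D * 2 ^ DIM('a))"
  unfolding avg_ineq_def
proof (intro allI impI ballI)
  fix x :: 'a and r :: real and u :: "'a \<Rightarrow> ennreal" assume r: "0 < r" and u: "u \<in> borel_measurable lebesgue"
  have sub: "\<forall>y\<in>ball x r. ball x r \<subseteq> ball y (2 * r)"
  proof (intro ballI subsetI)
    fix y z assume "y \<in> ball x r" "z \<in> ball x r"
    then show "z \<in> ball y (2 * r)" using dist_triangle[of y z x] by (simp add: dist_commute)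
  qed
  have "(\<integral>\<^sup>+y\<in>ball x r. ennreal (v y) \<partial>lebesgue) * (\<integral>\<^sup>+y\<in>ball x r. u y \<partial>lebesgue) \<le> ennreal (D * measure lebesgue (ball (0::'a) (2 * r))) * (\<integral>\<^sup>+y\<in>ball x r. (u y * ennreal (v y)) \<partial>lebesgue)"
    using A1 sub r u unfolding fat_A1_def by simp
  also have "D * measure lebesgue (ball (0::'a) (2 * r)) = D * 2 ^ DIM('a) * measure lebesgue (ball x r)"
    using r by (simp add: content_ball power_mult_distrib)
  finally show "(\<integral>\<^sup>+y\<in>ball x r. u y \<partial>lebesgue) * epowr (wmeas w (ball x r)) (1 / 1)
     \<le> ennreal (D * 2 ^ DIM('a) * measure lebesgue (ball x r)) * epowr (\<integral>\<^sup>+y\<in>ball x r. (epowr (u y) 1 * w y) \<partial>lebesgue) (1 / 1)"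
    unfolding wmeas_def nn_integral_AE_weight(2)[OF v] using nn_integral_AE_weight(3)[OF v, of u "ball x r"]
    by (simp add: mult.commute)
qed

text \<open>
  Hoelder's inequality in the form of \<open>young_split\<close>, followed by the \<open>A_p\<close> condition.
\<close>

lemma avg_ineq_gt1:
  fixes w :: "'a::euclidean_space \<Rightarrow> ennreal"
  assumes p: "1 < p" and D: "0 < D"
    and v: "v \<in> borel_measurable lebesgue" "\<And>x. 0 < v x" "AE x in lebesgue. w x = ennreal (v x)" "locint v"
    and \<sigma>: "\<sigma> \<in> borel_measurable lebesgue" "\<And>x. 0 < \<sigma> x" "\<And>x. \<sigma> x powr (p - 1) * v x = 1" "locint \<sigma>"
    and Ap: "\<And>x r. 0 < r \<Longrightarrow> (LINT y|lebesgue. indicator (ball x r) y * v y) * (LINT y|lebesgue. indicator (ball x r) y * \<sigma> y) powr (p - 1) \<le> D * measure lebesgue (ball x r) powr p"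
  shows "avg_ineq p w (2 * D powr (1 / p))"
  unfolding avg_ineq_def
proof (intro allI impI ballI)
  fix x :: 'a and r :: real and u :: "'a \<Rightarrow> ennreal" assume r: "0 < r" and um: "u \<in> borel_measurable lebesgue"
  define W where "W = (LINT y|lebesgue. indicator (ball x r) y * v y)"
  define V where "V = (LINT y|lebesgue. indicator (ball x r) y * \<sigma> y)"
  define B where "B = measure lebesgue (ball x r)"
  have pos: "0 < W" "0 < V" "0 < B" unfolding W_def V_def B_def
    using locint_integral_ball_pos[OF v(4,2) r] locint_integral_ball_pos[OF \<sigma>(4,2) r] r by (auto simp: content_ball)
  define U where "U = (\<integral>\<^sup>+y\<in>ball x r. u y \<partial>lebesgue)"
  define F where "F = (\<integral>\<^sup>+y\<in>ball x r. (epowr (u y) p * ennreal (v y)) \<partial>lebesgue)"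
  have [measurable]: "ball x r \<in> sets lebesgue" by simp
  have [measurable]: "u \<in> borel_measurable lebesgue" "v \<in> borel_measurable lebesgue" "\<sigma> \<in> borel_measurable lebesgue" using um v \<sigma> by auto
  have split: "U \<le> ennreal t * ennreal V + ennreal (t powr (1 - p)) * F" if t: "0 < t" for t
  proof -
    have pt: "u y \<le> ennreal t * ennreal (\<sigma> y) + ennreal (t powr (1 - p)) * (epowr (u y) p * ennreal (v y))" for y
    proof (cases "u y")
      case (real q)
      have "q \<le> t * \<sigma> y + t powr (1 - p) * (q powr p * v y)"
        using young_split[OF real(1) \<sigma>(2) v(2) \<sigma>(3) p t] .
      then have "ennreal q \<le> ennreal (t * \<sigma> y + t powr (1 - p) * (q powr p * v y))" by (rule ennreal_leI)
      also have "\<dots> = ennreal t * ennreal (\<sigma> y) + ennreal (t powr (1 - p)) * ennreal (q powr p * v y)"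
        using t \<sigma>(2)[of y] v(2)[of y] by (intro ennreal_lincomb) auto
      also have "ennreal (q powr p * v y) = epowr (u y) p * ennreal (v y)"
        using real p v(2)[of y] by (simp add: epowr_ennreal ennreal_mult)
      finally show ?thesis using real by simp
    next
      case top
      have "epowr (u y) p * ennreal (v y) = \<infinity>" using v(2)[of y] p by (simp add: top epowr_top[simplified] ennreal_top_mult)
      then show ?thesis using t by (simp add: ennreal_mult_top)
    qed
    have "U \<le> (\<integral>\<^sup>+y. ennreal t * (ennreal (\<sigma> y) * indicator (ball x r) y) + ennreal (t powr (1 - p)) * (epowr (u y) p * ennreal (v y) * indicator (ball x r) y) \<partial>lebesgue)"
      unfolding U_def using pt by (intro nn_integral_mono) (auto simp: indicator_def)
    also have "\<dots> = (\<integral>\<^sup>+y. ennreal t * (ennreal (\<sigma> y) * indicator (ball x r) y) \<partial>lebesgue) + (\<integral>\<^sup>+y. ennreal (t powr (1 - p)) * (epowr (u y) p * ennreal (v y) * indicator (ball x r) y) \<partial>lebesgue)"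
      by (rule nn_integral_add) measurable
    also have "(\<integral>\<^sup>+y. ennreal t * (ennreal (\<sigma> y) * indicator (ball x r) y) \<partial>lebesgue) = ennreal t * (\<integral>\<^sup>+y\<in>ball x r. ennreal (\<sigma> y) \<partial>lebesgue)"
      by (rule nn_integral_cmult) measurable
    also have "(\<integral>\<^sup>+y. ennreal (t powr (1 - p)) * (epowr (u y) p * ennreal (v y) * indicator (ball x r) y) \<partial>lebesgue) = ennreal (t powr (1 - p)) * F"
      unfolding F_def by (rule nn_integral_cmult) measurable
    also have "(\<integral>\<^sup>+y\<in>ball x r. ennreal (\<sigma> y) \<partial>lebesgue) = ennreal V" unfolding V_def by (rule locint_nn_integral_ball[OF \<sigma>(4,2)])
    finally show ?thesis .
  qed
  have root: "W powr (1 / p) * V powr (1 - 1 / p) \<le> D powr (1 / p) * B"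
  proof -
    have "(W * V powr (p - 1)) powr (1 / p) \<le> (D * B powr p) powr (1 / p)"
      using Ap[OF r, of x] pos p unfolding W_def[symmetric] V_def[symmetric] B_def[symmetric] by (intro powr_mono2) auto
    then show ?thesis using pos D p by (simp add: powr_mult powr_powr diff_divide_distrib)
  qed
  have "U * ennreal (W powr (1 / p)) \<le> ennreal (2 * D powr (1 / p) * B) * epowr F (1 / p)"
  proof (cases F)
    case (real f)
    have Ufin: "U < \<infinity>" using split[of 1] real by (auto simp: ennreal_mult[symmetric] ennreal_plus[symmetric] simp del: ennreal_plus intro: le_less_trans)
    then obtain a where a: "U = ennreal a" "0 \<le> a" by (cases U) auto
    have sp: "a \<le> t * V + t powr (1 - p) * f" if t: "0 < t" for t
    proof -
      have "ennreal a \<le> ennreal (t * V + t powr (1 - p) * f)"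
        using split[OF t] ennreal_lincomb[of t "t powr (1 - p)" V f] t pos real a by simp
      then show ?thesis using t pos real by (subst (asm) ennreal_le_iff) (auto intro!: add_nonneg_nonneg)
    qed
    have "a \<le> 2 * (f powr (1 / p) * V powr (1 - 1 / p))"
    proof (cases "f = 0")
      case True
      have "a \<le> 0"
      proof (rule field_le_epsilon)
        fix e :: real assume "0 < e"
        then show "a \<le> 0 + e" using sp[of "e / V"] pos True by simp
      qed
      then show ?thesis using True p by simp
    next
      case False
      then show ?thesis using young_split_optimize[of a V p f] sp pos p real by auto
    qed
    then have "a * W powr (1 / p) \<le> 2 * (f powr (1 / p) * V powr (1 - 1 / p)) * W powr (1 / p)" by (intro mult_right_mono) auto
    also have "\<dots> = 2 * f powr (1 / p) * (W powr (1 / p) * V powr (1 - 1 / p))" by (simp add: mult_ac)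
    also have "\<dots> \<le> 2 * f powr (1 / p) * (D powr (1 / p) * B)" using root by (intro mult_left_mono) auto
    finally have "ennreal (a * W powr (1 / p)) \<le> ennreal (2 * D powr (1 / p) * B * f powr (1 / p))" by (intro ennreal_leI) (simp add: mult_ac)
    moreover have "ennreal (a * W powr (1 / p)) = U * ennreal (W powr (1 / p))" using a by (simp add: ennreal_mult)
    moreover have "ennreal (2 * D powr (1 / p) * B * f powr (1 / p)) = ennreal (2 * D powr (1 / p) * B) * epowr F (1 / p)"
      using real p pos by (simp add: epowr_ennreal ennreal_mult)
    ultimately show ?thesis by simp
  next
    case top
    then have "epowr F (1 / p) = \<infinity>" using p by (simp add: epowr_top[simplified])
    moreover have "ennreal (2 * D powr (1 / p) * B) \<noteq> 0" using D pos by simp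
    ultimately show ?thesis by (simp add: ennreal_mult_top)
  qed
  moreover have "epowr (wmeas w (ball x r)) (1 / p) = ennreal (W powr (1 / p))"
    unfolding wmeas_def nn_integral_AE_weight(2)[OF v(3)] locint_nn_integral_ball[OF v(4,2)] W_def[symmetric] using pos p by (simp add: epowr_ennreal)
  ultimately show "(\<integral>\<^sup>+y\<in>ball x r. u y \<partial>lebesgue) * epowr (wmeas w (ball x r)) (1 / p)
     \<le> ennreal (2 * D powr (1 / p) * measure lebesgue (ball x r)) * epowr (\<integral>\<^sup>+y\<in>ball x r. (epowr (u y) p * w y) \<partial>lebesgue) (1 / p)"
    unfolding nn_integral_AE_weight(3)[OF v(3)] U_def F_def B_def by simp
qed

text \<open>
  The averaging inequality is applied on the large ball to the indicator function of the small
  one.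
\<close>

lemma doubling:
  fixes w :: "'a::euclidean_space \<Rightarrow> ennreal"
  assumes A: "avg_ineq p w A" "0 < A" and p: "1 \<le> p" and r: "0 < r" and w: "w \<in> borel_measurable lebesgue"
  shows "epowr (wmeas w (ball x (2 * r))) (1 / p) \<le> ennreal (A * 2 ^ DIM('a)) * epowr (wmeas w (ball x r)) (1 / p)"
proof -
  define B where "B = measure lebesgue (ball x r)"
  have B0: "0 < B" using r by (simp add: B_def content_ball)
  have "(\<integral>\<^sup>+y\<in>ball x (2 * r). indicator (ball x r) y \<partial>lebesgue) * epowr (wmeas w (ball x (2 * r))) (1 / p)
     \<le> ennreal (A * measure lebesgue (ball x (2 * r))) * epowr (\<integral>\<^sup>+y\<in>ball x (2 * r). (epowr (indicator (ball x r) y) p * w y) \<partial>lebesgue) (1 / p)"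
    using A(1)[unfolded avg_ineq_def, rule_format, of "2 * r" "indicator (ball x r)" x] r borel_measurable_indicator[of "ball x r" lebesgue] by simp
  also have "(\<integral>\<^sup>+y\<in>ball x (2 * r). indicator (ball x r) y \<partial>lebesgue) = (\<integral>\<^sup>+y. indicator (ball x r) y \<partial>lebesgue)"
    using r by (intro nn_integral_cong) (auto simp: indicator_def)
  also have "\<dots> = ennreal B" using r by (simp add: B_def emeasure_ball content_ball)
  also have "measure lebesgue (ball x (2 * r)) = 2 ^ DIM('a) * B" using r by (simp add: B_def content_ball power_mult_distrib)
  also have "(\<integral>\<^sup>+y\<in>ball x (2 * r). (epowr (indicator (ball x r) y) p * w y) \<partial>lebesgue) = wmeas w (ball x r)"
    unfolding wmeas_def using r p by (intro nn_integral_cong) (auto simp: indicator_def epowr_def)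
  also have "ennreal (A * (2 ^ DIM('a) * B)) * epowr (wmeas w (ball x r)) (1 / p) = ennreal B * (ennreal (A * 2 ^ DIM('a)) * epowr (wmeas w (ball x r)) (1 / p))"
  proof -
    have "ennreal (A * (2 ^ DIM('a) * B)) = ennreal (B * (A * 2 ^ DIM('a)))" by (simp only: mult_ac)
    also have "\<dots> = ennreal B * ennreal (A * 2 ^ DIM('a))" using A B0 by (intro ennreal_mult) auto
    finally show ?thesis by (simp only: mult.assoc)
  qed
  finally show ?thesis using B0 by (subst (asm) ennreal_mult_le_mult_iff) auto
qed

section \<open>Splitting the energy\<close>

text \<open>
  The extended-valued companion of \<open>L2_set_integral_le\<close>: since nothing is assumed to be finite,
  the case of an infinite right-hand side is split off first.
\<close>

lemma Minkowski_sum_sq: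
  fixes u :: "nat \<Rightarrow> 'a \<Rightarrow> ennreal"
  assumes u: "\<And>k. u k \<in> borel_measurable M" and H: "H \<in> borel_measurable M" and le: "\<And>x. (\<Sum>k<m. (u k x)\<^sup>2) \<le> (H x)\<^sup>2"
  shows "(\<Sum>k<m. (\<integral>\<^sup>+x. u k x \<partial>M)\<^sup>2) \<le> (\<integral>\<^sup>+x. H x \<partial>M)\<^sup>2"
proof (cases "(\<integral>\<^sup>+x. H x \<partial>M) = \<infinity>")
  case False
  have sq: "a \<le> b" if "a\<^sup>2 \<le> b\<^sup>2" for a b :: ennreal
    using epowr_mono[OF _ that, of "1/2"] by (simp add: epowr_2[symmetric] epowr_epowr)
  have uH: "u k x \<le> H x" if "k < m" for k x
    by (rule sq, rule order_trans[OF _ le]) (use that in \<open>auto intro!: member_le_sum\<close>)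
  have fin: "(\<integral>\<^sup>+x. u k x \<partial>M) < \<infinity>" if "k < m" for k
    using nn_integral_mono[of M "u k" H] uH[OF that] False by (auto simp: less_top[symmetric] top_unique)
  let ?H = "\<integral>\<^sup>+x. H x \<partial>M"
  let ?u = "\<lambda>k. \<integral>\<^sup>+x. u k x \<partial>M"
  define c where "c k = enn2real (?u k)" for k
  have ck: "(?u k) = ennreal (c k)" "0 \<le> c k" if "k < m" for k using fin[OF that] by (auto simp: c_def)
  define d where "d = L2_set c {..<m}"
  have d0: "0 \<le> d" by (simp add: d_def)
  have d2: "d\<^sup>2 = (\<Sum>k<m. (c k)\<^sup>2)" by (simp add: d_def L2_set_def sum_nonneg)
  have "ennreal (d\<^sup>2) = (\<Sum>k<m. ennreal (c k) * (?u k))"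
    unfolding d2 using ck by (subst sum_ennreal[symmetric]) (auto intro!: sum.cong simp: ennreal_mult[symmetric] power2_eq_square)
  also have "\<dots> = (\<integral>\<^sup>+x. (\<Sum>k<m. ennreal (c k) * u k x) \<partial>M)"
    using u by (subst nn_integral_sum) (auto simp: nn_integral_cmult)
  also have "\<dots> \<le> (\<integral>\<^sup>+x. ennreal d * H x \<partial>M)"
  proof (rule nn_integral_mono)
    fix x
    show "(\<Sum>k<m. ennreal (c k) * u k x) \<le> ennreal d * H x"
    proof (cases "H x")
      case (real h)
      define q where "q k = enn2real (u k x)" for k
      have q: "u k x = ennreal (q k)" "0 \<le> q k" if "k < m" for k
      proof -
        have "u k x < top" using uH[OF that, of x] real by (auto intro: le_less_trans)
        then show "u k x = ennreal (q k)" "0 \<le> q k" by (simp_all add: q_def)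
      qed
      have "(\<Sum>k<m. ennreal (c k) * u k x) = ennreal (\<Sum>k<m. c k * q k)"
        using q ck by (subst sum_ennreal[symmetric]) (auto intro!: sum.cong simp: ennreal_mult[symmetric])
      also have "\<dots> \<le> ennreal (d * h)"
      proof (rule ennreal_leI)
        have "(\<Sum>k<m. c k * q k) = (\<Sum>k<m. \<bar>c k\<bar> * \<bar>q k\<bar>)" using q ck by (intro sum.cong) auto
        also have "\<dots> \<le> d * L2_set q {..<m}" unfolding d_def by (rule L2_set_mult_ineq)
        also have "L2_set q {..<m} \<le> h"
        proof -
          have "ennreal (\<Sum>k<m. (q k)\<^sup>2) = (\<Sum>k<m. (u k x)\<^sup>2)"
            using q by (subst sum_ennreal[symmetric]) (auto intro!: sum.cong simp: ennreal_power)
          also have "\<dots> \<le> ennreal (h\<^sup>2)" using le[of x] real by (simp add: ennreal_power)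
          finally have "(\<Sum>k<m. (q k)\<^sup>2) \<le> h\<^sup>2" by (simp add: ennreal_le_iff)
          then show ?thesis using real by (simp add: L2_set_def real_le_lsqrt)
        qed
        finally show "(\<Sum>k<m. c k * q k) \<le> d * h" using d0 by (simp add: mult_left_mono)
      qed
      also have "\<dots> = ennreal d * H x" using real d0 by (simp add: ennreal_mult)
      finally show ?thesis .
    next
      case top
      show ?thesis
      proof (cases "d = 0")
        case True
        then have "c k = 0" if "k < m" for k using that by (simp add: d_def L2_set_eq_0_iff)
        then show ?thesis by simp
      next
        case False then show ?thesis using top d0 by (simp add: ennreal_mult_top)
      qed
    qed
  qed
  also have "\<dots> = ennreal d * ?H" using H by (rule nn_integral_cmult)
  finally have *: "ennreal (d\<^sup>2) \<le> ennreal d * ?H" .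
  have dH: "ennreal d \<le> ?H"
  proof (cases "d = 0")
    case False
    then have "ennreal d * ennreal d \<le> ennreal d * ?H" using * d0 by (simp add: power2_eq_square ennreal_mult)
    then show ?thesis using False d0 by (subst (asm) ennreal_mult_le_mult_iff) auto
  qed simp
  have "(\<Sum>k<m. (?u k)\<^sup>2) = ennreal (\<Sum>k<m. (c k)\<^sup>2)"
    using ck by (subst sum_ennreal[symmetric]) (auto intro!: sum.cong simp: ennreal_power)
  also have "\<dots> = (ennreal d)\<^sup>2" unfolding d2[symmetric] using d0 by (simp add: ennreal_power)
  also have "\<dots> \<le> ?H\<^sup>2" using dH by (rule power_mono) simp
  finally show ?thesis .
qed (simp add: top_power_ennreal)

lemma abs_integral_le_nn_integral:
  fixes g :: "'a \<Rightarrow> real" shows "ennreal \<bar>LINT x|M. g x\<bar> \<le> (\<integral>\<^sup>+x. ennreal \<bar>g x\<bar> \<partial>M)"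
  using integral_norm_bound_ennreal[of M g] by (cases "integrable M g") (auto simp: not_integrable_integral_eq)

lemma mono_borel_measurable_ennreal:
  fixes F :: "real \<Rightarrow> ennreal" assumes "mono F" shows "F \<in> borel_measurable borel"
proof (rule borel_measurableI_greater)
  fix c
  have "is_interval {t. c < F t}" unfolding is_interval_1 using assms by (auto dest: monoD intro: less_le_trans)
  then show "{t \<in> space borel. c < F t} \<in> sets borel" using real_interval_borel_measurable by simp
qed

text \<open>
  Additivity of the convolution rests on the integrability of both parts, because the integral
  of a non-integrable function is zero by convention.
\<close>

lemma A_fun_add_le:
  fixes f f1 f2 :: "'a::euclidean_space \<Rightarrow> ereal"
  assumes \<alpha>: "0 < \<alpha>" "\<alpha> \<le> 1" and t: "0 < t" and f1: "locint (\<lambda>z. real_of_ereal (f1 z))" and f2: "locint (\<lambda>z. real_of_ereal (f2 z))"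
    and f: "\<And>z. real_of_ereal (f z) = real_of_ereal (f1 z) + real_of_ereal (f2 z)"
  shows "A_fun \<alpha> f t y \<le> A_fun \<alpha> f1 t y + A_fun \<alpha> f2 t y"
  unfolding A_fun_def[of \<alpha> f]
proof (rule SUP_least)
  fix \<phi> :: "'a \<Rightarrow> real" assume \<phi>: "\<phi> \<in> C_class \<alpha>"
  have pm [measurable]: "\<phi> \<in> borel_measurable borel" using \<phi> \<alpha>(1) by (rule C_class_borel)
  have dm: "(\<lambda>z. dilate \<phi> t (y - z)) \<in> borel_measurable lebesgue"
    by (rule measurable_completion) (unfold dilate_def, measurable)
  have int: "integrable lebesgue (\<lambda>z. g z * dilate \<phi> t (y - z))" if g: "locint g" for g
  proof -
    have "integrable lebesgue (\<lambda>z. indicator (cball y t) z * g z)" by (rule locint_bounded[OF g]) auto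
    then have i: "integrable lebesgue (\<lambda>z. (3 / t ^ DIM('a)) * (indicator (cball y t) z * g z))" by (rule integrable_mult_right)
    have eq: "g z * dilate \<phi> t (y - z) = (indicator (cball y t) z * g z) * dilate \<phi> t (y - z)" for z
      using dilate_supp[OF \<phi> t, of "y - z"] by (cases "z \<in> cball y t") (auto simp: dist_norm not_le)
    show ?thesis
    proof (rule Bochner_Integration.integrable_bound[OF i])
      show "(\<lambda>z. g z * dilate \<phi> t (y - z)) \<in> borel_measurable lebesgue"
        unfolding eq by (rule borel_measurable_times[OF borel_measurable_integrable[OF \<open>integrable lebesgue (\<lambda>z. indicator (cball y t) z * g z)\<close>] dm])
      show "AE z in lebesgue. norm (g z * dilate \<phi> t (y - z)) \<le> norm ((3 / t ^ DIM('a)) * (indicator (cball y t) z * g z))"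
      proof (rule AE_I2)
        fix z
        have "\<bar>dilate \<phi> t (y - z)\<bar> \<le> 3 / t ^ DIM('a)"
          using C_class_bound[OF \<phi> \<alpha>, of "(y - z) /\<^sub>R t"] t by (simp add: dilate_def divide_right_mono)
        from mult_left_mono[OF this, of "\<bar>indicator (cball y t) z * g z\<bar>"]
        show "norm (g z * dilate \<phi> t (y - z)) \<le> norm ((3 / t ^ DIM('a)) * (indicator (cball y t) z * g z))"
          unfolding eq[of z] using t by (simp add: abs_mult mult_ac)
      qed
    qed
  qed
  have "convol f (dilate \<phi> t) y = convol f1 (dilate \<phi> t) y + convol f2 (dilate \<phi> t) y"
    unfolding convol_def f distrib_right using int[OF f1] int[OF f2] by (rule Bochner_Integration.integral_add)
  then have "ennreal \<bar>convol f (dilate \<phi> t) y\<bar> \<le> ennreal (\<bar>convol f1 (dilate \<phi> t) y\<bar> + \<bar>convol f2 (dilate \<phi> t) y\<bar>)"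
    by (intro ennreal_leI) simp
  also have "\<dots> = ennreal \<bar>convol f1 (dilate \<phi> t) y\<bar> + ennreal \<bar>convol f2 (dilate \<phi> t) y\<bar>" by (rule ennreal_plus) auto
  also have "\<dots> \<le> A_fun \<alpha> f1 t y + A_fun \<alpha> f2 t y"
    unfolding A_fun_def using \<phi> by (intro add_mono SUP_upper)
  finally show "ennreal \<bar>convol f (dilate \<phi> t) y\<bar> \<le> A_fun \<alpha> f1 t y + A_fun \<alpha> f2 t y" .
qed

lemma sq_add_le_ennreal: "(a + b)\<^sup>2 \<le> 2 * a\<^sup>2 + 2 * (b::ennreal)\<^sup>2"
proof (cases "a = \<infinity> \<or> b = \<infinity>")
  case True
  then show ?thesis by (auto simp: top_power_ennreal ennreal_mult_top)
next
  case False
  then obtain x y where xy: "a = ennreal x" "0 \<le> x" "b = ennreal y" "0 \<le> y" by (cases a; cases b) auto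
  have "(x + y)\<^sup>2 \<le> 2 * x\<^sup>2 + 2 * y\<^sup>2" using sum_squares_bound[of x y] by (simp add: power2_sum)
  then have "ennreal ((x + y)\<^sup>2) \<le> ennreal (2 * x\<^sup>2 + 2 * y\<^sup>2)" by (rule ennreal_leI)
  also have "\<dots> = ennreal 2 * ennreal (x\<^sup>2) + ennreal 2 * ennreal (y\<^sup>2)" by (rule ennreal_lincomb) auto
  finally show ?thesis using xy by (simp add: ennreal_power[symmetric] ennreal_plus[symmetric] del: ennreal_plus)
qed

lemma energy_add_le:
  fixes f f1 f2 :: "nat \<Rightarrow> 'a::euclidean_space \<Rightarrow> ereal"
  assumes \<alpha>: "0 < \<alpha>" "\<alpha> \<le> 1"
    and f1: "\<And>k. f1 k \<in> borel_measurable lebesgue" "\<And>k. locint (\<lambda>z. real_of_ereal (f1 k z))"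
    and f2: "\<And>k. f2 k \<in> borel_measurable lebesgue" "\<And>k. locint (\<lambda>z. real_of_ereal (f2 k z))"
    and f: "\<And>k z. real_of_ereal (f k z) = real_of_ereal (f1 k z) + real_of_ereal (f2 k z)"
  shows "energy \<alpha> f x \<le> 2 * energy \<alpha> f1 x + 2 * energy \<alpha> f2 x"
proof -
  have "energy1 \<alpha> (f k) (\<lambda>_. True) x \<le> 2 * energy1 \<alpha> (f1 k) (\<lambda>_. True) x + 2 * energy1 \<alpha> (f2 k) (\<lambda>_. True) x" for k
  proof -
    have [measurable]: "kernel \<alpha> (f1 k) \<in> borel_measurable borel" "kernel \<alpha> (f2 k) \<in> borel_measurable borel"
      using kernel_measurable[OF f1 \<alpha>] kernel_measurable[OF f2 \<alpha>] by auto
    have [measurable]: "snd \<in> borel_measurable (borel :: ('a \<times> real) measure)" "fst \<in> borel_measurable (borel :: ('a \<times> real) measure)"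
      by (intro borel_measurable_continuous_onI continuous_intros)+
    let ?I = "indicator {(y, t). norm (x - y) < t \<and> True} :: 'a \<times> real \<Rightarrow> ennreal"
    have Im [measurable]: "{(y::'a, t). norm (x - y) < t \<and> True} \<in> sets borel"
    proof -
      have "{(y::'a, t). norm (x - y) < t \<and> True} = {z. norm (x - fst z) < snd z}" by auto
      moreover have "{z::'a \<times> real. norm (x - fst z) < snd z} \<in> sets borel" by measurable
      ultimately show ?thesis by simp
    qed
    have "kernel \<alpha> (f k) z \<le> 2 * kernel \<alpha> (f1 k) z + 2 * kernel \<alpha> (f2 k) z" for z
    proof -
      obtain y t where z: "z = (y, t)" by fastforce
      show ?thesis
      proof (cases "0 < t")
        case True
        have "(A_fun \<alpha> (f k) t y)\<^sup>2 \<le> (A_fun \<alpha> (f1 k) t y + A_fun \<alpha> (f2 k) t y)\<^sup>2"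
          using A_fun_add_le[OF \<alpha> True f1(2) f2(2) f] by (rule power_mono) simp
        also have "\<dots> \<le> 2 * (A_fun \<alpha> (f1 k) t y)\<^sup>2 + 2 * (A_fun \<alpha> (f2 k) t y)\<^sup>2" by (rule sq_add_le_ennreal)
        finally have "(A_fun \<alpha> (f k) t y)\<^sup>2 * ennreal (1 / t ^ (DIM('a) + 1)) \<le> (2 * (A_fun \<alpha> (f1 k) t y)\<^sup>2 + 2 * (A_fun \<alpha> (f2 k) t y)\<^sup>2) * ennreal (1 / t ^ (DIM('a) + 1))"
          by (rule mult_right_mono) simp
        then show ?thesis using True by (simp add: z kernel_def distrib_right mult.assoc)
      qed (simp add: z kernel_def)
    qed
    then have "energy1 \<alpha> (f k) (\<lambda>_. True) x \<le> (\<integral>\<^sup>+z. 2 * (kernel \<alpha> (f1 k) z * ?I z) + 2 * (kernel \<alpha> (f2 k) z * ?I z) \<partial>lborel)"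
      unfolding energy1_def by (intro nn_integral_mono) (auto simp: indicator_def)
    also have "\<dots> = (\<integral>\<^sup>+z. 2 * (kernel \<alpha> (f1 k) z * ?I z) \<partial>lborel) + (\<integral>\<^sup>+z. 2 * (kernel \<alpha> (f2 k) z * ?I z) \<partial>lborel)"
      by (rule nn_integral_add) measurable
    also have "(\<integral>\<^sup>+z. 2 * (kernel \<alpha> (f1 k) z * ?I z) \<partial>lborel) = 2 * energy1 \<alpha> (f1 k) (\<lambda>_. True) x"
      unfolding energy1_def by (rule nn_integral_cmult) measurable
    also have "(\<integral>\<^sup>+z. 2 * (kernel \<alpha> (f2 k) z * ?I z) \<partial>lborel) = 2 * energy1 \<alpha> (f2 k) (\<lambda>_. True) x"
      unfolding energy1_def by (rule nn_integral_cmult) measurable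
    finally show ?thesis .
  qed
  then have "energy \<alpha> f x \<le> (\<Sum>k. 2 * energy1 \<alpha> (f1 k) (\<lambda>_. True) x + 2 * energy1 \<alpha> (f2 k) (\<lambda>_. True) x)"
    unfolding energy_def by (intro suminf_le) auto
  also have "\<dots> = 2 * energy \<alpha> f1 x + 2 * energy \<alpha> f2 x"
    unfolding energy_def by (subst suminf_add[symmetric]) (auto simp: ennreal_suminf_cmult)
  finally show ?thesis .
qed

lemma e2ennreal_le_l2_norm: "e2ennreal \<bar>f k x\<bar> \<le> l2_norm f x"
proof -
  have "(e2ennreal \<bar>f k x\<bar>)\<^sup>2 \<le> sqsum f x" unfolding sqsum_def
    using sum_le_suminf[of "\<lambda>j. (e2ennreal \<bar>f j x\<bar>)\<^sup>2" "{k}"] by simp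
  then have "epowr ((e2ennreal \<bar>f k x\<bar>)\<^sup>2) (1/2) \<le> l2_norm f x" unfolding l2_norm_sqsum by (rule epowr_mono[rotated]) simp
  then show ?thesis by (simp add: epowr_2[symmetric] epowr_epowr)
qed

lemma abs_real_le_e2ennreal: "ennreal \<bar>real_of_ereal v\<bar> \<le> e2ennreal \<bar>v\<bar>"
  by (cases v) (auto simp: e2ennreal_ereal)

lemma sqsum_measurable: assumes "meas_seq f" shows "sqsum f \<in> borel_measurable lebesgue"
proof -
  have [measurable]: "f k \<in> borel_measurable lebesgue" for k using assms by (simp add: meas_seq_def)
  show ?thesis unfolding sqsum_def[abs_def] by measurable
qed

section \<open>Estimates on balls\<close>

locale avg_weight =
  fixes p :: real and w :: "'a::euclidean_space \<Rightarrow> ennreal" and A :: real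
  assumes p: "1 \<le> p" and w: "weight w" and A: "avg_ineq p w A" and A0: "0 < A"
begin

lemma wm [measurable]: "w \<in> borel_measurable lebesgue" using w by (simp add: weight_def)

definition wroot :: "'a \<Rightarrow> real \<Rightarrow> ennreal" where "wroot x t = epowr (wmeas w (ball x t)) (1 / p)"
definition local_norm :: "(nat \<Rightarrow> 'a \<Rightarrow> ereal) \<Rightarrow> 'a \<Rightarrow> real \<Rightarrow> ennreal" where "local_norm f x t = Lp_norm p w (ball x t) f"
definition mean_norm :: "(nat \<Rightarrow> 'a \<Rightarrow> ereal) \<Rightarrow> 'a \<Rightarrow> real \<Rightarrow> ennreal" where "mean_norm f x t = local_norm f x t / wroot x t"
text \<open>
  The integral \<open>V\<close> of the introduction; all estimates on the ball of radius \<open>r\<close> end in this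
  quantity.
\<close>

definition tail :: "(nat \<Rightarrow> 'a \<Rightarrow> ereal) \<Rightarrow> 'a \<Rightarrow> real \<Rightarrow> ennreal" where
  "tail f x r = (\<integral>\<^sup>+t\<in>{r<..}. (mean_norm f x t * ennreal (1 / t)) \<partial>lborel)"
definition dbl :: real where "dbl = A * 2 ^ DIM('a)"

lemma dbl_pos: "0 < dbl" using A0 by (simp add: dbl_def)

lemma wroot_pos: "0 < t \<Longrightarrow> wroot x t \<noteq> 0" and wroot_fin: "0 < t \<Longrightarrow> wroot x t \<noteq> \<infinity>"
proof -
  assume t: "0 < t"
  obtain q where q: "wmeas w (ball x t) = ennreal q" "0 < q" using wmeas_ball[OF w t, of x] by (cases "wmeas w (ball x t)") auto
  have "wroot x t = ennreal (q powr (1 / p))" using q p by (simp add: wroot_def epowr_ennreal)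
  then show "wroot x t \<noteq> 0" "wroot x t \<noteq> \<infinity>" using q by auto
qed

lemma wroot_powr: "epowr (wroot x t) p = wmeas w (ball x t)"
  using p by (simp add: wroot_def epowr_epowr)

lemma wroot_mono: "s \<le> t \<Longrightarrow> wroot x s \<le> wroot x t"
  unfolding wroot_def wmeas_def using p by (intro epowr_mono nn_integral_mono) (auto simp: indicator_def)

lemma local_norm_mono: "s \<le> t \<Longrightarrow> local_norm f x s \<le> local_norm f x t"
  unfolding local_norm_def Lp_norm_def using p by (intro epowr_mono nn_integral_mono) (auto simp: indicator_def)

lemma wroot_double: "0 < t \<Longrightarrow> wroot x (2 * t) \<le> ennreal dbl * wroot x t"
  unfolding wroot_def dbl_def by (rule doubling[OF A A0 p _ wm])

lemma local_norm_eq: "0 < t \<Longrightarrow> local_norm f x t = mean_norm f x t * wroot x t"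
  unfolding mean_norm_def using wroot_pos[of t x] wroot_fin[of t x] by (simp add: ennreal_divide_times less_top)

lemma mean_norm_measurable [measurable]: "mean_norm f x \<in> borel_measurable borel"
proof -
  have [measurable]: "local_norm f x \<in> borel_measurable borel" "wroot x \<in> borel_measurable borel"
    by (intro mono_borel_measurable_ennreal monoI local_norm_mono wroot_mono; simp)+
  show ?thesis unfolding mean_norm_def[abs_def] by measurable
qed

text \<open>
  The local norm increases with the radius, and doubling bounds the growth of the normalising
  factor.
\<close>

lemma mean_norm_le:
  assumes t: "0 < t" "t \<le> s" "s \<le> 2 * t" shows "mean_norm f x t \<le> ennreal dbl * mean_norm f x s"
proof -
  have "local_norm f x t \<le> local_norm f x s" using t by (intro local_norm_mono)
  also have "\<dots> = mean_norm f x s * wroot x s" using t by (intro local_norm_eq) auto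
  also have "\<dots> \<le> mean_norm f x s * (ennreal dbl * wroot x t)"
    using wroot_mono[OF t(3), of x] wroot_double[OF t(1), of x] by (intro mult_left_mono) (auto intro: order_trans)
  finally have "local_norm f x t \<le> wroot x t * (ennreal dbl * mean_norm f x s)" by (simp add: mult_ac)
  then show ?thesis unfolding mean_norm_def[of f x t] using wroot_pos[OF t(1), of x] by (intro divide_le_posI_ennreal) (auto simp: zero_less_iff_neq_zero)
qed

text \<open>
  The almost monotonicity of \<open>mean_norm\<close> is integrated over the radii between \<open>t\<close> and \<open>2 * t\<close>.
\<close>

lemma mean_norm_le_tail:
  assumes r: "0 < r" "r \<le> t" shows "mean_norm f x t \<le> ennreal (2 * dbl) * tail f x r"
proof -
  have t: "0 < t" using r by simp
  let ?c = "1 / (dbl * (2 * t))"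
  have "mean_norm f x t * ennreal (1 / (2 * dbl)) = (\<integral>\<^sup>+s. mean_norm f x t * ennreal ?c * indicator {t<..<2 * t} s \<partial>lborel)"
  proof -
    have "(\<integral>\<^sup>+s. mean_norm f x t * ennreal ?c * indicator {t<..<2 * t} s \<partial>lborel) = mean_norm f x t * ennreal ?c * ennreal t"
      using t by (subst nn_integral_cmult) auto
    also have "\<dots> = mean_norm f x t * ennreal (1 / (dbl * (2 * t)) * t)"
      using t dbl_pos by (subst ennreal_mult) (auto simp: mult.assoc)
    also have "1 / (dbl * (2 * t)) * t = 1 / (2 * dbl)" using t by simp
    finally show ?thesis by simp
  qed
  also have "\<dots> \<le> tail f x r"
    unfolding tail_def
  proof (rule nn_integral_mono)
    fix s :: real
    show "mean_norm f x t * ennreal ?c * indicator {t<..<2 * t} s \<le> mean_norm f x s * ennreal (1 / s) * indicator {r<..} s"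
    proof (cases "s \<in> {t<..<2 * t}")
      case True
      then have s: "0 < s" "t \<le> s" "s \<le> 2 * t" "r < s" using t r by auto
      have "ennreal (1 / dbl) * mean_norm f x t \<le> ennreal (1 / dbl) * (ennreal dbl * mean_norm f x s)" by (intro mult_left_mono mean_norm_le t s) auto
      also have "\<dots> = mean_norm f x s" using dbl_pos by (simp add: mult.assoc[symmetric] ennreal_mult[symmetric])
      finally have 1: "ennreal (1 / dbl) * mean_norm f x t \<le> mean_norm f x s" .
      have "mean_norm f x t * ennreal ?c = (ennreal (1 / dbl) * mean_norm f x t) * ennreal (1 / (2 * t))"
      proof -
        have "ennreal ?c = ennreal (1 / dbl) * ennreal (1 / (2 * t))"
          using dbl_pos t by (subst ennreal_mult[symmetric]) auto
        then show ?thesis by (simp add: mult_ac)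
      qed
      also have "\<dots> \<le> mean_norm f x s * ennreal (1 / s)"
        using 1 s t by (intro mult_mono ennreal_leI divide_left_mono) auto
      finally show ?thesis using True s by simp
    qed simp
  qed
  finally have "ennreal (2 * dbl) * (mean_norm f x t * ennreal (1 / (2 * dbl))) \<le> ennreal (2 * dbl) * tail f x r" by (rule mult_left_mono) simp
  moreover have "ennreal (2 * dbl) * (mean_norm f x t * ennreal (1 / (2 * dbl))) = mean_norm f x t"
  proof -
    have "ennreal (2 * dbl) * ennreal (1 / (2 * dbl)) = 1" using dbl_pos by (subst ennreal_mult[symmetric]) auto
    then show ?thesis by (metis mult.assoc mult.commute mult.right_neutral)
  qed
  ultimately show ?thesis by simp
qed

lemma integral_l2_le:
  assumes f: "meas_seq f" and t: "0 < t"
  shows "(\<integral>\<^sup>+y\<in>ball x t. l2_norm f y \<partial>lebesgue) \<le> ennreal (A * measure lebesgue (ball x t)) * mean_norm f x t"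
proof -
  have [measurable]: "l2_norm f \<in> borel_measurable lebesgue" unfolding l2_norm_sqsum[abs_def] using sqsum_measurable[OF f] by measurable
  have "(\<integral>\<^sup>+y\<in>ball x t. l2_norm f y \<partial>lebesgue) * wroot x t \<le> ennreal (A * measure lebesgue (ball x t)) * local_norm f x t"
    using A[unfolded avg_ineq_def, rule_format, OF t, of "l2_norm f" x] unfolding wroot_def local_norm_def Lp_norm_def by simp
  also have "\<dots> = (ennreal (A * measure lebesgue (ball x t)) * mean_norm f x t) * wroot x t"
    unfolding local_norm_eq[OF t] by (simp add: mult.assoc)
  finally have "wroot x t * (\<integral>\<^sup>+y\<in>ball x t. l2_norm f y \<partial>lebesgue) \<le> wroot x t * (ennreal (A * measure lebesgue (ball x t)) * mean_norm f x t)" by (simp add: mult.commute)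
  then show ?thesis using wroot_pos[OF t, of x] wroot_fin[OF t, of x] by (subst (asm) ennreal_mult_le_mult_iff) auto
qed

lemma locint_of_Lp_loc:
  assumes f: "f \<in> Lp_loc p w" shows "locint (\<lambda>z. real_of_ereal (f k z))"
  unfolding locint_def
proof
  fix R :: real
  have m: "meas_seq f" using f by (simp add: Lp_loc_def)
  have fk: "f k \<in> borel_measurable lebesgue" using m by (simp add: meas_seq_def)
  define r where "r = max R 1"
  have r: "0 < r" by (simp add: r_def)
  show "integrable lebesgue (\<lambda>z. indicator (ball 0 R) z * real_of_ereal (f k z))"
  proof (rule integrableI_bounded)
    show "(\<lambda>z. indicator (ball 0 R) z * real_of_ereal (f k z)) \<in> borel_measurable lebesgue"
      using fk by (intro borel_measurable_times borel_measurable_indicator) auto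
    have "ennreal (norm (indicator (ball 0 R) z * real_of_ereal (f k z))) \<le> l2_norm f z * indicator (ball 0 r) z" for z
      using order_trans[OF abs_real_le_e2ennreal e2ennreal_le_l2_norm, of f k z] by (auto simp: indicator_def r_def)
    then have "(\<integral>\<^sup>+z. ennreal (norm (indicator (ball 0 R) z * real_of_ereal (f k z))) \<partial>lebesgue) \<le> (\<integral>\<^sup>+y\<in>ball 0 r. l2_norm f y \<partial>lebesgue)"
      by (rule nn_integral_mono)
    also have "\<dots> \<le> ennreal (A * measure lebesgue (ball (0::'a) r)) * mean_norm f 0 r" by (rule integral_l2_le[OF m r])
    also have "\<dots> < \<infinity>"
    proof -
      have "local_norm f 0 r < \<infinity>" using f r by (simp add: Lp_loc_def local_norm_def)
      then have "mean_norm f 0 r < \<infinity>" unfolding mean_norm_def using wroot_pos[OF r, of 0] by (auto simp: less_top[symmetric] ennreal_divide_eq_top_iff)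
      then show ?thesis by (simp add: ennreal_mult_less_top)
    qed
    finally show "(\<integral>\<^sup>+z. ennreal (norm (indicator (ball 0 R) z * real_of_ereal (f k z))) \<partial>lebesgue) < \<infinity>" .
  qed
qed

definition near :: "(nat \<Rightarrow> 'a \<Rightarrow> ereal) \<Rightarrow> 'a \<Rightarrow> real \<Rightarrow> nat \<Rightarrow> 'a \<Rightarrow> ereal" where
  "near f x r k z = (if z \<in> ball x (2 * r) then f k z else 0)"
definition far :: "(nat \<Rightarrow> 'a \<Rightarrow> ereal) \<Rightarrow> 'a \<Rightarrow> real \<Rightarrow> nat \<Rightarrow> 'a \<Rightarrow> ereal" where
  "far f x r k z = (if z \<in> ball x (2 * r) then 0 else f k z)"

lemma near_far_measurable:
  assumes "meas_seq f" shows "near f x r k \<in> borel_measurable lebesgue" "far f x r k \<in> borel_measurable lebesgue"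
proof -
  have [measurable]: "f k \<in> borel_measurable lebesgue" using assms by (simp add: meas_seq_def)
  have [measurable]: "ball x (2 * r) \<in> sets lebesgue" by simp
  show "near f x r k \<in> borel_measurable lebesgue" unfolding near_def[abs_def] by measurable
  show "far f x r k \<in> borel_measurable lebesgue" unfolding far_def[abs_def] by measurable
qed

lemma locint_mono_abs:
  assumes "locint g" "h \<in> borel_measurable lebesgue" "\<And>z. \<bar>h z\<bar> \<le> \<bar>g z\<bar>" shows "locint h"
  unfolding locint_def
proof
  fix R
  have "integrable lebesgue (\<lambda>z. indicator (ball 0 R) z * g z)" using assms(1) by (simp add: locint_def)
  then show "integrable lebesgue (\<lambda>z. indicator (ball 0 R) z * h z)"
    by (rule Bochner_Integration.integrable_bound) (use assms in \<open>auto simp: abs_mult intro!: borel_measurable_times borel_measurable_indicator mult_left_mono\<close>)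
qed

lemma near_far_locint:
  assumes "f \<in> Lp_loc p w" shows "locint (\<lambda>z. real_of_ereal (near f x r k z))" "locint (\<lambda>z. real_of_ereal (far f x r k z))"
proof -
  have m: "meas_seq f" using assms by (simp add: Lp_loc_def)
  note [measurable] = near_far_measurable[OF m, of x r k]
  show "locint (\<lambda>z. real_of_ereal (near f x r k z))"
  proof (rule locint_mono_abs[OF locint_of_Lp_loc[OF assms, of k]])
    show "\<bar>real_of_ereal (near f x r k z)\<bar> \<le> \<bar>real_of_ereal (f k z)\<bar>" for z
      unfolding near_def by (cases "z \<in> ball x (2 * r)") (simp_all del: abs_real_of_ereal)
  qed measurable
  show "locint (\<lambda>z. real_of_ereal (far f x r k z))"
  proof (rule locint_mono_abs[OF locint_of_Lp_loc[OF assms, of k]])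
    show "\<bar>real_of_ereal (far f x r k z)\<bar> \<le> \<bar>real_of_ereal (f k z)\<bar>" for z
      unfolding far_def by (cases "z \<in> ball x (2 * r)") (simp_all del: abs_real_of_ereal)
  qed measurable
qed

text \<open>
  Let \<open>z\<close> be outside the double ball and in the support of the dilate. Then
  \<open>2 * r \<le> \<bar>x0 - z\<bar> < r + 2 * t\<close>, so that \<open>r < 2 * t\<close> and \<open>z\<close> lies in the ball of radius
  \<open>4 * t\<close>.
\<close>

lemma A_fun_far_le:
  assumes \<alpha>: "0 < \<alpha>" "\<alpha> \<le> 1" and fm [measurable]: "f k \<in> borel_measurable lebesgue" and r: "0 < r" and x: "x \<in> ball x0 r" and y: "norm (x - y) < t"
  shows "A_fun \<alpha> (far f x0 r k) t y \<le> ennreal (3 / t ^ DIM('a)) * (\<integral>\<^sup>+z\<in>ball x0 (4 * t). e2ennreal \<bar>f k z\<bar> \<partial>lebesgue) * (if r < 2 * t then 1 else 0)"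
  unfolding A_fun_def
proof (rule SUP_least)
  fix \<phi> :: "'a \<Rightarrow> real" assume \<phi>: "\<phi> \<in> C_class \<alpha>"
  have t: "0 < t" using y norm_ge_zero[of "x - y"] by linarith
  let ?c = "3 / t ^ DIM('a)"
  have pt: "ennreal \<bar>real_of_ereal (far f x0 r k z) * dilate \<phi> t (y - z)\<bar> \<le> ennreal ?c * (e2ennreal \<bar>f k z\<bar> * indicator (ball x0 (4 * t)) z) * (if r < 2 * t then 1 else 0)" for z
  proof (cases "z \<in> ball x0 (2 * r) \<or> dilate \<phi> t (y - z) = 0")
    case True then show ?thesis by (auto simp: far_def)
  next
    case False
    then have z1: "2 * r \<le> norm (x0 - z)" by (simp add: dist_norm)
    have z2: "norm (y - z) \<le> t"
    proof (rule ccontr)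
      assume "\<not> norm (y - z) \<le> t"
      then have "dilate \<phi> t (y - z) = 0" by (intro dilate_supp[OF \<phi> t]) simp
      then show False using False by simp
    qed
    note z = z1 z2
    define q where "q = real_of_ereal (f k z)"
    have "norm (x0 - z) \<le> norm (x0 - x) + (norm (x - y) + norm (y - z))"
      using norm_triangle_ineq[of "x0 - x" "x - z"] norm_triangle_ineq[of "x - y" "y - z"] by simp
    then have le: "norm (x0 - z) < r + 2 * t" using x y z by (simp add: dist_norm)
    then have rt: "r < 2 * t" "norm (x0 - z) < 4 * t" using z by auto
    have "\<bar>dilate \<phi> t (y - z)\<bar> \<le> ?c"
      using C_class_bound[OF \<phi> \<alpha>, of "(y - z) /\<^sub>R t"] t by (simp add: dilate_def divide_right_mono)
    then have "\<bar>q * dilate \<phi> t (y - z)\<bar> \<le> ?c * \<bar>q\<bar>"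
      using mult_right_mono[of "\<bar>dilate \<phi> t (y - z)\<bar>" ?c "\<bar>q\<bar>"] by (simp add: abs_mult mult_ac)
    then have "ennreal \<bar>q * dilate \<phi> t (y - z)\<bar> \<le> ennreal (?c * \<bar>q\<bar>)" by (rule ennreal_leI)
    also have "\<dots> = ennreal ?c * ennreal \<bar>q\<bar>" using t by (intro ennreal_mult) auto
    also have "\<dots> \<le> ennreal ?c * e2ennreal \<bar>f k z\<bar>" unfolding q_def by (intro mult_left_mono abs_real_le_e2ennreal) simp
    finally show ?thesis using False rt by (simp add: far_def dist_norm q_def)
  qed
  have "ennreal \<bar>convol (far f x0 r k) (dilate \<phi> t) y\<bar> \<le> (\<integral>\<^sup>+z. ennreal \<bar>real_of_ereal (far f x0 r k z) * dilate \<phi> t (y - z)\<bar> \<partial>lebesgue)"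
    unfolding convol_def by (rule abs_integral_le_nn_integral)
  also have "\<dots> \<le> (\<integral>\<^sup>+z. ennreal ?c * (e2ennreal \<bar>f k z\<bar> * indicator (ball x0 (4 * t)) z) * (if r < 2 * t then 1 else 0) \<partial>lebesgue)"
    by (rule nn_integral_mono) (rule pt)
  also have "\<dots> \<le> ennreal ?c * (\<integral>\<^sup>+z\<in>ball x0 (4 * t). e2ennreal \<bar>f k z\<bar> \<partial>lebesgue) * (if r < 2 * t then 1 else 0)"
  proof (cases "r < 2 * t")
    case True
    have [measurable]: "ball x0 (4 * t) \<in> sets lebesgue" by simp
    have "(\<integral>\<^sup>+z. ennreal ?c * (e2ennreal \<bar>f k z\<bar> * indicator (ball x0 (4 * t)) z) \<partial>lebesgue) = ennreal ?c * (\<integral>\<^sup>+z\<in>ball x0 (4 * t). e2ennreal \<bar>f k z\<bar> \<partial>lebesgue)"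
      by (rule nn_integral_cmult) measurable
    then show ?thesis using True by simp
  qed simp
  finally show "ennreal \<bar>convol (far f x0 r k) (dilate \<phi> t) y\<bar> \<le> ennreal ?c * (\<integral>\<^sup>+z\<in>ball x0 (4 * t). e2ennreal \<bar>f k z\<bar> \<partial>lebesgue) * (if r < 2 * t then 1 else 0)" .
qed

definition far_const :: real where
  "far_const = (3 * A * unit_ball_vol DIM('a) * 4 ^ DIM('a))\<^sup>2 * unit_ball_vol DIM('a) * (2 * dbl)"

text \<open>
  Minkowski's inequality moves the norm of the sequence under the integral over the ball, so
  that each height \<open>t\<close> contributes at most a multiple of \<open>mean_norm f x0 (4 * t)\<close> squared,
  divided by \<open>t\<close>. One of the two factors is bounded by the tail, the other one is integrated.
\<close>

lemma energy_far_le: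
  assumes \<alpha>: "0 < \<alpha>" "\<alpha> \<le> 1" and f: "f \<in> Lp_loc p w" and r: "0 < r" and x: "x \<in> ball x0 r"
  shows "energy \<alpha> (far f x0 r) x \<le> ennreal far_const * (tail f x0 r)\<^sup>2"
proof -
  let ?n = "DIM('a)"
  have m: "meas_seq f" using f by (simp add: Lp_loc_def)
  have fk [measurable]: "f k \<in> borel_measurable lebesgue" for k using m by (simp add: meas_seq_def)
  have l2m [measurable]: "l2_norm f \<in> borel_measurable lebesgue" unfolding l2_norm_sqsum[abs_def] using sqsum_measurable[OF m] by measurable
  define c where "c = 3 * A * unit_ball_vol ?n * 4 ^ ?n"
  have c0: "0 \<le> c" using A0 by (simp add: c_def)
  let ?K = "c\<^sup>2 * unit_ball_vol ?n * (2 * dbl)"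
  \<comment> \<open>The terms \<open>0 + 4 * t\<close> prepare the affine substitution \<open>u = 0 + 4 * t\<close>.\<close>
  let ?v = "\<lambda>t. mean_norm f x0 (0 + 4 * t) * ennreal (1 / (0 + 4 * t)) * indicator {2 * r<..} (0 + 4 * t)"
  let ?k = "\<lambda>t. c\<^sup>2 * unit_ball_vol ?n * (1 / t)"
  define h where "h t = ennreal (c\<^sup>2) * (mean_norm f x0 (4 * t))\<^sup>2 * (if r < 2 * t then 1 else 0) * ennreal (1 / t ^ (?n + 1))" for t
  have hm [measurable]: "h \<in> borel_measurable borel" unfolding h_def[abs_def] by measurable
  have km: "kernel \<alpha> (far f x0 r k) \<in> borel_measurable borel" for k
    by (rule kernel_measurable[OF near_far_measurable(2)[OF m] near_far_locint(2)[OF f] \<alpha>])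
  have [measurable]: "snd \<in> borel_measurable (borel :: ('a \<times> real) measure)" "fst \<in> borel_measurable (borel :: ('a \<times> real) measure)"
    by (intro borel_measurable_continuous_onI continuous_intros)+
  let ?S = "{(y, t). norm (x - y) < t \<and> True} :: ('a \<times> real) set"
  have Sm: "?S \<in> sets borel"
  proof -
    have "?S = {z. norm (x - fst z) < snd z}" by auto
    moreover have "{z::'a \<times> real. norm (x - fst z) < snd z} \<in> sets borel" by measurable
    ultimately show ?thesis by simp
  qed
  have kb: "(\<Sum>k. kernel \<alpha> (far f x0 r k) (y, t)) \<le> h t" if y: "norm (x - y) < t" for y t
  proof -
    have t: "0 < t" using y norm_ge_zero[of "x - y"] by linarith
    define J where "J k = (\<integral>\<^sup>+z\<in>ball x0 (4 * t). e2ennreal \<bar>f k z\<bar> \<partial>lebesgue)" for k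
    define L where "L = (\<integral>\<^sup>+z\<in>ball x0 (4 * t). l2_norm f z \<partial>lebesgue)"
    have bm [measurable]: "ball x0 (4 * t) \<in> sets lebesgue" by simp
    have Mink: "(\<Sum>k. (J k)\<^sup>2) \<le> L\<^sup>2"
      unfolding suminf_eq_SUP
    proof (rule SUP_least)
      fix n
      show "(\<Sum>k<n. (J k)\<^sup>2) \<le> L\<^sup>2" unfolding J_def L_def
      proof (rule Minkowski_sum_sq)
        show "(\<Sum>k<n. (e2ennreal \<bar>f k z\<bar> * indicator (ball x0 (4 * t)) z)\<^sup>2) \<le> (l2_norm f z * indicator (ball x0 (4 * t)) z)\<^sup>2" for z
        proof -
          have "(\<Sum>k<n. (e2ennreal \<bar>f k z\<bar>)\<^sup>2) \<le> sqsum f z" unfolding sqsum_def by (rule sum_le_suminf) auto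
          also have "\<dots> = (l2_norm f z)\<^sup>2" by (simp add: l2_norm_sqsum epowr_2[symmetric] epowr_epowr)
          finally show ?thesis by (auto simp: indicator_def)
        qed
      qed measurable
    qed
    have LV: "ennreal (3 / t ^ ?n) * L \<le> ennreal c * mean_norm f x0 (4 * t)"
    proof -
      have "L \<le> ennreal (A * measure lebesgue (ball x0 (4 * t))) * mean_norm f x0 (4 * t)" unfolding L_def using t by (intro integral_l2_le[OF m]) auto
      then have "ennreal (3 / t ^ ?n) * L \<le> ennreal (3 / t ^ ?n) * (ennreal (A * measure lebesgue (ball x0 (4 * t))) * mean_norm f x0 (4 * t))" by (rule mult_left_mono) simp
      also have "\<dots> = ennreal (3 / t ^ ?n * (A * measure lebesgue (ball x0 (4 * t)))) * mean_norm f x0 (4 * t)"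
        using t A0 by (subst ennreal_mult) (auto simp: mult.assoc)
      also have "3 / t ^ ?n * (A * measure lebesgue (ball x0 (4 * t))) = c"
        using t by (simp add: content_ball c_def power_mult_distrib)
      finally show ?thesis .
    qed
    let ?i = "if r < 2 * t then 1 else 0 :: ennreal"
    have "(\<Sum>k. kernel \<alpha> (far f x0 r k) (y, t)) \<le> (\<Sum>k. (ennreal (3 / t ^ ?n))\<^sup>2 * ?i * ennreal (1 / t ^ (?n + 1)) * (J k)\<^sup>2)"
    proof (rule suminf_le)
      fix k
      have "(A_fun \<alpha> (far f x0 r k) t y)\<^sup>2 \<le> (ennreal (3 / t ^ ?n) * J k * ?i)\<^sup>2"
        unfolding J_def by (intro power_mono A_fun_far_le[OF \<alpha> fk r x y]) simp
      also have "\<dots> = (ennreal (3 / t ^ ?n))\<^sup>2 * ?i * (J k)\<^sup>2" by (simp add: power_mult_distrib mult_ac)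
      finally have "(A_fun \<alpha> (far f x0 r k) t y)\<^sup>2 * ennreal (1 / t ^ (?n + 1)) \<le> (ennreal (3 / t ^ ?n))\<^sup>2 * ?i * (J k)\<^sup>2 * ennreal (1 / t ^ (?n + 1))"
        by (rule mult_right_mono) simp
      then show "kernel \<alpha> (far f x0 r k) (y, t) \<le> (ennreal (3 / t ^ ?n))\<^sup>2 * ?i * ennreal (1 / t ^ (?n + 1)) * (J k)\<^sup>2"
        using t by (simp add: kernel_def mult_ac)
    qed auto
    also have "\<dots> = (ennreal (3 / t ^ ?n))\<^sup>2 * ?i * ennreal (1 / t ^ (?n + 1)) * (\<Sum>k. (J k)\<^sup>2)" by (rule ennreal_suminf_cmult)
    also have "\<dots> \<le> (ennreal (3 / t ^ ?n))\<^sup>2 * ?i * ennreal (1 / t ^ (?n + 1)) * L\<^sup>2" by (intro mult_left_mono Mink) simp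
    also have "\<dots> = (ennreal (3 / t ^ ?n) * L)\<^sup>2 * ?i * ennreal (1 / t ^ (?n + 1))" by (simp only: power_mult_distrib mult_ac)
    also have "\<dots> \<le> (ennreal c * mean_norm f x0 (4 * t))\<^sup>2 * ?i * ennreal (1 / t ^ (?n + 1))"
      by (intro mult_right_mono power_mono LV) auto
    also have "\<dots> = h t" unfolding h_def using c0 by (simp add: power_mult_distrib ennreal_power)
    finally show ?thesis .
  qed
  have "energy \<alpha> (far f x0 r) x = (\<integral>\<^sup>+z. (\<Sum>k. kernel \<alpha> (far f x0 r k) z * indicator ?S z) \<partial>lborel)"
    unfolding energy_def energy1_def using km Sm by (intro nn_integral_suminf[symmetric]) auto
  also have "\<dots> \<le> (\<integral>\<^sup>+z. h (snd z) * (if norm (x - fst z) < snd z then 1 else 0) \<partial>lborel)"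
  proof (rule nn_integral_mono)
    fix z :: "'a \<times> real"
    obtain y t where z: "z = (y, t)" by fastforce
    show "(\<Sum>k. kernel \<alpha> (far f x0 r k) z * indicator ?S z) \<le> h (snd z) * (if norm (x - fst z) < snd z then 1 else 0)"
      using kb[of y t] by (auto simp: z)
  qed
  also have "\<dots> = (\<integral>\<^sup>+z. h (snd z) * (if norm (x - fst z) < snd z then 1 else 0) \<partial>(lborel \<Otimes>\<^sub>M lborel))" by (simp add: lborel_prod)
  also have "\<dots> = (\<integral>\<^sup>+t. \<integral>\<^sup>+y. h t * (if norm (x - y) < t then 1 else 0) \<partial>lborel \<partial>lborel)"
    by (subst lborel_pair.nn_integral_snd[symmetric]) (auto simp: case_prod_beta)
  also have "\<dots> \<le> (\<integral>\<^sup>+t. ennreal ?K * tail f x0 r * (4 * (?v t)) \<partial>lborel)"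
  proof (rule nn_integral_mono)
    fix t :: real
    show "(\<integral>\<^sup>+y. h t * (if norm (x - y) < t then 1 else 0) \<partial>lborel) \<le> ennreal ?K * tail f x0 r * (4 * (?v t))"
    proof (cases "r < 2 * t")
      case True
      then have t: "0 < t" using r by simp
      have "(\<integral>\<^sup>+y. h t * (if norm (x - y) < t then 1 else 0) \<partial>lborel) = (\<integral>\<^sup>+y. h t * indicator (ball x t) y \<partial>lborel)"
        by (rule nn_integral_cong) (auto simp: indicator_def dist_norm)
      also have "\<dots> = h t * ennreal (unit_ball_vol ?n * t ^ ?n)"
        using t by (subst nn_integral_cmult_indicator) (simp_all add: emeasure_ball)
      also have "\<dots> = mean_norm f x0 (4 * t) * (mean_norm f x0 (4 * t) * (ennreal (c\<^sup>2) * ennreal (1 / t ^ (?n + 1)) * ennreal (unit_ball_vol ?n * t ^ ?n)))"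
        using True by (simp add: h_def power2_eq_square mult_ac)
      also have "ennreal (c\<^sup>2) * ennreal (1 / t ^ (?n + 1)) * ennreal (unit_ball_vol ?n * t ^ ?n) = ennreal (?k t)"
        using t by (simp add: ennreal_mult[symmetric])
      also have "mean_norm f x0 (4 * t) * (mean_norm f x0 (4 * t) * ennreal (?k t)) \<le> (ennreal (2 * dbl) * tail f x0 r) * (mean_norm f x0 (4 * t) * ennreal (?k t))"
        using True r by (intro mult_right_mono mean_norm_le_tail) auto
      also have "\<dots> = ennreal ?K * tail f x0 r * (mean_norm f x0 (4 * t) * ennreal (1 / t))"
      proof -
        have "ennreal (2 * dbl) * ennreal (?k t) = ennreal (?K * (1 / t))"
          using dbl_pos t by (subst ennreal_mult[symmetric]) (auto simp: mult_ac)
        also have "\<dots> = ennreal ?K * ennreal (1 / t)" using dbl_pos t by (intro ennreal_mult) auto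
        finally have e: "ennreal (2 * dbl) * ennreal (?k t) = ennreal ?K * ennreal (1 / t)" .
        have "(ennreal (2 * dbl) * tail f x0 r) * (mean_norm f x0 (4 * t) * ennreal (?k t)) = (ennreal (2 * dbl) * ennreal (?k t)) * (tail f x0 r * mean_norm f x0 (4 * t))" by (simp only: mult_ac)
        also have "\<dots> = ennreal ?K * tail f x0 r * (mean_norm f x0 (4 * t) * ennreal (1 / t))" unfolding e by (simp only: mult_ac)
        finally show ?thesis .
      qed
      also have "mean_norm f x0 (4 * t) * ennreal (1 / t) = 4 * (?v t)"
      proof -
        have "ennreal (1 / t) = ennreal (4 * (1 / (4 * t)))" by simp
        also have "\<dots> = ennreal 4 * ennreal (1 / (4 * t))" using t by (intro ennreal_mult) auto
        finally show ?thesis using True by (simp add: mult_ac)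
      qed
      finally show ?thesis .
    qed (simp add: h_def)
  qed
  also have "\<dots> = ennreal ?K * tail f x0 r * (\<integral>\<^sup>+t. 4 * (?v t) \<partial>lborel)"
    by (rule nn_integral_cmult) measurable
  also have "(\<integral>\<^sup>+t. 4 * (?v t) \<partial>lborel) = (\<integral>\<^sup>+u. mean_norm f x0 u * ennreal (1 / u) * indicator {2 * r<..} u \<partial>lborel)"
    by (subst nn_integral_real_affine[where c=4 and t=0]) (auto intro!: nn_integral_cmult)
  also have "\<dots> \<le> tail f x0 r" unfolding tail_def using r by (intro nn_integral_mono) (auto simp: indicator_def)
  finally have "energy \<alpha> (far f x0 r) x \<le> ennreal ?K * tail f x0 r * tail f x0 r" by (simp add: mult_left_mono)
  then show ?thesis unfolding far_const_def c_def by (simp add: power2_eq_square mult.assoc)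
qed

lemma far_const_nonneg: "0 \<le> far_const" using dbl_pos by (simp add: far_const_def)

lemma local_norm_double: "0 < r \<Longrightarrow> local_norm f x (2 * r) \<le> ennreal (2 * dbl * dbl) * (tail f x r * wroot x r)"
proof -
  assume r: "0 < r"
  have "local_norm f x (2 * r) = mean_norm f x (2 * r) * wroot x (2 * r)" using r by (intro local_norm_eq) auto
  also have "\<dots> \<le> (ennreal (2 * dbl) * tail f x r) * (ennreal dbl * wroot x r)"
    using r by (intro mult_mono mean_norm_le_tail wroot_double) auto
  also have "\<dots> = ennreal (2 * dbl * dbl) * (tail f x r * wroot x r)"
    using dbl_pos by (subst ennreal_mult) (auto simp: mult_ac)
  finally show ?thesis .
qed

lemma near_integral: "(\<integral>\<^sup>+y. epowr (sqsum (near f x r) y) (p / 2) * w y \<partial>lebesgue) = epowr (local_norm f x (2 * r)) p"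
proof -
  have "(\<integral>\<^sup>+y. epowr (sqsum (near f x r) y) (p / 2) * w y \<partial>lebesgue) = (\<integral>\<^sup>+y\<in>ball x (2 * r). (epowr (l2_norm f y) p * w y) \<partial>lebesgue)"
  proof (rule nn_integral_cong)
    fix y
    have z: "e2ennreal 0 = 0" using e2ennreal_ereal[of 0] by (simp only: zero_ereal_def ennreal_0 order_refl)
    show "epowr (sqsum (near f x r) y) (p / 2) * w y = epowr (l2_norm f y) p * w y * indicator (ball x (2 * r)) y"
      using p by (cases "y \<in> ball x (2 * r)") (simp_all add: sqsum_def near_def l2_norm_sqsum epowr_epowr epowr_zero z)
  qed
  then show ?thesis unfolding local_norm_def Lp_norm_def using p by (simp add: epowr_epowr)
qed

lemma energy_split:
  assumes \<alpha>: "0 < \<alpha>" "\<alpha> \<le> 1" and f: "f \<in> Lp_loc p w"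
  shows "energy \<alpha> f x \<le> 2 * energy \<alpha> (near f x0 r) x + 2 * energy \<alpha> (far f x0 r) x"
proof -
  have m: "meas_seq f" using f by (simp add: Lp_loc_def)
  show ?thesis
    by (rule energy_add_le[OF \<alpha>]) (use near_far_measurable[OF m] near_far_locint[OF f] in \<open>auto simp: near_def far_def\<close>)
qed

lemma energy_measurable:
  assumes \<alpha>: "0 < \<alpha>" "\<alpha> \<le> 1" and f: "\<And>k. f k \<in> borel_measurable lebesgue" "\<And>k. locint (\<lambda>z. real_of_ereal (f k z))"
  shows "energy \<alpha> f \<in> borel_measurable lebesgue"
proof -
  have [measurable]: "energy1 \<alpha> (f k) (\<lambda>_. True) \<in> borel_measurable borel" for k by (rule energy1_measurable[OF f \<alpha>]) simp
  have "energy \<alpha> f \<in> borel_measurable borel" unfolding energy_def[abs_def] by measurable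
  then show ?thesis by (intro measurable_completion) simp
qed

text \<open>
  Near part by the global bound on the double ball, whose norm the tail controls by doubling;
  far part by \<open>energy_far_le\<close>, whose bound is constant on the ball.
\<close>

lemma local_strong:
  assumes \<alpha>: "0 < \<alpha>" "\<alpha> \<le> 1" and C: "0 < C"
    and G: "\<And>f. (\<forall>k. f k \<in> borel_measurable lebesgue) \<Longrightarrow> (\<forall>k. locint (\<lambda>z. real_of_ereal (f k z))) \<Longrightarrow>
      (\<integral>\<^sup>+x. epowr (energy \<alpha> f x) (p / 2) * w x \<partial>lebesgue) \<le> ennreal C * (\<integral>\<^sup>+x. epowr (sqsum f x) (p / 2) * w x \<partial>lebesgue)"
  obtains K :: real where "0 < K" "\<And>f x0 r. f \<in> Lp_loc p w \<Longrightarrow> 0 < r \<Longrightarrow> Lp_norm p w (ball x0 r) (G_seq \<alpha> f) \<le> ennreal K * (tail f x0 r * wroot x0 r)"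
proof -
  let ?d = "2 * dbl * dbl"
  define K0 where "K0 = 4 powr (p / 2) * (C * ?d powr p + far_const powr (p / 2))"
  have K00: "0 < K0" unfolding K0_def using C dbl_pos by (intro mult_pos_pos add_pos_nonneg) auto
  have "Lp_norm p w (ball x0 r) (G_seq \<alpha> f) \<le> ennreal (K0 powr (1 / p)) * (tail f x0 r * wroot x0 r)" if f: "f \<in> Lp_loc p w" and r: "0 < r" for f x0 r
  proof -
    have m: "meas_seq f" using f by (simp add: Lp_loc_def)
    let ?X = "tail f x0 r * wroot x0 r" and ?E1 = "energy \<alpha> (near f x0 r)"
    let ?E2 = "ennreal far_const * (tail f x0 r)\<^sup>2"
    have em [measurable]: "?E1 \<in> borel_measurable lebesgue"
      by (rule energy_measurable[OF \<alpha> near_far_measurable(1)[OF m] near_far_locint(1)[OF f]])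
    have bm [measurable]: "ball x0 r \<in> sets lebesgue" by simp
    let ?c = "ennreal (4 powr (p / 2))" and ?F = "ennreal (far_const powr (p / 2)) * epowr (tail f x0 r) p"
    have pt: "epowr (l2_norm (G_seq \<alpha> f) y) p * w y * indicator (ball x0 r) y \<le> ?c * (epowr (?E1 y) (p / 2) * w y) + ?c * ?F * (w y * indicator (ball x0 r) y)" for y
    proof (cases "y \<in> ball x0 r")
      case True
      have "epowr (l2_norm (G_seq \<alpha> f) y) p = epowr (energy \<alpha> f y) (p / 2)"
        using p by (simp add: l2_norm_sqsum sqsum_G_seq epowr_epowr)
      also have "\<dots> \<le> epowr (ennreal 4 * max (?E1 y) ?E2) (p / 2)"
      proof (rule epowr_mono)
        have "energy \<alpha> f y \<le> 2 * ?E1 y + 2 * ?E2"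
          using energy_split[OF \<alpha> f, of y x0 r] energy_far_le[OF \<alpha> f r True] by (meson add_left_mono mult_left_mono order_trans zero_le)
        also have "\<dots> \<le> 2 * max (?E1 y) ?E2 + 2 * max (?E1 y) ?E2"
          by (intro add_mono mult_left_mono) auto
        also have "\<dots> = ennreal 4 * max (?E1 y) ?E2"
          by (simp add: distrib_right[symmetric])
        finally show "energy \<alpha> f y \<le> ennreal 4 * max (?E1 y) ?E2" .
      qed (use p in simp)
      also have "\<dots> = ?c * epowr (max (?E1 y) ?E2) (p / 2)"
        using p by (subst epowr_mult) (auto simp: epowr_ennreal[of 4, simplified])
      also have "\<dots> \<le> ?c * (epowr (?E1 y) (p / 2) + epowr ?E2 (p / 2))"
        by (intro mult_left_mono) (auto simp: max_def)
      also have "epowr ?E2 (p / 2) = ?F"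
        using p far_const_nonneg by (simp add: epowr_mult epowr_ennreal epowr_2[symmetric] epowr_epowr)
      finally have "epowr (l2_norm (G_seq \<alpha> f) y) p * w y \<le> ?c * (epowr (?E1 y) (p / 2) + ?F) * w y" by (rule mult_right_mono) simp
      then show ?thesis using True by (simp add: distrib_left distrib_right mult_ac)
    qed simp
    have "(\<integral>\<^sup>+y\<in>ball x0 r. (epowr (l2_norm (G_seq \<alpha> f) y) p * w y) \<partial>lebesgue) \<le> (\<integral>\<^sup>+y. ?c * (epowr (?E1 y) (p / 2) * w y) + ?c * ?F * (w y * indicator (ball x0 r) y) \<partial>lebesgue)"
      by (rule nn_integral_mono) (rule pt)
    also have "\<dots> = (\<integral>\<^sup>+y. ?c * (epowr (?E1 y) (p / 2) * w y) \<partial>lebesgue) + (\<integral>\<^sup>+y. ?c * ?F * (w y * indicator (ball x0 r) y) \<partial>lebesgue)"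
      by (rule nn_integral_add) measurable
    also have "(\<integral>\<^sup>+y. ?c * (epowr (?E1 y) (p / 2) * w y) \<partial>lebesgue) = ?c * (\<integral>\<^sup>+y. epowr (?E1 y) (p / 2) * w y \<partial>lebesgue)"
      by (rule nn_integral_cmult) measurable
    also have "(\<integral>\<^sup>+y. epowr (?E1 y) (p / 2) * w y \<partial>lebesgue) \<le> ennreal C * (\<integral>\<^sup>+y. epowr (sqsum (near f x0 r) y) (p / 2) * w y \<partial>lebesgue)"
      using near_far_measurable(1)[OF m] near_far_locint(1)[OF f] by (intro G) auto
    also have "\<dots> = ennreal C * epowr (local_norm f x0 (2 * r)) p" unfolding near_integral ..
    also have "\<dots> \<le> ennreal C * epowr (ennreal ?d * ?X) p"
      using p r by (intro mult_left_mono epowr_mono local_norm_double) auto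
    also have "\<dots> = ennreal (C * ?d powr p) * epowr ?X p"
    proof -
      have "epowr (ennreal ?d * ?X) p = epowr (ennreal ?d) p * epowr ?X p" using p by (intro epowr_mult) simp
      also have "epowr (ennreal ?d) p = ennreal (?d powr p)" using p dbl_pos by (intro epowr_ennreal) auto
      finally show ?thesis using C by (simp only: ennreal_mult[OF less_imp_le[OF C] powr_ge_zero] mult.assoc)
    qed
    also have "(\<integral>\<^sup>+y. ?c * ?F * (w y * indicator (ball x0 r) y) \<partial>lebesgue) = ?c * ?F * wmeas w (ball x0 r)"
      unfolding wmeas_def by (rule nn_integral_cmult) measurable
    also have "\<dots> = ?c * (ennreal (far_const powr (p / 2)) * epowr ?X p)"
      unfolding wroot_powr[symmetric] using p by (simp add: epowr_mult[of p "tail f x0 r"] mult.assoc)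
    finally have "(\<integral>\<^sup>+y\<in>ball x0 r. (epowr (l2_norm (G_seq \<alpha> f) y) p * w y) \<partial>lebesgue) \<le> ?c * (ennreal (C * ?d powr p) * epowr ?X p) + ?c * (ennreal (far_const powr (p / 2)) * epowr ?X p)"
      by (simp add: mult_left_mono)
    also have "\<dots> = ?c * (ennreal (C * ?d powr p) + ennreal (far_const powr (p / 2))) * epowr ?X p"
      by (simp only: distrib_left distrib_right mult.assoc)
    also have "ennreal (C * ?d powr p) + ennreal (far_const powr (p / 2)) = ennreal (C * ?d powr p + far_const powr (p / 2))"
      using C by (intro ennreal_plus[symmetric]) auto
    also have "?c * \<dots> = ennreal K0" unfolding K0_def using C by (intro ennreal_mult[symmetric]) auto
    finally have "Lp_norm p w (ball x0 r) (G_seq \<alpha> f) \<le> epowr (ennreal K0 * epowr ?X p) (1 / p)"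
      unfolding Lp_norm_def using p by (intro epowr_mono) auto
    also have "\<dots> = ennreal (K0 powr (1 / p)) * ?X"
      using p K00 by (simp add: epowr_mult[of "1 / p" "ennreal K0"] epowr_ennreal epowr_epowr)
    finally show ?thesis .
  qed
  then show ?thesis using K00 by (intro that[of "K0 powr (1 / p)"]) auto
qed

text \<open>
  If \<open>\<theta>\<close> is at most a multiple of the tail, the whole ball is small enough. Otherwise the far
  part of the energy is at most \<open>\<theta>\<^sup>2 / 4\<close>, and the superlevel set is contained in one of the
  near part.
\<close>

lemma local_weak:
  assumes p1: "p = 1" and \<alpha>: "0 < \<alpha>" "\<alpha> \<le> 1" and C: "0 < C"
    and G: "\<And>f \<theta>. (\<forall>k. f k \<in> borel_measurable lebesgue) \<Longrightarrow> (\<forall>k. locint (\<lambda>z. real_of_ereal (f k z))) \<Longrightarrow> 0 < \<theta> \<Longrightarrow>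
      ennreal \<theta> * (\<integral>\<^sup>+x\<in>{x. ennreal (\<theta>\<^sup>2) < energy \<alpha> f x}. w x \<partial>lebesgue) \<le> ennreal C * (\<integral>\<^sup>+x. epowr (sqsum f x) (1 / 2) * w x \<partial>lebesgue)"
  obtains K :: real where "0 < K" "\<And>f x0 r. f \<in> Lp_loc 1 w \<Longrightarrow> 0 < r \<Longrightarrow> WLp_norm 1 w (ball x0 r) (G_seq \<alpha> f) \<le> ennreal K * (tail f x0 r * wroot x0 r)"
proof -
  let ?d = "2 * dbl * dbl"
  define K where "K = 2 * C * ?d + (2 * sqrt far_const + 1)"
  have K0: "0 < K" unfolding K_def using C dbl_pos far_const_nonneg by (intro add_pos_nonneg) auto
  have "WLp_norm 1 w (ball x0 r) (G_seq \<alpha> f) \<le> ennreal K * (tail f x0 r * wroot x0 r)" if f: "f \<in> Lp_loc 1 w" and r: "0 < r" for f x0 r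
    unfolding WLp_norm_def
  proof (rule SUP_least)
    fix \<theta> :: real assume "\<theta> \<in> {0<..}"
    then have \<theta>: "0 < \<theta>" by simp
    have f': "f \<in> Lp_loc p w" using f p1 by simp
    have m: "meas_seq f" using f by (simp add: Lp_loc_def)
    let ?X = "tail f x0 r * wroot x0 r" and ?E1 = "energy \<alpha> (near f x0 r)"
    have em [measurable]: "?E1 \<in> borel_measurable lebesgue"
      by (rule energy_measurable[OF \<alpha> near_far_measurable(1)[OF m] near_far_locint(1)[OF f']])
    have bm [measurable]: "ball x0 r \<in> sets lebesgue" by simp
    define S1 where "S1 = {x. ennreal ((\<theta> / 2)\<^sup>2) < ?E1 x}"
    have S1m [measurable]: "S1 \<in> sets lebesgue"
    proof -
      have "{x \<in> space lebesgue. ennreal ((\<theta> / 2)\<^sup>2) < ?E1 x} \<in> sets lebesgue" by measurable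
      then show ?thesis by (simp add: S1_def)
    qed
    have omw: "wroot x0 r = wmeas w (ball x0 r)" using wroot_powr[of x0 r] p1 by simp
    let ?W1 = "\<integral>\<^sup>+x\<in>S1. w x \<partial>lebesgue"
    let ?E2 = "ennreal far_const * (tail f x0 r)\<^sup>2"
    let ?Y = "{y \<in> ball x0 r. l2_norm (G_seq \<alpha> f) y > ennreal \<theta>}"
    have lt: "ennreal (\<theta>\<^sup>2) < energy \<alpha> f y" if "l2_norm (G_seq \<alpha> f) y > ennreal \<theta>" for y
    proof (rule ccontr)
      assume "\<not> ennreal (\<theta>\<^sup>2) < energy \<alpha> f y"
      then have "epowr (energy \<alpha> f y) (1 / 2) \<le> epowr (ennreal (\<theta>\<^sup>2)) (1 / 2)" by (intro epowr_mono) (auto simp: not_less)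
      also have "\<dots> = ennreal \<theta>" using \<theta> by (simp add: epowr_ennreal powr_half_sqrt)
      finally show False using that by (simp add: l2_norm_sqsum sqsum_G_seq)
    qed
    have part1: "ennreal \<theta> * ?W1 \<le> ennreal (2 * C * ?d) * ?X"
    proof -
      have "ennreal (\<theta> / 2) * ?W1 \<le> ennreal C * (\<integral>\<^sup>+x. epowr (sqsum (near f x0 r) x) (1 / 2) * w x \<partial>lebesgue)"
        unfolding S1_def using near_far_measurable(1)[OF m] near_far_locint(1)[OF f'] \<theta> by (intro G) auto
      also have "(\<integral>\<^sup>+x. epowr (sqsum (near f x0 r) x) (1 / 2) * w x \<partial>lebesgue) = local_norm f x0 (2 * r)" using near_integral[of f x0 r] p1 by simp
      also have "ennreal C * \<dots> \<le> ennreal C * (ennreal ?d * ?X)" by (intro mult_left_mono local_norm_double r) simp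
      finally have le: "ennreal (\<theta> / 2) * ?W1 \<le> ennreal C * (ennreal ?d * ?X)" .
      have "ennreal \<theta> = ennreal 2 * ennreal (\<theta> / 2)" using \<theta> by (subst ennreal_mult[symmetric]) auto
      then have "ennreal \<theta> * ?W1 = ennreal 2 * (ennreal (\<theta> / 2) * ?W1)" by (simp only: mult.assoc)
      also have "\<dots> \<le> ennreal 2 * (ennreal C * (ennreal ?d * ?X))" by (intro mult_left_mono le) simp
      also have "\<dots> = (ennreal 1 * ennreal 2 * ennreal C * ennreal ?d) * ?X" by (simp add: mult.assoc)
      also have "ennreal 1 * ennreal 2 * ennreal C * ennreal ?d = ennreal (1 * 2 * C * ?d)" using C dbl_pos by (intro ennreal_mult4) auto
      finally show ?thesis by simp
    qed
    have "ennreal \<theta> * wmeas w ?Y \<le> ennreal K * ?X"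
    proof (cases "ennreal \<theta> \<le> ennreal (2 * sqrt far_const + 1) * tail f x0 r")
      case True
      have "ennreal \<theta> * wmeas w ?Y \<le> ennreal \<theta> * wmeas w (ball x0 r)"
        unfolding wmeas_def by (intro mult_left_mono nn_integral_mono) (auto simp: indicator_def)
      also have "\<dots> \<le> (ennreal (2 * sqrt far_const + 1) * tail f x0 r) * wroot x0 r" unfolding omw using True by (rule mult_right_mono) simp
      also have "\<dots> = ennreal (2 * sqrt far_const + 1) * ?X" by (simp only: mult.assoc)
      also have "\<dots> \<le> ennreal K * ?X" unfolding K_def using C dbl_pos by (intro mult_right_mono ennreal_leI) auto
      finally show ?thesis .
    next
      case False
      then have big: "ennreal (2 * sqrt far_const + 1) * tail f x0 r < ennreal \<theta>" by simp
      have farsmall: "4 * ?E2 \<le> ennreal (\<theta>\<^sup>2)"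
      proof -
        have s0: "0 \<le> sqrt far_const" using far_const_nonneg by simp
        have "4 * ?E2 = (ennreal (2 * sqrt far_const) * tail f x0 r)\<^sup>2"
        proof -
          have "(ennreal (2 * sqrt far_const))\<^sup>2 = ennreal ((2 * sqrt far_const)\<^sup>2)" using s0 by (intro ennreal_power) auto
          also have "(2 * sqrt far_const)\<^sup>2 = 4 * far_const" using far_const_nonneg by (simp add: power_mult_distrib)
          also have "ennreal (4 * far_const) = ennreal 4 * ennreal far_const" using far_const_nonneg by (intro ennreal_mult) auto
          finally show ?thesis by (simp add: power_mult_distrib mult.assoc)
        qed
        also have "\<dots> \<le> (ennreal \<theta>)\<^sup>2"
        proof (rule power_mono)
          have "ennreal (2 * sqrt far_const) * tail f x0 r \<le> ennreal (2 * sqrt far_const + 1) * tail f x0 r" by (intro mult_right_mono ennreal_leI) auto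
          then show "ennreal (2 * sqrt far_const) * tail f x0 r \<le> ennreal \<theta>" using big by (auto intro: order_trans less_imp_le)
        qed simp
        also have "\<dots> = ennreal (\<theta>\<^sup>2)" using \<theta> by (intro ennreal_power) auto
        finally show ?thesis .
      qed
      have sub: "y \<in> S1" if y: "y \<in> ball x0 r" "l2_norm (G_seq \<alpha> f) y > ennreal \<theta>" for y
      proof (rule ccontr)
        assume "y \<notin> S1"
        then have s: "?E1 y \<le> ennreal ((\<theta> / 2)\<^sup>2)" by (simp add: S1_def not_less)
        have four: "4 * energy \<alpha> f y \<le> 4 * ennreal (\<theta>\<^sup>2)"
        proof -
          have "energy \<alpha> f y \<le> 2 * ?E1 y + 2 * ?E2"
            using energy_split[OF \<alpha> f', of y x0 r] energy_far_le[OF \<alpha> f' r y(1)] by (meson add_left_mono mult_left_mono order_trans zero_le)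
          then have "2 * energy \<alpha> f y \<le> 2 * (2 * ?E1 y + 2 * ?E2)" by (rule mult_left_mono) simp
          also have "\<dots> = 4 * ?E1 y + 4 * ?E2" by (simp add: distrib_left mult.assoc[symmetric])
          also have "\<dots> \<le> 4 * ennreal ((\<theta> / 2)\<^sup>2) + ennreal (\<theta>\<^sup>2)" by (intro add_mono mult_left_mono s farsmall) simp
          also have "4 * ennreal ((\<theta> / 2)\<^sup>2) = ennreal 4 * ennreal ((\<theta> / 2)\<^sup>2)" by simp
          also have "\<dots> = ennreal (\<theta>\<^sup>2)" by (subst ennreal_mult[symmetric]) (auto simp: power_divide)
          also have "ennreal (\<theta>\<^sup>2) + ennreal (\<theta>\<^sup>2) = 2 * ennreal (\<theta>\<^sup>2)" by (simp add: mult_2)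
          finally have "2 * energy \<alpha> f y \<le> 2 * ennreal (\<theta>\<^sup>2)" .
          then have "2 * (2 * energy \<alpha> f y) \<le> 2 * (2 * ennreal (\<theta>\<^sup>2))" by (rule mult_left_mono) simp
          then show ?thesis by (simp add: mult.assoc[symmetric])
        qed
        then have "energy \<alpha> f y \<le> ennreal (\<theta>\<^sup>2)" by (subst (asm) ennreal_mult_le_mult_iff) auto
        then show False using lt[OF y(2)] by simp
      qed
      have "wmeas w ?Y \<le> ?W1"
        unfolding wmeas_def using sub by (intro nn_integral_mono) (auto simp: indicator_def)
      then have "ennreal \<theta> * wmeas w ?Y \<le> ennreal \<theta> * ?W1" by (rule mult_left_mono) simp
      also note part1
      also have "ennreal (2 * C * ?d) * ?X \<le> ennreal K * ?X"
        unfolding K_def using far_const_nonneg by (intro mult_right_mono ennreal_leI) auto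
      finally show ?thesis .
    qed
    then show "ennreal \<theta> * epowr (wmeas w ?Y) (1 / 1) \<le> ennreal K * ?X" by simp
  qed
  then show ?thesis using K0 that by blast
qed

section \<open>Boundedness on Morrey spaces\<close>

lemma wroot_inverse: "0 < r \<Longrightarrow> epowr (wmeas w (ball x r)) (- 1 / p) * wroot x r = 1"
proof -
  assume r: "0 < r"
  obtain q where q: "wmeas w (ball x r) = ennreal q" "0 < q" using wmeas_ball[OF w r, of x] by (cases "wmeas w (ball x r)") auto
  have "epowr (wmeas w (ball x r)) (- 1 / p) = ennreal (q powr (- 1 / p))" using q p by (simp add: epowr_def)
  moreover have "wroot x r = ennreal (q powr (1 / p))" using q p by (simp add: wroot_def epowr_ennreal)
  moreover have "q powr (- 1 / p) * q powr (1 / p) = 1" using q by (simp add: powr_add[symmetric])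
  ultimately show ?thesis by (simp add: ennreal_mult[symmetric])
qed

text \<open>
  For \<open>s > t\<close> the norm on the ball of radius \<open>t\<close> is at most that on the ball of radius \<open>s\<close>,
  hence at most the Morrey norm \<open>N\<close> times \<open>\<phi>1 x s * wroot x s\<close>. So it is bounded by \<open>N\<close> times
  the essential infimum over \<open>s\<close>.
\<close>

lemma tail_le_Morrey:
  assumes f: "f \<in> Morrey p \<phi>1 w" and pos: "\<And>x r. 0 < r \<Longrightarrow> 0 < \<phi>1 x r" and r: "0 < r"
    and cond: "(\<integral>\<^sup>+t\<in>{r<..}.
              (ess_inf_on {t<..} (\<lambda>s. ennreal (\<phi>1 x s) * epowr (wmeas w (ball x s)) (1/p))
               / epowr (wmeas w (ball x t)) (1/p) * ennreal (1/t)) \<partial>lebesgue) \<le> ennreal b"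
  shows "tail f x r \<le> ennreal b * Morrey_norm p \<phi>1 w f"
proof -
  let ?g = "\<lambda>s. ennreal (\<phi>1 x s) * epowr (wmeas w (ball x s)) (1/p)"
  define N where "N = Morrey_norm p \<phi>1 w f"
  have Nfin: "N < \<infinity>" using f by (simp add: Morrey_def N_def)
  have nmN: "local_norm f x s \<le> N * (ennreal (\<phi>1 x s) * wroot x s)" if s: "0 < s" for s
  proof -
    have ph: "inverse (ennreal (\<phi>1 x s)) * ennreal (\<phi>1 x s) = 1" using pos[OF s, of x] by (simp add: inverse_ennreal ennreal_mult[symmetric])
    note oo = wroot_inverse[OF s, of x]
    have "inverse (ennreal (\<phi>1 x s)) * epowr (wmeas w (ball x s)) (- 1 / p) * local_norm f x s \<le> N"
      unfolding N_def Morrey_norm_def local_norm_def by (rule SUP_upper2[where i=x], simp, rule SUP_upper2[where i=s]) (use s in auto)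
    then have "(inverse (ennreal (\<phi>1 x s)) * epowr (wmeas w (ball x s)) (- 1 / p) * local_norm f x s) * (ennreal (\<phi>1 x s) * wroot x s) \<le> N * (ennreal (\<phi>1 x s) * wroot x s)"
      by (rule mult_right_mono) simp
    moreover have "(inverse (ennreal (\<phi>1 x s)) * epowr (wmeas w (ball x s)) (- 1 / p) * local_norm f x s) * (ennreal (\<phi>1 x s) * wroot x s)
      = (inverse (ennreal (\<phi>1 x s)) * ennreal (\<phi>1 x s)) * (epowr (wmeas w (ball x s)) (- 1 / p) * wroot x s) * local_norm f x s" by (simp only: mult_ac)
    ultimately show ?thesis unfolding ph oo by simp
  qed
  show ?thesis
  proof (cases "N = 0")
    case True
    have "mean_norm f x t = 0" if "r < t" for t using nmN[of t] r that True by (simp add: mean_norm_def)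
    then have "tail f x r = (\<integral>\<^sup>+t. 0 \<partial>(lborel :: real measure))" unfolding tail_def by (intro nn_integral_cong) (auto simp: indicator_def)
    then show ?thesis by simp
  next
    case False
    then obtain n where n: "N = ennreal n" "0 < n" using Nfin by (cases N) (auto simp: less_le)
    have i: "ennreal (1 / n) * ennreal n = 1" "ennreal n * ennreal (1 / n) = 1" using n by (simp_all add: ennreal_mult[symmetric])
    \<comment> \<open>Dividing by \<open>N\<close> is possible since \<open>N\<close> is positive and finite here; a vanishing
      Morrey norm was treated before.\<close>
    have ess: "ennreal (1 / n) * local_norm f x t \<le> ess_inf_on {t<..} ?g" if t: "0 < t" for t
      unfolding ess_inf_on_def
    proof (rule Sup_upper, rule CollectI, rule AE_I2, rule impI)
      fix s assume "s \<in> {t<..}"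
      then have s: "t < s" by simp
      have "ennreal (1 / n) * local_norm f x t \<le> ennreal (1 / n) * (ennreal n * (ennreal (\<phi>1 x s) * wroot x s))"
        using local_norm_mono[of t s f x] nmN[of s] s t n by (intro mult_left_mono) (auto intro: order_trans)
      also have "\<dots> = ennreal (\<phi>1 x s) * wroot x s" unfolding mult.assoc[symmetric] i by simp
      finally show "ennreal (1 / n) * local_norm f x t \<le> ennreal (\<phi>1 x s) * epowr (wmeas w (ball x s)) (1/p)" by (simp add: wroot_def)
    qed
    have "ennreal (1 / n) * tail f x r = (\<integral>\<^sup>+t. ennreal (1 / n) * (mean_norm f x t * ennreal (1 / t) * indicator {r<..} t) \<partial>lborel)"
      unfolding tail_def by (rule nn_integral_cmult[symmetric]) measurable
    also have "\<dots> \<le> (\<integral>\<^sup>+t\<in>{r<..}.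
              (ess_inf_on {t<..} ?g
               / epowr (wmeas w (ball x t)) (1/p) * ennreal (1/t)) \<partial>lborel)"
    proof (rule nn_integral_mono)
      fix t :: real
      show "ennreal (1 / n) * (mean_norm f x t * ennreal (1 / t) * indicator {r<..} t) \<le> ess_inf_on {t<..} ?g
               / epowr (wmeas w (ball x t)) (1/p) * ennreal (1/t) * indicator {r<..} t"
      proof (cases "r < t")
        case True
        have "ennreal (1 / n) * mean_norm f x t = ennreal (1 / n) * local_norm f x t / wroot x t" unfolding mean_norm_def by (simp add: ennreal_times_divide)
        also have "\<dots> \<le> ess_inf_on {t<..} ?g / epowr (wmeas w (ball x t)) (1/p)"
          unfolding wroot_def using True r by (intro divide_right_mono_ennreal ess) simp
        finally have "ennreal (1 / n) * mean_norm f x t * ennreal (1 / t) \<le> ess_inf_on {t<..} ?g / epowr (wmeas w (ball x t)) (1/p) * ennreal (1 / t)"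
          by (rule mult_right_mono) simp
        then show ?thesis using True by (simp add: mult.assoc)
      qed simp
    qed
    also have "\<dots> \<le> ennreal b" using cond by (simp add: nn_integral_completion)
    finally have "ennreal n * (ennreal (1 / n) * tail f x r) \<le> ennreal n * ennreal b" by (rule mult_left_mono) simp
    then show ?thesis unfolding mult.assoc[symmetric] i N_def[symmetric] n(1) by (simp add: mult.commute)
  qed
qed

lemma Morrey_from_local:
  assumes f: "f \<in> Morrey p \<phi>1 w" and pos1: "\<And>x r. 0 < r \<Longrightarrow> 0 < \<phi>1 x r" and pos2: "0 < \<phi>2 x r" and r: "0 < r" and K: "0 < K" and C: "0 < C"
    and cond: "(\<integral>\<^sup>+t\<in>{r<..}.
              (ess_inf_on {t<..} (\<lambda>s. ennreal (\<phi>1 x s) * epowr (wmeas w (ball x s)) (1/p))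
               / epowr (wmeas w (ball x t)) (1/p) * ennreal (1/t)) \<partial>lebesgue) \<le> ennreal (C * \<phi>2 x r)"
    and loc: "g \<le> ennreal K * (tail f x r * wroot x r)"
  shows "g < \<infinity>" "inverse (ennreal (\<phi>2 x r)) * epowr (wmeas w (ball x r)) (- 1/p) * g \<le> ennreal (K * C) * Morrey_norm p \<phi>1 w f"
proof -
  have t: "tail f x r \<le> ennreal (C * \<phi>2 x r) * Morrey_norm p \<phi>1 w f" by (rule tail_le_Morrey[OF f pos1 r cond])
  have Nfin: "Morrey_norm p \<phi>1 w f < \<infinity>" using f by (simp add: Morrey_def)
  have g: "g \<le> ennreal K * (ennreal (C * \<phi>2 x r) * Morrey_norm p \<phi>1 w f * wroot x r)"
    by (rule order_trans[OF loc]) (intro mult_left_mono mult_right_mono t, auto)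
  also have "\<dots> < \<infinity>" using Nfin wroot_fin[OF r, of x] by (simp add: ennreal_mult_less_top less_top)
  finally show "g < \<infinity>" .
  have i: "inverse (ennreal (\<phi>2 x r)) * ennreal (\<phi>2 x r) = 1" using pos2 by (simp add: inverse_ennreal ennreal_mult[symmetric])
  have "inverse (ennreal (\<phi>2 x r)) * epowr (wmeas w (ball x r)) (- 1/p) * g \<le> inverse (ennreal (\<phi>2 x r)) * epowr (wmeas w (ball x r)) (- 1/p) * (ennreal K * (ennreal (C * \<phi>2 x r) * Morrey_norm p \<phi>1 w f * wroot x r))"
    by (intro mult_left_mono g) simp
  also have "ennreal (C * \<phi>2 x r) = ennreal C * ennreal (\<phi>2 x r)" using C pos2 by (intro ennreal_mult) auto
  also have "inverse (ennreal (\<phi>2 x r)) * epowr (wmeas w (ball x r)) (- 1/p) * (ennreal K * (ennreal C * ennreal (\<phi>2 x r) * Morrey_norm p \<phi>1 w f * wroot x r))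
     = (inverse (ennreal (\<phi>2 x r)) * ennreal (\<phi>2 x r)) * (epowr (wmeas w (ball x r)) (- 1/p) * wroot x r) * (ennreal K * ennreal C * Morrey_norm p \<phi>1 w f)"
    by (simp only: mult_ac)
  also have "\<dots> = ennreal (K * C) * Morrey_norm p \<phi>1 w f"
    unfolding i wroot_inverse[OF r] using K C by (simp add: ennreal_mult)
  finally show "inverse (ennreal (\<phi>2 x r)) * epowr (wmeas w (ball x r)) (- 1/p) * g \<le> ennreal (K * C) * Morrey_norm p \<phi>1 w f" .
qed

lemma G_seq_meas:
  assumes "0 < \<alpha>" "\<alpha> \<le> 1" "f \<in> Lp_loc p w" shows "meas_seq (G_seq \<alpha> f)"
  unfolding meas_seq_def G_seq_def using assms
  by (auto intro!: G_fun_measurable locint_of_Lp_loc simp: Lp_loc_def meas_seq_def)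

end

theorem theorem1p1:
  fixes p \<alpha> :: real
    and w :: "'a::euclidean_space \<Rightarrow> ennreal"
    and \<phi>1 \<phi>2 :: "'a \<Rightarrow> real \<Rightarrow> real"
  assumes "1 \<le> p"
    and "0 < \<alpha>" and "\<alpha> \<le> 1"
    and "w \<in> Muckenhoupt p"
    and "pos_measurable \<phi>1" and "pos_measurable \<phi>2"
    and "\<exists>C::real. C > 0 \<and> (\<forall>x. \<forall>r>0.
           (\<integral>\<^sup>+t\<in>{r<..}.
              (ess_inf_on {t<..} (\<lambda>s. ennreal (\<phi>1 x s) * epowr (wmeas w (ball x s)) (1/p))
               / epowr (wmeas w (ball x t)) (1/p) * ennreal (1/t)) \<partial>lebesgue)
           \<le> ennreal (C * \<phi>2 x r))"
  shows "(p > 1 \<longrightarrow> bounded_operator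
            (Morrey p \<phi>1 w) (Morrey_norm p \<phi>1 w)
            (Morrey p \<phi>2 w) (Morrey_norm p \<phi>2 w) (G_seq \<alpha>))
       \<and> (p = 1 \<longrightarrow> bounded_operator
            (Morrey 1 \<phi>1 w) (Morrey_norm 1 \<phi>1 w)
            (WMorrey 1 \<phi>2 w) (WMorrey_norm 1 \<phi>2 w) (G_seq \<alpha>))"
proof -
  note \<alpha> = assms(2,3)
  obtain C :: real where C: "0 < C" and cond: "\<And>x r. 0 < r \<Longrightarrow> (\<integral>\<^sup>+t\<in>{r<..}.
              (ess_inf_on {t<..} (\<lambda>s. ennreal (\<phi>1 x s) * epowr (wmeas w (ball x s)) (1/p))
               / epowr (wmeas w (ball x t)) (1/p) * ennreal (1/t)) \<partial>lebesgue) \<le> ennreal (C * \<phi>2 x r)"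
    using assms(7) by blast
  have pos1: "\<And>x r. 0 < r \<Longrightarrow> 0 < \<phi>1 x r" and pos2: "\<And>x r. 0 < r \<Longrightarrow> 0 < \<phi>2 x r"
    using assms(5,6) by (auto simp: pos_measurable_def)
  have wt: "weight w" using assms(4) by (auto simp: Muckenhoupt_def)
  obtain v where v: "v \<in> borel_measurable lebesgue" "\<And>x. 0 < v x" "AE x in lebesgue. w x = ennreal (v x)" "locint v"
    using weight_real[OF wt] by blast
  show ?thesis
  proof (intro conjI impI)
    assume gt1: "1 < p"
    obtain \<sigma> :: "'a \<Rightarrow> real" and D :: real where D: "0 < D" and \<sigma>: "\<sigma> \<in> borel_measurable lebesgue" "\<And>x. 0 < \<sigma> x" "\<And>x. \<sigma> x powr (p - 1) * v x = 1" "locint \<sigma>"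
      and Ap: "\<And>x r. 0 < r \<Longrightarrow> (LINT y|lebesgue. indicator (ball x r) y * v y) * (LINT y|lebesgue. indicator (ball x r) y * \<sigma> y) powr (p - 1) \<le> D * measure lebesgue (ball x r) powr p"
    proof (rule Muckenhoupt_dual[OF gt1 assms(4) v], goal_cases)
      case (1 \<sigma> D)
      show ?case by (rule 1(1)[OF 1(2-7)])
    qed
    have ai: "avg_ineq p w (2 * D powr (1 / p))" by (rule avg_ineq_gt1[OF gt1 D v \<sigma> Ap])
    interpret avg_weight p w "2 * D powr (1 / p)"
      by unfold_locales (use gt1 wt ai D in auto)
    obtain C1 :: real where C1: "0 < C1" and G: "\<And>f. (\<forall>k. f k \<in> borel_measurable lebesgue) \<Longrightarrow> (\<forall>k. locint (\<lambda>z. real_of_ereal (f k z))) \<Longrightarrow>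
      (\<integral>\<^sup>+x. epowr (energy \<alpha> f x) (p / 2) * ennreal (v x) \<partial>lebesgue) \<le> ennreal C1 * (\<integral>\<^sup>+x. epowr (sqsum f x) (p / 2) * ennreal (v x) \<partial>lebesgue)"
      using global_strong[OF \<alpha> gt1 D v(1) \<sigma>(1) v(2) \<sigma>(2,3) v(4) \<sigma>(4) Ap] by blast
    obtain K :: real where K: "0 < K" and loc: "\<And>f x0 r. f \<in> Lp_loc p w \<Longrightarrow> 0 < r \<Longrightarrow> Lp_norm p w (ball x0 r) (G_seq \<alpha> f) \<le> ennreal K * (tail f x0 r * wroot x0 r)"
      using local_strong[OF \<alpha> C1 G[folded nn_integral_AE_weight(1)[OF v(3)]]] by blast
    show "bounded_operator (Morrey p \<phi>1 w) (Morrey_norm p \<phi>1 w) (Morrey p \<phi>2 w) (Morrey_norm p \<phi>2 w) (G_seq \<alpha>)"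
      unfolding bounded_operator_def
    proof (intro exI[of _ "K * C"] conjI ballI)
      show "0 < K * C" using K C by simp
      fix f assume f: "f \<in> Morrey p \<phi>1 w"
      then have fl: "f \<in> Lp_loc p w" by (simp add: Morrey_def)
      have M: "Lp_norm p w (ball x r) (G_seq \<alpha> f) < \<infinity>"
        "inverse (ennreal (\<phi>2 x r)) * epowr (wmeas w (ball x r)) (- 1 / p) * Lp_norm p w (ball x r) (G_seq \<alpha> f) \<le> ennreal (K * C) * Morrey_norm p \<phi>1 w f"
        if r: "0 < r" for x r
        using Morrey_from_local[where x=x and r=r and ?\<phi>1.0=\<phi>1 and ?\<phi>2.0=\<phi>2, OF f pos1 pos2[OF r] r K C cond[OF r] loc[OF fl r]] by auto
      show nb: "Morrey_norm p \<phi>2 w (G_seq \<alpha> f) \<le> ennreal (K * C) * Morrey_norm p \<phi>1 w f"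
        unfolding Morrey_norm_def[of p \<phi>2] by (intro SUP_least M(2)) auto
      have "\<dots> < \<infinity>" using f by (simp add: Morrey_def ennreal_mult_less_top)
      then have "Morrey_norm p \<phi>2 w (G_seq \<alpha> f) < \<infinity>" using nb by (rule le_less_trans[rotated])
      moreover have "G_seq \<alpha> f \<in> Lp_loc p w" using M(1) G_seq_meas[OF \<alpha> fl] by (auto simp: Lp_loc_def)
      ultimately show "G_seq \<alpha> f \<in> Morrey p \<phi>2 w" by (simp add: Morrey_def)
    qed
  next
    assume eq1: "p = 1"
    have w1: "w \<in> Muckenhoupt 1" using assms(4) eq1 by simp
    obtain D :: real where D: "0 < D" "fat_A1 v D" using Muckenhoupt_1_fat_A1[OF w1 v(1,2,3)] by blast
    have ai: "avg_ineq 1 w (D * 2 ^ DIM('a))" by (rule avg_ineq_1[OF v(3) D(2,1)])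
    interpret avg_weight 1 w "D * 2 ^ DIM('a)"
      by unfold_locales (use wt ai D in auto)
    obtain C1 :: real where C1: "0 < C1" and G: "\<And>f \<theta>. (\<forall>k. f k \<in> borel_measurable lebesgue) \<Longrightarrow> (\<forall>k. locint (\<lambda>z. real_of_ereal (f k z))) \<Longrightarrow> 0 < \<theta> \<Longrightarrow>
      ennreal \<theta> * (\<integral>\<^sup>+x\<in>{x. ennreal (\<theta>\<^sup>2) < energy \<alpha> f x}. ennreal (v x) \<partial>lebesgue) \<le> ennreal C1 * (\<integral>\<^sup>+x. epowr (sqsum f x) (1 / 2) * ennreal (v x) \<partial>lebesgue)"
      using global_weak[OF \<alpha> D(1) v(1,2,4) D(2)] by blast
    obtain K :: real where K: "0 < K" and loc: "\<And>f x0 r. f \<in> Lp_loc 1 w \<Longrightarrow> 0 < r \<Longrightarrow> WLp_norm 1 w (ball x0 r) (G_seq \<alpha> f) \<le> ennreal K * (tail f x0 r * wroot x0 r)"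
      using local_weak[OF refl \<alpha> C1 G[folded nn_integral_AE_weight(1)[OF v(3)] nn_integral_AE_weight(2)[OF v(3)]]] by blast
    show "bounded_operator (Morrey 1 \<phi>1 w) (Morrey_norm 1 \<phi>1 w) (WMorrey 1 \<phi>2 w) (WMorrey_norm 1 \<phi>2 w) (G_seq \<alpha>)"
      unfolding bounded_operator_def
    proof (intro exI[of _ "K * C"] conjI ballI)
      show "0 < K * C" using K C by simp
      fix f assume f: "f \<in> Morrey 1 \<phi>1 w"
      then have fl: "f \<in> Lp_loc 1 w" by (simp add: Morrey_def)
      have M: "WLp_norm 1 w (ball x r) (G_seq \<alpha> f) < \<infinity>"
        "inverse (ennreal (\<phi>2 x r)) * epowr (wmeas w (ball x r)) (- 1 / 1) * WLp_norm 1 w (ball x r) (G_seq \<alpha> f) \<le> ennreal (K * C) * Morrey_norm 1 \<phi>1 w f"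
        if r: "0 < r" for x r
        using Morrey_from_local[where x=x and r=r and ?\<phi>1.0=\<phi>1 and ?\<phi>2.0=\<phi>2, OF f pos1 pos2[OF r] r K C cond[unfolded eq1, OF r] loc[OF fl r]] by auto
      show nb: "WMorrey_norm 1 \<phi>2 w (G_seq \<alpha> f) \<le> ennreal (K * C) * Morrey_norm 1 \<phi>1 w f"
        unfolding WMorrey_norm_def[of 1 \<phi>2] by (intro SUP_least M(2)) auto
      have "\<dots> < \<infinity>" using f by (simp add: Morrey_def ennreal_mult_less_top)
      then have "WMorrey_norm 1 \<phi>2 w (G_seq \<alpha> f) < \<infinity>" using nb by (rule le_less_trans[rotated])
      moreover have "G_seq \<alpha> f \<in> WLp_loc 1 w" using M(1) G_seq_meas[OF \<alpha> fl] by (auto simp: WLp_loc_def)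
      ultimately show "G_seq \<alpha> f \<in> WMorrey 1 \<phi>2 w" by (simp add: WMorrey_def)
    qed
  qed
qed

end
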